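(* Let $\mathcal C$ be a strongly semi-abelian category and $n\ge2$. Let $\Pi\colon\mathbf{XExt}^n(\mathcal C)\to\mathbf{Mod}(\mathcal C)$ be the forgetful functor that sends a crossed $n$-fold extension $0\to B\to G_n\to\cdots\to G_1\to C\to1$ to the $C$-module $B$, let $(\underline{\ })_0\colon\mathbf{Mod}(\mathcal C)\to\mathcal C$ be the functor that assigns to the $C$-module $B$ the object $C$, and let $\Pi_0=(\underline{\ })_0\cdot\Pi$. Then $$\Pi\colon(\mathbf{XExt}^n(\mathcal C),\Pi_0)\to(\mathbf{Mod}(\mathcal C),(\underline{\ })_0)$$ is a fiberwise opfibration in $\mathbf{Fib}(\mathcal C)$.
   Context: A category is strongly semi-abelian if it is pointed, finitely complete, Barr-exact, has coproducts (finite ones, as usual for semi-abelian categories), and is strongly protomodular. Strong protomodularity means here: for any morphism $(1_B,\varphi,\psi)$ of split short exact sequences over the same $B$, from $X\xrightarrow{\kappa}A\rightleftarrows B$ to $X'\xrightarrow{\kappa'}A'\rightleftarrows B$, if $\psi$ is an isomorphism then so is $\varphi$, and if $\psi$ is a normal monomorphism then so is $\varphi\cdot\kappa=\kappa'\cdot\psi$. Internal actions: for objects $B,X$, let $\kappa_{B,X}\colon B\flat X\to B+X$ be the kernel of $[1,0]\colon B+X\to B$. $B\flat(-)$ is a monad on $\mathcal C$, and its algebras $\xi\colon B\flat X\to X$ are the internal actions of $B$ on $X$ (equivalent to split epimorphisms over $B$ with kernel $X$). The conjugation action of $X$ is $\chi=[1,1]\cdot\kappa_{X,X}\colon X\flat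 X\to X$. For $f\colon A\to B$, $f^*(\xi)=\xi\cdot(f\flat1_X)$. A morphism of actions from $\xi\colon B\flat X\to X$ to $\xi'\colon B'\flat X'\to X'$ is a pair $(f,h)$ with $h\cdot\xi=\xi'\cdot(f\flat h)$; if $f=1_B$, $h$ is called $B$-equivariant. A $C$-module is an abelian object $B$ with an internal $C$-action. $\mathbf{Mod}(\mathcal C)$ has as objects pairs ($C$, $C$-module $B$) and as morphisms the morphisms of actions $(\gamma,\beta)$. An internal crossed module is a map $\partial\colon G_2\to G_1$ with an action $\xi\colon G_1\flat G_2\to G_2$ such that $\partial\cdot\xi=\chi\cdot(1\flat\partial)$ and $\xi\cdot(\partial\flat1)=\chi$. If $p\colon G_1\to C$ is the cokernel of $\partial$ and $k\colon K\to G_2$ its kernel, $K$ is central in $G_2$ and has an induced $C$-module structure $\phi\colon C\flat K\to K$ determined by $k\cdot\phi\cdot(p\flat1)=\xi\cdot(1\flat k)$. A crossed $n$-fold extension is an exact sequence in $\mathcal C$ $$0\to B\xrightarrow{j}G_n\xrightarrow{d_{n-1}}\cdots\xrightarrow{d_2}G_2\xrightarrow{\partial}G_1\xrightarrow{p}C\to1$$ where $\partial$ is an internal crossed module, $B,G_n,\dots,G_3$ are $C$-modules and $j,d_{n-1},\dots,d_2$ are $C$-equivariant; for the map into $G_2$ ($d_2$, or $j$ if $n=2$) this means equivariance of its corestriction to its image $\ker\partial$, with the induced $C$-action. A morphism of crossed $n$-fold extensions is a morphism $(\gamma,f_1,f_2,\dots,f_n,\beta)$ of exact sequences such that $(f_1,f_2)$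 is a morphism of actions and the components $f_3,\dots,f_n,\beta$ are equivariant with respect to $\gamma\colon C\to C'$. These form the category $\mathbf{XExt}^n(\mathcal C)$. $\mathbf{Fib}(\mathcal A)$: the objects are Grothendieck fibrations $(\mathcal X,F)$ over $\mathcal A$; a morphism $(\mathcal X,F)\to(\mathcal M,G)$ is a functor $P$ with $G\cdot P=F$ preserving cartesian arrows. $P$ is a fiberwise opfibration if for every object $a$ of $\mathcal A$ its restriction $P_a\colon\mathcal X_a\to\mathcal M_a$ to the fibers over $a$ is an opfibration. The claim includes that $\Pi_0,(\underline{\ })_0$ are fibrations and that $\Pi$ preserves cartesian arrows. *)

theory Defs
  imports Main
begin

section \<open>Categories, functors and limits\<close>

record ('o, 'a) cat =
  Ob :: "'o set"
  Ar :: "'a set"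
  Dom :: "'a \<Rightarrow> 'o"
  Cod :: "'a \<Rightarrow> 'o"
  Idt :: "'o \<Rightarrow> 'a"
  Comp :: "'a \<Rightarrow> 'a \<Rightarrow> 'a"  (infixr "\<cdot>\<index>" 75)

text \<open>Composition is written in applicative order: the composite of \<open>f : A \<rightarrow> B\<close> followed by
  \<open>g : B \<rightarrow> C\<close> is \<open>g \<cdot> f\<close>.\<close>

definition hom :: "('o, 'a) cat \<Rightarrow> 'o \<Rightarrow> 'o \<Rightarrow> 'a set" where
  "hom C A B = {f \<in> Ar C. Dom C f = A \<and> Cod C f = B}"

definition category :: "('o, 'a) cat \<Rightarrow> bool" where
  "category C \<longleftrightarrow>
     (\<forall>f\<in>Ar C. Dom C f \<in> Ob C \<and> Cod C f \<in> Ob C) \<and>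
     (\<forall>A\<in>Ob C. Idt C A \<in> hom C A A) \<and>
     (\<forall>f\<in>Ar C. \<forall>g\<in>Ar C. Cod C f = Dom C g \<longrightarrow> g \<cdot>\<^bsub>C\<^esub> f \<in> hom C (Dom C f) (Cod C g)) \<and>
     (\<forall>f\<in>Ar C. f \<cdot>\<^bsub>C\<^esub> Idt C (Dom C f) = f \<and> Idt C (Cod C f) \<cdot>\<^bsub>C\<^esub> f = f) \<and>
     (\<forall>f\<in>Ar C. \<forall>g\<in>Ar C. \<forall>h\<in>Ar C. Cod C f = Dom C g \<and> Cod C g = Dom C h \<longrightarrow>
        (h \<cdot>\<^bsub>C\<^esub> g) \<cdot>\<^bsub>C\<^esub> f = h \<cdot>\<^bsub>C\<^esub> (g \<cdot>\<^bsub>C\<^esub> f))"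

definition is_iso :: "('o, 'a) cat \<Rightarrow> 'a \<Rightarrow> bool" where
  "is_iso C f \<longleftrightarrow> f \<in> Ar C \<and>
     (\<exists>g\<in>hom C (Cod C f) (Dom C f).
        g \<cdot>\<^bsub>C\<^esub> f = Idt C (Dom C f) \<and> f \<cdot>\<^bsub>C\<^esub> g = Idt C (Cod C f))"

record ('o, 'a, 'p, 'b) fctr =
  omap :: "'o \<Rightarrow> 'p"
  amap :: "'a \<Rightarrow> 'b"

definition is_functor ::
    "('o, 'a) cat \<Rightarrow> ('p, 'b) cat \<Rightarrow> ('o, 'a, 'p, 'b) fctr \<Rightarrow> bool" where
  "is_functor A B F \<longleftrightarrow> category A \<and> category B \<and>
     (\<forall>x\<in>Ob A. omap F x \<in> Ob B) \<and>
     (\<forall>f\<in>Ar A. amap F f \<in> hom B (omap F (Dom A f)) (omap F (Cod A f))) \<and>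
     (\<forall>x\<in>Ob A. amap F (Idt A x) = Idt B (omap F x)) \<and>
     (\<forall>f\<in>Ar A. \<forall>g\<in>Ar A. Cod A f = Dom A g \<longrightarrow>
        amap F (g \<cdot>\<^bsub>A\<^esub> f) = amap F g \<cdot>\<^bsub>B\<^esub> amap F f)"

definition fcomp ::
    "('p, 'b, 'q, 'c) fctr \<Rightarrow> ('o, 'a, 'p, 'b) fctr \<Rightarrow> ('o, 'a, 'q, 'c) fctr" where
  "fcomp G F = \<lparr>omap = omap G \<circ> omap F, amap = amap G \<circ> amap F\<rparr>"

text \<open>Functors are total functions on the underlying types, so equality of functors is agreement
  on the carriers of the source category.\<close>

definition functor_eq ::
    "('o, 'a) cat \<Rightarrow> ('o, 'a, 'p, 'b) fctr \<Rightarrow> ('o, 'a, 'p, 'b) fctr \<Rightarrow> bool" where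
  "functor_eq A F G \<longleftrightarrow> (\<forall>x\<in>Ob A. omap F x = omap G x) \<and> (\<forall>f\<in>Ar A. amap F f = amap G f)"

definition is_cone ::
    "('i, 'j) cat \<Rightarrow> ('o, 'a) cat \<Rightarrow> ('i, 'j, 'o, 'a) fctr \<Rightarrow> 'o \<Rightarrow> ('i \<Rightarrow> 'a) \<Rightarrow> bool" where
  "is_cone J C D L l \<longleftrightarrow> L \<in> Ob C \<and> (\<forall>i\<in>Ob J. l i \<in> hom C L (omap D i)) \<and>
     (\<forall>u\<in>Ar J. amap D u \<cdot>\<^bsub>C\<^esub> l (Dom J u) = l (Cod J u))"

definition is_limit ::
    "('i, 'j) cat \<Rightarrow> ('o, 'a) cat \<Rightarrow> ('i, 'j, 'o, 'a) fctr \<Rightarrow> 'o \<Rightarrow> ('i \<Rightarrow> 'a) \<Rightarrow> bool" where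
  "is_limit J C D L l \<longleftrightarrow> is_cone J C D L l \<and>
     (\<forall>M m. is_cone J C D M m \<longrightarrow>
        (\<exists>!f. f \<in> hom C M L \<and> (\<forall>i\<in>Ob J. l i \<cdot>\<^bsub>C\<^esub> f = m i)))"

text \<open>Every finite category is isomorphic to one whose objects and arrows are natural numbers, so
  it suffices to let the shape \<open>J\<close> range over these.\<close>

definition finitely_complete :: "('o, 'a) cat \<Rightarrow> bool" where
  "finitely_complete C \<longleftrightarrow>
     (\<forall>(J :: (nat, nat) cat) D. finite (Ob J) \<and> finite (Ar J) \<and> is_functor J C D \<longrightarrow>
        (\<exists>L l. is_limit J C D L l))"

definition has_finite_coproducts :: "('o, 'a) cat \<Rightarrow> bool" where
  "has_finite_coproducts C \<longleftrightarrow>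
     (\<forall>(I :: nat set) X. finite I \<and> (\<forall>i\<in>I. X i \<in> Ob C) \<longrightarrow>
        (\<exists>S\<in>Ob C. \<exists>inj. (\<forall>i\<in>I. inj i \<in> hom C (X i) S) \<and>
           (\<forall>T\<in>Ob C. \<forall>t. (\<forall>i\<in>I. t i \<in> hom C (X i) T) \<longrightarrow>
              (\<exists>!f. f \<in> hom C S T \<and> (\<forall>i\<in>I. f \<cdot>\<^bsub>C\<^esub> inj i = t i)))))"

definition is_product :: "('o, 'a) cat \<Rightarrow> 'o \<Rightarrow> 'o \<Rightarrow> 'a \<Rightarrow> 'a \<Rightarrow> bool" where
  "is_product C A B p q \<longleftrightarrow> A \<in> Ob C \<and> B \<in> Ob C \<and>
     p \<in> hom C (Dom C p) A \<and> q \<in> hom C (Dom C p) B \<and>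
     (\<forall>T. \<forall>f\<in>hom C T A. \<forall>g\<in>hom C T B.
        \<exists>!h. h \<in> hom C T (Dom C p) \<and> p \<cdot>\<^bsub>C\<^esub> h = f \<and> q \<cdot>\<^bsub>C\<^esub> h = g)"

definition is_coproduct :: "('o, 'a) cat \<Rightarrow> 'o \<Rightarrow> 'o \<Rightarrow> 'a \<Rightarrow> 'a \<Rightarrow> bool" where
  "is_coproduct C A B i j \<longleftrightarrow> A \<in> Ob C \<and> B \<in> Ob C \<and>
     i \<in> hom C A (Cod C i) \<and> j \<in> hom C B (Cod C i) \<and>
     (\<forall>T. \<forall>f\<in>hom C A T. \<forall>g\<in>hom C B T.
        \<exists>!h. h \<in> hom C (Cod C i) T \<and> h \<cdot>\<^bsub>C\<^esub> i = f \<and> h \<cdot>\<^bsub>C\<^esub> j = g)"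

text \<open>\<open>p\<close> and \<open>q\<close> are the projections of a pullback of \<open>f\<close> and \<open>g\<close>; \<open>p\<close> is parallel to \<open>g\<close>
  and \<open>q\<close> to \<open>f\<close>.\<close>

definition is_pullback :: "('o, 'a) cat \<Rightarrow> 'a \<Rightarrow> 'a \<Rightarrow> 'a \<Rightarrow> 'a \<Rightarrow> bool" where
  "is_pullback C f g p q \<longleftrightarrow> f \<in> Ar C \<and> g \<in> Ar C \<and> Cod C f = Cod C g \<and>
     p \<in> hom C (Dom C p) (Dom C f) \<and> q \<in> hom C (Dom C p) (Dom C g) \<and>
     f \<cdot>\<^bsub>C\<^esub> p = g \<cdot>\<^bsub>C\<^esub> q \<and>
     (\<forall>T. \<forall>u\<in>hom C T (Dom C f). \<forall>v\<in>hom C T (Dom C g). f \<cdot>\<^bsub>C\<^esub> u = g \<cdot>\<^bsub>C\<^esub> v \<longrightarrow>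
        (\<exists>!h. h \<in> hom C T (Dom C p) \<and> p \<cdot>\<^bsub>C\<^esub> h = u \<and> q \<cdot>\<^bsub>C\<^esub> h = v))"

definition is_coequalizer :: "('o, 'a) cat \<Rightarrow> 'a \<Rightarrow> 'a \<Rightarrow> 'a \<Rightarrow> bool" where
  "is_coequalizer C f g e \<longleftrightarrow> f \<in> Ar C \<and> g \<in> hom C (Dom C f) (Cod C f) \<and>
     e \<in> hom C (Cod C f) (Cod C e) \<and> e \<cdot>\<^bsub>C\<^esub> f = e \<cdot>\<^bsub>C\<^esub> g \<and>
     (\<forall>T. \<forall>h\<in>hom C (Cod C f) T. h \<cdot>\<^bsub>C\<^esub> f = h \<cdot>\<^bsub>C\<^esub> g \<longrightarrow>
        (\<exists>!t. t \<in> hom C (Cod C e) T \<and> t \<cdot>\<^bsub>C\<^esub> e = h))"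


section \<open>Strongly semi-abelian categories\<close>

definition is_zero :: "('o, 'a) cat \<Rightarrow> 'o \<Rightarrow> bool" where
  "is_zero C Z \<longleftrightarrow> Z \<in> Ob C \<and>
     (\<forall>A\<in>Ob C. (\<exists>!f. f \<in> hom C Z A) \<and> (\<exists>!f. f \<in> hom C A Z))"

definition pointed :: "('o, 'a) cat \<Rightarrow> bool" where
  "pointed C \<longleftrightarrow> (\<exists>Z. is_zero C Z)"

definition zero_ob :: "('o, 'a) cat \<Rightarrow> 'o" where
  "zero_ob C = (SOME Z. is_zero C Z)"

definition zero_arr :: "('o, 'a) cat \<Rightarrow> 'o \<Rightarrow> 'o \<Rightarrow> 'a" where
  "zero_arr C A B = (THE f. \<exists>u\<in>hom C A (zero_ob C). \<exists>v\<in>hom C (zero_ob C) B. f = v \<cdot>\<^bsub>C\<^esub> u)"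

definition is_kernel :: "('o, 'a) cat \<Rightarrow> 'a \<Rightarrow> 'a \<Rightarrow> bool" where
  "is_kernel C k f \<longleftrightarrow> f \<in> Ar C \<and> k \<in> hom C (Dom C k) (Dom C f) \<and>
     f \<cdot>\<^bsub>C\<^esub> k = zero_arr C (Dom C k) (Cod C f) \<and>
     (\<forall>T. \<forall>h\<in>hom C T (Dom C f). f \<cdot>\<^bsub>C\<^esub> h = zero_arr C T (Cod C f) \<longrightarrow>
        (\<exists>!t. t \<in> hom C T (Dom C k) \<and> k \<cdot>\<^bsub>C\<^esub> t = h))"

definition normal_mono :: "('o, 'a) cat \<Rightarrow> 'a \<Rightarrow> bool" where
  "normal_mono C k \<longleftrightarrow> (\<exists>f. is_kernel C k f)"

definition regular_epi :: "('o, 'a) cat \<Rightarrow> 'a \<Rightarrow> bool" where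
  "regular_epi C e \<longleftrightarrow> (\<exists>f g. is_coequalizer C f g e)"

definition is_kernel_pair :: "('o, 'a) cat \<Rightarrow> 'a \<Rightarrow> 'a \<Rightarrow> 'a \<Rightarrow> bool" where
  "is_kernel_pair C f p q \<longleftrightarrow> is_pullback C f f p q"

definition regular_category :: "('o, 'a) cat \<Rightarrow> bool" where
  "regular_category C \<longleftrightarrow> finitely_complete C \<and>
     (\<forall>f p q. is_kernel_pair C f p q \<longrightarrow> (\<exists>e. is_coequalizer C p q e)) \<and>
     (\<forall>f g p q. is_pullback C f g p q \<and> regular_epi C f \<longrightarrow> regular_epi C q)"

definition equivalence_relation :: "('o, 'a) cat \<Rightarrow> 'a \<Rightarrow> 'a \<Rightarrow> bool" where
  "equivalence_relation C r s \<longleftrightarrow>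
     r \<in> Ar C \<and> s \<in> hom C (Dom C r) (Cod C r) \<and>
     (\<forall>T. \<forall>u\<in>hom C T (Dom C r). \<forall>v\<in>hom C T (Dom C r).
        r \<cdot>\<^bsub>C\<^esub> u = r \<cdot>\<^bsub>C\<^esub> v \<and> s \<cdot>\<^bsub>C\<^esub> u = s \<cdot>\<^bsub>C\<^esub> v \<longrightarrow> u = v) \<and>
     (\<exists>d\<in>hom C (Cod C r) (Dom C r).
        r \<cdot>\<^bsub>C\<^esub> d = Idt C (Cod C r) \<and> s \<cdot>\<^bsub>C\<^esub> d = Idt C (Cod C r)) \<and>
     (\<exists>t\<in>hom C (Dom C r) (Dom C r). r \<cdot>\<^bsub>C\<^esub> t = s \<and> s \<cdot>\<^bsub>C\<^esub> t = r) \<and>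
     (\<forall>p q. is_pullback C s r p q \<longrightarrow>
        (\<exists>m\<in>hom C (Dom C p) (Dom C r). r \<cdot>\<^bsub>C\<^esub> m = r \<cdot>\<^bsub>C\<^esub> p \<and> s \<cdot>\<^bsub>C\<^esub> m = s \<cdot>\<^bsub>C\<^esub> q))"

definition barr_exact :: "('o, 'a) cat \<Rightarrow> bool" where
  "barr_exact C \<longleftrightarrow> regular_category C \<and>
     (\<forall>r s. equivalence_relation C r s \<longrightarrow> (\<exists>f. is_kernel_pair C f r s))"

definition split_ses :: "('o, 'a) cat \<Rightarrow> 'a \<Rightarrow> 'a \<Rightarrow> 'a \<Rightarrow> bool" where
  "split_ses C \<kappa> p s \<longleftrightarrow> is_kernel C \<kappa> p \<and> s \<in> hom C (Cod C p) (Dom C p) \<and>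
     p \<cdot>\<^bsub>C\<^esub> s = Idt C (Cod C p)"

definition strongly_protomodular :: "('o, 'a) cat \<Rightarrow> bool" where
  "strongly_protomodular C \<longleftrightarrow>
     (\<forall>\<kappa> p s \<kappa>' p' s' \<phi> \<psi>.
        split_ses C \<kappa> p s \<and> split_ses C \<kappa>' p' s' \<and> Cod C p = Cod C p' \<and>
        \<phi> \<in> hom C (Dom C p) (Dom C p') \<and> \<psi> \<in> hom C (Dom C \<kappa>) (Dom C \<kappa>') \<and>
        \<phi> \<cdot>\<^bsub>C\<^esub> \<kappa> = \<kappa>' \<cdot>\<^bsub>C\<^esub> \<psi> \<and> p' \<cdot>\<^bsub>C\<^esub> \<phi> = p \<and> \<phi> \<cdot>\<^bsub>C\<^esub> s = s' \<longrightarrow>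
        (is_iso C \<psi> \<longrightarrow> is_iso C \<phi>) \<and>
        (normal_mono C \<psi> \<longrightarrow> normal_mono C (\<phi> \<cdot>\<^bsub>C\<^esub> \<kappa>)))"

definition strongly_semi_abelian :: "('o, 'a) cat \<Rightarrow> bool" where
  "strongly_semi_abelian C \<longleftrightarrow> category C \<and> pointed C \<and> finitely_complete C \<and> barr_exact C \<and>
     has_finite_coproducts C \<and> strongly_protomodular C"

text \<open>Abelian objects are the objects carrying an internal abelian group structure. The axioms are
  written on generalised elements \<open>T \<rightarrow> X\<close>; the unit is the unique arrow from the terminal
  (that is, zero) object, so it becomes the zero arrow \<open>T \<rightarrow> X\<close>.\<close>

definition prod_pair :: "('o, 'a) cat \<Rightarrow> 'a \<Rightarrow> 'a \<Rightarrow> 'a \<Rightarrow> 'a \<Rightarrow> 'a" where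
  "prod_pair C p q f g =
     (THE h. h \<in> hom C (Dom C f) (Dom C p) \<and> p \<cdot>\<^bsub>C\<^esub> h = f \<and> q \<cdot>\<^bsub>C\<^esub> h = g)"

definition abelian_object :: "('o, 'a) cat \<Rightarrow> 'o \<Rightarrow> bool" where
  "abelian_object C X \<longleftrightarrow>
     (\<exists>p q. is_product C X X p q \<and>
       (\<exists>m\<in>hom C (Dom C p) X. \<exists>v\<in>hom C X X.
         let add = (\<lambda>x y. m \<cdot>\<^bsub>C\<^esub> prod_pair C p q x y) in
         \<forall>T\<in>Ob C. \<forall>x\<in>hom C T X. \<forall>y\<in>hom C T X. \<forall>z\<in>hom C T X.
           add (add x y) z = add x (add y z) \<and> add x y = add y x \<and>
           add x (zero_arr C T X) = x \<and> add x (v \<cdot>\<^bsub>C\<^esub> x) = zero_arr C T X))"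

text \<open>Exactness at the middle object of \<open>f\<close> followed by \<open>g\<close>: the regular image of \<open>f\<close> is the
  kernel of \<open>g\<close>.\<close>

definition exact_at :: "('o, 'a) cat \<Rightarrow> 'a \<Rightarrow> 'a \<Rightarrow> bool" where
  "exact_at C f g \<longleftrightarrow>
     (\<exists>e m. regular_epi C e \<and> is_kernel C m g \<and> Cod C e = Dom C m \<and> f = m \<cdot>\<^bsub>C\<^esub> e)"


section \<open>Internal actions\<close>

text \<open>Coproducts \<open>B + X\<close> and kernels \<open>\<kappa>\<^sub>B\<^sub>,\<^sub>X\<close> are fixed once and for all by choice.\<close>

definition coprod_inj :: "('o, 'a) cat \<Rightarrow> 'o \<Rightarrow> 'o \<Rightarrow> 'a \<times> 'a" where
  "coprod_inj C A B = (SOME ij. is_coproduct C A B (fst ij) (snd ij))"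

definition inl :: "('o, 'a) cat \<Rightarrow> 'o \<Rightarrow> 'o \<Rightarrow> 'a" where
  "inl C A B = fst (coprod_inj C A B)"

definition inr :: "('o, 'a) cat \<Rightarrow> 'o \<Rightarrow> 'o \<Rightarrow> 'a" where
  "inr C A B = snd (coprod_inj C A B)"

definition coprod_ob :: "('o, 'a) cat \<Rightarrow> 'o \<Rightarrow> 'o \<Rightarrow> 'o" where
  "coprod_ob C A B = Cod C (inl C A B)"

definition copair :: "('o, 'a) cat \<Rightarrow> 'a \<Rightarrow> 'a \<Rightarrow> 'a" where
  "copair C f g = (THE h. h \<in> hom C (coprod_ob C (Dom C f) (Dom C g)) (Cod C f) \<and>
     h \<cdot>\<^bsub>C\<^esub> inl C (Dom C f) (Dom C g) = f \<and> h \<cdot>\<^bsub>C\<^esub> inr C (Dom C f) (Dom C g) = g)"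

definition coprod_arr :: "('o, 'a) cat \<Rightarrow> 'a \<Rightarrow> 'a \<Rightarrow> 'a" where
  "coprod_arr C f h = copair C (inl C (Cod C f) (Cod C h) \<cdot>\<^bsub>C\<^esub> f) (inr C (Cod C f) (Cod C h) \<cdot>\<^bsub>C\<^esub> h)"

definition flat_ker :: "('o, 'a) cat \<Rightarrow> 'o \<Rightarrow> 'o \<Rightarrow> 'a" where
  "flat_ker C B X = (SOME k. is_kernel C k (copair C (Idt C B) (zero_arr C X B)))"

definition flat_ob :: "('o, 'a) cat \<Rightarrow> 'o \<Rightarrow> 'o \<Rightarrow> 'o" where
  "flat_ob C B X = Dom C (flat_ker C B X)"

text \<open>The factorisation of \<open>g : T \<rightarrow> B + X\<close> through \<open>\<kappa>\<^sub>B\<^sub>,\<^sub>X\<close>.\<close>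

definition flat_lift :: "('o, 'a) cat \<Rightarrow> 'o \<Rightarrow> 'o \<Rightarrow> 'a \<Rightarrow> 'a" where
  "flat_lift C B X g =
     (THE t. t \<in> hom C (Dom C g) (flat_ob C B X) \<and> flat_ker C B X \<cdot>\<^bsub>C\<^esub> t = g)"

definition flat_arr :: "('o, 'a) cat \<Rightarrow> 'a \<Rightarrow> 'a \<Rightarrow> 'a" where
  "flat_arr C f h =
     flat_lift C (Cod C f) (Cod C h) (coprod_arr C f h \<cdot>\<^bsub>C\<^esub> flat_ker C (Dom C f) (Dom C h))"

text \<open>Unit and multiplication of the monad \<open>B\<flat>(-)\<close>; the multiplication is induced by
  \<open>[\<iota>\<^sub>B, \<kappa>\<^sub>B\<^sub>,\<^sub>X] : B + B\<flat>X \<rightarrow> B + X\<close>.\<close>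

definition flat_unit :: "('o, 'a) cat \<Rightarrow> 'o \<Rightarrow> 'o \<Rightarrow> 'a" where
  "flat_unit C B X = flat_lift C B X (inr C B X)"

definition flat_mult :: "('o, 'a) cat \<Rightarrow> 'o \<Rightarrow> 'o \<Rightarrow> 'a" where
  "flat_mult C B X = flat_lift C B X
     (copair C (inl C B X) (flat_ker C B X) \<cdot>\<^bsub>C\<^esub> flat_ker C B (flat_ob C B X))"

definition is_action :: "('o, 'a) cat \<Rightarrow> 'o \<Rightarrow> 'o \<Rightarrow> 'a \<Rightarrow> bool" where
  "is_action C B X \<xi> \<longleftrightarrow> B \<in> Ob C \<and> X \<in> Ob C \<and> \<xi> \<in> hom C (flat_ob C B X) X \<and>
     \<xi> \<cdot>\<^bsub>C\<^esub> flat_unit C B X = Idt C X \<and>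
     \<xi> \<cdot>\<^bsub>C\<^esub> flat_mult C B X = \<xi> \<cdot>\<^bsub>C\<^esub> flat_arr C (Idt C B) \<xi>"

definition action_morphism :: "('o, 'a) cat \<Rightarrow> 'a \<Rightarrow> 'a \<Rightarrow> 'a \<Rightarrow> 'a \<Rightarrow> bool" where
  "action_morphism C \<xi> \<xi>' f h \<longleftrightarrow> f \<in> Ar C \<and> h \<in> Ar C \<and>
     is_action C (Dom C f) (Dom C h) \<xi> \<and> is_action C (Cod C f) (Cod C h) \<xi>' \<and>
     h \<cdot>\<^bsub>C\<^esub> \<xi> = \<xi>' \<cdot>\<^bsub>C\<^esub> flat_arr C f h"

definition equivariant :: "('o, 'a) cat \<Rightarrow> 'o \<Rightarrow> 'a \<Rightarrow> 'a \<Rightarrow> 'a \<Rightarrow> bool" where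
  "equivariant C B \<xi> \<xi>' h \<longleftrightarrow> action_morphism C \<xi> \<xi>' (Idt C B) h"

definition conjugation :: "('o, 'a) cat \<Rightarrow> 'o \<Rightarrow> 'a" where
  "conjugation C X = copair C (Idt C X) (Idt C X) \<cdot>\<^bsub>C\<^esub> flat_ker C X X"

definition is_module :: "('o, 'a) cat \<Rightarrow> 'o \<Rightarrow> 'o \<Rightarrow> 'a \<Rightarrow> bool" where
  "is_module C G B \<phi> \<longleftrightarrow> abelian_object C B \<and> is_action C G B \<phi>"

definition crossed_module :: "('o, 'a) cat \<Rightarrow> 'a \<Rightarrow> 'a \<Rightarrow> bool" where
  "crossed_module C b \<xi> \<longleftrightarrow> b \<in> Ar C \<and> is_action C (Cod C b) (Dom C b) \<xi> \<and>
     b \<cdot>\<^bsub>C\<^esub> \<xi> = conjugation C (Cod C b) \<cdot>\<^bsub>C\<^esub> flat_arr C (Idt C (Cod C b)) b \<and>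
     \<xi> \<cdot>\<^bsub>C\<^esub> flat_arr C b (Idt C (Dom C b)) = conjugation C (Dom C b)"

text \<open>\<open>\<phi>\<close> is the action of \<open>Cod p\<close> on the kernel \<open>k\<close> of the crossed module \<open>(b, \<xi>)\<close> with
  cokernel \<open>p\<close> induced by \<open>\<xi>\<close>.\<close>

definition induced_action :: "('o, 'a) cat \<Rightarrow> 'a \<Rightarrow> 'a \<Rightarrow> 'a \<Rightarrow> 'a \<Rightarrow> 'a \<Rightarrow> bool" where
  "induced_action C p b \<xi> k \<phi> \<longleftrightarrow> is_kernel C k b \<and> is_action C (Cod C p) (Dom C k) \<phi> \<and>
     k \<cdot>\<^bsub>C\<^esub> \<phi> \<cdot>\<^bsub>C\<^esub> flat_arr C p (Idt C (Dom C k)) = \<xi> \<cdot>\<^bsub>C\<^esub> flat_arr C (Idt C (Cod C b)) k"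


section \<open>The categories of modules and of crossed extensions\<close>

datatype ('x, 'm) arrow = Arrow (src: 'x) (comps: 'm) (tgt: 'x)

record ('o, 'a) cmodule =
  mod_base :: 'o
  mod_ob :: 'o
  mod_act :: 'a

definition mod_cat ::
    "('o, 'a) cat \<Rightarrow> (('o, 'a) cmodule, (('o, 'a) cmodule, 'a \<times> 'a) arrow) cat" where
  "mod_cat C =
     \<lparr>Ob = {M. is_module C (mod_base M) (mod_ob M) (mod_act M)},
      Ar = {Arrow M (\<gamma>, \<beta>) N | M \<gamma> \<beta> N.
        is_module C (mod_base M) (mod_ob M) (mod_act M) \<and>
        is_module C (mod_base N) (mod_ob N) (mod_act N) \<and>
        \<gamma> \<in> hom C (mod_base M) (mod_base N) \<and> \<beta> \<in> hom C (mod_ob M) (mod_ob N) \<and>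
        action_morphism C (mod_act M) (mod_act N) \<gamma> \<beta>},
      Dom = src,
      Cod = tgt,
      Idt = (\<lambda>M. Arrow M (Idt C (mod_base M), Idt C (mod_ob M)) M),
      Comp = (\<lambda>g f. Arrow (src f)
        (fst (comps g) \<cdot>\<^bsub>C\<^esub> fst (comps f), snd (comps g) \<cdot>\<^bsub>C\<^esub> snd (comps f)) (tgt g))\<rparr>"

definition mod_proj ::
    "(('o, 'a) cmodule, (('o, 'a) cmodule, 'a \<times> 'a) arrow, 'o, 'a) fctr" where
  "mod_proj = \<lparr>omap = mod_base, amap = (\<lambda>f. fst (comps f))\<rparr>"

text \<open>The underlying sequence of a crossed \<open>n\<close>-fold extension is indexed from the right,
  \<open>0 \<rightarrow> A\<^sub>n\<^sub>+\<^sub>1 \<rightarrow> A\<^sub>n \<rightarrow> \<dots> \<rightarrow> A\<^sub>2 \<rightarrow> A\<^sub>1 \<rightarrow> A\<^sub>0 \<rightarrow> 1\<close> with \<open>A\<^sub>0 = C\<close>, \<open>A\<^sub>i = G\<^sub>i\<close> for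
  \<open>1 \<le> i \<le> n\<close> and \<open>A\<^sub>n\<^sub>+\<^sub>1 = B\<close>. The list \<open>x_maps\<close> has entries \<open>a\<^sub>i : A\<^sub>i\<^sub>+\<^sub>1 \<rightarrow> A\<^sub>i\<close> for
  \<open>0 \<le> i \<le> n\<close>, that is, \<open>[p, \<partial>, d\<^sub>2, \<dots>, d\<^sub>n\<^sub>-\<^sub>1, j]\<close>; \<open>x_xi\<close> is the action of \<open>G\<^sub>1\<close> on \<open>G\<^sub>2\<close>; and
  \<open>x_acts\<close> lists the \<open>C\<close>-actions on \<open>A\<^sub>3, \<dots>, A\<^sub>n\<^sub>+\<^sub>1\<close>.\<close>

record 'a xext =
  x_maps :: "'a list"
  x_xi :: 'a
  x_acts :: "'a list"

definition x_ob :: "('o, 'a) cat \<Rightarrow> 'a xext \<Rightarrow> nat \<Rightarrow> 'o" where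
  "x_ob C E i = (if i = 0 then Cod C (x_maps E ! 0) else Dom C (x_maps E ! (i - 1)))"

definition x_act :: "'a xext \<Rightarrow> nat \<Rightarrow> 'a" where
  "x_act E i = x_acts E ! (i - 3)"

definition exact_sequence :: "('o, 'a) cat \<Rightarrow> nat \<Rightarrow> 'a xext \<Rightarrow> bool" where
  "exact_sequence C n E \<longleftrightarrow> length (x_maps E) = n + 1 \<and>
     (\<forall>i\<le>n. x_maps E ! i \<in> hom C (x_ob C E (i + 1)) (x_ob C E i)) \<and>
     exact_at C (zero_arr C (zero_ob C) (x_ob C E (n + 1))) (x_maps E ! n) \<and>
     (\<forall>i\<in>{1..n}. exact_at C (x_maps E ! i) (x_maps E ! (i - 1))) \<and>
     exact_at C (x_maps E ! 0) (zero_arr C (x_ob C E 0) (zero_ob C))"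

text \<open>The arrow \<open>a\<^sub>2\<close> into \<open>G\<^sub>2\<close> (\<open>d\<^sub>2\<close>, or \<open>j\<close> if \<open>n = 2\<close>) is only required to be equivariant after
  corestriction \<open>a\<^sub>2 = k \<cdot> e\<close> to the kernel \<open>k\<close> of \<open>\<partial>\<close> with its induced action.\<close>

definition crossed_extension :: "('o, 'a) cat \<Rightarrow> nat \<Rightarrow> 'a xext \<Rightarrow> bool" where
  "crossed_extension C n E \<longleftrightarrow> exact_sequence C n E \<and>
     crossed_module C (x_maps E ! 1) (x_xi E) \<and>
     length (x_acts E) = n - 1 \<and>
     (\<forall>i\<in>{3..n + 1}. is_module C (x_ob C E 0) (x_ob C E i) (x_act E i)) \<and>
     (\<forall>i\<in>{3..n}. equivariant C (x_ob C E 0) (x_act E (i + 1)) (x_act E i) (x_maps E ! i)) \<and>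
     (\<exists>k \<phi> e. induced_action C (x_maps E ! 0) (x_maps E ! 1) (x_xi E) k \<phi> \<and>
        e \<in> hom C (x_ob C E 3) (Dom C k) \<and> x_maps E ! 2 = k \<cdot>\<^bsub>C\<^esub> e \<and>
        equivariant C (x_ob C E 0) (x_act E 3) \<phi> e)"

text \<open>A morphism \<open>(\<gamma>, f\<^sub>1, \<dots>, f\<^sub>n, \<beta>)\<close> is the list \<open>fs\<close> of its components \<open>A\<^sub>i \<rightarrow> A'\<^sub>i\<close> for
  \<open>0 \<le> i \<le> n + 1\<close>.\<close>

definition xext_morphism ::
    "('o, 'a) cat \<Rightarrow> nat \<Rightarrow> 'a xext \<Rightarrow> 'a list \<Rightarrow> 'a xext \<Rightarrow> bool" where
  "xext_morphism C n E fs E' \<longleftrightarrow> length fs = n + 2 \<and>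
     (\<forall>i\<le>n + 1. fs ! i \<in> hom C (x_ob C E i) (x_ob C E' i)) \<and>
     (\<forall>i\<le>n. fs ! i \<cdot>\<^bsub>C\<^esub> x_maps E ! i = x_maps E' ! i \<cdot>\<^bsub>C\<^esub> fs ! (i + 1)) \<and>
     action_morphism C (x_xi E) (x_xi E') (fs ! 1) (fs ! 2) \<and>
     (\<forall>i\<in>{3..n + 1}. action_morphism C (x_act E i) (x_act E' i) (fs ! 0) (fs ! i))"

definition xext_cat ::
    "('o, 'a) cat \<Rightarrow> nat \<Rightarrow> ('a xext, ('a xext, 'a list) arrow) cat" where
  "xext_cat C n =
     \<lparr>Ob = {E. crossed_extension C n E},
      Ar = {Arrow E fs E' | E fs E'.
        crossed_extension C n E \<and> crossed_extension C n E' \<and> xext_morphism C n E fs E'},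
      Dom = src,
      Cod = tgt,
      Idt = (\<lambda>E. Arrow E (map (\<lambda>i. Idt C (x_ob C E i)) [0..<n + 2]) E),
      Comp = (\<lambda>g f. Arrow (src f) (map2 (Comp C) (comps g) (comps f)) (tgt g))\<rparr>"

definition xext_module :: "('o, 'a) cat \<Rightarrow> nat \<Rightarrow> 'a xext \<Rightarrow> ('o, 'a) cmodule" where
  "xext_module C n E =
     \<lparr>mod_base = x_ob C E 0, mod_ob = x_ob C E (n + 1), mod_act = x_act E (n + 1)\<rparr>"

definition xext_Pi ::
    "('o, 'a) cat \<Rightarrow> nat \<Rightarrow>
     ('a xext, ('a xext, 'a list) arrow,
      ('o, 'a) cmodule, (('o, 'a) cmodule, 'a \<times> 'a) arrow) fctr" where
  "xext_Pi C n =
     \<lparr>omap = xext_module C n,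
      amap = (\<lambda>f. Arrow (xext_module C n (src f)) (comps f ! 0, comps f ! (n + 1))
        (xext_module C n (tgt f)))\<rparr>"

definition xext_Pi0 ::
    "('o, 'a) cat \<Rightarrow> nat \<Rightarrow> ('a xext, ('a xext, 'a list) arrow, 'o, 'a) fctr" where
  "xext_Pi0 C n = fcomp mod_proj (xext_Pi C n)"


section \<open>Fibrations and fiberwise opfibrations\<close>

definition cartesian ::
    "('o, 'a) cat \<Rightarrow> ('p, 'b) cat \<Rightarrow> ('o, 'a, 'p, 'b) fctr \<Rightarrow> 'a \<Rightarrow> bool" where
  "cartesian X A F g \<longleftrightarrow> g \<in> Ar X \<and>
     (\<forall>h\<in>Ar X. \<forall>u\<in>hom A (omap F (Dom X h)) (omap F (Dom X g)).
        Cod X h = Cod X g \<and> amap F g \<cdot>\<^bsub>A\<^esub> u = amap F h \<longrightarrow>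
        (\<exists>!w. w \<in> hom X (Dom X h) (Dom X g) \<and> amap F w = u \<and> g \<cdot>\<^bsub>X\<^esub> w = h))"

definition opcartesian ::
    "('o, 'a) cat \<Rightarrow> ('p, 'b) cat \<Rightarrow> ('o, 'a, 'p, 'b) fctr \<Rightarrow> 'a \<Rightarrow> bool" where
  "opcartesian X A F g \<longleftrightarrow> g \<in> Ar X \<and>
     (\<forall>h\<in>Ar X. \<forall>u\<in>hom A (omap F (Cod X g)) (omap F (Cod X h)).
        Dom X h = Dom X g \<and> u \<cdot>\<^bsub>A\<^esub> amap F g = amap F h \<longrightarrow>
        (\<exists>!w. w \<in> hom X (Cod X g) (Cod X h) \<and> amap F w = u \<and> w \<cdot>\<^bsub>X\<^esub> g = h))"

definition fibration ::
    "('o, 'a) cat \<Rightarrow> ('p, 'b) cat \<Rightarrow> ('o, 'a, 'p, 'b) fctr \<Rightarrow> bool" where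
  "fibration X A F \<longleftrightarrow> is_functor X A F \<and>
     (\<forall>x\<in>Ob X. \<forall>f\<in>Ar A. Cod A f = omap F x \<longrightarrow>
        (\<exists>g. cartesian X A F g \<and> Cod X g = x \<and> amap F g = f))"

definition opfibration ::
    "('o, 'a) cat \<Rightarrow> ('p, 'b) cat \<Rightarrow> ('o, 'a, 'p, 'b) fctr \<Rightarrow> bool" where
  "opfibration X A F \<longleftrightarrow> is_functor X A F \<and>
     (\<forall>x\<in>Ob X. \<forall>f\<in>Ar A. Dom A f = omap F x \<longrightarrow>
        (\<exists>g. opcartesian X A F g \<and> Dom X g = x \<and> amap F g = f))"

definition fiber ::
    "('o, 'a) cat \<Rightarrow> ('p, 'b) cat \<Rightarrow> ('o, 'a, 'p, 'b) fctr \<Rightarrow> 'p \<Rightarrow> ('o, 'a) cat" where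
  "fiber X A F a = X\<lparr>Ob := {x \<in> Ob X. omap F x = a},
     Ar := {f \<in> Ar X. omap F (Dom X f) = a \<and> omap F (Cod X f) = a \<and> amap F f = Idt A a}\<rparr>"

definition fib_morphism ::
    "('p, 'b) cat \<Rightarrow> ('o, 'a) cat \<Rightarrow> ('o, 'a, 'p, 'b) fctr \<Rightarrow>
     ('q, 'c) cat \<Rightarrow> ('q, 'c, 'p, 'b) fctr \<Rightarrow> ('o, 'a, 'q, 'c) fctr \<Rightarrow> bool" where
  "fib_morphism A X F M G P \<longleftrightarrow> fibration X A F \<and> fibration M A G \<and> is_functor X M P \<and>
     functor_eq X (fcomp G P) F \<and>
     (\<forall>f. cartesian X A F f \<longrightarrow> cartesian M A G (amap P f))"

definition fiberwise_opfibration ::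
    "('p, 'b) cat \<Rightarrow> ('o, 'a) cat \<Rightarrow> ('o, 'a, 'p, 'b) fctr \<Rightarrow>
     ('q, 'c) cat \<Rightarrow> ('q, 'c, 'p, 'b) fctr \<Rightarrow> ('o, 'a, 'q, 'c) fctr \<Rightarrow> bool" where
  "fiberwise_opfibration A X F M G P \<longleftrightarrow> fib_morphism A X F M G P \<and>
     (\<forall>a\<in>Ob A. opfibration (fiber X A F a) (fiber M A G a) P)"

end

theory Submission
  imports Defs
begin

text \<open>An internal action is the same thing as a split extension: the semidirect product is the coequaliser
  of a reflexive graph, whose image is an effective equivalence relation by protomodularity and exactness.
  Strong protomodularity then says that the cokernel of an equivariant normal monomorphism inherits an
  action. Applied to the diagonal of an abelian object this makes subtraction equivariant, and applied to
  the kernel of a cooperator \<open>X \<times> B \<rightarrow> X\<close> of a central \<open>j : B \<rightarrow> X\<close> it makes the cooperator equivariant.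

  The cartesian lift of \<open>\<gamma> : C' \<rightarrow> C\<close> at an extension pulls \<open>G\<^sub>1\<close> back along \<open>\<gamma>\<close> and restricts all
  actions. The opcartesian lift of \<open>\<beta> : B \<rightarrow> B'\<close> in the fiber over \<open>C\<close> replaces \<open>G\<^sub>n\<close> by the cokernel of
  the central monomorphism \<open>\<langle>j, -\<beta>\<rangle> : B \<rightarrow> G\<^sub>n \<times> B'\<close>; a morphism out of it is induced by
  \<open>G\<^sub>n \<times> B' \<rightarrow> G''\<^sub>n \<times> B'' \<rightarrow> G''\<^sub>n\<close>, which is equivariant because the cooperator is. For \<open>n = 2\<close> the
  map \<open>j\<close> is central by the Peiffer identity.\<close>

section \<open>Categories with pullbacks and a zero object\<close>

text \<open>The axioms speak only of split short exact sequences, whereas extensions carry algebras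
  for \<open>B \<flat> (-)\<close>. A fact about actions therefore has to be moved to semidirect
  products and back, and the kernel found there has to be identified with the intended object.

  The cokernel of \<open>(j, -\<beta>)\<close> is used instead of an abstract pushout because a
  cooperator of this monomorphism with the identity describes the kernel pair explicitly:
  \<open>(x, w) ~ (x + j s, w - \<beta> s)\<close>. Exactness of the new sequence can then be
  checked on elements. Since \<open>\<beta>\<close> enters with a sign, the construction depends on
  the equivariance of negation, which the definition of a module does not contain.

  Elements are generalised elements, lifted along regular covers. Equations on
  \<open>B \<flat> Q\<close> are tested on \<open>B \<flat> X\<close>, and the Peiffer identity
  needs the first variable of \<open>\<flat>\<close> to be covered as well; hence the work on
  regular epimorphisms and \<open>\<flat>\<close>.

  For \<open>n = 2\<close> the object receiving \<open>B\<close> is acted on by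
  \<open>G\<^sub>1\<close>, for larger \<open>n\<close> by \<open>C\<close>. Restricting modules
  along \<open>p\<close> or along the identity merges the two cases.\<close>

locale categ =
  fixes C :: "('o, 'a) cat" (structure)
  assumes category: "category C"
begin

lemma hom_iff [simp]: "f \<in> hom C A B \<longleftrightarrow> f \<in> Ar C \<and> Dom C f = A \<and> Cod C f = B"
  by (auto simp: hom_def)

lemma Dom_ob [simp]: "f \<in> Ar C \<Longrightarrow> Dom C f \<in> Ob C"
  and Cod_ob [simp]: "f \<in> Ar C \<Longrightarrow> Cod C f \<in> Ob C"
  using category by (auto simp: category_def)

lemma Idt_ar [simp]: "A \<in> Ob C \<Longrightarrow> Idt C A \<in> Ar C"
  and Dom_Idt [simp]: "A \<in> Ob C \<Longrightarrow> Dom C (Idt C A) = A"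
  and Cod_Idt [simp]: "A \<in> Ob C \<Longrightarrow> Cod C (Idt C A) = A"
  using category by (auto simp: category_def)

lemma comp_ar [simp]: "f \<in> Ar C \<Longrightarrow> g \<in> Ar C \<Longrightarrow> Cod C f = Dom C g \<Longrightarrow> g \<cdot> f \<in> Ar C"
  and Dom_comp [simp]: "f \<in> Ar C \<Longrightarrow> g \<in> Ar C \<Longrightarrow> Cod C f = Dom C g \<Longrightarrow> Dom C (g \<cdot> f) = Dom C f"
  and Cod_comp [simp]: "f \<in> Ar C \<Longrightarrow> g \<in> Ar C \<Longrightarrow> Cod C f = Dom C g \<Longrightarrow> Cod C (g \<cdot> f) = Cod C g"
  using category by (auto simp: category_def)

lemma comp_Idt [simp]: "f \<in> Ar C \<Longrightarrow> Dom C f = A \<Longrightarrow> f \<cdot> Idt C A = f"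
  and Idt_comp [simp]: "f \<in> Ar C \<Longrightarrow> Cod C f = A \<Longrightarrow> Idt C A \<cdot> f = f"
  using category by (auto simp: category_def)

lemma comp_assoc [simp]:
  "f \<in> Ar C \<Longrightarrow> g \<in> Ar C \<Longrightarrow> h \<in> Ar C \<Longrightarrow> Cod C f = Dom C g \<Longrightarrow> Cod C g = Dom C h \<Longrightarrow>
    (h \<cdot> g) \<cdot> f = h \<cdot> (g \<cdot> f)"
  using category unfolding category_def by blast

text \<open>Composites are normalised to the right, so an equation between composites is needed by the
  simplifier also with an arbitrary arrow composed on the right.\<close>

lemma rw:
  "g \<cdot> f = h \<Longrightarrow> g \<cdot> f = h \<and> (\<forall>x. f \<in> Ar C \<longrightarrow> g \<in> Ar C \<longrightarrow> Cod C f = Dom C g \<longrightarrow> x \<in> Ar C \<longrightarrow>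
     Cod C x = Dom C f \<longrightarrow> g \<cdot> (f \<cdot> x) = h \<cdot> x)"
  by (metis comp_assoc)

lemma rw3:
  "g \<cdot> (f \<cdot> e) = h \<Longrightarrow> g \<cdot> (f \<cdot> e) = h \<and> (\<forall>x. e \<in> Ar C \<longrightarrow> f \<in> Ar C \<longrightarrow> g \<in> Ar C \<longrightarrow>
     Cod C f = Dom C g \<longrightarrow> Cod C e = Dom C f \<longrightarrow> x \<in> Ar C \<longrightarrow> Cod C x = Dom C e \<longrightarrow>
     g \<cdot> (f \<cdot> (e \<cdot> x)) = h \<cdot> x)"
  by (metis comp_assoc comp_ar Dom_comp Cod_comp)

definition monic :: "'a \<Rightarrow> bool" where
  "monic m \<longleftrightarrow> m \<in> Ar C \<and> (\<forall>u\<in>Ar C. \<forall>v\<in>Ar C. Cod C u = Dom C m \<longrightarrow> Cod C v = Dom C m \<longrightarrow>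
     Dom C u = Dom C v \<longrightarrow> m \<cdot> u = m \<cdot> v \<longrightarrow> u = v)"

definition epic :: "'a \<Rightarrow> bool" where
  "epic e \<longleftrightarrow> e \<in> Ar C \<and> (\<forall>u\<in>Ar C. \<forall>v\<in>Ar C. Dom C u = Cod C e \<longrightarrow> Dom C v = Cod C e \<longrightarrow>
     Cod C u = Cod C v \<longrightarrow> u \<cdot> e = v \<cdot> e \<longrightarrow> u = v)"

lemma monicD: "monic m \<Longrightarrow> m \<cdot> u = m \<cdot> v \<Longrightarrow> u \<in> Ar C \<Longrightarrow> v \<in> Ar C \<Longrightarrow> Cod C u = Dom C m \<Longrightarrow>
    Cod C v = Dom C m \<Longrightarrow> Dom C u = Dom C v \<Longrightarrow> u = v"
  and monic_ar: "monic m \<Longrightarrow> m \<in> Ar C"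
  by (auto simp: monic_def)

lemma epicD: "epic e \<Longrightarrow> u \<cdot> e = v \<cdot> e \<Longrightarrow> u \<in> Ar C \<Longrightarrow> v \<in> Ar C \<Longrightarrow> Dom C u = Cod C e \<Longrightarrow>
    Dom C v = Cod C e \<Longrightarrow> Cod C u = Cod C v \<Longrightarrow> u = v"
  by (auto simp: epic_def)

lemma iso_inverse:
  assumes "is_iso C f"
  obtains g where "f \<in> Ar C" "g \<in> Ar C" "Dom C g = Cod C f" "Cod C g = Dom C f"
    "g \<cdot> f = Idt C (Dom C f)" "f \<cdot> g = Idt C (Cod C f)"
  using assms that by (auto simp: is_iso_def)

lemma isoI:
  "f \<in> Ar C \<Longrightarrow> g \<in> Ar C \<Longrightarrow> Dom C g = Cod C f \<Longrightarrow> Cod C g = Dom C f \<Longrightarrow>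
    g \<cdot> f = Idt C (Dom C f) \<Longrightarrow> f \<cdot> g = Idt C (Cod C f) \<Longrightarrow> is_iso C f"
  by (auto simp: is_iso_def)

lemma iso_Idt [simp]: "A \<in> Ob C \<Longrightarrow> is_iso C (Idt C A)"
  by (rule isoI[where g = "Idt C A"]) auto

lemma monic_comp:
  assumes "monic f" "monic g" "Cod C f = Dom C g"
  shows "monic (g \<cdot> f)"
  using assms by (auto simp: monic_def)

lemma monic_cancel:
  assumes "monic (g \<cdot> f)" "f \<in> Ar C" "g \<in> Ar C" "Cod C f = Dom C g"
  shows "monic f"
  using assms by (auto simp: monic_def)

lemma split_monic:
  assumes "f \<in> Ar C" "g \<in> Ar C" "Cod C f = Dom C g" "Cod C g = Dom C f" "g \<cdot> f = Idt C (Dom C f)"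
  shows "monic f"
  unfolding monic_def
proof (intro conjI ballI impI)
  fix u v
  assume a: "u \<in> Ar C" "v \<in> Ar C" "Cod C u = Dom C f" "Cod C v = Dom C f" "Dom C u = Dom C v"
    "f \<cdot> u = f \<cdot> v"
  have "g \<cdot> (f \<cdot> u) = g \<cdot> (f \<cdot> v)" using a by simp
  then show "u = v" using a(1-5) assms(1-4) by (simp add: assms(5)[THEN rw])
qed (use assms in auto)

lemma split_monic_iso:
  assumes "monic m" "g \<in> Ar C" "Dom C g = Cod C m" "Cod C g = Dom C m" "m \<cdot> g = Idt C (Cod C m)"
  shows "is_iso C m"
proof (rule isoI[where g = g])
  have m: "m \<in> Ar C" using assms by (simp add: monic_ar)
  show "g \<cdot> m = Idt C (Dom C m)"
    by (rule monicD[OF assms(1)]) (use assms(2-4) m in \<open>simp_all add: assms(5)[THEN rw]\<close>)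
qed (use assms in \<open>auto simp: monic_ar\<close>)

lemma iso_monic: "is_iso C f \<Longrightarrow> monic f"
  by (erule iso_inverse) (rule split_monic, auto)

lemma pullback_ar:
  assumes "is_pullback C f g p q"
  shows "f \<in> Ar C" "g \<in> Ar C" "p \<in> Ar C" "q \<in> Ar C" "Cod C f = Cod C g" "Cod C p = Dom C f"
    "Cod C q = Dom C g" "Dom C q = Dom C p" "f \<cdot> p = g \<cdot> q"
  using assms by (auto simp: is_pullback_def)

lemma pullback_lift:
  assumes "is_pullback C f g p q" "f \<cdot> u = g \<cdot> v" "u \<in> Ar C" "v \<in> Ar C" "Dom C u = Dom C v"
    "Cod C u = Dom C f" "Cod C v = Dom C g"
  obtains h where "h \<in> Ar C" "Dom C h = Dom C u" "Cod C h = Dom C p" "p \<cdot> h = u" "q \<cdot> h = v"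
proof -
  have "\<exists>h. h \<in> hom C (Dom C u) (Dom C p) \<and> p \<cdot> h = u \<and> q \<cdot> h = v"
    using assms unfolding is_pullback_def by (metis hom_iff)
  then show ?thesis using that by auto
qed

lemma pullback_eq:
  assumes "is_pullback C f g p q" "p \<cdot> h = p \<cdot> h'" "q \<cdot> h = q \<cdot> h'" "h \<in> Ar C" "h' \<in> Ar C"
    "Dom C h = Dom C h'" "Cod C h = Dom C p" "Cod C h' = Dom C p"
  shows "h = h'"
proof -
  note P = pullback_ar[OF assms(1)]
  have 1: "p \<cdot> h \<in> hom C (Dom C h) (Dom C f)" "q \<cdot> h \<in> hom C (Dom C h) (Dom C g)"
    "f \<cdot> (p \<cdot> h) = g \<cdot> (q \<cdot> h)" using assms(4-8) P by (simp_all add: P(9)[THEN rw])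
  then have "\<exists>!k. k \<in> hom C (Dom C h) (Dom C p) \<and> p \<cdot> k = p \<cdot> h \<and> q \<cdot> k = q \<cdot> h"
    using assms(1) unfolding is_pullback_def by blast
  then show ?thesis using assms(2-8) by auto
qed

lemma pullbackI:
  assumes "f \<in> Ar C" "g \<in> Ar C" "p \<in> Ar C" "q \<in> Ar C" "Cod C f = Cod C g" "Cod C p = Dom C f"
    "Cod C q = Dom C g" "Dom C q = Dom C p" "f \<cdot> p = g \<cdot> q"
    and "\<And>u v. u \<in> Ar C \<Longrightarrow> v \<in> Ar C \<Longrightarrow> Dom C u = Dom C v \<Longrightarrow> Cod C u = Dom C f \<Longrightarrow> Cod C v = Dom C g
      \<Longrightarrow> f \<cdot> u = g \<cdot> v \<Longrightarrow> \<exists>h. h \<in> Ar C \<and> Dom C h = Dom C u \<and> Cod C h = Dom C p \<and> p \<cdot> h = u \<and> q \<cdot> h = v"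
    and "\<And>h h'. h \<in> Ar C \<Longrightarrow> h' \<in> Ar C \<Longrightarrow> Dom C h = Dom C h' \<Longrightarrow> Cod C h = Dom C p \<Longrightarrow>
      Cod C h' = Dom C p \<Longrightarrow> p \<cdot> h = p \<cdot> h' \<Longrightarrow> q \<cdot> h = q \<cdot> h' \<Longrightarrow> h = h'"
  shows "is_pullback C f g p q"
  unfolding is_pullback_def
proof (intro conjI allI ballI impI)
  fix T u v
  assume a: "u \<in> hom C T (Dom C f)" "v \<in> hom C T (Dom C g)" "f \<cdot> u = g \<cdot> v"
  then obtain h where h: "h \<in> Ar C" "Dom C h = Dom C u" "Cod C h = Dom C p" "p \<cdot> h = u" "q \<cdot> h = v"
    using assms(10)[of u v] by auto
  show "\<exists>!h. h \<in> hom C T (Dom C p) \<and> p \<cdot> h = u \<and> q \<cdot> h = v"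
    by (rule ex1I[where a = h]) (use h a assms(11) in auto)
qed (use assms in auto)

lemma pullback_sym: "is_pullback C f g p q \<Longrightarrow> is_pullback C g f q p"
proof -
  assume pb: "is_pullback C f g p q"
  note P = pullback_ar[OF pb]
  show ?thesis
  proof (rule pullbackI)
    fix u v assume a: "u \<in> Ar C" "v \<in> Ar C" "Dom C u = Dom C v" "Cod C u = Dom C g" "Cod C v = Dom C f" "g \<cdot> u = f \<cdot> v"
    obtain h where "h \<in> Ar C" "Dom C h = Dom C v" "Cod C h = Dom C p" "p \<cdot> h = v" "q \<cdot> h = u"
      by (rule pullback_lift[OF pb a(6)[symmetric]]) (use a in simp_all)
    then show "\<exists>h. h \<in> Ar C \<and> Dom C h = Dom C u \<and> Cod C h = Dom C q \<and> q \<cdot> h = u \<and> p \<cdot> h = v"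
      using a P by auto
  next
    fix h h' assume "h \<in> Ar C" "h' \<in> Ar C" "Dom C h = Dom C h'" "Cod C h = Dom C q" "Cod C h' = Dom C q"
      "q \<cdot> h = q \<cdot> h'" "p \<cdot> h = p \<cdot> h'"
    then show "h = h'" using P by - (rule pullback_eq[OF pb], simp_all)
  qed (use P in simp_all)
qed

lemma coequalizer_ar:
  assumes "is_coequalizer C f g e"
  shows "f \<in> Ar C" "g \<in> Ar C" "e \<in> Ar C" "Dom C g = Dom C f" "Cod C g = Cod C f" "Dom C e = Cod C f"
    "e \<cdot> f = e \<cdot> g"
  using assms by (auto simp: is_coequalizer_def)

lemma coequalizer_desc:
  assumes "is_coequalizer C f g e" "h \<cdot> f = h \<cdot> g" "h \<in> Ar C" "Dom C h = Cod C f"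
  obtains t where "t \<in> Ar C" "Dom C t = Cod C e" "Cod C t = Cod C h" "t \<cdot> e = h"
proof -
  have "\<exists>t. t \<in> hom C (Cod C e) (Cod C h) \<and> t \<cdot> e = h"
    using assms unfolding is_coequalizer_def by (metis hom_iff)
  then show ?thesis using that by auto
qed

lemma coequalizer_epic: "is_coequalizer C f g e \<Longrightarrow> epic e"
proof -
  assume co: "is_coequalizer C f g e"
  note E = coequalizer_ar[OF co]
  have "u = v" if a: "u \<in> Ar C" "v \<in> Ar C" "Dom C u = Cod C e" "Dom C v = Cod C e" "Cod C u = Cod C v"
    "u \<cdot> e = v \<cdot> e" for u v
  proof -
    have "u \<cdot> e \<in> hom C (Cod C f) (Cod C u)" "(u \<cdot> e) \<cdot> f = (u \<cdot> e) \<cdot> g"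
      using a(1-5) E by simp_all
    then have "\<exists>!t. t \<in> hom C (Cod C e) (Cod C u) \<and> t \<cdot> e = u \<cdot> e"
      using co unfolding is_coequalizer_def by blast
    then show ?thesis using a by (metis hom_iff)
  qed
  then show ?thesis using E by (auto simp: epic_def)
qed

lemma coequalizerI:
  assumes "f \<in> Ar C" "g \<in> Ar C" "e \<in> Ar C" "Dom C g = Dom C f" "Cod C g = Cod C f" "Dom C e = Cod C f"
    "e \<cdot> f = e \<cdot> g" "epic e"
    and "\<And>h. h \<in> Ar C \<Longrightarrow> Dom C h = Cod C f \<Longrightarrow> h \<cdot> f = h \<cdot> g \<Longrightarrow>
      \<exists>t. t \<in> Ar C \<and> Dom C t = Cod C e \<and> Cod C t = Cod C h \<and> t \<cdot> e = h"
  shows "is_coequalizer C f g e"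
  unfolding is_coequalizer_def
proof (intro conjI allI ballI impI)
  fix T h assume a: "h \<in> hom C (Cod C f) T" "h \<cdot> f = h \<cdot> g"
  then obtain t where t: "t \<in> Ar C" "Dom C t = Cod C e" "Cod C t = Cod C h" "t \<cdot> e = h"
    using assms(9)[of h] by auto
  show "\<exists>!t. t \<in> hom C (Cod C e) T \<and> t \<cdot> e = h"
    by (rule ex1I[where a = t]) (use t a epicD[OF assms(8)] in auto)
qed (use assms in auto)

lemma regular_epi_ar: "regular_epi C e \<Longrightarrow> e \<in> Ar C"
  and regular_epi_epic: "regular_epi C e \<Longrightarrow> epic e"
  by (auto simp: regular_epi_def coequalizer_ar coequalizer_epic)

text \<open>Since \<open>m\<close> is monic, \<open>a\<close> already coequalises the pair of which
  \<open>e\<close> is the coequaliser, and so it descends to the diagonal \<open>d\<close>. This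
  filler is the basic way to factor an arrow through a subobject.\<close>

lemma regular_epi_orthogonal:
  assumes "regular_epi C e" "monic m" "m \<cdot> a = b \<cdot> e" "a \<in> Ar C" "b \<in> Ar C" "Dom C a = Dom C e"
    "Cod C a = Dom C m" "Dom C b = Cod C e" "Cod C b = Cod C m"
  obtains d where "d \<in> Ar C" "Dom C d = Cod C e" "Cod C d = Dom C m" "d \<cdot> e = a" "m \<cdot> d = b"
proof -
  obtain f g where fg: "is_coequalizer C f g e" using assms(1) by (auto simp: regular_epi_def)
  note E = coequalizer_ar[OF fg] and M = monic_ar[OF assms(2)]
  have "m \<cdot> (a \<cdot> f) = m \<cdot> (a \<cdot> g)"
    using E M assms(4-9) by (simp add: assms(3)[THEN rw])
  then have "a \<cdot> f = a \<cdot> g"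
    by (rule monicD[OF assms(2)]) (use E M assms(4-9) in simp_all)
  then obtain d where d: "d \<in> Ar C" "Dom C d = Cod C e" "Cod C d = Cod C a" "d \<cdot> e = a"
    using coequalizer_desc[OF fg] E assms(4-9) by metis
  have "m \<cdot> d = b"
    by (rule epicD[OF coequalizer_epic[OF fg]]) (use d E M assms in simp_all)
  then show ?thesis using that d assms by auto
qed

text \<open>The diagonal filler of the square \<open>m \<cdot> a = 1 \<cdot> e\<close> is a section
  of the monomorphism \<open>m\<close>.\<close>

lemma regular_epi_monic_iso:
  assumes "regular_epi C e" "monic m" "m \<cdot> a = e" "a \<in> Ar C" "Cod C a = Dom C m"
  shows "is_iso C m"
proof -
  note E = regular_epi_ar[OF assms(1)] and M = monic_ar[OF assms(2)]
  have D: "Dom C a = Dom C e" "Cod C m = Cod C e"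
    unfolding assms(3)[symmetric] using M assms(4,5) by simp_all
  obtain d where d: "d \<in> Ar C" "Dom C d = Cod C e" "Cod C d = Dom C m" "m \<cdot> d = Idt C (Cod C e)"
    by (rule regular_epi_orthogonal[OF assms(1,2), of a "Idt C (Cod C e)"])
      (use E M D assms(3-5) in simp_all)
  show ?thesis by (rule split_monic_iso[OF assms(2), of d]) (use d E M D in simp_all)
qed

lemma iso_regular_epi:
  assumes "is_iso C f" shows "regular_epi C f"
proof -
  obtain g where g: "f \<in> Ar C" "g \<in> Ar C" "Dom C g = Cod C f" "Cod C g = Dom C f"
    "g \<cdot> f = Idt C (Dom C f)" "f \<cdot> g = Idt C (Cod C f)" using iso_inverse[OF assms] .
  have "is_coequalizer C (Idt C (Dom C f)) (Idt C (Dom C f)) f"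
  proof (rule coequalizerI)
    show "epic f" unfolding epic_def
    proof (intro conjI ballI impI)
      fix u v assume a: "u \<in> Ar C" "v \<in> Ar C" "Dom C u = Cod C f" "Dom C v = Cod C f"
        "Cod C u = Cod C v" "u \<cdot> f = v \<cdot> f"
      have "(u \<cdot> f) \<cdot> g = (v \<cdot> f) \<cdot> g" using a by simp
      then show "u = v" using a(1-5) g by simp
    qed (rule g)
    show "\<exists>t. t \<in> Ar C \<and> Dom C t = Cod C f \<and> Cod C t = Cod C h \<and> t \<cdot> f = h"
      if "h \<in> Ar C" "Dom C h = Cod C (Idt C (Dom C f))" for h
      by (rule exI[where x = "h \<cdot> g"]) (use g that in simp)
  qed (use g in auto)
  then show ?thesis by (auto simp: regular_epi_def)
qed

end

section \<open>Pullbacks, zero arrows and kernels\<close>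

locale ssa = categ C for C :: "('o, 'a) cat" (structure) +
  assumes strongly_semi_abelian: "strongly_semi_abelian C"
begin

lemma pullback_exists:
  assumes f: "f \<in> Ar C" and g: "g \<in> Ar C" and fg: "Cod C f = Cod C g"
  obtains p q where "is_pullback C f g p q"
proof -
  \<comment> \<open>The cospan as a category of numbers: 0, 1, 2 are the objects and also their
    identities, 3 is the arrow from 0 to 2 and 4 the arrow from 1 to 2. If \<open>v\<close> is not
    an identity, whatever it is composed with must be one; this explains
    \<open>Comp\<close>.\<close>
  define J :: "(nat, nat) cat" where
    "J = \<lparr>Ob = {0, 1, 2}, Ar = {0, 1, 2, 3, 4},
      Dom = (\<lambda>u. if u = 3 then 0 else if u = 4 then 1 else u), Cod = (\<lambda>u. if u \<ge> 3 then 2 else u),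
      Idt = (\<lambda>u. u), Comp = (\<lambda>v u. if v \<le> 2 then u else v)\<rparr>"
  define D :: "(nat, nat, 'o, 'a) fctr" where
    "D = \<lparr>omap = (\<lambda>i. if i = 0 then Dom C f else if i = 1 then Dom C g else Cod C f),
      amap = (\<lambda>u. if u = 0 then Idt C (Dom C f) else if u = 1 then Idt C (Dom C g)
        else if u = 2 then Idt C (Cod C f) else if u = 3 then f else g)\<rparr>"
  have J: "category J" by (simp add: category_def hom_def J_def)
  have "is_functor J C D"
    unfolding is_functor_def using J category f g fg
    by (simp add: J_def D_def)
  moreover have "finite (Ob J)" "finite (Ar J)" by (simp_all add: J_def)
  ultimately obtain L l where L: "is_limit J C D L l"
    using strongly_semi_abelian unfolding strongly_semi_abelian_def finitely_complete_def by blast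
  have l: "l 0 \<in> Ar C" "l 1 \<in> Ar C" "Dom C (l 0) = L" "Dom C (l 1) = L" "Cod C (l 0) = Dom C f"
     "Cod C (l 1) = Dom C g" "f \<cdot> l 0 = l 2" "g \<cdot> l 1 = l 2" "L \<in> Ob C"
    using L by (auto simp: is_limit_def is_cone_def J_def D_def)
  have cone: "is_cone J C D T (\<lambda>i. if i = 0 then u else if i = 1 then v else f \<cdot> u)"
    if "u \<in> hom C T (Dom C f)" "v \<in> hom C T (Dom C g)" "f \<cdot> u = g \<cdot> v" for T u v
    unfolding is_cone_def using that f g fg by (auto simp: J_def D_def)
  have "is_pullback C f g (l 0) (l 1)"
    unfolding is_pullback_def
  proof (intro conjI allI ballI impI)
    fix T u v
    assume a: "u \<in> hom C T (Dom C f)" "v \<in> hom C T (Dom C g)" "f \<cdot> u = g \<cdot> v"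
    have "\<exists>!h. h \<in> hom C T L \<and> (\<forall>i\<in>Ob J. l i \<cdot> h = (if i = 0 then u else if i = 1 then v else f \<cdot> u))"
      using L cone[OF a] unfolding is_limit_def by blast
    \<comment> \<open>The leg at the vertex 2 is determined by the leg at 0, so only two of the
      three cone conditions carry information.\<close>
    moreover have "(\<forall>i\<in>Ob J. l i \<cdot> h = (if i = 0 then u else if i = 1 then v else f \<cdot> u)) \<longleftrightarrow>
        l 0 \<cdot> h = u \<and> l 1 \<cdot> h = v" if "h \<in> hom C T L" for h
      using that l f by (auto simp: J_def l(7)[symmetric])
    ultimately show "\<exists>!h. h \<in> hom C T (Dom C (l 0)) \<and> l 0 \<cdot> h = u \<and> l 1 \<cdot> h = v"
      unfolding l(3) by (metis (no_types, lifting))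
  qed (use l f g fg in auto)
  then show ?thesis using that by blast
qed

abbreviation Z :: 'o where "Z \<equiv> zero_ob C"

lemma is_zero: "is_zero C Z"
  using strongly_semi_abelian someI_ex[of "is_zero C"]
  by (auto simp: strongly_semi_abelian_def pointed_def zero_ob_def)

lemma Z_ob [simp]: "Z \<in> Ob C" using is_zero by (simp add: is_zero_def)

abbreviation zero :: "'o \<Rightarrow> 'o \<Rightarrow> 'a" where "zero A B \<equiv> zero_arr C A B"

text \<open>\<open>zero_arr\<close> is a definite description; its use rests on the uniqueness of
  both factors through the zero object.\<close>

lemma zero_ex1:
  assumes "A \<in> Ob C" "B \<in> Ob C"
  shows "\<exists>!f. \<exists>u\<in>hom C A Z. \<exists>v\<in>hom C Z B. f = v \<cdot> u"
proof -
  have "\<exists>!u. u \<in> hom C A Z" "\<exists>!v. v \<in> hom C Z B" using is_zero assms by (auto simp: is_zero_def)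
  then show ?thesis by metis
qed

lemma zero_factor:
  assumes "A \<in> Ob C" "B \<in> Ob C"
  obtains u v where "u \<in> hom C A Z" "v \<in> hom C Z B" "zero A B = v \<cdot> u"
  using theI'[OF zero_ex1[OF assms]] unfolding zero_arr_def by blast

lemma zero_unique:
  assumes "u \<in> hom C A Z" "v \<in> hom C Z B" shows "v \<cdot> u = zero A B"
  using the1_equality[OF zero_ex1[of A B], of "v \<cdot> u"] assms unfolding zero_arr_def by (metis Dom_ob Cod_ob hom_iff)

lemma zero_ar [simp]: "A \<in> Ob C \<Longrightarrow> B \<in> Ob C \<Longrightarrow> zero A B \<in> Ar C"
  and Dom_zero [simp]: "A \<in> Ob C \<Longrightarrow> B \<in> Ob C \<Longrightarrow> Dom C (zero A B) = A"
  and Cod_zero [simp]: "A \<in> Ob C \<Longrightarrow> B \<in> Ob C \<Longrightarrow> Cod C (zero A B) = B"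
  by (auto elim!: zero_factor[of A B])

lemma comp_zero [simp]:
  assumes "f \<in> Ar C" "Dom C f = B" "A \<in> Ob C" shows "f \<cdot> zero A B = zero A (Cod C f)"
proof -
  have "B \<in> Ob C" using assms by auto
  then obtain u v where uv: "u \<in> hom C A Z" "v \<in> hom C Z B" "zero A B = v \<cdot> u" using zero_factor assms(3) by blast
  then have "f \<cdot> zero A B = (f \<cdot> v) \<cdot> u" using assms by simp
  also have "\<dots> = zero A (Cod C f)" by (rule zero_unique) (use uv(1,2) assms in simp_all)
  finally show ?thesis .
qed

lemma zero_comp [simp]:
  assumes "f \<in> Ar C" "Cod C f = A" "B \<in> Ob C" shows "zero A B \<cdot> f = zero (Dom C f) B"
proof -
  have "A \<in> Ob C" using assms by auto
  then obtain u v where uv: "u \<in> hom C A Z" "v \<in> hom C Z B" "zero A B = v \<cdot> u" using zero_factor assms(3) by blast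
  then have "zero A B \<cdot> f = v \<cdot> (u \<cdot> f)" using assms by simp
  also have "\<dots> = zero (Dom C f) B" by (rule zero_unique) (use uv(1,2) assms in simp_all)
  finally show ?thesis .
qed

lemma to_Z: "f \<in> Ar C \<Longrightarrow> Cod C f = Z \<Longrightarrow> f = zero (Dom C f) Z"
  using is_zero unfolding is_zero_def by (metis hom_iff zero_ar Dom_zero Cod_zero Dom_ob Cod_ob)

lemma kernel_ar:
  assumes "is_kernel C k f"
  shows "k \<in> Ar C" "f \<in> Ar C" "Cod C k = Dom C f" "f \<cdot> k = zero (Dom C k) (Cod C f)"
  using assms by (auto simp: is_kernel_def)

lemma kernel_lift:
  assumes "is_kernel C k f" "h \<in> Ar C" "Cod C h = Dom C f" "f \<cdot> h = zero (Dom C h) (Cod C f)"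
  obtains t where "t \<in> Ar C" "Dom C t = Dom C h" "Cod C t = Dom C k" "k \<cdot> t = h"
proof -
  have "\<exists>t. t \<in> hom C (Dom C h) (Dom C k) \<and> k \<cdot> t = h"
    using assms unfolding is_kernel_def by (metis hom_iff)
  then show ?thesis using that by auto
qed

lemma kernel_monic:
  assumes "is_kernel C k f" shows "monic k"
  unfolding monic_def
proof (intro conjI ballI impI)
  note K = kernel_ar[OF assms]
  fix u v assume a: "u \<in> Ar C" "v \<in> Ar C" "Cod C u = Dom C k" "Cod C v = Dom C k" "Dom C u = Dom C v"
    "k \<cdot> u = k \<cdot> v"
  have "k \<cdot> u \<in> hom C (Dom C u) (Dom C f)" "f \<cdot> (k \<cdot> u) = zero (Dom C u) (Cod C f)"
    using a K by (simp_all add: K(4)[THEN rw])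
  then have "\<exists>!t. t \<in> hom C (Dom C u) (Dom C k) \<and> k \<cdot> t = k \<cdot> u"
    using assms unfolding is_kernel_def by blast
  then show "u = v" using a by (metis hom_iff)
qed (use kernel_ar[OF assms] in auto)

lemma kernelI:
  assumes "monic k" "f \<in> Ar C" "Cod C k = Dom C f" "f \<cdot> k = zero (Dom C k) (Cod C f)"
    and "\<And>h. h \<in> Ar C \<Longrightarrow> Cod C h = Dom C f \<Longrightarrow> f \<cdot> h = zero (Dom C h) (Cod C f) \<Longrightarrow>
      \<exists>t. t \<in> Ar C \<and> Dom C t = Dom C h \<and> Cod C t = Dom C k \<and> k \<cdot> t = h"
  shows "is_kernel C k f"
  unfolding is_kernel_def
proof (intro conjI allI ballI impI)
  fix T h assume a: "h \<in> hom C T (Dom C f)" "f \<cdot> h = zero T (Cod C f)"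
  then obtain t where t: "t \<in> Ar C" "Dom C t = Dom C h" "Cod C t = Dom C k" "k \<cdot> t = h"
    using assms(5)[of h] by auto
  show "\<exists>!t. t \<in> hom C T (Dom C k) \<and> k \<cdot> t = h"
    by (rule ex1I[where a = t]) (use t a monicD[OF assms(1)] in auto)
qed (use assms monic_ar in auto)

text \<open>The kernel is the pullback of \<open>f\<close> along the arrow out of the zero object;
  the other projection ends in zero and carries no information.\<close>

lemma kernel_exists:
  assumes "f \<in> Ar C" obtains k where "is_kernel C k f"
proof -
  obtain k z where pb: "is_pullback C f (zero Z (Cod C f)) k z"
    using pullback_exists[of f "zero Z (Cod C f)"] assms by auto
  note P = pullback_ar[OF pb]
  have z: "z = zero (Dom C k) Z" using P to_Z[of z] assms by simp
  have "is_kernel C k f"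
  proof (rule kernelI)
    show "monic k" unfolding monic_def
    proof (intro conjI ballI impI)
      fix u v assume a: "u \<in> Ar C" "v \<in> Ar C" "Cod C u = Dom C k" "Cod C v = Dom C k"
        "Dom C u = Dom C v" "k \<cdot> u = k \<cdot> v"
      show "u = v" by (rule pullback_eq[OF pb]) (use a P z in simp_all)
    qed (rule P)
    show "f \<cdot> k = zero (Dom C k) (Cod C f)" using P(1-8) assms by (simp add: P(9) z)
    show "\<exists>t. t \<in> Ar C \<and> Dom C t = Dom C h \<and> Cod C t = Dom C k \<and> k \<cdot> t = h"
      if "h \<in> Ar C" "Cod C h = Dom C f" "f \<cdot> h = zero (Dom C h) (Cod C f)" for h
      by (rule pullback_lift[OF pb, of h "zero (Dom C h) Z"]) (use that assms in auto)
  qed (use P in auto)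
  then show ?thesis using that by blast
qed

text \<open>Opposite sides of a pullback square have the same kernel: pairing a zero arrow with
  \<open>k\<close> lifts it to the kernel \<open>l\<close> of \<open>p\<close>, the side opposite
  \<open>g\<close>.\<close>

lemma pullback_kernel:
  assumes pb: "is_pullback C f g p q" and k: "is_kernel C k g"
  obtains l where "l \<in> Ar C" "Dom C l = Dom C k" "Cod C l = Dom C p" "p \<cdot> l = zero (Dom C k) (Dom C f)"
    "q \<cdot> l = k" "is_kernel C l p"
proof -
  note P = pullback_ar[OF pb] and K = kernel_ar[OF k]
  obtain l where l: "l \<in> Ar C" "Dom C l = Dom C (zero (Dom C k) (Dom C f))" "Cod C l = Dom C p"
    "p \<cdot> l = zero (Dom C k) (Dom C f)" "q \<cdot> l = k"
    by (rule pullback_lift[OF pb, of "zero (Dom C k) (Dom C f)" k]) (use P K in simp_all)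
  have l2: "Dom C l = Dom C k" using l(2) P K by simp
  have "is_kernel C l p"
  proof (rule kernelI)
    show "monic l" by (rule monic_cancel[of q]) (use l(1,3,5) P(1-8) kernel_monic[OF k] in simp_all)
    fix h assume h: "h \<in> Ar C" "Cod C h = Dom C p" "p \<cdot> h = zero (Dom C h) (Cod C p)"
    have "f \<cdot> (p \<cdot> h) = g \<cdot> (q \<cdot> h)" using P(1-8) h(1,2) by (simp add: P(9)[THEN rw])
    then obtain t where t: "t \<in> Ar C" "Dom C t = Dom C (q \<cdot> h)" "Cod C t = Dom C k" "k \<cdot> t = q \<cdot> h"
      by - (rule kernel_lift[OF k, of "q \<cdot> h"], (use P(1-8) h in simp_all))
    have "l \<cdot> t = h"
      by (rule pullback_eq[OF pb]) (use P(1-8) h l(1,3) l2 t K in \<open>simp_all add: l(4,5)[THEN rw]\<close>)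
    then show "\<exists>t. t \<in> Ar C \<and> Dom C t = Dom C h \<and> Cod C t = Dom C l \<and> l \<cdot> t = h"
      using t P h l2 by auto
  qed (use l l2 P K in simp_all)
  then show ?thesis using that l l2 by blast
qed

text \<open>An element is killed by \<open>p\<close> exactly when \<open>e\<close> sends it into the
  kernel of \<open>r\<close>. Together with pullback stability this turns a regular epimorphism
  \<open>e\<close> over a base into a regular epimorphism \<open>w\<close> between the
  kernels.\<close>

lemma kernel_restriction_pullback:
  assumes k: "is_kernel C k p" and l: "is_kernel C l r" and e: "e \<in> Ar C" "Cod C e = Dom C r" "r \<cdot> e = p"
    and w: "w \<in> Ar C" "Dom C w = Dom C k" "Cod C w = Dom C l" "l \<cdot> w = e \<cdot> k"
  shows "is_pullback C e l k w"
proof -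
  note K = kernel_ar[OF k] and L = kernel_ar[OF l]
  have Dp: "Dom C p = Dom C e" "Cod C p = Cod C r" unfolding e(3)[symmetric] using e(1,2) L by simp_all
  show ?thesis
  proof (rule pullbackI)
    fix u v assume a: "u \<in> Ar C" "v \<in> Ar C" "Dom C u = Dom C v" "Cod C u = Dom C e" "Cod C v = Dom C l" "e \<cdot> u = l \<cdot> v"
    have "r \<cdot> (e \<cdot> u) = r \<cdot> (l \<cdot> v)" using a(6) by simp
    then have "p \<cdot> u = zero (Dom C u) (Cod C p)"
      using a(1-5) e(1,2) L(1-3) Dp by (simp add: e(3)[THEN rw] L(4)[THEN rw])
    then obtain t where t: "t \<in> Ar C" "Dom C t = Dom C u" "Cod C t = Dom C k" "k \<cdot> t = u"
      using a Dp by - (rule kernel_lift[OF k, of u], simp_all)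
    have "w \<cdot> t = v"
      by (rule monicD[OF kernel_monic[OF l]])
        (use a t w(1-3) e(1,2) L(1-3) K(1-3) Dp in \<open>simp_all add: w(4)[THEN rw]\<close>)
    then show "\<exists>h. h \<in> Ar C \<and> Dom C h = Dom C u \<and> Cod C h = Dom C k \<and> k \<cdot> h = u \<and> w \<cdot> h = v"
      using t by (intro exI[where x = t]) simp
  next
    fix h h' assume "h \<in> Ar C" "h' \<in> Ar C" "Dom C h = Dom C h'" "Cod C h = Dom C k"
      "Cod C h' = Dom C k" "k \<cdot> h = k \<cdot> h'"
    then show "h = h'" by - (rule monicD[OF kernel_monic[OF k]])
  qed (use w e K L Dp in simp_all)
qed

section \<open>Chosen binary products\<close>

lemma product_exists:
  assumes "A \<in> Ob C" "B \<in> Ob C"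
  shows "\<exists>pq. is_product C A B (fst pq) (snd pq)"
proof -
  obtain p q where pb: "is_pullback C (zero A Z) (zero B Z) p q"
    using pullback_exists[of "zero A Z" "zero B Z"] assms by auto
  have "is_product C A B p q"
    using pb assms unfolding is_product_def is_pullback_def by auto
  then show ?thesis by auto
qed

definition pr1 :: "'o \<Rightarrow> 'o \<Rightarrow> 'a" where
  "pr1 A B = fst (SOME pq. is_product C A B (fst pq) (snd pq))"

definition pr2 :: "'o \<Rightarrow> 'o \<Rightarrow> 'a" where
  "pr2 A B = snd (SOME pq. is_product C A B (fst pq) (snd pq))"

definition prd :: "'o \<Rightarrow> 'o \<Rightarrow> 'o" where
  "prd A B = Dom C (pr1 A B)"

definition pair :: "'a \<Rightarrow> 'a \<Rightarrow> 'a" ("\<langle>_, _\<rangle>") where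
  "\<langle>f, g\<rangle> = prod_pair C (pr1 (Cod C f) (Cod C g)) (pr2 (Cod C f) (Cod C g)) f g"

lemma pr_product: "A \<in> Ob C \<Longrightarrow> B \<in> Ob C \<Longrightarrow> is_product C A B (pr1 A B) (pr2 A B)"
  unfolding pr1_def pr2_def by (rule someI_ex, rule product_exists)

lemma pr_ar [simp]:
  assumes "A \<in> Ob C" "B \<in> Ob C"
  shows "pr1 A B \<in> Ar C" "pr2 A B \<in> Ar C" "Dom C (pr1 A B) = prd A B" "Dom C (pr2 A B) = prd A B"
    "Cod C (pr1 A B) = A" "Cod C (pr2 A B) = B" "prd A B \<in> Ob C"
  using pr_product[OF assms] by (auto simp: is_product_def prd_def)

lemma prod_pair:
  assumes "is_product C A B p q" "f \<in> Ar C" "g \<in> Ar C" "Dom C f = Dom C g" "Cod C f = A" "Cod C g = B"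
  shows "prod_pair C p q f g \<in> Ar C" "Dom C (prod_pair C p q f g) = Dom C f"
    "Cod C (prod_pair C p q f g) = Dom C p" "p \<cdot> prod_pair C p q f g = f" "q \<cdot> prod_pair C p q f g = g"
    and "\<And>h. h \<in> Ar C \<Longrightarrow> Dom C h = Dom C f \<Longrightarrow> Cod C h = Dom C p \<Longrightarrow> p \<cdot> h = f \<Longrightarrow> q \<cdot> h = g \<Longrightarrow>
      h = prod_pair C p q f g"
proof -
  have ex: "\<exists>!h. h \<in> hom C (Dom C f) (Dom C p) \<and> p \<cdot> h = f \<and> q \<cdot> h = g"
    using assms unfolding is_product_def by auto
  show "prod_pair C p q f g \<in> Ar C" "Dom C (prod_pair C p q f g) = Dom C f"
    "Cod C (prod_pair C p q f g) = Dom C p" "p \<cdot> prod_pair C p q f g = f" "q \<cdot> prod_pair C p q f g = g"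
    using theI'[OF ex] unfolding prod_pair_def by auto
  show "h = prod_pair C p q f g" if "h \<in> Ar C" "Dom C h = Dom C f" "Cod C h = Dom C p" "p \<cdot> h = f" "q \<cdot> h = g" for h
    using the1_equality[OF ex, of h] that unfolding prod_pair_def by auto
qed

lemma pair_ar [simp]:
  assumes "f \<in> Ar C" "g \<in> Ar C" "Dom C f = Dom C g"
  shows "\<langle>f, g\<rangle> \<in> Ar C" "Dom C \<langle>f, g\<rangle> = Dom C f" "Cod C \<langle>f, g\<rangle> = prd (Cod C f) (Cod C g)"
  using prod_pair(1-3)[OF pr_product assms refl refl] assms by (simp_all add: pair_def)

lemma pr_pair [simp]:
  assumes "f \<in> Ar C" "g \<in> Ar C" "Dom C f = Dom C g" "Cod C f = A" "Cod C g = B"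
  shows "pr1 A B \<cdot> \<langle>f, g\<rangle> = f" "pr2 A B \<cdot> \<langle>f, g\<rangle> = g"
  using prod_pair(4,5)[OF pr_product assms] assms by (auto simp: pair_def)

lemma pair_eqI:
  assumes "pr1 A B \<cdot> h = pr1 A B \<cdot> k" "pr2 A B \<cdot> h = pr2 A B \<cdot> k" "h \<in> Ar C" "k \<in> Ar C"
    "Dom C h = Dom C k" "Cod C h = prd A B" "Cod C k = prd A B" "A \<in> Ob C" "B \<in> Ob C"
  shows "h = k"
proof -
  have *: "is_product C A B (pr1 A B) (pr2 A B)" using assms by (simp add: pr_product)
  have "h = prod_pair C (pr1 A B) (pr2 A B) (pr1 A B \<cdot> h) (pr2 A B \<cdot> h)"
    by (rule prod_pair(6)[OF *]) (use assms in simp_all)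
  also have "\<dots> = k" by (rule prod_pair(6)[OF *, symmetric]) (use assms in simp_all)
  finally show ?thesis .
qed

lemma pair_comp [simp]:
  assumes "f \<in> Ar C" "g \<in> Ar C" "Dom C f = Dom C g" "x \<in> Ar C" "Cod C x = Dom C f"
  shows "\<langle>f, g\<rangle> \<cdot> x = \<langle>f \<cdot> x, g \<cdot> x\<rangle>"
  by (rule pair_eqI[of "Cod C f" "Cod C g"])
    (use assms in \<open>simp_all add: pr_pair[THEN rw, of f g]\<close>)

lemma pair_eta [simp]:
  assumes "h \<in> Ar C" "Cod C h = prd A B" "A \<in> Ob C" "B \<in> Ob C"
  shows "\<langle>pr1 A B \<cdot> h, pr2 A B \<cdot> h\<rangle> = h"
  by (rule pair_eqI[of A B]) (use assms in simp_all)

lemma pair_pr [simp]: "A \<in> Ob C \<Longrightarrow> B \<in> Ob C \<Longrightarrow> \<langle>pr1 A B, pr2 A B\<rangle> = Idt C (prd A B)"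
  by (rule pair_eqI[of A B]) simp_all

lemma pair_inject:
  assumes "\<langle>f, g\<rangle> = \<langle>f', g'\<rangle>" "f \<in> Ar C" "g \<in> Ar C" "f' \<in> Ar C" "g' \<in> Ar C" "Dom C f = Dom C g"
    "Dom C f' = Dom C g'" "Cod C f = Cod C f'" "Cod C g = Cod C g'"
  shows "f = f'" "g = g'"
proof -
  have "pr1 (Cod C f) (Cod C g) \<cdot> \<langle>f, g\<rangle> = pr1 (Cod C f) (Cod C g) \<cdot> \<langle>f', g'\<rangle>"
    "pr2 (Cod C f) (Cod C g) \<cdot> \<langle>f, g\<rangle> = pr2 (Cod C f) (Cod C g) \<cdot> \<langle>f', g'\<rangle>"
    by (simp_all only: assms(1))
  then show "f = f'" "g = g'" using assms(2-) by simp_all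
qed

section \<open>Regular epimorphisms\<close>

lemma regular_epi_pullback: "is_pullback C f g p q \<Longrightarrow> regular_epi C f \<Longrightarrow> regular_epi C q"
  and coequalizer_kernel_pair: "is_pullback C f f p q \<Longrightarrow> \<exists>e. is_coequalizer C p q e"
  and effective_relation: "equivalence_relation C r s \<Longrightarrow> \<exists>f. is_pullback C f f r s"
  using strongly_semi_abelian unfolding strongly_semi_abelian_def barr_exact_def regular_category_def
    is_kernel_pair_def by blast+

text \<open>Pullback stability as a device for chasing elements: a generalised element
  \<open>u\<close> of the codomain acquires a preimage \<open>v\<close> over a regular cover
  \<open>t\<close> of its domain, and \<open>t\<close>, being epic, can be cancelled at the
  end.\<close>

lemma regular_epi_cover:
  assumes "regular_epi C e" "u \<in> Ar C" "Cod C u = Cod C e"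
  obtains t v where "regular_epi C t" "t \<in> Ar C" "v \<in> Ar C" "Cod C t = Dom C u" "Dom C v = Dom C t"
    "Cod C v = Dom C e" "e \<cdot> v = u \<cdot> t"
proof -
  obtain p q where pb: "is_pullback C e u p q"
    using pullback_exists[of e u] assms regular_epi_ar by metis
  show ?thesis using that[of q p] pullback_ar[OF pb] regular_epi_pullback[OF pb] assms by simp
qed

text \<open>The image is the quotient by the kernel pair. The last clause serves the quotient of an
  effective equivalence relation, whose projections are a given kernel pair of
  \<open>f\<close>.\<close>

lemma image_factorisation_kernel_pair:
  assumes f: "f \<in> Ar C"
  obtains e m where "regular_epi C e" "monic m" "e \<in> Ar C" "m \<in> Ar C" "Cod C e = Dom C m"
    "Dom C e = Dom C f" "Cod C m = Cod C f" "m \<cdot> e = f" "\<And>p q. is_pullback C f f p q \<Longrightarrow> is_coequalizer C p q e"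
proof -
  obtain p q where pb: "is_pullback C f f p q" by (rule pullback_exists[OF f f refl])
  note P = pullback_ar[OF pb]
  obtain e where co: "is_coequalizer C p q e" using coequalizer_kernel_pair[OF pb] by auto
  note E = coequalizer_ar[OF co]
  have re: "regular_epi C e" using co by (auto simp: regular_epi_def)
  obtain m where m: "m \<in> Ar C" "Dom C m = Cod C e" "Cod C m = Cod C f" "m \<cdot> e = f"
    using coequalizer_desc[OF co P(9)] P E by metis
  have "u = v" if a: "u \<in> Ar C" "v \<in> Ar C" "Cod C u = Dom C m" "Cod C v = Dom C m" "Dom C u = Dom C v"
    "m \<cdot> u = m \<cdot> v" for u v
  proof -
    \<comment> \<open>Both arrows are lifted through \<open>e\<close> over successive covers. The
      lifts have the same composite with \<open>f\<close>, so they form an arrow into the kernel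
      pair, whose projections \<open>e\<close> identifies.\<close>
    obtain t1 u1 where t1: "regular_epi C t1" "t1 \<in> Ar C" "u1 \<in> Ar C" "Cod C t1 = Dom C u" "Dom C u1 = Dom C t1"
      "Cod C u1 = Dom C e" "e \<cdot> u1 = u \<cdot> t1"
      using regular_epi_cover[OF re, of u] a m by auto
    obtain t2 v2 where t2: "regular_epi C t2" "t2 \<in> Ar C" "v2 \<in> Ar C" "Cod C t2 = Dom C (v \<cdot> t1)"
      "Dom C v2 = Dom C t2" "Cod C v2 = Dom C e" "e \<cdot> v2 = (v \<cdot> t1) \<cdot> t2"
      using regular_epi_cover[OF re, of "v \<cdot> t1"] a(1-5) m t1 by auto
    have "f \<cdot> (u1 \<cdot> t2) = f \<cdot> v2"
      using a(1-5) m(1-3) t1(2-6) t2(2-6) E by (simp add: m(4)[symmetric] t1(7)[THEN rw] t2(7) a(6)[THEN rw])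
    then obtain h where h: "h \<in> Ar C" "Dom C h = Dom C t2" "Cod C h = Dom C p" "p \<cdot> h = u1 \<cdot> t2" "q \<cdot> h = v2"
      by (rule pullback_lift[OF pb]) (use a(1-5) m(1-3) t1(2-6) t2(2-6) E P in simp_all)
    have "e \<cdot> (p \<cdot> h) = e \<cdot> (q \<cdot> h)" using E(1-6) h(1-3) P by (simp add: E(7)[THEN rw])
    then have "(u \<cdot> t1) \<cdot> t2 = (v \<cdot> t1) \<cdot> t2"
      using a(1-5) m(1-3) t1(2-6) t2(2-6) E h by (simp add: t1(7)[THEN rw] t2(7))
    then have "u \<cdot> t1 = v \<cdot> t1"
      by (rule epicD[OF regular_epi_epic[OF t2(1)]]) (use a(1-5) m(1-3) t1(2-6) t2(2-6) in simp_all)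
    then show "u = v"
      by (rule epicD[OF regular_epi_epic[OF t1(1)]]) (use a(1-5) m(1-3) t1(2-6) in simp_all)
  qed
  then have mono: "monic m" using m by (auto simp: monic_def)
  have *: "is_coequalizer C p' q' e" if pb': "is_pullback C f f p' q'" for p' q'
  proof (rule coequalizerI)
    note P' = pullback_ar[OF pb']
    show "e \<cdot> p' = e \<cdot> q'"
      by (rule monicD[OF mono]) (use P' P m E in \<open>simp_all add: m(4)[THEN rw]\<close>)
    show "\<exists>t. t \<in> Ar C \<and> Dom C t = Cod C e \<and> Cod C t = Cod C h \<and> t \<cdot> e = h"
      if h: "h \<in> Ar C" "Dom C h = Cod C p'" "h \<cdot> p' = h \<cdot> q'" for h
    proof -
      obtain k where k: "k \<in> Ar C" "Dom C k = Dom C p" "Cod C k = Dom C p'" "p' \<cdot> k = p" "q' \<cdot> k = q"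
        by (rule pullback_lift[OF pb' P(9)]) (use P in simp_all)
      have "h \<cdot> (p' \<cdot> k) = h \<cdot> (q' \<cdot> k)" using h(1,2) P' k(1-3) by (simp add: h(3)[THEN rw])
      then have "h \<cdot> p = h \<cdot> q" using k by simp
      then show ?thesis using coequalizer_desc[OF co] h P P' by metis
    qed
  qed (use pullback_ar[OF pb'] E P regular_epi_epic[OF re] in simp_all)
  show ?thesis by (rule that[of e m, OF re mono]) (use E m P * in simp_all)
qed

lemma image_factorisation:
  assumes f: "f \<in> Ar C"
  obtains e m where "regular_epi C e" "monic m" "e \<in> Ar C" "m \<in> Ar C" "Cod C e = Dom C m"
    "Dom C e = Dom C f" "Cod C m = Cod C f" "m \<cdot> e = f"
proof (rule image_factorisation_kernel_pair[OF f])
  fix e m assume "regular_epi C e" "monic m" "e \<in> Ar C" "m \<in> Ar C" "Cod C e = Dom C m"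
    "Dom C e = Dom C f" "Cod C m = Cod C f" "m \<cdot> e = f"
  then show ?thesis by (rule that)
qed

text \<open>Applied to the monic part of the image factorisation of \<open>f\<close>. Composites,
  cancellation and coproducts are treated through this criterion because it only asks for diagonal
  fillers.\<close>

lemma extremal_regular_epi:
  assumes f: "f \<in> Ar C"
    and "\<And>m g. monic m \<Longrightarrow> m \<in> Ar C \<Longrightarrow> g \<in> Ar C \<Longrightarrow> Cod C g = Dom C m \<Longrightarrow> Dom C g = Dom C f \<Longrightarrow>
      Cod C m = Cod C f \<Longrightarrow> m \<cdot> g = f \<Longrightarrow> is_iso C m"
  shows "regular_epi C f"
proof -
  obtain e m where em: "regular_epi C e" "monic m" "e \<in> Ar C" "m \<in> Ar C" "Cod C e = Dom C m"
    "Dom C e = Dom C f" "Cod C m = Cod C f" "m \<cdot> e = f" by (rule image_factorisation[OF f])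
  have "is_iso C m" by (rule assms(2)[of m e]) (use em in simp_all)
  then obtain n where n: "m \<in> Ar C" "n \<in> Ar C" "Dom C n = Cod C m" "Cod C n = Dom C m" "n \<cdot> m = Idt C (Dom C m)"
    "m \<cdot> n = Idt C (Cod C m)" by (rule iso_inverse)
  obtain a b where ab: "is_coequalizer C a b e" using em(1) unfolding regular_epi_def by blast
  note E = coequalizer_ar[OF ab]
  have "is_coequalizer C a b f"
  proof (rule coequalizerI)
    have "(m \<cdot> e) \<cdot> a = (m \<cdot> e) \<cdot> b" using E em(1-7) by simp
    then show "f \<cdot> a = f \<cdot> b" by (simp only: em(8))
    show "epic f" unfolding epic_def
    proof (intro conjI ballI impI)
      fix u v assume a: "u \<in> Ar C" "v \<in> Ar C" "Dom C u = Cod C f" "Dom C v = Cod C f" "Cod C u = Cod C v" "u \<cdot> f = v \<cdot> f"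
      have "u \<cdot> m = v \<cdot> m"
        by (rule epicD[OF regular_epi_epic[OF em(1)]]) (use a(1-5) em(1-7) a(6)[folded em(8)] in simp_all)
      then have "(u \<cdot> m) \<cdot> n = (v \<cdot> m) \<cdot> n" by simp
      then show "u = v" using a(1-5) em(1-7) n by simp
    qed (rule f)
    show "\<exists>t. t \<in> Ar C \<and> Dom C t = Cod C f \<and> Cod C t = Cod C h \<and> t \<cdot> f = h"
      if h: "h \<in> Ar C" "Dom C h = Cod C a" "h \<cdot> a = h \<cdot> b" for h
    proof -
      obtain t where t: "t \<in> Ar C" "Dom C t = Cod C e" "Cod C t = Cod C h" "t \<cdot> e = h"
        by (rule coequalizer_desc[OF ab h(3)]) (use h in simp_all)
      have "(t \<cdot> n) \<cdot> (m \<cdot> e) = h" using em(1-7) n t by (simp add: n(5)[THEN rw])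
      then have "(t \<cdot> n) \<cdot> f = h" by (simp only: em(8))
      then show ?thesis using em(1-7) n t by (intro exI[where x = "t \<cdot> n"]) simp
    qed
  qed (use E em f in auto)
  then show ?thesis by (auto simp: regular_epi_def)
qed

lemma regular_epi_comp:
  assumes "regular_epi C f" "regular_epi C g" "Cod C f = Dom C g"
  shows "regular_epi C (g \<cdot> f)"
proof (rule extremal_regular_epi)
  have F: "f \<in> Ar C" "g \<in> Ar C" using assms regular_epi_ar by auto
  show "g \<cdot> f \<in> Ar C" using F assms by simp
  fix m a assume m: "monic m" "m \<in> Ar C" "a \<in> Ar C" "Cod C a = Dom C m" "Dom C a = Dom C (g \<cdot> f)"
    "Cod C m = Cod C (g \<cdot> f)" "m \<cdot> a = g \<cdot> f"
  obtain d where d: "d \<in> Ar C" "Dom C d = Cod C f" "Cod C d = Dom C m" "m \<cdot> d = g"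
    by (rule regular_epi_orthogonal[OF assms(1) m(1) m(7)]) (use m F assms in simp_all)
  then show "is_iso C m" using regular_epi_monic_iso[OF assms(2) m(1)] by metis
qed

lemma regular_epi_cancel:
  assumes "regular_epi C (g \<cdot> f)" "f \<in> Ar C" "g \<in> Ar C" "Cod C f = Dom C g"
  shows "regular_epi C g"
proof (rule extremal_regular_epi)
  fix m a assume m: "monic m" "m \<in> Ar C" "a \<in> Ar C" "Cod C a = Dom C m" "Dom C a = Dom C g"
    "Cod C m = Cod C g" "m \<cdot> a = g"
  have "m \<cdot> (a \<cdot> f) = g \<cdot> f" using m(1-6) assms(2-4) by (simp add: m(7)[THEN rw])
  then show "is_iso C m" using regular_epi_monic_iso[OF assms(1) m(1)] m assms by simp
qed (use assms in auto)

lemma split_regular_epi: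
  assumes "g \<cdot> f = Idt C (Cod C g)" "f \<in> Ar C" "g \<in> Ar C" "Cod C f = Dom C g"
  shows "regular_epi C g"
  using regular_epi_cancel[of g f] assms iso_regular_epi by simp


section \<open>Protomodularity\<close>

lemma split_ses_ar:
  assumes "split_ses C \<kappa> p s"
  shows "\<kappa> \<in> Ar C" "p \<in> Ar C" "s \<in> Ar C" "Cod C \<kappa> = Dom C p" "Dom C s = Cod C p" "Cod C s = Dom C p"
    "p \<cdot> s = Idt C (Cod C p)" "p \<cdot> \<kappa> = zero (Dom C \<kappa>) (Cod C p)" "is_kernel C \<kappa> p" "monic \<kappa>"
  using assms kernel_ar[of \<kappa> p] kernel_monic[of \<kappa> p] by (simp_all add: split_ses_def)

lemma split_sesI:
  "is_kernel C \<kappa> p \<Longrightarrow> s \<in> Ar C \<Longrightarrow> Dom C s = Cod C p \<Longrightarrow> Cod C s = Dom C p \<Longrightarrow>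
    p \<cdot> s = Idt C (Cod C p) \<Longrightarrow> split_ses C \<kappa> p s"
  by (simp add: split_ses_def)

text \<open>The axiom with its hom-sets unfolded. The first part is ordinary protomodularity; the
  second, on normal monomorphisms, is called upon only for quotient actions.\<close>

lemma split_short_five:
  assumes "split_ses C \<kappa> p s" "split_ses C \<kappa>' p' s'" "Cod C p = Cod C p'" "\<phi> \<in> Ar C" "Dom C \<phi> = Dom C p"
    "Cod C \<phi> = Dom C p'" "\<psi> \<in> Ar C" "Dom C \<psi> = Dom C \<kappa>" "Cod C \<psi> = Dom C \<kappa>'"
    "\<phi> \<cdot> \<kappa> = \<kappa>' \<cdot> \<psi>" "p' \<cdot> \<phi> = p" "\<phi> \<cdot> s = s'"
  shows "is_iso C \<psi> \<Longrightarrow> is_iso C \<phi>" "normal_mono C \<psi> \<Longrightarrow> normal_mono C (\<phi> \<cdot> \<kappa>)"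
proof -
  have "(is_iso C \<psi> \<longrightarrow> is_iso C \<phi>) \<and> (normal_mono C \<psi> \<longrightarrow> normal_mono C (\<phi> \<cdot> \<kappa>))"
    using strongly_semi_abelian assms unfolding strongly_semi_abelian_def strongly_protomodular_def
    by (metis hom_iff)
  then show "is_iso C \<psi> \<Longrightarrow> is_iso C \<phi>" "normal_mono C \<psi> \<Longrightarrow> normal_mono C (\<phi> \<cdot> \<kappa>)" by auto
qed

lemma trivial_kernel:
  assumes "f \<in> Ar C"
    and "\<And>x. x \<in> Ar C \<Longrightarrow> Cod C x = Dom C f \<Longrightarrow> f \<cdot> x = zero (Dom C x) (Cod C f) \<Longrightarrow>
      x = zero (Dom C x) (Dom C f)"
  shows "is_kernel C (zero Z (Dom C f)) f"
proof (rule kernelI)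
  show "monic (zero Z (Dom C f))" unfolding monic_def
  proof (intro conjI ballI impI)
    fix u v assume "u \<in> Ar C" "v \<in> Ar C" "Cod C u = Dom C (zero Z (Dom C f))"
      "Cod C v = Dom C (zero Z (Dom C f))" "Dom C u = Dom C v"
    then show "u = v" using to_Z[of u] to_Z[of v] assms(1) by simp
  qed (use assms(1) in simp)
  show "\<exists>t. t \<in> Ar C \<and> Dom C t = Dom C h \<and> Cod C t = Dom C (zero Z (Dom C f)) \<and> zero Z (Dom C f) \<cdot> t = h"
    if h: "h \<in> Ar C" "Cod C h = Dom C f" "f \<cdot> h = zero (Dom C h) (Cod C f)" for h
    using assms(2)[OF h] h(1,2) assms(1) by (intro exI[where x = "zero (Dom C h) Z"]) simp
qed (use assms(1) in simp_all)

lemma kernel_pair_exists: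
  assumes "f \<in> Ar C"
  obtains p q d where "is_pullback C f f p q" "d \<in> Ar C" "Dom C d = Dom C f" "Cod C d = Dom C p"
    "p \<cdot> d = Idt C (Dom C f)" "q \<cdot> d = Idt C (Dom C f)"
proof -
  obtain p q where pb: "is_pullback C f f p q" by (rule pullback_exists[OF assms assms refl])
  obtain d where "d \<in> Ar C" "Dom C d = Dom C (Idt C (Dom C f))" "Cod C d = Dom C p"
    "p \<cdot> d = Idt C (Dom C f)" "q \<cdot> d = Idt C (Dom C f)"
    by (rule pullback_lift[OF pb, of "Idt C (Dom C f)" "Idt C (Dom C f)"]) (use assms in simp_all)
  then show ?thesis using that[OF pb] assms by simp
qed

text \<open>The first projection of the kernel pair then has zero kernel too, so the split short
  five lemma makes the diagonal invertible and the two projections coincide.\<close>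

lemma monic_if_trivial_kernel:
  assumes f: "f \<in> Ar C"
    and tk: "\<And>x. x \<in> Ar C \<Longrightarrow> Cod C x = Dom C f \<Longrightarrow> f \<cdot> x = zero (Dom C x) (Cod C f) \<Longrightarrow>
      x = zero (Dom C x) (Dom C f)"
  shows "monic f"
proof -
  obtain p q d where pb: "is_pullback C f f p q" and d: "d \<in> Ar C" "Dom C d = Dom C f" "Cod C d = Dom C p"
    "p \<cdot> d = Idt C (Dom C f)" "q \<cdot> d = Idt C (Dom C f)" by (rule kernel_pair_exists[OF f])
  note P = pullback_ar[OF pb]
  have "is_kernel C (zero Z (Dom C p)) p"
  proof (rule trivial_kernel)
    fix x assume x: "x \<in> Ar C" "Cod C x = Dom C p" "p \<cdot> x = zero (Dom C x) (Cod C p)"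
    have "f \<cdot> (p \<cdot> x) = f \<cdot> (q \<cdot> x)" using P(1-8) x(1,2) by (simp add: P(9)[THEN rw])
    then have "q \<cdot> x = zero (Dom C (q \<cdot> x)) (Dom C f)"
      by - (rule tk, (use P(1-8) x in simp_all))
    then show "x = zero (Dom C x) (Dom C p)"
      by - (rule pullback_eq[OF pb], (use P(1-8) x in simp_all))
  qed (rule P)
  then have s1: "split_ses C (zero Z (Dom C p)) p d"
    by (rule split_sesI) (use P d in simp_all)
  have "is_kernel C (zero Z (Dom C (Idt C (Dom C f)))) (Idt C (Dom C f))"
    by (rule trivial_kernel) (use f in simp_all)
  then have s2: "split_ses C (zero Z (Dom C f)) (Idt C (Dom C f)) (Idt C (Dom C f))"
    by - (rule split_sesI, (use f in simp_all))
  have "is_iso C d"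
    by (rule split_short_five(1)[OF s2 s1, where \<psi> = "Idt C Z"]) (use f d P in simp_all)
  then obtain g where g: "d \<in> Ar C" "g \<in> Ar C" "Dom C g = Cod C d" "Cod C g = Dom C d"
    "g \<cdot> d = Idt C (Dom C d)" "d \<cdot> g = Idt C (Cod C d)" by (rule iso_inverse)
  have "p \<cdot> (d \<cdot> g) = q \<cdot> (d \<cdot> g)" using P(1-8) g(1-4) d(1-3) by (simp add: d(4,5)[THEN rw])
  then have pq: "p = q" using P(1-8) g d by simp
  show ?thesis unfolding monic_def
  proof (intro conjI ballI impI)
    fix u v assume a: "u \<in> Ar C" "v \<in> Ar C" "Cod C u = Dom C f" "Cod C v = Dom C f" "Dom C u = Dom C v"
      "f \<cdot> u = f \<cdot> v"
    obtain h where "p \<cdot> h = u" "q \<cdot> h = v"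
      by (rule pullback_lift[OF pb a(6)]) (use a in simp_all)
    then show "u = v" using pq by simp
  qed (rule f)
qed

text \<open>Such a subobject is itself a point over the same base, with section \<open>s'\<close>
  and kernel \<open>k'\<close>, and the split short five lemma applies with the identity on kernels.
  Most consequences of protomodularity below go through this form.\<close>

lemma split_ses_extremal:
  assumes S: "split_ses C \<kappa> p s" and m: "monic m" "Cod C m = Dom C p"
    and s': "m \<cdot> s' = s" "s' \<in> Ar C" "Dom C s' = Cod C p" "Cod C s' = Dom C m"
    and k': "m \<cdot> k' = \<kappa>" "k' \<in> Ar C" "Dom C k' = Dom C \<kappa>" "Cod C k' = Dom C m"
  shows "is_iso C m"
proof -
  note A = split_ses_ar[OF S] and M = monic_ar[OF m(1)]
  have "is_kernel C k' (p \<cdot> m)"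
  proof (rule kernelI)
    show "monic k'" by (rule monic_cancel[of m]) (use A k' M in simp_all)
    show "(p \<cdot> m) \<cdot> k' = zero (Dom C k') (Cod C (p \<cdot> m))" using A M m(2) k' by simp
    fix h assume h: "h \<in> Ar C" "Cod C h = Dom C (p \<cdot> m)" "(p \<cdot> m) \<cdot> h = zero (Dom C h) (Cod C (p \<cdot> m))"
    obtain t where t: "t \<in> Ar C" "Dom C t = Dom C (m \<cdot> h)" "Cod C t = Dom C \<kappa>" "\<kappa> \<cdot> t = m \<cdot> h"
      by (rule kernel_lift[OF A(9), of "m \<cdot> h"]) (use A M m(2) h in simp_all)
    have "k' \<cdot> t = h"
      by (rule monicD[OF m(1)]) (use A M m(2) h t k' in \<open>simp_all add: k'(1)[THEN rw]\<close>)
    then show "\<exists>t. t \<in> Ar C \<and> Dom C t = Dom C h \<and> Cod C t = Dom C k' \<and> k' \<cdot> t = h"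
      using t A M m(2) h k'(2-) by auto
  qed (use A M m(2) k' in simp_all)
  then have "split_ses C k' (p \<cdot> m) s'"
    by (rule split_sesI) (use A M m(2) s' in simp_all)
  then show ?thesis
    by (rule split_short_five(1)[OF _ S, where \<psi> = "Idt C (Dom C \<kappa>)"])
      (use A M m(2) s' k' in simp_all)
qed

text \<open>The equaliser of \<open>h\<close> and \<open>h'\<close> contains the section and the
  kernel, hence is everything.\<close>

lemma split_ses_epic:
  assumes S: "split_ses C \<kappa> p s" and "h \<cdot> s = h' \<cdot> s" "h \<cdot> \<kappa> = h' \<cdot> \<kappa>" "h \<in> Ar C" "h' \<in> Ar C"
    "Dom C h = Dom C p" "Dom C h' = Dom C p" "Cod C h = Cod C h'"
  shows "h = h'"
proof -
  note A = split_ses_ar[OF S]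
  \<comment> \<open>The equaliser is built as the pullback of the graphs of \<open>h\<close> and
    \<open>h'\<close>.\<close>
  let ?f = "\<langle>Idt C (Dom C p), h\<rangle>" and ?g = "\<langle>Idt C (Dom C p), h'\<rangle>"
  obtain m n where pb: "is_pullback C ?f ?g m n"
    by (rule pullback_exists[of ?f ?g]) (use A assms in simp_all)
  note P = pullback_ar[OF pb]
  have P': "Cod C m = Dom C p" "Cod C n = Dom C p" using P(6,7) A assms by simp_all
  have "\<langle>m, h \<cdot> m\<rangle> = \<langle>n, h' \<cdot> n\<rangle>"
    using P(9) P(3,4,8) P' A assms(4-) by simp
  note eq = pair_inject[OF this]
  have mn: "m = n" by (rule eq(1)) (use P(3,4,8) P' assms(4-) in simp_all)
  have hm: "h \<cdot> m = h' \<cdot> m" unfolding mn by (rule eq(2)[unfolded mn]) (use P(3,4,8) P' assms(4-) in simp_all)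
  have "monic m" unfolding monic_def
  proof (intro conjI ballI impI)
    fix u v assume "u \<in> Ar C" "v \<in> Ar C" "Cod C u = Dom C m" "Cod C v = Dom C m" "Dom C u = Dom C v"
      "m \<cdot> u = m \<cdot> v"
    then show "u = v" by - (rule pullback_eq[OF pb], (use mn in simp_all))
  qed (rule P)
  moreover obtain s' where "s' \<in> Ar C" "Dom C s' = Dom C s" "Cod C s' = Dom C m" "m \<cdot> s' = s" "n \<cdot> s' = s"
    by (rule pullback_lift[OF pb, of s s]) (use A assms in simp_all)
  moreover obtain k' where "k' \<in> Ar C" "Dom C k' = Dom C \<kappa>" "Cod C k' = Dom C m" "m \<cdot> k' = \<kappa>" "n \<cdot> k' = \<kappa>"
    by (rule pullback_lift[OF pb, of \<kappa> \<kappa>]) (use A assms in simp_all)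
  ultimately have "is_iso C m"
    by - (rule split_ses_extremal[OF S, of m s' k'], (use A P' in simp_all))
  then obtain g where g: "m \<in> Ar C" "g \<in> Ar C" "Dom C g = Cod C m" "Cod C g = Dom C m"
    "g \<cdot> m = Idt C (Dom C m)" "m \<cdot> g = Idt C (Cod C m)" by (rule iso_inverse)
  have "h \<cdot> (m \<cdot> g) = h' \<cdot> (m \<cdot> g)" using g(1-4) P' assms(4-) by (simp add: hm[THEN rw])
  then show ?thesis using g P' assms(4-) by simp
qed

abbreviation in1 :: "'o \<Rightarrow> 'o \<Rightarrow> 'a" where "in1 A B \<equiv> \<langle>Idt C A, zero A B\<rangle>"
abbreviation in2 :: "'o \<Rightarrow> 'o \<Rightarrow> 'a" where "in2 A B \<equiv> \<langle>zero B A, Idt C B\<rangle>"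

lemma prd_split_ses:
  assumes "A \<in> Ob C" "B \<in> Ob C" shows "split_ses C (in2 A B) (pr1 A B) (in1 A B)"
proof (rule split_sesI)
  show "is_kernel C (in2 A B) (pr1 A B)"
  proof (rule kernelI)
    show "monic (in2 A B)" by (rule split_monic[where g = "pr2 A B"]) (use assms in simp_all)
    fix h assume h: "h \<in> Ar C" "Cod C h = Dom C (pr1 A B)" "pr1 A B \<cdot> h = zero (Dom C h) (Cod C (pr1 A B))"
    have "in2 A B \<cdot> (pr2 A B \<cdot> h) = h"
      by (rule pair_eqI[of A B]) (use h assms in simp_all)
    then show "\<exists>t. t \<in> Ar C \<and> Dom C t = Dom C h \<and> Cod C t = Dom C (in2 A B) \<and> in2 A B \<cdot> t = h"
      by (intro exI[where x = "pr2 A B \<cdot> h"]) (use h assms in simp_all)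
  qed (use assms in simp_all)
qed (use assms in simp_all)

text \<open>A product is a split extension of its first factor, so its two axes are jointly epic.
  Identities between operations, such as associativity, are checked on axes.\<close>

lemma prd_epic:
  assumes "h \<cdot> in1 A B = h' \<cdot> in1 A B" "h \<cdot> in2 A B = h' \<cdot> in2 A B" "h \<in> Ar C" "h' \<in> Ar C"
    "Dom C h = prd A B" "Dom C h' = prd A B" "Cod C h = Cod C h'" "A \<in> Ob C" "B \<in> Ob C"
  shows "h = h'"
  by (rule split_ses_epic[OF prd_split_ses[of A B]]) (use assms in simp_all)

lemma regular_epi_coequalizer:
  assumes "regular_epi C f" "is_pullback C f f p q"
  shows "is_coequalizer C p q f"
proof (rule coequalizerI)
  note P = pullback_ar[OF assms(2)]
  obtain a b where ab: "is_coequalizer C a b f" using assms(1) unfolding regular_epi_def by blast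
  note E = coequalizer_ar[OF ab]
  show "\<exists>t. t \<in> Ar C \<and> Dom C t = Cod C f \<and> Cod C t = Cod C h \<and> t \<cdot> f = h"
    if h: "h \<in> Ar C" "Dom C h = Cod C p" "h \<cdot> p = h \<cdot> q" for h
  proof -
    obtain k where k: "k \<in> Ar C" "Dom C k = Dom C a" "Cod C k = Dom C p" "p \<cdot> k = a" "q \<cdot> k = b"
      by (rule pullback_lift[OF assms(2) E(7)]) (use E in simp_all)
    have "h \<cdot> (p \<cdot> k) = h \<cdot> (q \<cdot> k)" using h(1,2) k(1-3) P(1-8) by (simp add: h(3)[THEN rw])
    then have *: "h \<cdot> a = h \<cdot> b" using k by simp
    obtain t where "t \<in> Ar C" "Dom C t = Cod C f" "Cod C t = Cod C h" "t \<cdot> f = h"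
      by (rule coequalizer_desc[OF ab *]) (use h P E in simp_all)
    then show ?thesis by blast
  qed
qed (use pullback_ar[OF assms(2)] regular_epi_epic[OF assms(1)] in simp_all)

lemma regular_epi_desc:
  assumes "regular_epi C f" "g \<in> Ar C" "Dom C g = Dom C f"
    and "\<And>u v. u \<in> Ar C \<Longrightarrow> v \<in> Ar C \<Longrightarrow> Dom C u = Dom C v \<Longrightarrow> Cod C u = Dom C f \<Longrightarrow> Cod C v = Dom C f \<Longrightarrow>
      f \<cdot> u = f \<cdot> v \<Longrightarrow> g \<cdot> u = g \<cdot> v"
  obtains t where "t \<in> Ar C" "Dom C t = Cod C f" "Cod C t = Cod C g" "t \<cdot> f = g"
proof -
  have f: "f \<in> Ar C" using assms regular_epi_ar by simp
  obtain p q where pb: "is_pullback C f f p q" by (rule pullback_exists[OF f f refl])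
  note P = pullback_ar[OF pb]
  have "g \<cdot> p = g \<cdot> q" by (rule assms(4)) (use P in simp_all)
  then show ?thesis
    by (rule coequalizer_desc[OF regular_epi_coequalizer[OF assms(1) pb]])
      (use assms P that in simp_all)
qed

text \<open>The kernel pair of \<open>f\<close> is a split extension with the diagonal as section
  and \<open>(0, k)\<close> as kernel. The two composites of \<open>g\<close> with the projections
  agree on both, so \<open>g\<close> coequalises the kernel pair.\<close>

lemma regular_epi_cokernel:
  assumes f: "regular_epi C f" and k: "is_kernel C k f"
    and g: "g \<in> Ar C" "Dom C g = Dom C f" "g \<cdot> k = zero (Dom C k) (Cod C g)"
  obtains t where "t \<in> Ar C" "Dom C t = Cod C f" "Cod C t = Cod C g" "t \<cdot> f = g"
proof -
  note K = kernel_ar[OF k]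
  obtain p q d where pb: "is_pullback C f f p q" and d: "d \<in> Ar C" "Dom C d = Dom C f" "Cod C d = Dom C p"
    "p \<cdot> d = Idt C (Dom C f)" "q \<cdot> d = Idt C (Dom C f)" by (rule kernel_pair_exists[OF K(2)])
  note P = pullback_ar[OF pb]
  obtain l where l: "l \<in> Ar C" "Dom C l = Dom C k" "Cod C l = Dom C p" "p \<cdot> l = zero (Dom C k) (Dom C f)" "q \<cdot> l = k"
    "is_kernel C l p" by (rule pullback_kernel[OF pb k])
  from l(6) have S: "split_ses C l p d" by (rule split_sesI) (use d P in simp_all)
  have "g \<cdot> p = g \<cdot> q"
    by (rule split_ses_epic[OF S]) (use g K P(1-8) d l in simp_all)
  then show ?thesis
    by (rule coequalizer_desc[OF regular_epi_coequalizer[OF f pb]])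
      (use assms P that in simp_all)
qed

text \<open>Compare the points \<open>I \<times> I\<close> and \<open>I \<times> R\<close> over \<open>I\<close>, with fibre products taken over the codomain
  of \<open>r\<close>.\<close>

lemma monic_iso_if_kernel_factors:
  assumes m: "monic m" and r: "regular_epi C r" "Cod C m = Dom C r" and k: "is_kernel C k r"
    and k': "k' \<in> Ar C" "Dom C k' = Dom C k" "Cod C k' = Dom C m" "m \<cdot> k' = k"
    and rm: "regular_epi C (r \<cdot> m)"
  shows "is_iso C m"
proof -
  note K = kernel_ar[OF k] and M = monic_ar[OF m]
  note R = K(2) and ar = K(1) K(3) M r(2) k'(1-3)
  obtain i x where pb: "is_pullback C (r \<cdot> m) r i x"
    by (rule pullback_exists[of "r \<cdot> m" r]) (use R ar in simp_all)
  note P = pullback_ar[OF pb]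
  have P': "Cod C i = Dom C m" using P(6) R ar by simp
  have P9: "r \<cdot> (m \<cdot> i) = r \<cdot> x" using P(9) P P' R ar by simp
  obtain \<sigma> where \<sigma>: "\<sigma> \<in> Ar C" "Dom C \<sigma> = Dom C m" "Cod C \<sigma> = Dom C i" "i \<cdot> \<sigma> = Idt C (Dom C m)" "x \<cdot> \<sigma> = m"
    by (rule pullback_lift[OF pb, of "Idt C (Dom C m)" m]) (use R ar in simp_all)
  obtain l where "l \<in> Ar C" "Dom C l = Dom C k" "Cod C l = Dom C i" "i \<cdot> l = zero (Dom C k) (Dom C (r \<cdot> m))" "x \<cdot> l = k"
    and li: "is_kernel C l i" by (rule pullback_kernel[OF pb k])
  then have l: "l \<in> Ar C" "Dom C l = Dom C k" "Cod C l = Dom C i" "i \<cdot> l = zero (Dom C k) (Dom C m)" "x \<cdot> l = k"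
    using R ar by simp_all
  from li have S: "split_ses C l i \<sigma>" by (rule split_sesI) (use \<sigma> P P' R ar in simp_all)
  obtain u v where pw: "is_pullback C (r \<cdot> m) (r \<cdot> m) u v"
    by (rule pullback_exists[of "r \<cdot> m" "r \<cdot> m"]) (use R ar in simp_all)
  note W = pullback_ar[OF pw]
  have W': "Cod C u = Dom C m" "Cod C v = Dom C m" using W(6,7) R ar by simp_all
  have W9: "r \<cdot> (m \<cdot> u) = r \<cdot> (m \<cdot> v)" using W(9) W W' R ar by simp
  \<comment> \<open>The comparison \<open>(a, b) |-> (a, m b)\<close>, monic because
    \<open>m\<close> is.\<close>
  obtain w where w: "w \<in> Ar C" "Dom C w = Dom C u" "Cod C w = Dom C i" "i \<cdot> w = u" "x \<cdot> w = m \<cdot> v"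
    by (rule pullback_lift[OF pb, of u "m \<cdot> v"]) (use R ar W W' W9 in simp_all)
  have wm: "monic w" unfolding monic_def
  proof (intro conjI ballI impI)
    fix a b assume a: "a \<in> Ar C" "b \<in> Ar C" "Cod C a = Dom C w" "Cod C b = Dom C w" "Dom C a = Dom C b"
      "w \<cdot> a = w \<cdot> b"
    have "i \<cdot> (w \<cdot> a) = i \<cdot> (w \<cdot> b)" "x \<cdot> (w \<cdot> a) = x \<cdot> (w \<cdot> b)" using a(6) by simp_all
    then have 1: "u \<cdot> a = u \<cdot> b" "m \<cdot> (v \<cdot> a) = m \<cdot> (v \<cdot> b)"
      using a(1-5) w(1-3) W W' P P' ar by (simp_all add: w(4,5)[THEN rw])
    have "v \<cdot> a = v \<cdot> b" by (rule monicD[OF m 1(2)]) (use a(1-5) w(1-3) W W' in simp_all)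
    with 1(1) show "a = b" by (rule pullback_eq[OF pw]) (use a(1-5) w(1-3) W in simp_all)
  qed (rule w)
  obtain s' where s': "s' \<in> Ar C" "Dom C s' = Dom C m" "Cod C s' = Dom C u"
    "u \<cdot> s' = Idt C (Dom C m)" "v \<cdot> s' = Idt C (Dom C m)"
    by (rule pullback_lift[OF pw, of "Idt C (Dom C m)" "Idt C (Dom C m)"]) (use R ar in simp_all)
  obtain l' where l': "l' \<in> Ar C" "Dom C l' = Dom C k" "Cod C l' = Dom C u"
    "u \<cdot> l' = zero (Dom C k) (Dom C m)" "v \<cdot> l' = k'"
    by (rule pullback_lift[OF pw, of "zero (Dom C k) (Dom C m)" k']) (use R ar K k'(4) in simp_all)
  have "is_iso C w"
  proof (rule split_ses_extremal[OF S wm])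
    show "w \<cdot> s' = \<sigma>"
      by (rule pullback_eq[OF pb]) (use w(1-3) W(1-8) W' P(1-8) P' ar s' \<sigma> in \<open>simp_all add: w(4,5)[THEN rw]\<close>)
    show "w \<cdot> l' = l"
      by (rule pullback_eq[OF pb]) (use w(1-3) W(1-8) W' P(1-8) P' ar l' l k' in \<open>simp_all add: w(4,5)[THEN rw]\<close>)
  qed (use w W W' P P' ar s' l' l in simp_all)
  then obtain g where g: "w \<in> Ar C" "g \<in> Ar C" "Dom C g = Cod C w" "Cod C g = Dom C w"
    "g \<cdot> w = Idt C (Dom C w)" "w \<cdot> g = Idt C (Cod C w)" by (rule iso_inverse)
  \<comment> \<open>Once \<open>w\<close> is invertible, \<open>x\<close> factors through
    \<open>m\<close>; and \<open>x\<close> is a regular epimorphism, as the pullback of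
    \<open>r \<cdot> m\<close>.\<close>
  have "x \<cdot> (w \<cdot> g) = m \<cdot> (v \<cdot> g)"
    using g(1-4) w(1-3) W(1-8) W' P(1-8) P' ar by (simp add: w(5)[THEN rw])
  then have "m \<cdot> (v \<cdot> g) = x" using g w P by simp
  then show ?thesis
    by (rule regular_epi_monic_iso[OF regular_epi_pullback[OF pb rm] m])
      (use g w W W' ar in simp_all)
qed

section \<open>Reflexive relations and quotients\<close>

text \<open>Write \<open>x R y\<close> for the relation. The object of all \<open>(x, y, z)\<close> with \<open>x R y\<close> and \<open>x R z\<close> is a point over
  that of all \<open>(x, y)\<close> with \<open>x R y\<close>, with the diagonal as section; its subobject where \<open>y R z\<close> contains the
  section and has the same kernel.\<close>

lemma reflexive_relation_euclidean:
  assumes r: "r \<in> Ar C" "s \<in> Ar C" "Dom C s = Dom C r" "Cod C s = Cod C r" "monic \<langle>r, s\<rangle>"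
    and d: "d \<in> Ar C" "Dom C d = Cod C r" "Cod C d = Dom C r" "r \<cdot> d = Idt C (Cod C r)" "s \<cdot> d = Idt C (Cod C r)"
    and uv: "u \<in> Ar C" "v \<in> Ar C" "Dom C u = Dom C v" "Cod C u = Dom C r" "Cod C v = Dom C r" "r \<cdot> u = r \<cdot> v"
  obtains w where "w \<in> Ar C" "Dom C w = Dom C u" "Cod C w = Dom C r" "r \<cdot> w = s \<cdot> u" "s \<cdot> w = s \<cdot> v"
proof -
  obtain p q e where pb: "is_pullback C r r p q" and e: "e \<in> Ar C" "Dom C e = Dom C r" "Cod C e = Dom C p"
    "p \<cdot> e = Idt C (Dom C r)" "q \<cdot> e = Idt C (Dom C r)" by (rule kernel_pair_exists[OF r(1)])
  note P = pullback_ar[OF pb]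
  obtain k where k: "is_kernel C k r" by (rule kernel_exists[OF r(1)])
  note K = kernel_ar[OF k]
  obtain l where l: "l \<in> Ar C" "Dom C l = Dom C k" "Cod C l = Dom C p" "p \<cdot> l = zero (Dom C k) (Dom C r)" "q \<cdot> l = k"
    "is_kernel C l p" by (rule pullback_kernel[OF pb k])
  from l(6) have S: "split_ses C l p e" by (rule split_sesI) (use e P in simp_all)
  \<comment> \<open>\<open>m\<close> is the subobject of the triples with \<open>y R z\<close>, and
    \<open>c\<close> is the witness of that relation.\<close>
  obtain m c where pw: "is_pullback C \<langle>s \<cdot> p, s \<cdot> q\<rangle> \<langle>r, s\<rangle> m c"
    by (rule pullback_exists[of "\<langle>s \<cdot> p, s \<cdot> q\<rangle>" "\<langle>r, s\<rangle>"]) (use r P in simp_all)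
  note W = pullback_ar[OF pw]
  have W': "Cod C m = Dom C p" "Cod C c = Dom C r" using W(6,7) r P by simp_all
  have "\<langle>s \<cdot> p \<cdot> m, s \<cdot> q \<cdot> m\<rangle> = \<langle>r \<cdot> c, s \<cdot> c\<rangle>" using W(9) W(3,4,8) W' r(1-4) P(1-8) by simp
  note eq = pair_inject[OF this]
  have c: "s \<cdot> p \<cdot> m = r \<cdot> c" "s \<cdot> q \<cdot> m = s \<cdot> c"
    by (rule eq; use W(3,4,8) W' r(1-4) P(1-8) in simp)+
  have mm: "monic m" unfolding monic_def
  proof (intro conjI ballI impI)
    fix a b assume a: "a \<in> Ar C" "b \<in> Ar C" "Cod C a = Dom C m" "Cod C b = Dom C m" "Dom C a = Dom C b"
      "m \<cdot> a = m \<cdot> b"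
    have "\<langle>s \<cdot> p, s \<cdot> q\<rangle> \<cdot> (m \<cdot> a) = \<langle>s \<cdot> p, s \<cdot> q\<rangle> \<cdot> (m \<cdot> b)" using a(6) by simp
    then have "\<langle>r, s\<rangle> \<cdot> (c \<cdot> a) = \<langle>r, s\<rangle> \<cdot> (c \<cdot> b)"
      using a(1-5) W(1-8) W' r(1-4) P(1-8) by (simp add: c[THEN rw3])
    then have "c \<cdot> a = c \<cdot> b" by (rule monicD[OF r(5)]) (use a(1-5) W W' r in simp_all)
    with a(6) show "a = b" by (rule pullback_eq[OF pw]) (use a(1-5) in simp_all)
  qed (rule W)
  \<comment> \<open>The triples \<open>(x, y, y)\<close> belong to it by reflexivity at
    \<open>y\<close>.\<close>
  obtain s' where s': "s' \<in> Ar C" "Dom C s' = Dom C e" "Cod C s' = Dom C m" "m \<cdot> s' = e" "c \<cdot> s' = d \<cdot> s"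
    by (rule pullback_lift[OF pw, of e "d \<cdot> s"]) (use r P e d in \<open>simp_all add: d(4,5)[THEN rw]\<close>)
  \<comment> \<open>On the kernel \<open>x\<close> and \<open>y\<close> are zero, so
    \<open>y R z\<close> is just the given \<open>x R z\<close>.\<close>
  obtain l' where l': "l' \<in> Ar C" "Dom C l' = Dom C l" "Cod C l' = Dom C m" "m \<cdot> l' = l" "c \<cdot> l' = k"
    by (rule pullback_lift[OF pw, of l k]) (use r P K l in simp_all)
  have "is_iso C m"
    by (rule split_ses_extremal[OF S mm, where s' = s' and k' = l']) (use W' W P e s' l' in simp_all)
  then obtain g where g: "m \<in> Ar C" "g \<in> Ar C" "Dom C g = Cod C m" "Cod C g = Dom C m"
    "g \<cdot> m = Idt C (Dom C m)" "m \<cdot> g = Idt C (Cod C m)" by (rule iso_inverse)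
  obtain h where h: "h \<in> Ar C" "Dom C h = Dom C u" "Cod C h = Dom C p" "p \<cdot> h = u" "q \<cdot> h = v"
    by (rule pullback_lift[OF pb uv(6)]) (use uv in simp_all)
  have "r \<cdot> (c \<cdot> (g \<cdot> h)) = s \<cdot> p \<cdot> (m \<cdot> (g \<cdot> h))" "s \<cdot> (c \<cdot> (g \<cdot> h)) = s \<cdot> q \<cdot> (m \<cdot> (g \<cdot> h))"
    using g(1-4) h(1-3) W(1-8) W' r(1-4) P(1-8) by (simp_all add: c[THEN rw3])
  then have "r \<cdot> (c \<cdot> (g \<cdot> h)) = s \<cdot> u" "s \<cdot> (c \<cdot> (g \<cdot> h)) = s \<cdot> v"
    using g(1-4) h W(1-8) W' r(1-4) P(1-8) by (simp_all add: g(6)[THEN rw])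
  then show ?thesis by - (rule that[of "c \<cdot> (g \<cdot> h)"], (use g h W W' r P in simp_all))
qed

text \<open>Symmetry is the Euclidean property for \<open>x R y\<close> and \<open>x R x\<close>;
  transitivity is the Euclidean property for \<open>y R x\<close> and \<open>y R z\<close>. This is
  the Mal'tsev property of protomodular categories.\<close>

lemma reflexive_relation_equivalence:
  assumes r: "r \<in> Ar C" "s \<in> Ar C" "Dom C s = Dom C r" "Cod C s = Cod C r" "monic \<langle>r, s\<rangle>"
    and d: "d \<in> Ar C" "Dom C d = Cod C r" "Cod C d = Dom C r" "r \<cdot> d = Idt C (Cod C r)" "s \<cdot> d = Idt C (Cod C r)"
  shows "equivalence_relation C r s"
proof -
  obtain t where t: "t \<in> Ar C" "Dom C t = Dom C (Idt C (Dom C r))" "Cod C t = Dom C r"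
    "r \<cdot> t = s \<cdot> Idt C (Dom C r)" "s \<cdot> t = s \<cdot> d \<cdot> r"
    by (rule reflexive_relation_euclidean[OF r d, of "Idt C (Dom C r)" "d \<cdot> r"])
      (use r d in \<open>simp_all add: d(4)[THEN rw]\<close>)
  have t': "Dom C t = Dom C r" "r \<cdot> t = s" "s \<cdot> t = r"
    using t r d by (simp_all add: d(5)[THEN rw])
  have trans: "\<exists>m\<in>hom C (Dom C p) (Dom C r). r \<cdot> m = r \<cdot> p \<and> s \<cdot> m = s \<cdot> q" if pb: "is_pullback C s r p q" for p q
  proof -
    note P = pullback_ar[OF pb]
    have "r \<cdot> (t \<cdot> p) = r \<cdot> q" using P(1-8) t(1) t'(1) r t(3) by (simp add: t'(2)[THEN rw] P(9))
    then obtain w where "w \<in> Ar C" "Dom C w = Dom C (t \<cdot> p)" "Cod C w = Dom C r" "r \<cdot> w = s \<cdot> t \<cdot> p" "s \<cdot> w = s \<cdot> q"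
      by - (rule reflexive_relation_euclidean[OF r d, of "t \<cdot> p" q], (use P(1-8) t(1,3) t' r in simp_all))
    then show ?thesis by (intro bexI[where x = w]) (use P(1-8) t(1,3) t' r in \<open>simp_all add: t'(3)[THEN rw]\<close>)
  qed
  show ?thesis
    unfolding equivalence_relation_def
  proof (intro conjI allI ballI impI)
    fix T u v assume "u \<in> hom C T (Dom C r)" "v \<in> hom C T (Dom C r)" "r \<cdot> u = r \<cdot> v \<and> s \<cdot> u = s \<cdot> v"
    then show "u = v" by - (rule monicD[OF r(5)], (use r in simp_all))
  next
    show "\<exists>d\<in>hom C (Cod C r) (Dom C r). r \<cdot> d = Idt C (Cod C r) \<and> s \<cdot> d = Idt C (Cod C r)"
      by (rule bexI[where x = d]) (use d in simp_all)
    show "\<exists>t\<in>hom C (Dom C r) (Dom C r). r \<cdot> t = s \<and> s \<cdot> t = r"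
      by (rule bexI[where x = t]) (use t(1,3) t' in simp_all)
  qed (use r trans in simp_all)
qed

text \<open>Effectiveness only provides some \<open>f\<close> with the given kernel pair. Its
  regular image has the same kernel pair because the remaining factor is monic.\<close>

lemma equivalence_relation_quotient:
  assumes "equivalence_relation C r s"
  obtains q where "regular_epi C q" "is_pullback C q q r s"
proof -
  obtain f where pb: "is_pullback C f f r s" using effective_relation[OF assms] by blast
  note P = pullback_ar[OF pb]
  obtain e m where em: "regular_epi C e" "monic m" "e \<in> Ar C" "m \<in> Ar C" "Cod C e = Dom C m"
    "Dom C e = Dom C f" "Cod C m = Cod C f" "m \<cdot> e = f"
    and co: "\<And>p q. is_pullback C f f p q \<Longrightarrow> is_coequalizer C p q e"
    by (rule image_factorisation_kernel_pair[OF P(1)]) blast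
  note E = coequalizer_ar[OF co[OF pb]]
  have "is_pullback C e e r s"
  proof (rule pullbackI)
    fix u v assume a: "u \<in> Ar C" "v \<in> Ar C" "Dom C u = Dom C v" "Cod C u = Dom C e" "Cod C v = Dom C e" "e \<cdot> u = e \<cdot> v"
    have "m \<cdot> (e \<cdot> u) = m \<cdot> (e \<cdot> v)" using a(6) by simp
    then have "f \<cdot> u = f \<cdot> v" using a(1-5) em(3-7) by (simp add: em(8)[THEN rw])
    then obtain h where "h \<in> Ar C" "Dom C h = Dom C u" "Cod C h = Dom C r" "r \<cdot> h = u" "s \<cdot> h = v"
      by (rule pullback_lift[OF pb]) (use a em in simp_all)
    then show "\<exists>h. h \<in> Ar C \<and> Dom C h = Dom C u \<and> Cod C h = Dom C r \<and> r \<cdot> h = u \<and> s \<cdot> h = v" by blast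
  next
    fix h h' assume "h \<in> Ar C" "h' \<in> Ar C" "Dom C h = Dom C h'" "Cod C h = Dom C r" "Cod C h' = Dom C r"
      "r \<cdot> h = r \<cdot> h'" "s \<cdot> h = s \<cdot> h'"
    then show "h = h'" by - (rule pullback_eq[OF pb])
  qed (use P E em in simp_all)
  then show ?thesis using that em(1) by blast
qed

text \<open>The image of a reflexive graph is a reflexive relation, hence an effective equivalence
  relation. The cover \<open>i\<close> is part of the conclusion because the relation is accessible
  only through the graph that covers it.\<close>

lemma reflexive_graph_quotient:
  assumes g: "d \<in> Ar C" "c \<in> Ar C" "Dom C c = Dom C d" "Cod C c = Cod C d"
    and e: "e \<in> Ar C" "Dom C e = Cod C d" "Cod C e = Dom C d" "d \<cdot> e = Idt C (Cod C d)" "c \<cdot> e = Idt C (Cod C d)"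
  obtains q i r s where "regular_epi C q" "regular_epi C i" "is_pullback C q q r s" "Dom C q = Cod C d"
    "Dom C i = Dom C d" "Cod C i = Dom C r" "r \<cdot> i = d" "s \<cdot> i = c"
proof -
  let ?A = "Cod C d"
  obtain i m where im: "regular_epi C i" "monic m" "i \<in> Ar C" "m \<in> Ar C" "Cod C i = Dom C m"
    "Dom C i = Dom C \<langle>d, c\<rangle>" "Cod C m = Cod C \<langle>d, c\<rangle>" "m \<cdot> i = \<langle>d, c\<rangle>"
    by (rule image_factorisation[of "\<langle>d, c\<rangle>"]) (use g in simp_all)
  have im': "Dom C i = Dom C d" "Cod C m = prd ?A ?A" using im(6,7) g by simp_all
  have A: "?A \<in> Ob C" using g by simp
  define r where "r = pr1 ?A ?A \<cdot> m"
  define s where "s = pr2 ?A ?A \<cdot> m"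
  have rs: "r \<in> Ar C" "s \<in> Ar C" "Dom C r = Dom C m" "Dom C s = Dom C m" "Cod C r = ?A" "Cod C s = ?A"
    "\<langle>r, s\<rangle> = m"
    using im(4) im' A by (simp_all add: r_def s_def)
  have ri: "r \<cdot> i = d" "s \<cdot> i = c" using im(3-5,8) im' A g by (simp_all add: r_def s_def)
  have eq: "equivalence_relation C r s"
    by (rule reflexive_relation_equivalence[where d = "i \<cdot> e"])
      (use rs im(2,3,5) im' g e in \<open>simp_all add: ri[THEN rw]\<close>)
  obtain q where q: "regular_epi C q" "is_pullback C q q r s" by (rule equivalence_relation_quotient[OF eq])
  have "Dom C q = ?A" using pullback_ar[OF q(2)] rs by simp
  then show ?thesis by - (rule that[OF q(1) im(1) q(2)], (use im(5) im' rs ri in simp_all))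
qed

text \<open>A monomorphism that cooperates with the identity is the zero class of an equivalence relation.\<close>

lemma central_monic_normal:
  assumes k: "monic k" "Dom C k = B" "Cod C k = Y"
    and \<rho>: "\<rho> \<in> Ar C" "Dom C \<rho> = prd Y B" "Cod C \<rho> = Y" "\<rho> \<cdot> in1 Y B = Idt C Y" "\<rho> \<cdot> in2 Y B = k"
  obtains q where "regular_epi C q" "is_kernel C k q" "q \<cdot> pr1 Y B = q \<cdot> \<rho>"
proof -
  have ob: "B \<in> Ob C" "Y \<in> Ob C" using monic_ar[OF k(1)] k by auto
  note K = monic_ar[OF k(1)] k(2,3)
  \<comment> \<open>An element \<open>(y, b)\<close> of the kernel has \<open>y = 0\<close>, so
    \<open>\<rho>\<close> sends it to \<open>k b\<close>, and \<open>k\<close> is monic.\<close>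
  have m: "monic \<langle>pr1 Y B, \<rho>\<rangle>"
  proof (rule monic_if_trivial_kernel)
    fix x assume x: "x \<in> Ar C" "Cod C x = Dom C \<langle>pr1 Y B, \<rho>\<rangle>"
      "\<langle>pr1 Y B, \<rho>\<rangle> \<cdot> x = zero (Dom C x) (Cod C \<langle>pr1 Y B, \<rho>\<rangle>)"
    have x2: "Cod C x = prd Y B" using x \<rho> ob by simp
    have "\<langle>pr1 Y B \<cdot> x, \<rho> \<cdot> x\<rangle> = \<langle>zero (Dom C x) Y, zero (Dom C x) Y\<rangle>"
      using x(1,3) x2 \<rho>(1-3) ob pair_eta[of "zero (Dom C x) (prd Y Y)" Y Y] by simp
    note eq = pair_inject[OF this]
    have 1: "pr1 Y B \<cdot> x = zero (Dom C x) Y" "\<rho> \<cdot> x = zero (Dom C x) Y"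
      by (rule eq; use x(1) x2 \<rho>(1-3) ob in simp)+
    have 2: "x = in2 Y B \<cdot> (pr2 Y B \<cdot> x)"
      by (rule pair_eqI[of Y B]) (use 1(1) x(1) x2 \<rho>(1-3) ob in simp_all)
    have "k \<cdot> (pr2 Y B \<cdot> x) = \<rho> \<cdot> (in2 Y B \<cdot> (pr2 Y B \<cdot> x))"
      using x(1) x2 \<rho>(1-3) ob K by (subst \<rho>(5)[symmetric], subst comp_assoc) simp_all
    also have "\<dots> = \<rho> \<cdot> x" by (subst 2[symmetric]) simp
    finally have "k \<cdot> (pr2 Y B \<cdot> x) = k \<cdot> zero (Dom C x) B" using 1(2) x(1) K ob by simp
    then have "pr2 Y B \<cdot> x = zero (Dom C x) B"
      by (rule monicD[OF k(1)]) (use x(1) x2 ob K in simp_all)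
    then show "x = zero (Dom C x) (Dom C \<langle>pr1 Y B, \<rho>\<rangle>)"
      by - (rule pair_eqI[of Y B], (use 1 x(1) x2 \<rho>(1-3) ob in simp_all))
  qed (use \<rho> ob in simp_all)
  \<comment> \<open>Written additively, the relation identifies \<open>y\<close> with
    \<open>y + k b\<close>; taking \<open>b = 0\<close> gives reflexivity.\<close>
  have eq: "equivalence_relation C (pr1 Y B) \<rho>"
    by (rule reflexive_relation_equivalence[where d = "in1 Y B"]) (use m \<rho> ob in simp_all)
  obtain q where q: "regular_epi C q" "is_pullback C q q (pr1 Y B) \<rho>" by (rule equivalence_relation_quotient[OF eq])
  note Q = pullback_ar[OF q(2)]
  have Q': "Dom C q = Y" using Q ob by simp
  have "is_kernel C k q"
  proof (rule kernelI[OF k(1)])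
    have "(q \<cdot> \<rho>) \<cdot> in2 Y B = zero B (Cod C q)"
      using Q(1) Q' ob by (subst Q(9)[symmetric]) simp
    then show "q \<cdot> k = zero (Dom C k) (Cod C q)" using Q(1) Q' ob \<rho> k by simp
    fix h assume h: "h \<in> Ar C" "Cod C h = Dom C q" "q \<cdot> h = zero (Dom C h) (Cod C q)"
    \<comment> \<open>That \<open>q\<close> kills \<open>h\<close> means that zero is related to
      \<open>h\<close>, so \<open>h = \<rho> (0, b) = k b\<close>.\<close>
    obtain t where t: "t \<in> Ar C" "Dom C t = Dom C (zero (Dom C h) Y)" "Cod C t = Dom C (pr1 Y B)"
      "pr1 Y B \<cdot> t = zero (Dom C h) Y" "\<rho> \<cdot> t = h"
      by (rule pullback_lift[OF q(2), of "zero (Dom C h) Y" h]) (use Q(1) Q' ob h in simp_all)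
    have t': "Dom C t = Dom C h" "Cod C t = prd Y B" using t h ob by simp_all
    have 2: "t = in2 Y B \<cdot> (pr2 Y B \<cdot> t)"
      by (rule pair_eqI[of Y B]) (use t(1,4) t' h(1) ob in simp_all)
    have "k \<cdot> (pr2 Y B \<cdot> t) = \<rho> \<cdot> (in2 Y B \<cdot> (pr2 Y B \<cdot> t))"
      using t(1) t' \<rho>(1-3) ob K by (subst \<rho>(5)[symmetric], subst comp_assoc) simp_all
    also have "\<dots> = h" using t(5) by (subst 2[symmetric]) simp
    finally show "\<exists>t. t \<in> Ar C \<and> Dom C t = Dom C h \<and> Cod C t = Dom C k \<and> k \<cdot> t = h"
      by (intro exI[where x = "pr2 Y B \<cdot> t"]) (use t(1) t' ob k in simp_all)
  qed (use Q Q' k in simp_all)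
  with q(1) show ?thesis using Q(9) by (rule that)
qed

text \<open>Replacing \<open>f\<close> by the regular part of its image factorisation keeps the
  kernel, since the other factor is monic.\<close>

lemma normal_mono_cokernel:
  assumes "normal_mono C k"
  obtains q where "regular_epi C q" "is_kernel C k q"
proof -
  obtain f where k: "is_kernel C k f" using assms unfolding normal_mono_def by blast
  note K = kernel_ar[OF k]
  obtain e m where em: "regular_epi C e" "monic m" "e \<in> Ar C" "m \<in> Ar C" "Cod C e = Dom C m"
    "Dom C e = Dom C f" "Cod C m = Cod C f" "m \<cdot> e = f" by (rule image_factorisation[OF K(2)])
  have "is_kernel C k e"
  proof (rule kernelI[OF kernel_monic[OF k]])
    show "e \<cdot> k = zero (Dom C k) (Cod C e)"
      by (rule monicD[OF em(2)]) (use em(3-7) K in \<open>simp_all add: em(8)[THEN rw]\<close>)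
    fix h assume h: "h \<in> Ar C" "Cod C h = Dom C e" "e \<cdot> h = zero (Dom C h) (Cod C e)"
    have "m \<cdot> (e \<cdot> h) = zero (Dom C h) (Cod C f)" using h em(3-7) by simp
    then have "f \<cdot> h = zero (Dom C h) (Cod C f)" using h(1,2) em(3-7) by (simp add: em(8)[THEN rw])
    then obtain t where "t \<in> Ar C" "Dom C t = Dom C h" "Cod C t = Dom C k" "k \<cdot> t = h"
      by - (rule kernel_lift[OF k, of h], (use h em in simp_all))
    then show "\<exists>t. t \<in> Ar C \<and> Dom C t = Dom C h \<and> Cod C t = Dom C k \<and> k \<cdot> t = h" by blast
  qed (use em K in simp_all)
  with em(1) show ?thesis by (rule that)
qed

lemma split_regular_epi_prd:
  assumes "A \<in> Ob C" "B \<in> Ob C" shows "regular_epi C (pr1 A B)" "regular_epi C (pr2 A B)"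
  by (rule split_regular_epi[of _ "in1 A B"] split_regular_epi[of _ "in2 A B"]; use assms in simp)+

text \<open>Both factors of \<open>q \<times> q = (q \<times> 1) (1 \<times> q)\<close> are
  pullbacks of \<open>q\<close>.\<close>

lemma regular_epi_prd:
  assumes q: "regular_epi C q" "Dom C q = Y" "Cod C q = Q"
  shows "regular_epi C \<langle>q \<cdot> pr1 Y Y, q \<cdot> pr2 Y Y\<rangle>"
proof -
  have Q: "q \<in> Ar C" "Y \<in> Ob C" "Q \<in> Ob C" using q regular_epi_ar[OF q(1)] by auto
  have "is_pullback C q (pr1 Q Q) (pr1 Y Q) \<langle>q \<cdot> pr1 Y Q, pr2 Y Q\<rangle>"
  proof (rule pullbackI)
    fix u v assume a: "u \<in> Ar C" "v \<in> Ar C" "Dom C u = Dom C v" "Cod C u = Dom C q" "Cod C v = Dom C (pr1 Q Q)"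
      "q \<cdot> u = pr1 Q Q \<cdot> v"
    then show "\<exists>h. h \<in> Ar C \<and> Dom C h = Dom C u \<and> Cod C h = Dom C (pr1 Y Q) \<and> pr1 Y Q \<cdot> h = u \<and>
        \<langle>q \<cdot> pr1 Y Q, pr2 Y Q\<rangle> \<cdot> h = v"
      using Q q by (intro exI[where x = "\<langle>u, pr2 Q Q \<cdot> v\<rangle>"]) simp
  next
    fix h h' assume a: "h \<in> Ar C" "h' \<in> Ar C" "Dom C h = Dom C h'" "Cod C h = Dom C (pr1 Y Q)"
      "Cod C h' = Dom C (pr1 Y Q)" "pr1 Y Q \<cdot> h = pr1 Y Q \<cdot> h'"
      "\<langle>q \<cdot> pr1 Y Q, pr2 Y Q\<rangle> \<cdot> h = \<langle>q \<cdot> pr1 Y Q, pr2 Y Q\<rangle> \<cdot> h'"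
    have "pr2 Q Q \<cdot> (\<langle>q \<cdot> pr1 Y Q, pr2 Y Q\<rangle> \<cdot> h) = pr2 Q Q \<cdot> (\<langle>q \<cdot> pr1 Y Q, pr2 Y Q\<rangle> \<cdot> h')" using a(7) by simp
    then have "pr2 Y Q \<cdot> h = pr2 Y Q \<cdot> h'" using a(1-5) Q q by simp
    with a(6) show "h = h'" by (rule pair_eqI) (use a(1-5) Q in simp_all)
  qed (use Q q in simp_all)
  then have 1: "regular_epi C \<langle>q \<cdot> pr1 Y Q, pr2 Y Q\<rangle>" using q(1) by (rule regular_epi_pullback)
  have "is_pullback C q (pr2 Y Q) (pr2 Y Y) \<langle>pr1 Y Y, q \<cdot> pr2 Y Y\<rangle>"
  proof (rule pullbackI)
    fix u v assume a: "u \<in> Ar C" "v \<in> Ar C" "Dom C u = Dom C v" "Cod C u = Dom C q" "Cod C v = Dom C (pr2 Y Q)"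
      "q \<cdot> u = pr2 Y Q \<cdot> v"
    then show "\<exists>h. h \<in> Ar C \<and> Dom C h = Dom C u \<and> Cod C h = Dom C (pr2 Y Y) \<and> pr2 Y Y \<cdot> h = u \<and>
        \<langle>pr1 Y Y, q \<cdot> pr2 Y Y\<rangle> \<cdot> h = v"
      using Q q by (intro exI[where x = "\<langle>pr1 Y Q \<cdot> v, u\<rangle>"]) simp
  next
    fix h h' assume a: "h \<in> Ar C" "h' \<in> Ar C" "Dom C h = Dom C h'" "Cod C h = Dom C (pr2 Y Y)"
      "Cod C h' = Dom C (pr2 Y Y)" "pr2 Y Y \<cdot> h = pr2 Y Y \<cdot> h'"
      "\<langle>pr1 Y Y, q \<cdot> pr2 Y Y\<rangle> \<cdot> h = \<langle>pr1 Y Y, q \<cdot> pr2 Y Y\<rangle> \<cdot> h'"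
    have "pr1 Y Q \<cdot> (\<langle>pr1 Y Y, q \<cdot> pr2 Y Y\<rangle> \<cdot> h) = pr1 Y Q \<cdot> (\<langle>pr1 Y Y, q \<cdot> pr2 Y Y\<rangle> \<cdot> h')" using a(7) by simp
    then have "pr1 Y Y \<cdot> h = pr1 Y Y \<cdot> h'" using a(1-5) Q q by simp
    then show "h = h'" using a(6) by (rule pair_eqI) (use a(1-5) Q in simp_all)
  qed (use Q q in simp_all)
  then have 2: "regular_epi C \<langle>pr1 Y Y, q \<cdot> pr2 Y Y\<rangle>" using q(1) by (rule regular_epi_pullback)
  have "regular_epi C (\<langle>q \<cdot> pr1 Y Q, pr2 Y Q\<rangle> \<cdot> \<langle>pr1 Y Y, q \<cdot> pr2 Y Y\<rangle>)"
    by (rule regular_epi_comp[OF 2 1]) (use Q q in simp_all)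
  then show ?thesis using Q q by simp
qed


section \<open>The functors \<open>B \<flat> X\<close>\<close>

lemma coproduct_exists:
  assumes "A \<in> Ob C" "B \<in> Ob C"
  shows "\<exists>ij. is_coproduct C A B (fst ij) (snd ij)"
proof -
  have fc: "has_finite_coproducts C" using strongly_semi_abelian by (simp add: strongly_semi_abelian_def)
  define X where "X = (\<lambda>i::nat. if i = 0 then A else B)"
  have "finite {0, 1::nat}" "\<forall>i\<in>{0, 1::nat}. X i \<in> Ob C" using assms by (simp_all add: X_def)
  then have "\<exists>S\<in>Ob C. \<exists>inj. (\<forall>i\<in>{0, 1::nat}. inj i \<in> hom C (X i) S) \<and>
      (\<forall>T\<in>Ob C. \<forall>t. (\<forall>i\<in>{0, 1}. t i \<in> hom C (X i) T) \<longrightarrow>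
       (\<exists>!f. f \<in> hom C S T \<and> (\<forall>i\<in>{0, 1::nat}. f \<cdot> inj i = t i)))"
    using fc[unfolded has_finite_coproducts_def, THEN spec[of _ "{0, 1}"], THEN spec[of _ X]] by fast
  then obtain S inj where S: "S \<in> Ob C" "\<forall>i\<in>{0, 1::nat}. inj i \<in> hom C (X i) S"
    "\<forall>T\<in>Ob C. \<forall>t. (\<forall>i\<in>{0, 1}. t i \<in> hom C (X i) T) \<longrightarrow>
       (\<exists>!f. f \<in> hom C S T \<and> (\<forall>i\<in>{0, 1::nat}. f \<cdot> inj i = t i))"
    by (elim bexE exE conjE)
  have "is_coproduct C A B (inj 0) (inj 1)" unfolding is_coproduct_def
  proof (intro conjI allI ballI)
    fix T f g assume a: "f \<in> hom C A T" "g \<in> hom C B T"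
    then have T: "T \<in> Ob C" by auto
    define t where "t = (\<lambda>i::nat. if i = 0 then f else g)"
    have "\<forall>i\<in>{0, 1}. t i \<in> hom C (X i) T" using a by (simp add: t_def X_def)
    then have "\<exists>!h. h \<in> hom C S T \<and> (\<forall>i\<in>{0, 1::nat}. h \<cdot> inj i = t i)" using S(3) T by blast
    then show "\<exists>!h. h \<in> hom C (Cod C (inj 0)) T \<and> h \<cdot> inj 0 = f \<and> h \<cdot> inj 1 = g"
      using S(2) by (simp add: t_def X_def)
  qed (use S assms in \<open>simp_all add: X_def\<close>)
  then show ?thesis by (intro exI[where x = "(inj 0, inj 1)"]) simp
qed

lemma inl_inr_coproduct:
  assumes "A \<in> Ob C" "B \<in> Ob C" shows "is_coproduct C A B (inl C A B) (inr C A B)"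
  using someI_ex[OF coproduct_exists[OF assms]] by (simp add: inl_def inr_def coprod_inj_def)

lemma inl_inr_ar [simp]:
  assumes "A \<in> Ob C" "B \<in> Ob C"
  shows "inl C A B \<in> Ar C" "inr C A B \<in> Ar C" "Dom C (inl C A B) = A" "Dom C (inr C A B) = B"
    "Cod C (inl C A B) = coprod_ob C A B" "Cod C (inr C A B) = coprod_ob C A B" "coprod_ob C A B \<in> Ob C"
  using inl_inr_coproduct[OF assms] by (auto simp: is_coproduct_def coprod_ob_def)

abbreviation cop :: "'a \<Rightarrow> 'a \<Rightarrow> 'a" where "cop f g \<equiv> copair C f g"
abbreviation fk :: "'o \<Rightarrow> 'o \<Rightarrow> 'a" where "fk B X \<equiv> flat_ker C B X"
abbreviation fl :: "'a \<Rightarrow> 'a \<Rightarrow> 'a" where "fl f h \<equiv> flat_arr C f h"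

lemma copair_ex1:
  assumes "f \<in> Ar C" "g \<in> Ar C" "Cod C f = Cod C g"
  shows "\<exists>!h. h \<in> hom C (coprod_ob C (Dom C f) (Dom C g)) (Cod C f) \<and>
     h \<cdot> inl C (Dom C f) (Dom C g) = f \<and> h \<cdot> inr C (Dom C f) (Dom C g) = g"
proof -
  have "f \<in> hom C (Dom C f) (Cod C f)" "g \<in> hom C (Dom C g) (Cod C f)" using assms by simp_all
  then show ?thesis
    using inl_inr_coproduct[of "Dom C f" "Dom C g"] assms
    unfolding is_coproduct_def coprod_ob_def by simp
qed

lemma copair_ar [simp]:
  assumes "f \<in> Ar C" "g \<in> Ar C" "Cod C f = Cod C g"
  shows "cop f g \<in> Ar C" "Dom C (cop f g) = coprod_ob C (Dom C f) (Dom C g)" "Cod C (cop f g) = Cod C f"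
  using theI'[OF copair_ex1[OF assms]] by (auto simp: copair_def)

lemma copair_in [simp]:
  assumes "f \<in> Ar C" "g \<in> Ar C" "Cod C f = Cod C g" "Dom C f = A" "Dom C g = B"
  shows "cop f g \<cdot> inl C A B = f" "cop f g \<cdot> inr C A B = g"
  using theI'[OF copair_ex1[OF assms(1-3)]] assms by (auto simp: copair_def)

lemma copair_in' [simp]:
  assumes "f \<in> Ar C" "g \<in> Ar C" "Cod C f = Cod C g" "Dom C f = A" "Dom C g = B" "x \<in> Ar C"
  shows "Cod C x = A \<Longrightarrow> cop f g \<cdot> (inl C A B \<cdot> x) = f \<cdot> x"
    "Cod C x = B \<Longrightarrow> cop f g \<cdot> (inr C A B \<cdot> x) = g \<cdot> x"
proof -
  have ob: "A \<in> Ob C" "B \<in> Ob C" using assms by auto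
  show "Cod C x = A \<Longrightarrow> cop f g \<cdot> (inl C A B \<cdot> x) = f \<cdot> x"
    "Cod C x = B \<Longrightarrow> cop f g \<cdot> (inr C A B \<cdot> x) = g \<cdot> x"
    using copair_in(1)[OF assms(1-5), THEN rw] copair_in(2)[OF assms(1-5), THEN rw] assms ob by simp_all
qed

lemma copair_unique:
  assumes "h \<in> Ar C" "Dom C h = coprod_ob C A B" "A \<in> Ob C" "B \<in> Ob C"
  shows "cop (h \<cdot> inl C A B) (h \<cdot> inr C A B) = h"
proof -
  have ar: "h \<cdot> inl C A B \<in> Ar C" "h \<cdot> inr C A B \<in> Ar C" "Cod C (h \<cdot> inl C A B) = Cod C (h \<cdot> inr C A B)"
    and d: "Dom C (h \<cdot> inl C A B) = A" "Dom C (h \<cdot> inr C A B) = B" "Cod C (h \<cdot> inl C A B) = Cod C h"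
    using assms by simp_all
  show ?thesis
    using the1_equality[OF copair_ex1[OF ar], of h, unfolded d] assms
    unfolding copair_def d by simp
qed

lemma copair_eqI:
  assumes "h \<cdot> inl C A B = k \<cdot> inl C A B" "h \<cdot> inr C A B = k \<cdot> inr C A B" "h \<in> Ar C" "k \<in> Ar C"
    "Dom C h = coprod_ob C A B" "Dom C k = coprod_ob C A B" "A \<in> Ob C" "B \<in> Ob C"
  shows "h = k"
proof -
  have "h = cop (h \<cdot> inl C A B) (h \<cdot> inr C A B)" by (rule copair_unique[symmetric]) (use assms in simp_all)
  also have "\<dots> = cop (k \<cdot> inl C A B) (k \<cdot> inr C A B)" by (simp only: assms(1,2))
  also have "\<dots> = k" by (rule copair_unique) (use assms in simp_all)
  finally show ?thesis .
qed

lemma comp_copair [simp]: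
  assumes "f \<in> Ar C" "g \<in> Ar C" "Cod C f = Cod C g" "h \<in> Ar C" "Dom C h = Cod C f"
  shows "h \<cdot> cop f g = cop (h \<cdot> f) (h \<cdot> g)"
  by (rule copair_eqI[of _ "Dom C f" "Dom C g"]) (use assms in simp_all)

lemma comp_copair' [simp]:
  assumes "f \<in> Ar C" "g \<in> Ar C" "Cod C f = Cod C g" "h \<in> Ar C" "Dom C h = Cod C f" "x \<in> Ar C"
    "Cod C x = coprod_ob C (Dom C f) (Dom C g)"
  shows "h \<cdot> (cop f g \<cdot> x) = cop (h \<cdot> f) (h \<cdot> g) \<cdot> x"
  using comp_copair[OF assms(1-5), THEN rw] assms by simp

lemma copair_Idt [simp]: "A \<in> Ob C \<Longrightarrow> B \<in> Ob C \<Longrightarrow> cop (inl C A B) (inr C A B) = Idt C (coprod_ob C A B)"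
  by (rule copair_eqI[of _ A B]) simp_all

lemma coprod_arr_ar [simp]:
  assumes "f \<in> Ar C" "h \<in> Ar C"
  shows "coprod_arr C f h \<in> Ar C" "Dom C (coprod_arr C f h) = coprod_ob C (Dom C f) (Dom C h)"
    "Cod C (coprod_arr C f h) = coprod_ob C (Cod C f) (Cod C h)"
  using assms by (simp_all add: coprod_arr_def)

lemma copair_coprod_arr [simp]:
  assumes "f \<in> Ar C" "h \<in> Ar C" "u \<in> Ar C" "v \<in> Ar C" "Cod C u = Cod C v" "Dom C u = Cod C f" "Dom C v = Cod C h"
  shows "cop u v \<cdot> coprod_arr C f h = cop (u \<cdot> f) (v \<cdot> h)"
  using assms by (simp add: coprod_arr_def)

lemma copair_coprod_arr' [simp]:
  assumes "f \<in> Ar C" "h \<in> Ar C" "u \<in> Ar C" "v \<in> Ar C" "Cod C u = Cod C v" "Dom C u = Cod C f" "Dom C v = Cod C h"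
    "x \<in> Ar C" "Cod C x = coprod_ob C (Dom C f) (Dom C h)"
  shows "cop u v \<cdot> (coprod_arr C f h \<cdot> x) = cop (u \<cdot> f) (v \<cdot> h) \<cdot> x"
  using copair_coprod_arr[OF assms(1-7), THEN rw] assms by simp

lemma coprod_arr_in [simp]:
  assumes "f \<in> Ar C" "h \<in> Ar C" "Dom C f = A" "Dom C h = B"
  shows "coprod_arr C f h \<cdot> inl C A B = inl C (Cod C f) (Cod C h) \<cdot> f"
    "coprod_arr C f h \<cdot> inr C A B = inr C (Cod C f) (Cod C h) \<cdot> h"
  using assms by (simp_all add: coprod_arr_def)

lemma coprod_arr_in' [simp]:
  assumes "f \<in> Ar C" "h \<in> Ar C" "Dom C f = A" "Dom C h = B" "x \<in> Ar C"
  shows "Cod C x = A \<Longrightarrow> coprod_arr C f h \<cdot> (inl C A B \<cdot> x) = inl C (Cod C f) (Cod C h) \<cdot> (f \<cdot> x)"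
    "Cod C x = B \<Longrightarrow> coprod_arr C f h \<cdot> (inr C A B \<cdot> x) = inr C (Cod C f) (Cod C h) \<cdot> (h \<cdot> x)"
  using assms by (simp_all add: coprod_arr_def)

lemma coprod_arr_comp:
  assumes "f \<in> Ar C" "h \<in> Ar C" "f' \<in> Ar C" "h' \<in> Ar C" "Cod C f = Dom C f'" "Cod C h = Dom C h'"
  shows "coprod_arr C f' h' \<cdot> coprod_arr C f h = coprod_arr C (f' \<cdot> f) (h' \<cdot> h)"
  by (rule copair_eqI[of _ "Dom C f" "Dom C h"]) (use assms in simp_all)

lemma flat_ker_kernel:
  assumes "B \<in> Ob C" "X \<in> Ob C" shows "is_kernel C (fk B X) (cop (Idt C B) (zero X B))"
proof -
  obtain k where "is_kernel C k (cop (Idt C B) (zero X B))"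
    by (rule kernel_exists[of "cop (Idt C B) (zero X B)"]) (use assms in simp_all)
  then show ?thesis unfolding flat_ker_def by (rule someI)
qed

lemma flat_ker_ar [simp]:
  assumes "B \<in> Ob C" "X \<in> Ob C"
  shows "fk B X \<in> Ar C" "Dom C (fk B X) = flat_ob C B X" "Cod C (fk B X) = coprod_ob C B X"
    "flat_ob C B X \<in> Ob C"
  using kernel_ar[OF flat_ker_kernel[OF assms]] assms by (auto simp: flat_ob_def)

lemma flat_ker_monic: "B \<in> Ob C \<Longrightarrow> X \<in> Ob C \<Longrightarrow> monic (fk B X)"
  by (rule kernel_monic[OF flat_ker_kernel])

lemma copair_flat_ker [simp]:
  assumes "f \<in> Ar C" "Dom C f = B" "X \<in> Ob C" "T = Cod C f"
  shows "cop f (zero X T) \<cdot> fk B X = zero (flat_ob C B X) T"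
proof -
  have B: "B \<in> Ob C" using assms by auto
  have "f \<cdot> (cop (Idt C B) (zero X B) \<cdot> fk B X) = f \<cdot> zero (flat_ob C B X) B"
    using kernel_ar(4)[OF flat_ker_kernel[OF B assms(3)]] B assms by simp
  then show ?thesis using B assms by simp
qed

lemma copair_flat_ker' [simp]:
  assumes "f \<in> Ar C" "Dom C f = B" "X \<in> Ob C" "T = Cod C f" "x \<in> Ar C" "Cod C x = flat_ob C B X"
  shows "cop f (zero X T) \<cdot> (fk B X \<cdot> x) = zero (Dom C x) T"
proof -
  have B: "B \<in> Ob C" using assms by auto
  show ?thesis using copair_flat_ker[OF assms(1-4), THEN rw] B assms by simp
qed

lemma flat_lift_ex:
  assumes "B \<in> Ob C" "X \<in> Ob C" "g \<in> Ar C" "Cod C g = coprod_ob C B X"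
    "cop (Idt C B) (zero X B) \<cdot> g = zero (Dom C g) B"
  obtains t where "t \<in> Ar C" "Dom C t = Dom C g" "Cod C t = flat_ob C B X" "fk B X \<cdot> t = g"
  by (rule kernel_lift[OF flat_ker_kernel[OF assms(1,2)], of g]) (use assms in simp_all)

lemma flat_lift:
  assumes "B \<in> Ob C" "X \<in> Ob C" "g \<in> Ar C" "Cod C g = coprod_ob C B X"
    "cop (Idt C B) (zero X B) \<cdot> g = zero (Dom C g) B"
  shows "flat_lift C B X g \<in> Ar C" "Dom C (flat_lift C B X g) = Dom C g"
    "Cod C (flat_lift C B X g) = flat_ob C B X" "fk B X \<cdot> flat_lift C B X g = g"
proof -
  obtain t where t: "t \<in> Ar C" "Dom C t = Dom C g" "Cod C t = flat_ob C B X" "fk B X \<cdot> t = g"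
    by (rule flat_lift_ex[OF assms])
  have u: "t' = t" if "t' \<in> hom C (Dom C g) (flat_ob C B X) \<and> fk B X \<cdot> t' = g" for t'
    by (rule monicD[OF flat_ker_monic[OF assms(1,2)]]) (use that t assms(1,2) in simp_all)
  have "flat_lift C B X g = t"
    unfolding flat_lift_def by (rule the_equality[OF _ u]) (use t in simp)
  then show "flat_lift C B X g \<in> Ar C" "Dom C (flat_lift C B X g) = Dom C g"
    "Cod C (flat_lift C B X g) = flat_ob C B X" "fk B X \<cdot> flat_lift C B X g = g" using t by simp_all
qed

lemma flat_arr_ar [simp]:
  assumes "f \<in> Ar C" "h \<in> Ar C"
  shows "fl f h \<in> Ar C" "Dom C (fl f h) = flat_ob C (Dom C f) (Dom C h)"
    "Cod C (fl f h) = flat_ob C (Cod C f) (Cod C h)"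
    "fk (Cod C f) (Cod C h) \<cdot> fl f h = coprod_arr C f h \<cdot> fk (Dom C f) (Dom C h)"
  using flat_lift[of "Cod C f" "Cod C h" "coprod_arr C f h \<cdot> fk (Dom C f) (Dom C h)"] assms
  by (simp_all add: flat_arr_def)

lemma flat_ker_arr [simp]:
  assumes "f \<in> Ar C" "h \<in> Ar C" "Cod C f = B" "Cod C h = X"
  shows "fk B X \<cdot> fl f h = coprod_arr C f h \<cdot> fk (Dom C f) (Dom C h)"
  using flat_arr_ar(4)[OF assms(1,2)] assms(3,4) by simp

lemma flat_ker_arr' [simp]:
  assumes "f \<in> Ar C" "h \<in> Ar C" "Cod C f = B" "Cod C h = X" "x \<in> Ar C" "Cod C x = flat_ob C (Dom C f) (Dom C h)"
  shows "fk B X \<cdot> (fl f h \<cdot> x) = coprod_arr C f h \<cdot> (fk (Dom C f) (Dom C h) \<cdot> x)"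
proof -
  have "B \<in> Ob C" "X \<in> Ob C" using assms by auto
  then show ?thesis using flat_ker_arr[OF assms(1-4), THEN rw] assms by simp
qed

lemma flat_eqI:
  assumes "fk B X \<cdot> u = fk B X \<cdot> v" "u \<in> Ar C" "v \<in> Ar C" "Dom C u = Dom C v" "Cod C u = flat_ob C B X"
    "Cod C v = flat_ob C B X" "B \<in> Ob C" "X \<in> Ob C"
  shows "u = v"
  by (rule monicD[OF flat_ker_monic[OF assms(7,8)] assms(1)]) (use assms in simp_all)

lemma flat_arr_comp [simp]:
  assumes "f \<in> Ar C" "h \<in> Ar C" "f' \<in> Ar C" "h' \<in> Ar C" "Cod C f = Dom C f'" "Cod C h = Dom C h'"
  shows "fl f' h' \<cdot> fl f h = fl (f' \<cdot> f) (h' \<cdot> h)"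
  by (rule flat_eqI[of "Cod C f'" "Cod C h'"])
    (use assms in \<open>simp_all add: coprod_arr_comp[THEN rw]\<close>)

lemma flat_arr_comp' [simp]:
  assumes "f \<in> Ar C" "h \<in> Ar C" "f' \<in> Ar C" "h' \<in> Ar C" "Cod C f = Dom C f'" "Cod C h = Dom C h'"
    "x \<in> Ar C" "Cod C x = flat_ob C (Dom C f) (Dom C h)"
  shows "fl f' h' \<cdot> (fl f h \<cdot> x) = fl (f' \<cdot> f) (h' \<cdot> h) \<cdot> x"
  using flat_arr_comp[OF assms(1-6), THEN rw] assms by simp

lemma coprod_arr_Idt [simp]:
  "A \<in> Ob C \<Longrightarrow> B \<in> Ob C \<Longrightarrow> coprod_arr C (Idt C A) (Idt C B) = Idt C (coprod_ob C A B)"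
  by (simp add: coprod_arr_def)

lemma flat_arr_Idt [simp]: "A \<in> Ob C \<Longrightarrow> B \<in> Ob C \<Longrightarrow> fl (Idt C A) (Idt C B) = Idt C (flat_ob C A B)"
  by (rule flat_eqI[of A B]) simp_all

lemma flat_arr_zero [simp]:
  assumes "f \<in> Ar C" "X \<in> Ob C" "Y \<in> Ob C"
  shows "fl f (zero X Y) = zero (flat_ob C (Dom C f) X) (flat_ob C (Cod C f) Y)"
proof (rule flat_eqI[of "Cod C f" Y])
  have "cop (inl C (Cod C f) Y \<cdot> f) (zero X (coprod_ob C (Cod C f) Y)) \<cdot> fk (Dom C f) X =
      zero (flat_ob C (Dom C f) X) (coprod_ob C (Cod C f) Y)"
    by (rule copair_flat_ker) (use assms in simp_all)
  then show "fk (Cod C f) Y \<cdot> fl f (zero X Y) =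
      fk (Cod C f) Y \<cdot> zero (flat_ob C (Dom C f) X) (flat_ob C (Cod C f) Y)"
    using assms by (simp add: coprod_arr_def)
qed (use assms in simp_all)

abbreviation un :: "'o \<Rightarrow> 'o \<Rightarrow> 'a" where "un B X \<equiv> flat_unit C B X"
abbreviation mu :: "'o \<Rightarrow> 'o \<Rightarrow> 'a" where "mu B X \<equiv> flat_mult C B X"

lemma flat_unit_ar [simp]:
  assumes "B \<in> Ob C" "X \<in> Ob C"
  shows "un B X \<in> Ar C" "Dom C (un B X) = X" "Cod C (un B X) = flat_ob C B X" "fk B X \<cdot> un B X = inr C B X"
  using flat_lift[of B X "inr C B X"] assms by (simp_all add: flat_unit_def)

lemma flat_mult_ar [simp]:
  assumes "B \<in> Ob C" "X \<in> Ob C"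
  shows "mu B X \<in> Ar C" "Dom C (mu B X) = flat_ob C B (flat_ob C B X)" "Cod C (mu B X) = flat_ob C B X"
    "fk B X \<cdot> mu B X = cop (inl C B X) (fk B X) \<cdot> fk B (flat_ob C B X)"
  using flat_lift[of B X "cop (inl C B X) (fk B X) \<cdot> fk B (flat_ob C B X)"] assms
  by (simp_all add: flat_mult_def)

lemma flat_unit_natural [simp]:
  assumes "f \<in> Ar C" "h \<in> Ar C" "Dom C f = B" "Dom C h = X"
  shows "fl f h \<cdot> un B X = un (Cod C f) (Cod C h) \<cdot> h"
proof (rule flat_eqI[of "Cod C f" "Cod C h"])
  have ob: "B \<in> Ob C" "X \<in> Ob C" using assms by auto
  show "fk (Cod C f) (Cod C h) \<cdot> fl f h \<cdot> un B X = fk (Cod C f) (Cod C h) \<cdot> un (Cod C f) (Cod C h) \<cdot> h"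
    using assms ob by (simp add: flat_unit_ar(4)[THEN rw])
qed (use assms in auto)

lemma flat_mult_natural [simp]:
  assumes "f \<in> Ar C" "h \<in> Ar C" "Dom C f = B" "Dom C h = X"
  shows "fl f h \<cdot> mu B X = mu (Cod C f) (Cod C h) \<cdot> fl f (fl f h)"
proof (rule flat_eqI[of "Cod C f" "Cod C h"])
  have ob: "B \<in> Ob C" "X \<in> Ob C" using assms by auto
  show "fk (Cod C f) (Cod C h) \<cdot> fl f h \<cdot> mu B X = fk (Cod C f) (Cod C h) \<cdot> mu (Cod C f) (Cod C h) \<cdot> fl f (fl f h)"
    using assms ob by (simp add: flat_mult_ar(4)[THEN rw])
qed (use assms in auto)

text \<open>A subobject through which the sum factors receives both injections by diagonal filling,
  and their copairing splits it.\<close>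

lemma regular_epi_coprod_arr:
  assumes "regular_epi C f" "regular_epi C h" shows "regular_epi C (coprod_arr C f h)"
proof (rule extremal_regular_epi)
  have ar: "f \<in> Ar C" "h \<in> Ar C" using assms regular_epi_ar by auto
  then show "coprod_arr C f h \<in> Ar C" by simp
  fix m g assume m: "monic m" "m \<in> Ar C" "g \<in> Ar C" "Cod C g = Dom C m"
    "Dom C g = Dom C (coprod_arr C f h)" "Cod C m = Cod C (coprod_arr C f h)" "m \<cdot> g = coprod_arr C f h"
  obtain a where a: "a \<in> Ar C" "Dom C a = Cod C f" "Cod C a = Dom C m" "a \<cdot> f = g \<cdot> inl C (Dom C f) (Dom C h)"
    "m \<cdot> a = inl C (Cod C f) (Cod C h)"
    by (rule regular_epi_orthogonal[OF assms(1) m(1), of "g \<cdot> inl C (Dom C f) (Dom C h)" "inl C (Cod C f) (Cod C h)"])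
      (use m ar in \<open>simp_all add: m(7)[THEN rw]\<close>)
  obtain b where b: "b \<in> Ar C" "Dom C b = Cod C h" "Cod C b = Dom C m" "b \<cdot> h = g \<cdot> inr C (Dom C f) (Dom C h)"
    "m \<cdot> b = inr C (Cod C f) (Cod C h)"
    by (rule regular_epi_orthogonal[OF assms(2) m(1), of "g \<cdot> inr C (Dom C f) (Dom C h)" "inr C (Cod C f) (Cod C h)"])
      (use m ar in \<open>simp_all add: m(7)[THEN rw]\<close>)
  show "is_iso C m"
    by (rule split_monic_iso[OF m(1), of "cop a b"]) (use m(1-6) a b ar in simp_all)
qed

text \<open>\<open>1 \<flat> q\<close> is the restriction of \<open>1 + q\<close> to the kernels
  over \<open>B\<close>, hence a pullback of it.\<close>

lemma regular_epi_flat_right: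
  assumes q: "regular_epi C q" and B: "B \<in> Ob C"
  shows "regular_epi C (fl (Idt C B) q)"
proof -
  have Q: "q \<in> Ar C" using q regular_epi_ar by simp
  let ?X = "Dom C q" and ?Q = "Cod C q"
  have "is_pullback C (coprod_arr C (Idt C B) q) (fk B ?Q) (fk B ?X) (fl (Idt C B) q)"
    by (rule kernel_restriction_pullback[OF flat_ker_kernel flat_ker_kernel]) (use Q B in simp_all)
  then show ?thesis
    by (rule regular_epi_pullback) (use regular_epi_coprod_arr[OF iso_regular_epi q] B in simp)
qed

text \<open>\<open>Y + X\<close> maps onto the pullback \<open>R\<close> of \<open>Q + X \<rightarrow> Q\<close> along \<open>q\<close>, since its image contains the
  kernel of \<open>R \<rightarrow> Q + X\<close>, which is that of \<open>q\<close>; now restrict to the kernels over \<open>Y\<close>.\<close>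

lemma regular_epi_flat_left:
  assumes q: "regular_epi C q" and X: "X \<in> Ob C"
  shows "regular_epi C (fl q (Idt C X))"
proof -
  have q': "q \<in> Ar C" using q regular_epi_ar by simp
  let ?Y = "Dom C q" and ?Q = "Cod C q"
  note ar = q' X
  let ?c = "cop (Idt C ?Q) (zero X ?Q)" and ?d = "cop (Idt C ?Y) (zero X ?Y)"
  obtain a b where pb: "is_pullback C ?c q a b"
    by (rule pullback_exists[of ?c q]) (use ar in simp_all)
  note P = pullback_ar[OF pb]
  have P': "Cod C a = coprod_ob C ?Q X" using P(6) ar by simp
  have a: "regular_epi C a" by (rule regular_epi_pullback[OF pullback_sym[OF pb] q])
  obtain g where g: "g \<in> Ar C" "Dom C g = Dom C (coprod_arr C q (Idt C X))" "Cod C g = Dom C a"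
    "a \<cdot> g = coprod_arr C q (Idt C X)" "b \<cdot> g = ?d"
    by (rule pullback_lift[OF pb, of "coprod_arr C q (Idt C X)" ?d]) (use ar in simp_all)
  have g2: "Dom C g = coprod_ob C ?Y X" using g ar by simp
  obtain e m where em: "regular_epi C e" "monic m" "e \<in> Ar C" "m \<in> Ar C" "Cod C e = Dom C m"
    "Dom C e = Dom C g" "Cod C m = Cod C g" "m \<cdot> e = g" by (rule image_factorisation[OF g(1)])
  obtain k where k: "is_kernel C k q" by (rule kernel_exists[OF q'])
  note K = kernel_ar[OF k]
  obtain l where "l \<in> Ar C" "Dom C l = Dom C k" "Cod C l = Dom C a" "a \<cdot> l = zero (Dom C k) (Dom C ?c)" "b \<cdot> l = k"
    and la: "is_kernel C l a"
    by (rule pullback_kernel[OF pb k])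
  then have l: "l \<in> Ar C" "Dom C l = Dom C k" "Cod C l = Dom C a" "a \<cdot> l = zero (Dom C k) (coprod_ob C ?Q X)" "b \<cdot> l = k"
    using ar by simp_all
  \<comment> \<open>The kernel of \<open>R -> Q + X\<close> is reached from \<open>Y + X\<close>
    through the first injection.\<close>
  have "m \<cdot> (e \<cdot> inl C ?Y X \<cdot> k) = l"
  proof (rule pullback_eq[OF pb])
    have 1: "m \<cdot> (e \<cdot> inl C ?Y X \<cdot> k) = g \<cdot> inl C ?Y X \<cdot> k"
      using em(3-7) g2 ar K by (simp add: em(8)[THEN rw])
    show "a \<cdot> (m \<cdot> (e \<cdot> inl C ?Y X \<cdot> k)) = a \<cdot> l" "b \<cdot> (m \<cdot> (e \<cdot> inl C ?Y X \<cdot> k)) = b \<cdot> l"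
      unfolding 1 using ar K P(1-8) P' g(1,3) g2 l by (simp_all add: g(4,5)[THEN rw])
  qed (use em(3-7) g g2 ar K l in simp_all)
  moreover have "regular_epi C (a \<cdot> m)"
  proof (rule regular_epi_cancel[of _ e])
    have "(a \<cdot> m) \<cdot> e = coprod_arr C q (Idt C X)" using em g P by simp
    then show "regular_epi C ((a \<cdot> m) \<cdot> e)" using regular_epi_coprod_arr[OF q iso_regular_epi] X by simp
  qed (use em g P in simp_all)
  ultimately have "is_iso C m"
    by - (rule monic_iso_if_kernel_factors[OF em(2) a _ la, where k' = "e \<cdot> inl C ?Y X \<cdot> k"],
      (use em(3-7) g g2 ar K l in simp_all))
  then have "regular_epi C (m \<cdot> e)" by - (rule regular_epi_comp[OF em(1) iso_regular_epi em(5)])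
  then have G: "regular_epi C g" by (simp add: em(8))
  obtain j where "j \<in> Ar C" "Dom C j = Dom C (fk ?Q X)" "Cod C j = Dom C b" "b \<cdot> j = zero (Dom C (fk ?Q X)) (Dom C q)"
    "a \<cdot> j = fk ?Q X" and jk: "is_kernel C j b"
    by (rule pullback_kernel[OF pullback_sym[OF pb] flat_ker_kernel[OF Cod_ob[OF q'] X]])
  then have j: "j \<in> Ar C" "Dom C j = flat_ob C ?Q X" "Cod C j = Dom C a" "a \<cdot> j = fk ?Q X"
    "b \<cdot> j = zero (flat_ob C ?Q X) ?Y"
    using ar P by simp_all
  have jfl: "j \<cdot> fl q (Idt C X) = g \<cdot> fk ?Y X"
    by (rule pullback_eq[OF pb]) (use j(1-3) g(1,3-) g2 P(1-8) P' ar in \<open>simp_all add: j(4,5)[THEN rw] g(4,5)[THEN rw]\<close>)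
  have "is_pullback C g j (fk ?Y X) (fl q (Idt C X))"
    by (rule kernel_restriction_pullback[OF flat_ker_kernel jk g(1) _ g(5)]) (use jfl g j P ar in simp_all)
  then show ?thesis using G by (rule regular_epi_pullback)
qed

lemma regular_epi_flat:
  assumes "regular_epi C f" "regular_epi C h" shows "regular_epi C (fl f h)"
proof -
  have ar: "f \<in> Ar C" "h \<in> Ar C" using assms regular_epi_ar by auto
  have "regular_epi C (fl (Idt C (Cod C f)) h \<cdot> fl f (Idt C (Dom C h)))"
    by (rule regular_epi_comp[OF regular_epi_flat_left[OF assms(1)] regular_epi_flat_right[OF assms(2)]])
      (use ar in simp_all)
  then show ?thesis using ar by simp
qed

section \<open>Actions and split extensions\<close>

lemma is_action_ar:
  assumes "is_action C B X \<xi>"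
  shows "B \<in> Ob C" "X \<in> Ob C" "\<xi> \<in> Ar C" "Dom C \<xi> = flat_ob C B X" "Cod C \<xi> = X"
    "\<xi> \<cdot> un B X = Idt C X" "\<xi> \<cdot> mu B X = \<xi> \<cdot> fl (Idt C B) \<xi>"
  using assms by (auto simp: is_action_def)

text \<open>The equation says that \<open>\<xi>\<close> is conjugation by the section inside the
  middle object. As \<open>\<kappa>\<close> is monic it determines \<open>\<xi>\<close>; this is the
  correspondence between split extensions and actions.\<close>

definition semidirect :: "'a \<Rightarrow> 'a \<Rightarrow> 'a \<Rightarrow> 'a \<Rightarrow> bool" where
  "semidirect \<kappa> p s \<xi> \<longleftrightarrow> split_ses C \<kappa> p s \<and> is_action C (Cod C p) (Dom C \<kappa>) \<xi> \<and>
     \<kappa> \<cdot> \<xi> = cop s \<kappa> \<cdot> fk (Cod C p) (Dom C \<kappa>)"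

text \<open>\<open>p\<close> kills the restriction of \<open>[s, \<kappa>]\<close> to
  \<open>B \<flat> X\<close>, which yields \<open>\<xi>\<close>; the algebra laws hold after the
  monomorphism \<open>\<kappa>\<close>.\<close>

lemma split_ses_action:
  assumes "split_ses C \<kappa> p s"
  obtains \<xi> where "semidirect \<kappa> p s \<xi>"
proof -
  note S = split_ses_ar[OF assms]
  let ?B = "Cod C p" and ?X = "Dom C \<kappa>"
  have ob: "?B \<in> Ob C" "?X \<in> Ob C" using S by simp_all
  obtain \<xi> where x: "\<xi> \<in> Ar C" "Dom C \<xi> = Dom C (cop s \<kappa> \<cdot> fk ?B ?X)" "Cod C \<xi> = ?X" "\<kappa> \<cdot> \<xi> = cop s \<kappa> \<cdot> fk ?B ?X"
    by (rule kernel_lift[OF S(9), of "cop s \<kappa> \<cdot> fk ?B ?X"]) (use S ob in simp_all)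
  have x2: "Dom C \<xi> = flat_ob C ?B ?X" using x S ob by simp
  have "is_action C ?B ?X \<xi>" unfolding is_action_def
  proof (intro conjI)
    show "\<xi> \<cdot> un ?B ?X = Idt C ?X"
      by (rule monicD[OF S(10)]) (use x(1,3) x2 S(1-6) ob in \<open>simp_all add: x(4)[THEN rw]\<close>)
    show "\<xi> \<cdot> mu ?B ?X = \<xi> \<cdot> fl (Idt C ?B) \<xi>"
      by (rule monicD[OF S(10)]) (use x(1,3) x2 S(1-6) ob in \<open>simp_all add: x(4)[THEN rw]\<close>)
  qed (use x x2 ob in simp_all)
  then show ?thesis using that[of \<xi>] assms x(4) by (simp add: semidirect_def)
qed

text \<open>A subobject through which \<open>[s, \<kappa>]\<close> factors contains the section and
  the kernel.\<close>

lemma split_ses_regular_epi: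
  assumes "split_ses C \<kappa> p s" shows "regular_epi C (cop s \<kappa>)"
proof (rule extremal_regular_epi)
  note S = split_ses_ar[OF assms]
  have ob: "Cod C p \<in> Ob C" "Dom C \<kappa> \<in> Ob C" using S by simp_all
  show "cop s \<kappa> \<in> Ar C" using S by simp
  fix m g assume m: "monic m" "m \<in> Ar C" "g \<in> Ar C" "Cod C g = Dom C m" "Dom C g = Dom C (cop s \<kappa>)"
    "Cod C m = Cod C (cop s \<kappa>)" "m \<cdot> g = cop s \<kappa>"
  have m': "Dom C g = coprod_ob C (Cod C p) (Dom C \<kappa>)" "Cod C m = Dom C p" using m(5,6) S by simp_all
  show "is_iso C m"
    by (rule split_ses_extremal[OF assms m(1), where s' = "g \<cdot> inl C (Cod C p) (Dom C \<kappa>)" and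
          k' = "g \<cdot> inr C (Cod C p) (Dom C \<kappa>)"])
      (use m(1-4) m' S ob in \<open>simp_all add: m(7)[THEN rw]\<close>)
qed

lemma semidirect_ar:
  assumes "semidirect \<kappa> p s \<xi>"
  shows "\<kappa> \<in> Ar C" "p \<in> Ar C" "s \<in> Ar C" "Cod C \<kappa> = Dom C p" "Dom C s = Cod C p" "Cod C s = Dom C p"
    "p \<cdot> s = Idt C (Cod C p)" "p \<cdot> \<kappa> = zero (Dom C \<kappa>) (Cod C p)" "is_kernel C \<kappa> p" "monic \<kappa>"
    "\<kappa> \<cdot> \<xi> = cop s \<kappa> \<cdot> fk (Cod C p) (Dom C \<kappa>)" "is_action C (Cod C p) (Dom C \<kappa>) \<xi>"
    "\<xi> \<in> Ar C" "Dom C \<xi> = flat_ob C (Cod C p) (Dom C \<kappa>)" "Cod C \<xi> = Dom C \<kappa>" "split_ses C \<kappa> p s"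
  using assms split_ses_ar[of \<kappa> p s] is_action_ar[of "Cod C p" "Dom C \<kappa>" \<xi>] by (simp_all add: semidirect_def)

text \<open>The middle object is the quotient of \<open>B + X\<close> by the kernel of
  \<open>[s, \<kappa>]\<close>. That kernel lies in \<open>B \<flat> X\<close> and is killed there
  by \<open>\<xi>\<close>, so the hypothesis on \<open>[f, g]\<close> makes \<open>[f, g]\<close>
  vanish on it.\<close>

lemma semidirect_desc:
  assumes S: "semidirect \<kappa> p s \<xi>"
    and f: "f \<in> Ar C" "Dom C f = Cod C p" "g \<in> Ar C" "Dom C g = Dom C \<kappa>" "Cod C f = Cod C g"
    and fg: "cop f g \<cdot> fk (Cod C p) (Dom C \<kappa>) = g \<cdot> \<xi>"
  obtains h where "h \<in> Ar C" "Dom C h = Dom C p" "Cod C h = Cod C f" "h \<cdot> s = f" "h \<cdot> \<kappa> = g"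
proof -
  note A = semidirect_ar[OF S]
  let ?B = "Cod C p" and ?X = "Dom C \<kappa>"
  have ob: "?B \<in> Ob C" "?X \<in> Ob C" using A by simp_all
  obtain k where k: "is_kernel C k (cop s \<kappa>)" by (rule kernel_exists[of "cop s \<kappa>"]) (use A in simp_all)
  note K = kernel_ar[OF k]
  have K': "Cod C k = coprod_ob C ?B ?X" "cop s \<kappa> \<cdot> k = zero (Dom C k) (Dom C p)" using K(3,4) A by simp_all
  have "p \<cdot> (cop s \<kappa> \<cdot> k) = zero (Dom C k) ?B" using K' K(1) A by simp
  then obtain v where v: "v \<in> Ar C" "Dom C v = Dom C k" "Cod C v = flat_ob C ?B ?X" "fk ?B ?X \<cdot> v = k"
    by - (rule flat_lift_ex[of ?B ?X k], (use K(1) K'(1) A ob in simp_all))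
  have "\<kappa> \<cdot> (\<xi> \<cdot> v) = cop s \<kappa> \<cdot> (fk ?B ?X \<cdot> v)" using A(1-6,13-15) v(1-3) ob by (simp add: A(11)[THEN rw])
  also have "\<dots> = \<kappa> \<cdot> zero (Dom C k) ?X" using v K' A ob K(1) by simp
  finally have xv: "\<xi> \<cdot> v = zero (Dom C k) ?X" by (rule monicD[OF A(10)]) (use A v K ob in simp_all)
  have "cop f g \<cdot> k = cop f g \<cdot> (fk ?B ?X \<cdot> v)" by (simp add: v(4))
  also have "\<dots> = g \<cdot> (\<xi> \<cdot> v)" using f A(1-6,13-15) v(1-3) ob by (simp add: fg[THEN rw])
  also have "\<dots> = zero (Dom C k) (Cod C (cop f g))" using xv f K(1) by simp
  finally have 1: "cop f g \<cdot> k = zero (Dom C k) (Cod C (cop f g))" .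
  obtain h where h: "h \<in> Ar C" "Dom C h = Cod C (cop s \<kappa>)" "Cod C h = Cod C (cop f g)" "h \<cdot> cop s \<kappa> = cop f g"
    by (rule regular_epi_cokernel[OF split_ses_regular_epi[OF A(16)] k _ _ 1]) (use f A in simp_all)
  have h': "Dom C h = Dom C p" "Cod C h = Cod C f" using h A f by simp_all
  have "h \<cdot> cop s \<kappa> \<cdot> inl C ?B ?X = cop f g \<cdot> inl C ?B ?X" "h \<cdot> cop s \<kappa> \<cdot> inr C ?B ?X = cop f g \<cdot> inr C ?B ?X"
    using h(1) h' A(1-6) ob f by (simp_all only: h(4)[symmetric], simp_all)
  then show ?thesis using that[of h] h(1) h' A(1-6) ob f by simp
qed

text \<open>Equivariance of \<open>(f, h)\<close> is the compatibility that
  \<open>semidirect_desc\<close> requires of the pair \<open>s' \<cdot> f\<close> and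
  \<open>\<kappa>' \<cdot> h\<close>.\<close>

lemma semidirect_map:
  assumes S: "semidirect \<kappa> p s \<xi>" and S': "semidirect \<kappa>' p' s' \<xi>'"
    and f: "f \<in> Ar C" "Dom C f = Cod C p" "Cod C f = Cod C p'" "h \<in> Ar C" "Dom C h = Dom C \<kappa>" "Cod C h = Dom C \<kappa>'"
    and eq: "h \<cdot> \<xi> = \<xi>' \<cdot> fl f h"
  obtains \<phi> where "\<phi> \<in> Ar C" "Dom C \<phi> = Dom C p" "Cod C \<phi> = Dom C p'" "\<phi> \<cdot> s = s' \<cdot> f" "\<phi> \<cdot> \<kappa> = \<kappa>' \<cdot> h"
    "p' \<cdot> \<phi> = f \<cdot> p"
proof -
  note A = semidirect_ar[OF S] and A' = semidirect_ar[OF S']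
  have ob: "Cod C p \<in> Ob C" "Dom C \<kappa> \<in> Ob C" "Cod C p' \<in> Ob C" "Dom C \<kappa>' \<in> Ob C" using A A' by simp_all
  have "\<kappa>' \<cdot> (\<xi>' \<cdot> fl f h) = cop (s' \<cdot> f) (\<kappa>' \<cdot> h) \<cdot> fk (Cod C p) (Dom C \<kappa>)"
    using A'(1-6,13-15) f ob by (simp add: A'(11)[THEN rw])
  then have 1: "cop (s' \<cdot> f) (\<kappa>' \<cdot> h) \<cdot> fk (Cod C p) (Dom C \<kappa>) = (\<kappa>' \<cdot> h) \<cdot> \<xi>"
    using A(13-15) A'(1-6) f eq by simp
  obtain \<phi> where \<phi>: "\<phi> \<in> Ar C" "Dom C \<phi> = Dom C p" "Cod C \<phi> = Cod C (s' \<cdot> f)" "\<phi> \<cdot> s = s' \<cdot> f" "\<phi> \<cdot> \<kappa> = \<kappa>' \<cdot> h"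
    by (rule semidirect_desc[OF S _ _ _ _ _ 1]) (use f A A' in simp_all)
  have \<phi>3: "Cod C \<phi> = Dom C p'" using \<phi>(3) f A' by simp
  have "p' \<cdot> \<phi> = f \<cdot> p"
    by (rule split_ses_epic[OF A(16)])
      (use \<phi>(1,2,4,5) \<phi>3 f A(1-8) A'(1-8) in \<open>simp_all add: A'(7,8)[THEN rw]\<close>)
  with \<phi>(1,2) \<phi>3 \<phi>(4,5) show ?thesis by (rule that)
qed

text \<open>Converse to \<open>semidirect_map\<close>: equivariance is read off in the middle
  object, after the monomorphism \<open>\<kappa>'\<close>.\<close>

lemma semidirect_map_equivariant:
  assumes S: "semidirect \<kappa> p s \<xi>" and S': "semidirect \<kappa>' p' s' \<xi>'"
    and f: "f \<in> Ar C" "Dom C f = Cod C p" "Cod C f = Cod C p'" "h \<in> Ar C" "Dom C h = Dom C \<kappa>" "Cod C h = Dom C \<kappa>'"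
    and \<phi>: "\<phi> \<in> Ar C" "Dom C \<phi> = Dom C p" "Cod C \<phi> = Dom C p'" "\<phi> \<cdot> s = s' \<cdot> f" "\<phi> \<cdot> \<kappa> = \<kappa>' \<cdot> h"
  shows "h \<cdot> \<xi> = \<xi>' \<cdot> fl f h"
proof -
  note A = semidirect_ar[OF S] and A' = semidirect_ar[OF S']
  have ob: "Cod C p \<in> Ob C" "Dom C \<kappa> \<in> Ob C" "Cod C p' \<in> Ob C" "Dom C \<kappa>' \<in> Ob C" using A A' by simp_all
  have "\<kappa>' \<cdot> (\<xi>' \<cdot> fl f h) = cop (s' \<cdot> f) (\<kappa>' \<cdot> h) \<cdot> fk (Cod C p) (Dom C \<kappa>)"
    using A'(1-6,13-15) f ob by (simp add: A'(11)[THEN rw])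
  also have "\<dots> = \<phi> \<cdot> (cop s \<kappa> \<cdot> fk (Cod C p) (Dom C \<kappa>))" using A(1-6) A' \<phi> ob by simp
  also have "\<dots> = \<phi> \<cdot> (\<kappa> \<cdot> \<xi>)" by (simp only: A(11))
  also have "\<dots> = \<kappa>' \<cdot> (h \<cdot> \<xi>)" using A(1-6,13-15) A'(1-6) f \<phi>(1-3) by (simp add: \<phi>(5)[THEN rw])
  finally have "\<kappa>' \<cdot> (\<xi>' \<cdot> fl f h) = \<kappa>' \<cdot> (h \<cdot> \<xi>)" .
  then show ?thesis by (rule monicD[OF A'(10), symmetric]) (use A A' f in simp_all)
qed

text \<open>The semidirect product is the coequaliser of the reflexive graph \<open>[\<iota>, \<kappa>], 1 + \<xi>\<close> on \<open>B + X\<close>; on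
  kernels over \<open>B\<close> this graph becomes the pair \<open>\<mu>, 1 \<flat> \<xi>\<close> which is coequalised by \<open>\<xi>\<close>.\<close>

lemma action_semidirect:
  assumes act: "is_action C B X \<xi>"
  obtains \<kappa> p s where "semidirect \<kappa> p s \<xi>" "Dom C \<kappa> = X" "Cod C p = B"
proof -
  note A = is_action_ar[OF act]
  let ?F = "flat_ob C B X"
  define d where "d = cop (inl C B X) (fk B X)"
  define c where "c = coprod_arr C (Idt C B) \<xi>"
  have dc: "d \<in> Ar C" "c \<in> Ar C" "Dom C d = coprod_ob C B ?F" "Dom C c = coprod_ob C B ?F"
    "Cod C d = coprod_ob C B X" "Cod C c = coprod_ob C B X" using A by (simp_all add: d_def c_def)
  \<comment> \<open>The unit of the monad induces a common section: for \<open>d\<close> by the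
    definition of the unit, for \<open>c\<close> by the unit law of \<open>\<xi>\<close>.\<close>
  have e: "d \<cdot> coprod_arr C (Idt C B) (un B X) = Idt C (coprod_ob C B X)"
    "c \<cdot> coprod_arr C (Idt C B) (un B X) = Idt C (coprod_ob C B X)"
    using A by (simp_all add: d_def c_def coprod_arr_comp)
  obtain q i r s where q: "regular_epi C q" "regular_epi C i" "is_pullback C q q r s" "Dom C q = coprod_ob C B X"
    "Dom C i = Dom C d" "Cod C i = Dom C r" "r \<cdot> i = d" "s \<cdot> i = c"
    by (rule reflexive_graph_quotient[of d c "coprod_arr C (Idt C B) (un B X)"]) (use dc e A in simp_all)
  note P = pullback_ar[OF q(3)]
  have qi: "q \<in> Ar C" "i \<in> Ar C" using q regular_epi_ar by auto
  have P': "Cod C r = coprod_ob C B X" "Cod C s = coprod_ob C B X" "Dom C i = coprod_ob C B ?F"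
    using P q dc by simp_all
  have qdc: "q \<cdot> d = q \<cdot> c"
    using qi P(1-8) P' q(6) by (simp add: q(7,8)[symmetric] P(9)[THEN rw])
  let ?b = "cop (Idt C B) (zero X B)"
  have bd: "?b \<cdot> d = cop (Idt C B) (zero ?F B)" "?b \<cdot> c = cop (Idt C B) (zero ?F B)"
    using A by (simp_all add: d_def c_def)
  have brs: "?b \<cdot> r = ?b \<cdot> s"
    by (rule epicD[OF regular_epi_epic[OF q(2)]])
      (use qi P(1-8) P' q(4-8) A bd in simp_all)
  obtain p where p: "p \<in> Ar C" "Dom C p = Cod C q" "Cod C p = Cod C ?b" "p \<cdot> q = ?b"
    by (rule coequalizer_desc[OF regular_epi_coequalizer[OF q(1,3)] brs]) (use A P' in simp_all)
  have p3: "Cod C p = B" using p A by simp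
  obtain k where k: "is_kernel C k p" by (rule kernel_exists[OF p(1)])
  note K = kernel_ar[OF k]
  obtain w where w: "w \<in> Ar C" "Dom C w = Dom C (q \<cdot> inr C B X)" "Cod C w = Dom C k" "k \<cdot> w = q \<cdot> inr C B X"
    by (rule kernel_lift[OF k, of "q \<cdot> inr C B X"]) (use qi q(4) A p(1,2) p3 in \<open>simp_all add: p(4)[THEN rw]\<close>)
  have w2: "Dom C w = X" using w qi q(4) A by simp
  \<comment> \<open>\<open>q0\<close> is \<open>q\<close> restricted to the kernels over
    \<open>B\<close>. The kernel of \<open>p\<close> is identified with \<open>X\<close> by showing
    \<open>w \<cdot> \<xi> = q0\<close> and descending \<open>\<xi>\<close> along \<open>q0\<close>
    to an inverse \<open>v\<close> of \<open>w\<close>.\<close>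
  obtain q0 where q0: "q0 \<in> Ar C" "Dom C q0 = Dom C (q \<cdot> fk B X)" "Cod C q0 = Dom C k" "k \<cdot> q0 = q \<cdot> fk B X"
    by (rule kernel_lift[OF k, of "q \<cdot> fk B X"]) (use qi q(4) A p(1,2) p3 in \<open>simp_all add: p(4)[THEN rw]\<close>)
  have q02: "Dom C q0 = ?F" using q0 qi q(4) A by simp
  have "is_pullback C q k (fk B X) q0"
    by (rule kernel_restriction_pullback[OF flat_ker_kernel k qi(1) _ p(4)]) (use q0 q02 p A in simp_all)
  then have q0r: "regular_epi C q0" using q(1) by (rule regular_epi_pullback)
  have din: "d \<cdot> inr C B ?F = fk B X" "c \<cdot> inr C B ?F = inr C B X \<cdot> \<xi>"
    using A by (simp_all add: d_def c_def)
  have "q \<cdot> (d \<cdot> inr C B ?F) = q \<cdot> (c \<cdot> inr C B ?F)"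
    using qi q(4) dc A by (simp add: qdc[THEN rw])
  then have qk: "q \<cdot> fk B X = q \<cdot> (inr C B X \<cdot> \<xi>)" by (simp only: din)
  have wx: "w \<cdot> \<xi> = q0"
    by (rule monicD[OF kernel_monic[OF k]])
      (use w(1,3) w2 q0 q02 qi q(4) K(1-3) A qk in \<open>simp_all add: w(4)[THEN rw]\<close>)
  obtain v where v: "v \<in> Ar C" "Dom C v = Cod C q0" "Cod C v = Cod C \<xi>" "v \<cdot> q0 = \<xi>"
  proof (rule regular_epi_desc[OF q0r, of \<xi>])
    fix u u' assume a: "u \<in> Ar C" "u' \<in> Ar C" "Dom C u = Dom C u'" "Cod C u = Dom C q0" "Cod C u' = Dom C q0"
      "q0 \<cdot> u = q0 \<cdot> u'"
    have "k \<cdot> (q0 \<cdot> u) = k \<cdot> (q0 \<cdot> u')" using a(6) by simp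
    then have "q \<cdot> (fk B X \<cdot> u) = q \<cdot> (fk B X \<cdot> u')"
      using a(1-5) q0(1,3) q02 K(1-3) qi q(4) A by (simp add: q0(4)[THEN rw])
    then obtain h where h: "h \<in> Ar C" "Dom C h = Dom C (fk B X \<cdot> u)" "Cod C h = Dom C r" "r \<cdot> h = fk B X \<cdot> u"
      "s \<cdot> h = fk B X \<cdot> u'"
      by (rule pullback_lift[OF q(3)]) (use a(1-5) q02 q(4) A in simp_all)
    have h2: "Dom C h = Dom C u" using h a q02 A by simp
    \<comment> \<open>After a cover, the identification by \<open>q\<close> is witnessed by an
      element \<open>g\<close> of the graph; it lies over zero in \<open>B\<close>, hence comes from
      \<open>B \<flat> (B \<flat> X)\<close>.\<close>
    obtain t g where t: "regular_epi C t" "t \<in> Ar C" "g \<in> Ar C" "Cod C t = Dom C h" "Dom C g = Dom C t"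
      "Cod C g = Dom C i" "i \<cdot> g = h \<cdot> t"
      by (rule regular_epi_cover[OF q(2), of h]) (use h q(6) in simp_all)
    have "r \<cdot> (i \<cdot> g) = r \<cdot> (h \<cdot> t)" "s \<cdot> (i \<cdot> g) = s \<cdot> (h \<cdot> t)" by (simp_all only: t(7))
    then have dg: "d \<cdot> g = fk B X \<cdot> u \<cdot> t" "c \<cdot> g = fk B X \<cdot> u' \<cdot> t"
      using qi(2) q(6) P(3,4,8) t(2-6) h(1,3) h2 a(1-5) q02 A
      by (simp_all add: q(7,8)[THEN rw] h(4,5)[THEN rw])
    have "cop (Idt C B) (zero ?F B) \<cdot> g = ?b \<cdot> (d \<cdot> g)"
      using dc t(2-6) P'(3) A by (simp add: bd(1)[THEN rw])
    also have "\<dots> = zero (Dom C g) B" unfolding dg using t(2-6) h2 a(1-5) q02 A by simp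
    finally obtain g' where g': "g' \<in> Ar C" "Dom C g' = Dom C g" "Cod C g' = flat_ob C B ?F" "fk B ?F \<cdot> g' = g"
      using t(3,6) P'(3) A by - (rule flat_lift_ex[of B ?F g], simp_all)
    have "u \<cdot> t = mu B X \<cdot> g'"
    proof (rule flat_eqI[of B X])
      have "fk B X \<cdot> (mu B X \<cdot> g') = d \<cdot> (fk B ?F \<cdot> g')"
        using g'(1-3) A by (simp add: flat_mult_ar(4)[THEN rw] d_def)
      then show "fk B X \<cdot> (u \<cdot> t) = fk B X \<cdot> (mu B X \<cdot> g')" by (simp only: g'(4) dg)
    qed (use g' t(2-6) h2 a(1-5) q02 A in simp_all)
    moreover have "u' \<cdot> t = fl (Idt C B) \<xi> \<cdot> g'"
    proof (rule flat_eqI[of B X])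
      have "fk B X \<cdot> (fl (Idt C B) \<xi> \<cdot> g') = c \<cdot> (fk B ?F \<cdot> g')"
        using g'(1-3) A by (simp add: c_def)
      then show "fk B X \<cdot> (u' \<cdot> t) = fk B X \<cdot> (fl (Idt C B) \<xi> \<cdot> g')" by (simp only: g'(4) dg)
    qed (use g' t(2-6) h2 a(1-5) q02 A in simp_all)
    ultimately have "\<xi> \<cdot> (u \<cdot> t) = \<xi> \<cdot> (u' \<cdot> t)"
      using g'(1-3) A(1-5) by (simp add: A(7)[THEN rw])
    then have "(\<xi> \<cdot> u) \<cdot> t = (\<xi> \<cdot> u') \<cdot> t" using t(2-6) h2 a(1-5) q02 A by simp
    then show "\<xi> \<cdot> u = \<xi> \<cdot> u'"
      by (rule epicD[OF regular_epi_epic[OF t(1)]]) (use t(2-6) h2 a(1-5) q02 A in simp_all)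
  qed (use A q02 in simp_all)
  have v': "Dom C v = Dom C k" "Cod C v = X" using v(2,3) q0(3) A by simp_all
  have vw: "v \<cdot> w = Idt C X"
  proof -
    have "(v \<cdot> (w \<cdot> \<xi>)) \<cdot> un B X = \<xi> \<cdot> un B X" by (simp only: wx v(4))
    then show ?thesis using v(1) v' w(1,3) w2 A by simp
  qed
  have wv: "w \<cdot> v = Idt C (Dom C k)"
    by (rule epicD[OF regular_epi_epic[OF q0r]])
      (use v(1) v' v(4) w(1,3) w2 wx q0(1,3) q02 K in simp_all)
  let ?k = "q \<cdot> inr C B X"
  have "is_kernel C ?k p"
  proof (rule kernelI)
    show "monic ?k" unfolding w(4)[symmetric]
      by (rule monic_comp[OF split_monic[of w v] kernel_monic[OF k]]) (use v(1) v' w(1,3) w2 vw in simp_all)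
    show "p \<cdot> ?k = zero (Dom C ?k) (Cod C p)"
      using qi q(4) A p(1,2) p3 by (simp add: p(4)[THEN rw])
    fix h assume h: "h \<in> Ar C" "Cod C h = Dom C p" "p \<cdot> h = zero (Dom C h) (Cod C p)"
    obtain t where t: "t \<in> Ar C" "Dom C t = Dom C h" "Cod C t = Dom C k" "k \<cdot> t = h"
      by (rule kernel_lift[OF k h])
    have "k \<cdot> (w \<cdot> (v \<cdot> t)) = h" using t v(1) v' w(1,3) w2 K by (simp add: wv[THEN rw])
    then have "?k \<cdot> (v \<cdot> t) = h" unfolding w(4)[symmetric] using t v(1) v' w(1,3) w2 K by simp
    then show "\<exists>t. t \<in> Ar C \<and> Dom C t = Dom C h \<and> Cod C t = Dom C ?k \<and> ?k \<cdot> t = h"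
      using t(1-3) v(1) v' w2 qi q(4) A by (intro exI[where x = "v \<cdot> t"]) simp
  qed (use qi q(4) A p(1,2) p3 in simp_all)
  then have S: "split_ses C ?k p (q \<cdot> inl C B X)"
    by (rule split_sesI) (use qi q(4) A p(1,2) p3 in \<open>simp_all add: p(4)[THEN rw]\<close>)
  \<comment> \<open>As \<open>[s, \<kappa>]\<close> is \<open>q\<close> itself, the equation
    defining \<open>semidirect\<close> is the relation \<open>qk\<close>.\<close>
  have "cop (q \<cdot> inl C B X) ?k = q"
    using copair_unique[of q B X] qi q(4) A by simp
  then have "semidirect ?k p (q \<cdot> inl C B X) \<xi>"
    unfolding semidirect_def using S act qi q(4) A p3 qk by simp
  then show ?thesis by (rule that) (use qi q(4) A p3 in simp_all)
qed


text \<open>Passing to semidirect products, strong protomodularity makes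
  \<open>\<kappa> \<cdot> k\<close> normal in the middle object, and not only \<open>k\<close> in
  \<open>X\<close>. The cokernel of \<open>\<kappa> \<cdot> k\<close> is again a point over
  \<open>B\<close>, and its kernel turns out to be the codomain of \<open>q\<close>.\<close>

lemma quotient_action:
  assumes z: "is_action C B K \<zeta>" and x: "is_action C B X \<xi>"
    and k: "Dom C k = K" "Cod C k = X" "k \<cdot> \<zeta> = \<xi> \<cdot> fl (Idt C B) k"
    and q: "regular_epi C q" "is_kernel C k q"
  obtains \<omega> where "is_action C B (Cod C q) \<omega>" "q \<cdot> \<xi> = \<omega> \<cdot> fl (Idt C B) q"
proof -
  note Kq = kernel_ar[OF q(2)] and Z = is_action_ar[OF z] and X = is_action_ar[OF x]
  have kq: "k \<in> Ar C" "q \<in> Ar C" "Dom C q = X" "q \<cdot> k = zero K (Cod C q)" using Kq k by simp_all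
  obtain \<kappa> p s where S: "semidirect \<kappa> p s \<xi>" and S2: "Dom C \<kappa> = X" "Cod C p = B" by (rule action_semidirect[OF x])
  obtain \<kappa>' p' s' where S': "semidirect \<kappa>' p' s' \<zeta>" and S2': "Dom C \<kappa>' = K" "Cod C p' = B" by (rule action_semidirect[OF z])
  note A = semidirect_ar[OF S] and A' = semidirect_ar[OF S']
  obtain \<phi> where \<phi>: "\<phi> \<in> Ar C" "Dom C \<phi> = Dom C p'" "Cod C \<phi> = Dom C p" "\<phi> \<cdot> s' = s \<cdot> Idt C B" "\<phi> \<cdot> \<kappa>' = \<kappa> \<cdot> k"
    "p \<cdot> \<phi> = Idt C B \<cdot> p'"
    by (rule semidirect_map[OF S' S _ _ _ _ _ _ k(3)]) (use S2 S2' kq k Z(1) in simp_all)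
  have "normal_mono C (\<phi> \<cdot> \<kappa>')"
    by (rule split_short_five(2)[OF A'(16) A(16), where \<psi> = k])
      (use S2 S2' kq k \<phi> A(1-8) A'(1-8) q(2) in \<open>auto simp: normal_mono_def\<close>)
  then have "normal_mono C (\<kappa> \<cdot> k)" by (simp only: \<phi>(5))
  then obtain e where e: "regular_epi C e" "is_kernel C (\<kappa> \<cdot> k) e" by (rule normal_mono_cokernel)
  note E = kernel_ar[OF e(2)]
  have E': "e \<in> Ar C" "Dom C e = Dom C p" "e \<cdot> (\<kappa> \<cdot> k) = zero K (Cod C e)"
    using E A(1-6) S2 kq k by simp_all
  obtain r where r: "r \<in> Ar C" "Dom C r = Cod C e" "Cod C r = Cod C p" "r \<cdot> e = p"
    by (rule regular_epi_cokernel[OF e, of p]) (use A(1-6) E' S2 kq k Z(1) in \<open>simp_all add: A(8)[THEN rw]\<close>)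
  obtain l where l: "is_kernel C l r" by (rule kernel_exists[OF r(1)])
  note L = kernel_ar[OF l]
  obtain w where w: "w \<in> Ar C" "Dom C w = Dom C (e \<cdot> \<kappa>)" "Cod C w = Dom C l" "l \<cdot> w = e \<cdot> \<kappa>"
    by (rule kernel_lift[OF l, of "e \<cdot> \<kappa>"]) (use A(1-8) E' r(1-3) S2 in \<open>simp_all add: r(4)[THEN rw]\<close>)
  have w2: "Dom C w = X" using w A(1-6) E' S2 by simp
  \<comment> \<open>Restricting the quotient \<open>e\<close> to the kernels over \<open>B\<close>
    gives a regular epimorphism \<open>w\<close> out of \<open>X\<close>. It has the same kernel as
    \<open>q\<close>, so the two quotients differ by the isomorphism \<open>a\<close>, with inverse
    \<open>b\<close>.\<close>
  have "is_pullback C e l \<kappa> w"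
    by (rule kernel_restriction_pullback[OF A(9) l E'(1) _ r(4)]) (use w w2 r S2 in simp_all)
  then have wr: "regular_epi C w" using e(1) by (rule regular_epi_pullback)
  have wk: "w \<cdot> k = zero K (Dom C l)"
    by (rule monicD[OF kernel_monic[OF l]])
      (use w(1,3) w2 E' L(1-3) r(1-3) A(1-6) S2 kq k(1,2) Z in \<open>simp_all add: w(4)[THEN rw]\<close>)
  have "is_kernel C k w"
  proof (rule kernelI[OF kernel_monic[OF q(2)]])
    fix h assume h: "h \<in> Ar C" "Cod C h = Dom C w" "w \<cdot> h = zero (Dom C h) (Cod C w)"
    have "l \<cdot> (w \<cdot> h) = zero (Dom C h) (Cod C e)" using h w L r by simp
    then have "e \<cdot> (\<kappa> \<cdot> h) = zero (Dom C h) (Cod C e)"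
      using h(1,2) w(1,3) w2 L(1-3) r(1-3) A(1-6) S2 E' by (simp add: w(4)[THEN rw])
    then obtain t where t: "t \<in> Ar C" "Dom C t = Dom C (\<kappa> \<cdot> h)" "Cod C t = Dom C (\<kappa> \<cdot> k)" "(\<kappa> \<cdot> k) \<cdot> t = \<kappa> \<cdot> h"
      using h w2 A(1-6) S2 E' by - (rule kernel_lift[OF e(2), of "\<kappa> \<cdot> h"], simp_all)
    have t': "Dom C t = Dom C h" "Cod C t = K" using t h w2 A(1-6) S2 kq k by simp_all
    have "k \<cdot> t = h" by (rule monicD[OF A(10)]) (use t(1,4) t' h w2 A(1-6) S2 kq k in simp_all)
    then show "\<exists>t. t \<in> Ar C \<and> Dom C t = Dom C h \<and> Cod C t = Dom C k \<and> k \<cdot> t = h"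
      using t(1) t' k by (intro exI[where x = t]) simp
  qed (use wk w w2 k kq in simp_all)
  then obtain b where b: "b \<in> Ar C" "Dom C b = Cod C w" "Cod C b = Cod C q" "b \<cdot> w = q"
    by - (rule regular_epi_cokernel[OF wr, of k q], (use w2 kq k in simp_all))
  obtain a where a: "a \<in> Ar C" "Dom C a = Cod C q" "Cod C a = Cod C w" "a \<cdot> q = w"
    by (rule regular_epi_cokernel[OF q, of w]) (use w w2 kq k wk in simp_all)
  have ba: "b \<cdot> a = Idt C (Cod C q)"
    by (rule epicD[OF regular_epi_epic[OF q(1)]]) (use a b kq in simp_all)
  have ab: "a \<cdot> b = Idt C (Cod C w)"
    by (rule epicD[OF regular_epi_epic[OF wr]]) (use a b w kq L in simp_all)
  \<comment> \<open>The kernel of \<open>r\<close> is transported along the isomorphism, so that the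
    resulting action lives on \<open>Cod C q\<close> itself.\<close>
  let ?l = "l \<cdot> a"
  have "is_kernel C ?l r"
  proof (rule kernelI)
    show "monic ?l" by (rule monic_comp[OF split_monic[of a b] kernel_monic[OF l]]) (use a b w ba in simp_all)
    show "r \<cdot> ?l = zero (Dom C ?l) (Cod C r)" using L a w kq by (simp add: L(4)[THEN rw])
    fix h assume h: "h \<in> Ar C" "Cod C h = Dom C r" "r \<cdot> h = zero (Dom C h) (Cod C r)"
    obtain t where t: "t \<in> Ar C" "Dom C t = Dom C h" "Cod C t = Dom C l" "l \<cdot> t = h" by (rule kernel_lift[OF l h])
    have "?l \<cdot> (b \<cdot> t) = h" using t a(1-3) b(1-3) w L by (simp add: ab[THEN rw])
    then show "\<exists>t. t \<in> Ar C \<and> Dom C t = Dom C h \<and> Cod C t = Dom C ?l \<and> ?l \<cdot> t = h"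
      using t a(1-3) b(1-3) w L by (intro exI[where x = "b \<cdot> t"]) simp
  qed (use L a w r in simp_all)
  then have "split_ses C ?l r (e \<cdot> s)"
    by (rule split_sesI) (use A(1-8) E' r(1-3) in \<open>simp_all add: r(4)[THEN rw]\<close>)
  then obtain \<omega> where O: "semidirect ?l r (e \<cdot> s) \<omega>" by (rule split_ses_action)
  note OA = semidirect_ar[OF O]
  have d: "Dom C ?l = Cod C q" "Cod C r = B" using L a w r S2 kq by simp_all
  have "e \<cdot> \<kappa> = ?l \<cdot> q" using a w L kq by simp
  then have "q \<cdot> \<xi> = \<omega> \<cdot> fl (Idt C B) q"
    by - (rule semidirect_map_equivariant[OF S O, where \<phi> = e], (use d S2 kq E' r A(1-6) Z(1) in simp_all))
  with OA(12) show ?thesis unfolding d by (rule that)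
qed

section \<open>Restriction, products and conjugation of actions\<close>

lemma base_change_action:
  assumes "is_action C B X \<xi>" "f \<in> Ar C" "Cod C f = B"
  shows "is_action C (Dom C f) X (\<xi> \<cdot> fl f (Idt C X))"
proof -
  note A = is_action_ar[OF assms(1)]
  show ?thesis unfolding is_action_def
    using A(1-5) assms(2,3) by (simp add: A(6)[THEN rw] A(7)[THEN rw])
qed

definition pact :: "'o \<Rightarrow> 'o \<Rightarrow> 'o \<Rightarrow> 'a \<Rightarrow> 'a \<Rightarrow> 'a" where
  "pact B X Y \<xi> \<upsilon> = \<langle>\<xi> \<cdot> fl (Idt C B) (pr1 X Y), \<upsilon> \<cdot> fl (Idt C B) (pr2 X Y)\<rangle>"

lemma pact_action:
  assumes "is_action C B X \<xi>" "is_action C B Y \<upsilon>"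
  shows "is_action C B (prd X Y) (pact B X Y \<xi> \<upsilon>)"
proof -
  note A = is_action_ar[OF assms(1)] and A' = is_action_ar[OF assms(2)]
  show ?thesis unfolding is_action_def pact_def
    using A(1-5) A'(2-5) by (simp add: A(6)[THEN rw] A(7)[THEN rw] A'(6)[THEN rw] A'(7)[THEN rw])
qed

lemma pact_ar [simp]:
  assumes "is_action C B X \<xi>" "is_action C B Y \<upsilon>"
  shows "pact B X Y \<xi> \<upsilon> \<in> Ar C" "Dom C (pact B X Y \<xi> \<upsilon>) = flat_ob C B (prd X Y)"
    "Cod C (pact B X Y \<xi> \<upsilon>) = prd X Y"
  using is_action_ar[OF pact_action[OF assms]] by simp_all

lemma pact_pair:
  assumes "is_action C B X \<xi>" "is_action C B Y \<upsilon>" "f \<in> Ar C" "Cod C f = B" "h \<in> Ar C" "h' \<in> Ar C"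
    "Cod C h = X" "Cod C h' = Y" "Dom C h = Dom C h'"
  shows "pact B X Y \<xi> \<upsilon> \<cdot> fl f \<langle>h, h'\<rangle> = \<langle>\<xi> \<cdot> fl f h, \<upsilon> \<cdot> fl f h'\<rangle>"
  unfolding pact_def using is_action_ar[OF assms(1)] is_action_ar[OF assms(2)] assms(3-) by simp

lemma pr_pact:
  assumes "is_action C B X \<xi>" "is_action C B Y \<upsilon>"
  shows "pr1 X Y \<cdot> pact B X Y \<xi> \<upsilon> = \<xi> \<cdot> fl (Idt C B) (pr1 X Y)"
    "pr2 X Y \<cdot> pact B X Y \<xi> \<upsilon> = \<upsilon> \<cdot> fl (Idt C B) (pr2 X Y)"
  unfolding pact_def using is_action_ar[OF assms(1)] is_action_ar[OF assms(2)] by simp_all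

text \<open>\<open>fl (zero A B) h\<close> factors through the unit of the monad, so acting through
  a zero arrow is trivial: the right-hand side forgets \<open>A\<close> and applies
  \<open>h\<close>.\<close>

lemma action_zero_base:
  assumes "is_action C B X \<xi>" "A \<in> Ob C" "h \<in> Ar C" "Cod C h = X"
  shows "\<xi> \<cdot> fl (zero A B) h = cop (zero A X) h \<cdot> fk A (Dom C h)"
proof -
  note X = is_action_ar[OF assms(1)]
  have "fl (zero A B) h = un B X \<cdot> cop (zero A X) h \<cdot> fk A (Dom C h)"
    by (rule flat_eqI[of B X])
      (use X assms(2-) in \<open>simp_all add: flat_unit_ar(4)[THEN rw] coprod_arr_def\<close>)
  then show ?thesis using X(1-5) assms(2-) by (simp add: X(6)[THEN rw])
qed

lemma conjugation_ar [simp]: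
  assumes "X \<in> Ob C"
  shows "conjugation C X \<in> Ar C" "Dom C (conjugation C X) = flat_ob C X X" "Cod C (conjugation C X) = X"
  using assms by (simp_all add: conjugation_def)

lemma conjugation_natural:
  assumes "f \<in> Ar C"
  shows "conjugation C (Cod C f) \<cdot> fl f f = f \<cdot> conjugation C (Dom C f)"
  using assms by (simp add: conjugation_def)

section \<open>Abelian objects\<close>

text \<open>The structure hidden in \<open>abelian_object\<close>, moved to the chosen product and
  with named operations: \<open>m\<close> is addition and \<open>v\<close> negation.\<close>

definition abgroup :: "'o \<Rightarrow> 'a \<Rightarrow> 'a \<Rightarrow> bool" where
  "abgroup X m v \<longleftrightarrow> X \<in> Ob C \<and> m \<in> Ar C \<and> Dom C m = prd X X \<and> Cod C m = X \<and>
     v \<in> Ar C \<and> Dom C v = X \<and> Cod C v = X \<and>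
     (\<forall>x\<in>Ar C. \<forall>y\<in>Ar C. \<forall>z\<in>Ar C. Dom C x = Dom C y \<longrightarrow> Dom C y = Dom C z \<longrightarrow>
        Cod C x = X \<longrightarrow> Cod C y = X \<longrightarrow> Cod C z = X \<longrightarrow>
        m \<cdot> \<langle>m \<cdot> \<langle>x, y\<rangle>, z\<rangle> = m \<cdot> \<langle>x, m \<cdot> \<langle>y, z\<rangle>\<rangle> \<and> m \<cdot> \<langle>x, y\<rangle> = m \<cdot> \<langle>y, x\<rangle> \<and>
        m \<cdot> \<langle>x, zero (Dom C x) X\<rangle> = x \<and> m \<cdot> \<langle>x, v \<cdot> x\<rangle> = zero (Dom C x) X)"

lemma abgroup_ar:
  assumes "abgroup X m v"
  shows "X \<in> Ob C" "m \<in> Ar C" "Dom C m = prd X X" "Cod C m = X" "v \<in> Ar C" "Dom C v = X" "Cod C v = X"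
  using assms by (simp_all add: abgroup_def)

lemma abgroup_laws:
  assumes "abgroup X m v" "x \<in> Ar C" "Cod C x = X"
  shows "y \<in> Ar C \<Longrightarrow> z \<in> Ar C \<Longrightarrow> Dom C y = Dom C x \<Longrightarrow> Dom C z = Dom C x \<Longrightarrow> Cod C y = X \<Longrightarrow> Cod C z = X \<Longrightarrow>
      m \<cdot> \<langle>m \<cdot> \<langle>x, y\<rangle>, z\<rangle> = m \<cdot> \<langle>x, m \<cdot> \<langle>y, z\<rangle>\<rangle>"
    and "y \<in> Ar C \<Longrightarrow> Dom C y = Dom C x \<Longrightarrow> Cod C y = X \<Longrightarrow> m \<cdot> \<langle>x, y\<rangle> = m \<cdot> \<langle>y, x\<rangle>"
    and "T = Dom C x \<Longrightarrow> m \<cdot> \<langle>x, zero T X\<rangle> = x"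
    and "T = Dom C x \<Longrightarrow> m \<cdot> \<langle>zero T X, x\<rangle> = x"
    and "m \<cdot> \<langle>x, v \<cdot> x\<rangle> = zero (Dom C x) X"
    and "m \<cdot> \<langle>v \<cdot> x, x\<rangle> = zero (Dom C x) X"
proof -
  note A = abgroup_ar[OF assms(1)]
  have law: "m \<cdot> \<langle>m \<cdot> \<langle>x, y\<rangle>, z\<rangle> = m \<cdot> \<langle>x, m \<cdot> \<langle>y, z\<rangle>\<rangle> \<and> m \<cdot> \<langle>x, y\<rangle> = m \<cdot> \<langle>y, x\<rangle> \<and>
        m \<cdot> \<langle>x, zero (Dom C x) X\<rangle> = x \<and> m \<cdot> \<langle>x, v \<cdot> x\<rangle> = zero (Dom C x) X"
    if "y \<in> Ar C" "z \<in> Ar C" "Dom C y = Dom C x" "Dom C z = Dom C x" "Cod C y = X" "Cod C z = X" for y z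
  proof -
    have all: "\<forall>x\<in>Ar C. \<forall>y\<in>Ar C. \<forall>z\<in>Ar C. Dom C x = Dom C y \<longrightarrow> Dom C y = Dom C z \<longrightarrow>
        Cod C x = X \<longrightarrow> Cod C y = X \<longrightarrow> Cod C z = X \<longrightarrow>
        m \<cdot> \<langle>m \<cdot> \<langle>x, y\<rangle>, z\<rangle> = m \<cdot> \<langle>x, m \<cdot> \<langle>y, z\<rangle>\<rangle> \<and> m \<cdot> \<langle>x, y\<rangle> = m \<cdot> \<langle>y, x\<rangle> \<and>
        m \<cdot> \<langle>x, zero (Dom C x) X\<rangle> = x \<and> m \<cdot> \<langle>x, v \<cdot> x\<rangle> = zero (Dom C x) X"
      using assms(1) unfolding abgroup_def by (elim conjE)
    note * = bspec[OF bspec[OF bspec[OF all assms(2)] that(1)] that(2)]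
    show ?thesis by (rule *[THEN mp, THEN mp, THEN mp, THEN mp, THEN mp]) (use that assms(2,3) in simp_all)
  qed
  show 1: "m \<cdot> \<langle>x, y\<rangle> = m \<cdot> \<langle>y, x\<rangle>" if "y \<in> Ar C" "Dom C y = Dom C x" "Cod C y = X" for y
    using law[of y y] that by blast
  show "m \<cdot> \<langle>m \<cdot> \<langle>x, y\<rangle>, z\<rangle> = m \<cdot> \<langle>x, m \<cdot> \<langle>y, z\<rangle>\<rangle>"
    if "y \<in> Ar C" "z \<in> Ar C" "Dom C y = Dom C x" "Dom C z = Dom C x" "Cod C y = X" "Cod C z = X"
    using law[of y z] that by blast
  show 2: "m \<cdot> \<langle>x, zero T X\<rangle> = x" if "T = Dom C x" using law[of x x] assms that by blast
  show 3: "m \<cdot> \<langle>x, v \<cdot> x\<rangle> = zero (Dom C x) X" using law[of x x] assms by blast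
  show "m \<cdot> \<langle>zero T X, x\<rangle> = x" if "T = Dom C x" 
    by (rule trans[OF 1[symmetric] 2]) (use assms A that in simp_all)
  show "m \<cdot> \<langle>v \<cdot> x, x\<rangle> = zero (Dom C x) X"
    by (rule trans[OF 1[symmetric] 3]) (use assms A in simp_all)
qed

lemma abgroup_in:
  assumes "abgroup X m v"
  shows "m \<cdot> in1 X X = Idt C X" "m \<cdot> in2 X X = Idt C X"
  by (rule abgroup_laws(3,4)[OF assms]; use abgroup_ar[OF assms] in simp)+

lemma abgroupI:
  assumes "X \<in> Ob C" "m \<in> Ar C" "Dom C m = prd X X" "Cod C m = X" "v \<in> Ar C" "Dom C v = X" "Cod C v = X"
    "\<And>x y z. x \<in> Ar C \<Longrightarrow> y \<in> Ar C \<Longrightarrow> z \<in> Ar C \<Longrightarrow> Dom C y = Dom C x \<Longrightarrow> Dom C z = Dom C x \<Longrightarrow>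
        Cod C x = X \<Longrightarrow> Cod C y = X \<Longrightarrow> Cod C z = X \<Longrightarrow> m \<cdot> \<langle>m \<cdot> \<langle>x, y\<rangle>, z\<rangle> = m \<cdot> \<langle>x, m \<cdot> \<langle>y, z\<rangle>\<rangle>"
    "\<And>x y. x \<in> Ar C \<Longrightarrow> y \<in> Ar C \<Longrightarrow> Dom C y = Dom C x \<Longrightarrow> Cod C x = X \<Longrightarrow> Cod C y = X \<Longrightarrow>
        m \<cdot> \<langle>x, y\<rangle> = m \<cdot> \<langle>y, x\<rangle>"
    "\<And>x. x \<in> Ar C \<Longrightarrow> Cod C x = X \<Longrightarrow> m \<cdot> \<langle>x, zero (Dom C x) X\<rangle> = x"
    "\<And>x. x \<in> Ar C \<Longrightarrow> Cod C x = X \<Longrightarrow> m \<cdot> \<langle>x, v \<cdot> x\<rangle> = zero (Dom C x) X"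
  shows "abgroup X m v"
  unfolding abgroup_def
proof (intro conjI ballI impI)
  fix x y z assume a: "x \<in> Ar C" "y \<in> Ar C" "z \<in> Ar C" "Dom C x = Dom C y" "Dom C y = Dom C z" "Cod C x = X"
    "Cod C y = X" "Cod C z = X"
  show "m \<cdot> \<langle>m \<cdot> \<langle>x, y\<rangle>, z\<rangle> = m \<cdot> \<langle>x, m \<cdot> \<langle>y, z\<rangle>\<rangle>" by (rule assms(8)) (use a in simp_all)
  show "m \<cdot> \<langle>x, y\<rangle> = m \<cdot> \<langle>y, x\<rangle>" by (rule assms(9)) (use a in simp_all)
  show "m \<cdot> \<langle>x, zero (Dom C x) X\<rangle> = x" by (rule assms(10)) (use a in simp_all)
  show "m \<cdot> \<langle>x, v \<cdot> x\<rangle> = zero (Dom C x) X" by (rule assms(11)) (use a in simp_all)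
qed (use assms(1-7) in simp_all)

lemma abelian_objectE:
  assumes "abelian_object C X"
  obtains m v where "abgroup X m v"
proof -
  obtain p q m v where pq: "is_product C X X p q" and m: "m \<in> hom C (Dom C p) X" and v: "v \<in> hom C X X"
    and laws: "\<And>T x y z. T \<in> Ob C \<Longrightarrow> x \<in> hom C T X \<Longrightarrow> y \<in> hom C T X \<Longrightarrow> z \<in> hom C T X \<Longrightarrow>
          m \<cdot> prod_pair C p q (m \<cdot> prod_pair C p q x y) z = m \<cdot> prod_pair C p q x (m \<cdot> prod_pair C p q y z) \<and>
          m \<cdot> prod_pair C p q x y = m \<cdot> prod_pair C p q y x \<and>
          m \<cdot> prod_pair C p q x (zero T X) = x \<and> m \<cdot> prod_pair C p q x (v \<cdot> x) = zero T X"
    using assms unfolding abelian_object_def Let_def by blast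
  have X: "X \<in> Ob C" using pq by (simp add: is_product_def)
  \<comment> \<open>The comparison from the chosen product to the product on which the addition was
    given.\<close>
  let ?J = "prod_pair C p q (pr1 X X) (pr2 X X)"
  have J: "?J \<in> Ar C" "Dom C ?J = prd X X" "Cod C ?J = Dom C p" "p \<cdot> ?J = pr1 X X" "q \<cdot> ?J = pr2 X X"
    using prod_pair(1-5)[OF pq, of "pr1 X X" "pr2 X X"] X by simp_all
  have pqa: "p \<in> Ar C" "q \<in> Ar C" "Dom C q = Dom C p" using pq by (simp_all add: is_product_def)
  have JJ: "(m \<cdot> ?J) \<cdot> \<langle>x, y\<rangle> = m \<cdot> prod_pair C p q x y"
    if "x \<in> Ar C" "y \<in> Ar C" "Dom C x = Dom C y" "Cod C x = X" "Cod C y = X" for x y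
  proof -
    have "?J \<cdot> \<langle>x, y\<rangle> = prod_pair C p q x y"
      by (rule prod_pair(6)[OF pq]) (use that J(1-3) pqa X in \<open>simp_all add: J(4,5)[THEN rw]\<close>)
    then show ?thesis using that m J(1-3) X by simp
  qed
  have PP: "prod_pair C p q x y \<in> Ar C" "Dom C (prod_pair C p q x y) = Dom C x" "Cod C (prod_pair C p q x y) = Dom C p"
    if "x \<in> Ar C" "y \<in> Ar C" "Dom C x = Dom C y" "Cod C x = X" "Cod C y = X" for x y
    using prod_pair(1-3)[OF pq, of x y] that by simp_all
  have "abgroup X (m \<cdot> ?J) v"
  proof (rule abgroupI)
    fix x y z assume a: "x \<in> Ar C" "y \<in> Ar C" "z \<in> Ar C" "Dom C y = Dom C x" "Dom C z = Dom C x" "Cod C x = X"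
      "Cod C y = X" "Cod C z = X"
    have "m \<cdot> prod_pair C p q (m \<cdot> prod_pair C p q x y) z = m \<cdot> prod_pair C p q x (m \<cdot> prod_pair C p q y z)"
      using conjunct1[OF laws[of "Dom C x" x y z]] a by simp
    moreover have "(m \<cdot> ?J) \<cdot> \<langle>(m \<cdot> ?J) \<cdot> \<langle>x, y\<rangle>, z\<rangle> = m \<cdot> prod_pair C p q (m \<cdot> prod_pair C p q x y) z"
      using a m PP J(1-3) by (subst JJ[of x y], simp_all only:, subst JJ, simp_all)
    moreover have "(m \<cdot> ?J) \<cdot> \<langle>x, (m \<cdot> ?J) \<cdot> \<langle>y, z\<rangle>\<rangle> = m \<cdot> prod_pair C p q x (m \<cdot> prod_pair C p q y z)"
      using a m PP J(1-3) by (subst JJ[of y z], simp_all only:, subst JJ, simp_all)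
    ultimately show "(m \<cdot> ?J) \<cdot> \<langle>(m \<cdot> ?J) \<cdot> \<langle>x, y\<rangle>, z\<rangle> = (m \<cdot> ?J) \<cdot> \<langle>x, (m \<cdot> ?J) \<cdot> \<langle>y, z\<rangle>\<rangle>" by simp
  next
    fix x y assume a: "x \<in> Ar C" "y \<in> Ar C" "Dom C y = Dom C x" "Cod C x = X" "Cod C y = X"
    have "m \<cdot> prod_pair C p q x y = m \<cdot> prod_pair C p q y x" using laws[of "Dom C x" x y y] a by simp
    then show "(m \<cdot> ?J) \<cdot> \<langle>x, y\<rangle> = (m \<cdot> ?J) \<cdot> \<langle>y, x\<rangle>" using JJ a by metis
  next
    fix x assume a: "x \<in> Ar C" "Cod C x = X"
    then have "m \<cdot> prod_pair C p q x (zero (Dom C x) X) = x" "m \<cdot> prod_pair C p q x (v \<cdot> x) = zero (Dom C x) X"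
      using laws[of "Dom C x" x x x] by simp_all
    then show "(m \<cdot> ?J) \<cdot> \<langle>x, zero (Dom C x) X\<rangle> = x" "(m \<cdot> ?J) \<cdot> \<langle>x, v \<cdot> x\<rangle> = zero (Dom C x) X"
      using JJ[of x "zero (Dom C x) X"] JJ[of x "v \<cdot> x"] a v X by simp_all
  qed (use m v J X in simp_all)
  then show ?thesis by (rule that)
qed

lemma abgroup_abelian_object:
  assumes "abgroup X m v" shows "abelian_object C X"
  unfolding abelian_object_def Let_def
proof (intro exI conjI bexI ballI)
  note A = abgroup_ar[OF assms]
  show "is_product C X X (pr1 X X) (pr2 X X)" using A by (simp add: pr_product)
  show "m \<in> hom C (Dom C (pr1 X X)) X" "v \<in> hom C X X" using A by simp_all
  have pp: "prod_pair C (pr1 X X) (pr2 X X) x y = \<langle>x, y\<rangle>" if "Cod C x = X" "Cod C y = X" for x y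
    using that by (simp add: pair_def)
  fix T x y z assume a: "T \<in> Ob C" "x \<in> hom C T X" "y \<in> hom C T X" "z \<in> hom C T X"
  note L = abgroup_laws[OF assms]
  show "m \<cdot> prod_pair C (pr1 X X) (pr2 X X) (m \<cdot> prod_pair C (pr1 X X) (pr2 X X) x y) z =
    m \<cdot> prod_pair C (pr1 X X) (pr2 X X) x (m \<cdot> prod_pair C (pr1 X X) (pr2 X X) y z)"
    using a A L(1)[of x y z] by (simp add: pp)
  show "m \<cdot> prod_pair C (pr1 X X) (pr2 X X) x y = m \<cdot> prod_pair C (pr1 X X) (pr2 X X) y x"
    using a A L(2)[of x y] by (simp add: pp)
  show "m \<cdot> prod_pair C (pr1 X X) (pr2 X X) x (zero T X) = x"
    using a A L(3)[of x] by (simp add: pp)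
  show "m \<cdot> prod_pair C (pr1 X X) (pr2 X X) x (v \<cdot> x) = zero T X"
    using a A L(5)[of x] by (simp add: pp)
qed

text \<open>\<open>[1, 1]\<close> is \<open>m\<close> after the copairing of the two axes, and on
  \<open>X \<flat> X\<close> the first component of that copairing vanishes. So conjugation on an
  abelian object is the trivial action.\<close>

lemma abgroup_conjugation:
  assumes "abgroup X m v"
  shows "conjugation C X = cop (zero X X) (Idt C X) \<cdot> fk X X"
proof -
  note A = abgroup_ar[OF assms] and I = abgroup_in[OF assms]
  have 1: "cop (in1 X X) (in2 X X) \<cdot> fk X X = in2 X X \<cdot> (cop (zero X X) (Idt C X) \<cdot> fk X X)"
    by (rule pair_eqI[of X X]) (use A in simp_all)
  have "conjugation C X = m \<cdot> (cop (in1 X X) (in2 X X) \<cdot> fk X X)"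
    using A I by (simp add: conjugation_def)
  also have "\<dots> = cop (zero X X) (Idt C X) \<cdot> fk X X"
    unfolding 1 using A(1-4) I(2)[THEN rw] by (simp del: pair_comp)
  finally show ?thesis .
qed

lemma abgroup_prd:
  assumes "abgroup X m v" "abgroup X' m' v'"
  shows "\<exists>M V. abgroup (prd X X') M V"
proof -
  note A = abgroup_ar[OF assms(1)] and A' = abgroup_ar[OF assms(2)]
  note L = abgroup_laws[OF assms(1)] and L' = abgroup_laws[OF assms(2)]
  let ?P = "prd X X'"
  let ?M = "\<langle>m \<cdot> \<langle>pr1 X X' \<cdot> pr1 ?P ?P, pr1 X X' \<cdot> pr2 ?P ?P\<rangle>, m' \<cdot> \<langle>pr2 X X' \<cdot> pr1 ?P ?P, pr2 X X' \<cdot> pr2 ?P ?P\<rangle>\<rangle>"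
  let ?V = "\<langle>v \<cdot> pr1 X X', v' \<cdot> pr2 X X'\<rangle>"
  have "abgroup ?P ?M ?V"
  proof (rule abgroupI)
    fix x y z assume a: "x \<in> Ar C" "y \<in> Ar C" "z \<in> Ar C" "Dom C y = Dom C x" "Dom C z = Dom C x" "Cod C x = ?P"
      "Cod C y = ?P" "Cod C z = ?P"
    then show "?M \<cdot> \<langle>?M \<cdot> \<langle>x, y\<rangle>, z\<rangle> = ?M \<cdot> \<langle>x, ?M \<cdot> \<langle>y, z\<rangle>\<rangle>"
      using A A' L(1)[of "pr1 X X' \<cdot> x" "pr1 X X' \<cdot> y" "pr1 X X' \<cdot> z"]
        L'(1)[of "pr2 X X' \<cdot> x" "pr2 X X' \<cdot> y" "pr2 X X' \<cdot> z"] by simp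
  next
    fix x y assume a: "x \<in> Ar C" "y \<in> Ar C" "Dom C y = Dom C x" "Cod C x = ?P" "Cod C y = ?P"
    then show "?M \<cdot> \<langle>x, y\<rangle> = ?M \<cdot> \<langle>y, x\<rangle>"
      using A A' L(2)[of "pr1 X X' \<cdot> x" "pr1 X X' \<cdot> y"] L'(2)[of "pr2 X X' \<cdot> x" "pr2 X X' \<cdot> y"] by simp
  next
    fix x assume a: "x \<in> Ar C" "Cod C x = ?P"
    then show "?M \<cdot> \<langle>x, zero (Dom C x) ?P\<rangle> = x"
      using A A' L(3)[of "pr1 X X' \<cdot> x"] L'(3)[of "pr2 X X' \<cdot> x"] by simp
    show "?M \<cdot> \<langle>x, ?V \<cdot> x\<rangle> = zero (Dom C x) ?P"
      by (rule pair_eqI[of X X'])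
        (use a A A' L(5)[of "pr1 X X' \<cdot> x"] L'(5)[of "pr2 X X' \<cdot> x"] in simp_all)
  qed (use A A' in simp_all)
  then show ?thesis by blast
qed

text \<open>Addition descends along \<open>q \<times> q\<close> because \<open>q \<cdot> m\<close>
  kills its kernel: that kernel lies in \<open>K \<times> K\<close>, with \<open>K\<close> the
  kernel of \<open>q\<close>, and on the axes of \<open>K \<times> K\<close> addition is the
  inclusion of \<open>K\<close>. The laws are verified on lifts over a cover.\<close>

lemma abgroup_quotient:
  assumes ab: "abgroup Y m v" and q: "regular_epi C q" "Dom C q = Y" "Cod C q = Q"
  shows "\<exists>M V. abgroup Q M V"
proof -
  note A = abgroup_ar[OF ab] and L = abgroup_laws[OF ab] and I = abgroup_in[OF ab]
  have qa: "q \<in> Ar C" "Q \<in> Ob C" using regular_epi_ar[OF q(1)] q by auto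
  let ?qq = "\<langle>q \<cdot> pr1 Y Y, q \<cdot> pr2 Y Y\<rangle>"
  have qq: "regular_epi C ?qq" by (rule regular_epi_prd[OF q])
  obtain k where k: "is_kernel C k q" by (rule kernel_exists[OF qa(1)])
  note K = kernel_ar[OF k]
  have K': "Cod C k = Y" "q \<cdot> k = zero (Dom C k) Q" using K q by simp_all
  let ?K = "Dom C k"
  have Ko: "?K \<in> Ob C" using K by simp
  have kk: "q \<cdot> m \<cdot> \<langle>k \<cdot> pr1 ?K ?K, k \<cdot> pr2 ?K ?K\<rangle> = zero (prd ?K ?K) Q"
  proof (rule prd_epic[of _ ?K ?K])
    have "m \<cdot> \<langle>k, zero ?K Y\<rangle> = k" "m \<cdot> \<langle>zero ?K Y, k\<rangle> = k"
      by (rule L(3,4); use K K' in simp)+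
    then show "(q \<cdot> m \<cdot> \<langle>k \<cdot> pr1 ?K ?K, k \<cdot> pr2 ?K ?K\<rangle>) \<cdot> in1 ?K ?K = zero (prd ?K ?K) Q \<cdot> in1 ?K ?K"
      "(q \<cdot> m \<cdot> \<langle>k \<cdot> pr1 ?K ?K, k \<cdot> pr2 ?K ?K\<rangle>) \<cdot> in2 ?K ?K = zero (prd ?K ?K) Q \<cdot> in2 ?K ?K"
      using A qa q K(1,2) K' Ko by simp_all
  qed (use A qa q K(1,2) K' Ko in simp_all)
  obtain l where l: "is_kernel C l ?qq" by (rule kernel_exists[of ?qq]) (use qa q A in simp_all)
  note Lk = kernel_ar[OF l]
  have L2: "Cod C l = prd Y Y" using Lk(3) qa q A by simp
  have "pr1 Q Q \<cdot> (?qq \<cdot> l) = zero (Dom C l) Q" "pr2 Q Q \<cdot> (?qq \<cdot> l) = zero (Dom C l) Q"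
    using Lk(1,4) qa q A by simp_all
  then have ql: "q \<cdot> (pr1 Y Y \<cdot> l) = zero (Dom C l) Q" "q \<cdot> (pr2 Y Y \<cdot> l) = zero (Dom C l) Q"
    using Lk(1) L2 qa q A by simp_all
  obtain a where a: "a \<in> Ar C" "Dom C a = Dom C (pr1 Y Y \<cdot> l)" "Cod C a = ?K" "k \<cdot> a = pr1 Y Y \<cdot> l"
    by (rule kernel_lift[OF k, of "pr1 Y Y \<cdot> l"]) (use ql Lk(1) L2 qa q A in simp_all)
  obtain b where b: "b \<in> Ar C" "Dom C b = Dom C (pr2 Y Y \<cdot> l)" "Cod C b = ?K" "k \<cdot> b = pr2 Y Y \<cdot> l"
    by (rule kernel_lift[OF k, of "pr2 Y Y \<cdot> l"]) (use ql Lk(1) L2 qa q A in simp_all)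
  have ab': "Dom C a = Dom C l" "Dom C b = Dom C l" using a b Lk(1) L2 A by simp_all
  have "(q \<cdot> m \<cdot> \<langle>k \<cdot> pr1 ?K ?K, k \<cdot> pr2 ?K ?K\<rangle>) \<cdot> \<langle>a, b\<rangle> = zero (Dom C l) Q"
    unfolding kk using a b ab' Ko qa by simp
  then have qml: "q \<cdot> m \<cdot> l = zero (Dom C l) Q"
    using a b ab' Ko K(1) K' qa q A Lk(1) L2 by simp
  obtain M where M: "M \<in> Ar C" "Dom C M = Cod C ?qq" "Cod C M = Cod C (q \<cdot> m)" "M \<cdot> ?qq = q \<cdot> m"
    by (rule regular_epi_cokernel[OF qq l, of "q \<cdot> m"]) (use qml qa q A Lk(1) L2 in simp_all)
  have M': "Dom C M = prd Q Q" "Cod C M = Q" using M qa q A by simp_all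
  have MM: "M \<cdot> \<langle>q \<cdot> x, q \<cdot> y\<rangle> = q \<cdot> (m \<cdot> \<langle>x, y\<rangle>)"
    if "x \<in> Ar C" "y \<in> Ar C" "Dom C y = Dom C x" "Cod C x = Y" "Cod C y = Y" for x y
  proof -
    have "(M \<cdot> ?qq) \<cdot> \<langle>x, y\<rangle> = (q \<cdot> m) \<cdot> \<langle>x, y\<rangle>" by (simp only: M(4))
    then show ?thesis using that M(1) M' qa q A by simp
  qed
  \<comment> \<open>Negation descends as well: in the quotient \<open>q k + q (-k) = 0\<close> while
    \<open>q k = 0\<close>.\<close>
  have "q \<cdot> (m \<cdot> \<langle>k, v \<cdot> k\<rangle>) = zero ?K Q" using L(5)[of k] K K' qa q A by simp
  then have "M \<cdot> \<langle>q \<cdot> k, q \<cdot> (v \<cdot> k)\<rangle> = zero ?K Q" using MM[of k "v \<cdot> k"] K K' A by simp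
  moreover have "M \<cdot> \<langle>q \<cdot> zero ?K Y, q \<cdot> (v \<cdot> k)\<rangle> = q \<cdot> (v \<cdot> k)"
    using MM[of "zero ?K Y" "v \<cdot> k"] L(4)[of "v \<cdot> k" ?K] K K' A by simp
  ultimately have qvk: "q \<cdot> (v \<cdot> k) = zero ?K Q" using K K' A qa q by simp
  obtain V where V: "V \<in> Ar C" "Dom C V = Cod C q" "Cod C V = Cod C (q \<cdot> v)" "V \<cdot> q = q \<cdot> v"
    by (rule regular_epi_cokernel[OF q(1) k, of "q \<cdot> v"]) (use qvk K K' A qa q in simp_all)
  have V': "Dom C V = Q" "Cod C V = Q" using V qa q A by simp_all
  have "abgroup Q M V"
  proof (rule abgroupI)
    fix x y z assume a: "x \<in> Ar C" "y \<in> Ar C" "z \<in> Ar C" "Dom C y = Dom C x" "Dom C z = Dom C x" "Cod C x = Q"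
      "Cod C y = Q" "Cod C z = Q"
    obtain t x' where t: "regular_epi C t" "t \<in> Ar C" "x' \<in> Ar C" "Cod C t = Dom C x" "Dom C x' = Dom C t"
      "Cod C x' = Dom C q" "q \<cdot> x' = x \<cdot> t"
      by (rule regular_epi_cover[OF q(1), of x]) (use a q in simp_all)
    obtain t2 y' where t2: "regular_epi C t2" "t2 \<in> Ar C" "y' \<in> Ar C" "Cod C t2 = Dom C (y \<cdot> t)" "Dom C y' = Dom C t2"
      "Cod C y' = Dom C q" "q \<cdot> y' = (y \<cdot> t) \<cdot> t2"
      by (rule regular_epi_cover[OF q(1), of "y \<cdot> t"]) (use a q t in simp_all)
    have t2': "Cod C t2 = Dom C t" using t2 a t by simp
    obtain t3 z' where t3: "regular_epi C t3" "t3 \<in> Ar C" "z' \<in> Ar C" "Cod C t3 = Dom C (z \<cdot> t \<cdot> t2)" "Dom C z' = Dom C t3"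
      "Cod C z' = Dom C q" "q \<cdot> z' = (z \<cdot> t \<cdot> t2) \<cdot> t3"
      by (rule regular_epi_cover[OF q(1), of "z \<cdot> t \<cdot> t2"]) (use a q t t2 t2' in simp_all)
    have t3': "Cod C t3 = Dom C t2" using t3 a t t2 t2' by simp
    \<comment> \<open>The three elements were lifted one after the other; over the composite cover
      all lifts have a common domain.\<close>
    let ?t = "t \<cdot> t2 \<cdot> t3" and ?x = "x' \<cdot> t2 \<cdot> t3" and ?y = "y' \<cdot> t3"
    have re: "regular_epi C ?t"
      by (rule regular_epi_comp[OF regular_epi_comp[OF t3(1) t2(1)] t(1)]) (use t2(2) t2' t3(2) t3' in simp_all)
    have e: "x \<cdot> ?t = q \<cdot> ?x" "y \<cdot> ?t = q \<cdot> ?y" "z \<cdot> ?t = q \<cdot> z'"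
      using a t(2-6) t2(2,3,5,6) t2' t3(2,3,5,6) t3' qa q
      by (simp_all add: t(7)[THEN rw] t2(7)[THEN rw] t3(7)[THEN rw])
    have ar: "?x \<in> Ar C" "?y \<in> Ar C" "z' \<in> Ar C" "Dom C ?x = Dom C t3" "Dom C ?y = Dom C t3" "Dom C z' = Dom C t3"
      "Cod C ?x = Y" "Cod C ?y = Y" "Cod C z' = Y" "?t \<in> Ar C" "Dom C ?t = Dom C t3" "Cod C ?t = Dom C x"
      using a t(2-6) t2(2,3,5,6) t2' t3(2,3,5,6) t3' qa q by simp_all
    have "(M \<cdot> \<langle>M \<cdot> \<langle>x, y\<rangle>, z\<rangle>) \<cdot> ?t = M \<cdot> \<langle>M \<cdot> \<langle>x \<cdot> ?t, y \<cdot> ?t\<rangle>, z \<cdot> ?t\<rangle>"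
      using a M(1) M' ar(10-12) by (simp del: comp_assoc add: comp_assoc[of _ "\<langle>M \<cdot> \<langle>x, y\<rangle>, z\<rangle>"] comp_assoc[of _ "\<langle>x, y\<rangle>"])
    also have "\<dots> = q \<cdot> (m \<cdot> \<langle>m \<cdot> \<langle>?x, ?y\<rangle>, z'\<rangle>)"
      unfolding e using ar(1-9) A by (simp add: MM del: comp_assoc)
    also have "\<dots> = q \<cdot> (m \<cdot> \<langle>?x, m \<cdot> \<langle>?y, z'\<rangle>\<rangle>)"
      using L(1)[of ?x ?y z'] ar(1-9) by (simp del: comp_assoc)
    also have "\<dots> = M \<cdot> \<langle>x \<cdot> ?t, M \<cdot> \<langle>y \<cdot> ?t, z \<cdot> ?t\<rangle>\<rangle>"
      unfolding e using ar(1-9) A by (simp add: MM del: comp_assoc)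
    also have "\<dots> = (M \<cdot> \<langle>x, M \<cdot> \<langle>y, z\<rangle>\<rangle>) \<cdot> ?t"
      using a M(1) M' ar(10-12) by (simp del: comp_assoc add: comp_assoc[of _ "\<langle>x, M \<cdot> \<langle>y, z\<rangle>\<rangle>"] comp_assoc[of _ "\<langle>y, z\<rangle>"])
    finally show "M \<cdot> \<langle>M \<cdot> \<langle>x, y\<rangle>, z\<rangle> = M \<cdot> \<langle>x, M \<cdot> \<langle>y, z\<rangle>\<rangle>"
      by (rule epicD[OF regular_epi_epic[OF re]]) (use a M(1) M' ar in simp_all)
  next
    fix x y assume a: "x \<in> Ar C" "y \<in> Ar C" "Dom C y = Dom C x" "Cod C x = Q" "Cod C y = Q"
    obtain t x' where t: "regular_epi C t" "t \<in> Ar C" "x' \<in> Ar C" "Cod C t = Dom C x" "Dom C x' = Dom C t"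
      "Cod C x' = Dom C q" "q \<cdot> x' = x \<cdot> t"
      by (rule regular_epi_cover[OF q(1), of x]) (use a q in simp_all)
    obtain t2 y' where t2: "regular_epi C t2" "t2 \<in> Ar C" "y' \<in> Ar C" "Cod C t2 = Dom C (y \<cdot> t)" "Dom C y' = Dom C t2"
      "Cod C y' = Dom C q" "q \<cdot> y' = (y \<cdot> t) \<cdot> t2"
      by (rule regular_epi_cover[OF q(1), of "y \<cdot> t"]) (use a q t in simp_all)
    have t2': "Cod C t2 = Dom C t" using t2 a t by simp
    let ?t = "t \<cdot> t2" and ?x = "x' \<cdot> t2"
    have re: "regular_epi C ?t" by (rule regular_epi_comp[OF t2(1) t(1) t2'])
    have "M \<cdot> \<langle>x \<cdot> ?t, y \<cdot> ?t\<rangle> = M \<cdot> \<langle>y \<cdot> ?t, x \<cdot> ?t\<rangle>"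
      using MM[of ?x y'] MM[of y' ?x] L(2)[of ?x y'] a t(2-6) t2(2,3,5,6) t2' qa q
      by (simp add: t(7)[THEN rw] t2(7)[THEN rw])
    then show "M \<cdot> \<langle>x, y\<rangle> = M \<cdot> \<langle>y, x\<rangle>"
      by - (rule epicD[OF regular_epi_epic[OF re]], (use a M(1) M' t(2-6) t2(2,3,5,6) t2' in simp_all))
  next
    fix x assume a: "x \<in> Ar C" "Cod C x = Q"
    obtain t x' where t: "regular_epi C t" "t \<in> Ar C" "x' \<in> Ar C" "Cod C t = Dom C x" "Dom C x' = Dom C t"
      "Cod C x' = Dom C q" "q \<cdot> x' = x \<cdot> t"
      by (rule regular_epi_cover[OF q(1), of x]) (use a q in simp_all)
    have ob: "Dom C x \<in> Ob C" "Dom C t \<in> Ob C" using a t by simp_all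
    have e: "q \<cdot> (m \<cdot> \<langle>x', zero (Dom C t) Y\<rangle>) = q \<cdot> x'" "q \<cdot> (m \<cdot> \<langle>x', v \<cdot> x'\<rangle>) = zero (Dom C t) Q"
      using L(3)[of x' "Dom C t"] L(5)[of x'] t(2-6) q qa A ob by simp_all
    have Vx: "(V \<cdot> x) \<cdot> t = q \<cdot> (v \<cdot> x')"
    proof -
      have "(V \<cdot> x) \<cdot> t = V \<cdot> (q \<cdot> x')" unfolding t(7) using a V(1) V' t(2-6) by simp
      also have "\<dots> = q \<cdot> (v \<cdot> x')" using V(1) V' t(2-6) qa q A by (simp add: V(4)[THEN rw])
      finally show ?thesis .
    qed
    have "(M \<cdot> \<langle>x, zero (Dom C x) Q\<rangle>) \<cdot> t = M \<cdot> \<langle>x \<cdot> t, q \<cdot> zero (Dom C t) Y\<rangle>"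
      using a M(1) M' t(2-6) ob qa q A by simp
    also have "\<dots> = M \<cdot> \<langle>q \<cdot> x', q \<cdot> zero (Dom C t) Y\<rangle>" by (simp only: t(7))
    also have "\<dots> = q \<cdot> (m \<cdot> \<langle>x', zero (Dom C t) Y\<rangle>)" by (rule MM) (use t(2-6) q ob A in simp_all)
    also have "\<dots> = x \<cdot> t" by (simp only: e t(7))
    finally show "M \<cdot> \<langle>x, zero (Dom C x) Q\<rangle> = x"
      by (rule epicD[OF regular_epi_epic[OF t(1)]]) (use a M(1) M' V(1) V' t(2-6) ob qa in simp_all)
    have "(M \<cdot> \<langle>x, V \<cdot> x\<rangle>) \<cdot> t = M \<cdot> \<langle>x \<cdot> t, (V \<cdot> x) \<cdot> t\<rangle>"
      using a M(1) M' t(2-6) V(1) V' by simp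
    also have "\<dots> = M \<cdot> \<langle>q \<cdot> x', q \<cdot> (v \<cdot> x')\<rangle>" by (simp only: t(7) Vx)
    also have "\<dots> = q \<cdot> (m \<cdot> \<langle>x', v \<cdot> x'\<rangle>)" by (rule MM) (use t(2-6) q ob A in simp_all)
    also have "\<dots> = zero (Dom C x) Q \<cdot> t" unfolding e using a t(2-6) qa ob by simp
    finally show "M \<cdot> \<langle>x, V \<cdot> x\<rangle> = zero (Dom C x) Q"
      by (rule epicD[OF regular_epi_epic[OF t(1)]]) (use a M(1) M' V(1) V' t(2-6) ob qa in simp_all)
  qed (use M M' V V' qa in simp_all)
  then show ?thesis by blast
qed

text \<open>Negation is the restriction of the subtraction \<open>X \<times> X \<rightarrow> X\<close>, which is equivariant as the cokernel
  of the diagonal.\<close>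

lemma negation_equivariant:
  assumes ab: "abgroup X m v" and act: "is_action C G X \<phi>"
  shows "v \<cdot> \<phi> = \<phi> \<cdot> fl (Idt C G) v"
proof -
  note A = abgroup_ar[OF ab] and L = abgroup_laws[OF ab] and F = is_action_ar[OF act]
  let ?d = "\<langle>Idt C X, Idt C X\<rangle>" and ?s = "m \<cdot> \<langle>pr1 X X, v \<cdot> pr2 X X\<rangle>"
  have k: "is_kernel C ?d ?s"
  proof (rule kernelI)
    show "monic ?d" by (rule split_monic[of _ "pr1 X X"]) (use A in simp_all)
    show "?s \<cdot> ?d = zero (Dom C ?d) (Cod C ?s)" using L(5)[of "Idt C X"] A by simp
    fix h assume h: "h \<in> Ar C" "Cod C h = Dom C ?s" "?s \<cdot> h = zero (Dom C h) (Cod C ?s)"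
    have h2: "Cod C h = prd X X" using h A by simp
    let ?a = "pr1 X X \<cdot> h" and ?b = "pr2 X X \<cdot> h"
    have ar: "?a \<in> Ar C" "?b \<in> Ar C" "v \<cdot> ?b \<in> Ar C" "Dom C ?a = Dom C h" "Dom C ?b = Dom C h" "Dom C (v \<cdot> ?b) = Dom C h"
      "Cod C ?a = X" "Cod C ?b = X" "Cod C (v \<cdot> ?b) = X" using h(1) h2 A by simp_all
    have s0: "m \<cdot> \<langle>?a, v \<cdot> ?b\<rangle> = zero (Dom C h) X" using h(1,3) h2 A by simp
    have "?a = m \<cdot> \<langle>?a, zero (Dom C h) X\<rangle>" using L(3)[of ?a "Dom C h"] ar by simp
    also have "\<dots> = m \<cdot> \<langle>?a, m \<cdot> \<langle>v \<cdot> ?b, ?b\<rangle>\<rangle>" using L(6)[of ?b] ar by simp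
    also have "\<dots> = m \<cdot> \<langle>m \<cdot> \<langle>?a, v \<cdot> ?b\<rangle>, ?b\<rangle>" by (rule L(1)[symmetric]) (use ar in simp_all)
    also have "\<dots> = ?b" unfolding s0 by (rule L(4)) (use ar in simp_all)
    finally have ab: "?a = ?b" .
    have "?d \<cdot> ?a = h" by (rule pair_eqI[of X X]) (use ab h(1) h2 A in simp_all)
    then show "\<exists>t. t \<in> Ar C \<and> Dom C t = Dom C h \<and> Cod C t = Dom C ?d \<and> ?d \<cdot> t = h"
      using ar A by (intro exI[where x = ?a]) simp
  qed (use A in simp_all)
  have s1: "?s \<cdot> in1 X X = Idt C X" using abgroup_in(1)[OF ab] A by simp
  have s2: "?s \<cdot> in2 X X = v"
  proof -
    have "m \<cdot> \<langle>zero X X, v\<rangle> = v" by (rule L(4)) (use A in simp_all)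
    then show ?thesis using A by simp
  qed
  have re: "regular_epi C ?s" by (rule split_regular_epi[of _ "in1 X X"]) (use s1 A in simp_all)
  \<comment> \<open>Subtraction is equivariant for some action \<open>\<omega>\<close> on
    \<open>X\<close>. On the first axis subtraction is the identity, which forces
    \<open>\<omega> = \<phi>\<close>; on the second it is \<open>v\<close>, which gives the
    claim.\<close>
  obtain \<omega> where \<omega>: "is_action C G (Cod C ?s) \<omega>" "?s \<cdot> pact G X X \<phi> \<phi> = \<omega> \<cdot> fl (Idt C G) ?s"
    by (rule quotient_action[OF act pact_action[OF act act] _ _ _ re k])
      (use A F(1-5) pact_pair[OF act act, of "Idt C G" "Idt C X" "Idt C X"] in simp_all)
  have \<omega>1: "is_action C G X \<omega>" using \<omega>(1) A by simp
  note W = is_action_ar[OF \<omega>1]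
  have "?s \<cdot> (pact G X X \<phi> \<phi> \<cdot> fl (Idt C G) (in1 X X)) = \<omega> \<cdot> fl (Idt C G) (?s \<cdot> in1 X X)"
    "?s \<cdot> (pact G X X \<phi> \<phi> \<cdot> fl (Idt C G) (in2 X X)) = \<omega> \<cdot> fl (Idt C G) (?s \<cdot> in2 X X)"
    using \<omega>(2)[THEN rw] A F(1-5) W(1-5) act by simp_all
  moreover have "pact G X X \<phi> \<phi> \<cdot> fl (Idt C G) (in1 X X) = in1 X X \<cdot> \<phi>"
    "pact G X X \<phi> \<phi> \<cdot> fl (Idt C G) (in2 X X) = in2 X X \<cdot> \<phi>"
    using A F(1-5) by (simp_all add: pact_pair[OF act act])
  ultimately have "?s \<cdot> (in1 X X \<cdot> \<phi>) = \<omega> \<cdot> fl (Idt C G) (Idt C X)" "?s \<cdot> (in2 X X \<cdot> \<phi>) = \<omega> \<cdot> fl (Idt C G) v"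
    unfolding s1 s2 by simp_all
  moreover have "?s \<cdot> (in1 X X \<cdot> \<phi>) = (?s \<cdot> in1 X X) \<cdot> \<phi>" "?s \<cdot> (in2 X X \<cdot> \<phi>) = (?s \<cdot> in2 X X) \<cdot> \<phi>"
    using A F(1-5) by simp_all
  ultimately show ?thesis unfolding s1 s2 using F W A by simp
qed


section \<open>Central kernels\<close>

text \<open>A cooperator of \<open>j\<close> with the identity, to be read as
  \<open>(x, b) |-> x + j b\<close>. Its existence says that \<open>j\<close> is central.\<close>

definition coop :: "'o \<Rightarrow> 'o \<Rightarrow> 'a \<Rightarrow> 'a \<Rightarrow> bool" where
  "coop X B j \<rho> \<longleftrightarrow> j \<in> Ar C \<and> Dom C j = B \<and> Cod C j = X \<and> \<rho> \<in> Ar C \<and> Dom C \<rho> = prd X B \<and> Cod C \<rho> = X \<and>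
     \<rho> \<cdot> in1 X B = Idt C X \<and> \<rho> \<cdot> in2 X B = j"

lemma coop_ar:
  assumes "coop X B j \<rho>"
  shows "j \<in> Ar C" "Dom C j = B" "Cod C j = X" "\<rho> \<in> Ar C" "Dom C \<rho> = prd X B" "Cod C \<rho> = X"
    "\<rho> \<cdot> in1 X B = Idt C X" "\<rho> \<cdot> in2 X B = j" "X \<in> Ob C" "B \<in> Ob C"
  using assms by (auto simp: coop_def)

lemma coop_in:
  assumes "coop X B j \<rho>" "x \<in> Ar C" "T = Dom C x"
  shows "Cod C x = X \<Longrightarrow> \<rho> \<cdot> \<langle>x, zero T B\<rangle> = x" "Cod C x = B \<Longrightarrow> \<rho> \<cdot> \<langle>zero T X, x\<rangle> = j \<cdot> x"
proof -
  note R = coop_ar[OF assms(1)]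
  show "\<rho> \<cdot> \<langle>x, zero T B\<rangle> = x" if "Cod C x = X"
  proof -
    have "(\<rho> \<cdot> in1 X B) \<cdot> x = \<rho> \<cdot> \<langle>x, zero T B\<rangle>" using R(1-6,9,10) assms(2,3) that by simp
    then show ?thesis unfolding R(7) using assms(2) that by simp
  qed
  show "\<rho> \<cdot> \<langle>zero T X, x\<rangle> = j \<cdot> x" if "Cod C x = B"
  proof -
    have "(\<rho> \<cdot> in2 X B) \<cdot> x = \<rho> \<cdot> \<langle>zero T X, x\<rangle>" using R(1-6,9,10) assms(2,3) that by simp
    then show ?thesis unfolding R(8) by simp
  qed
qed

lemma abgroup_coop:
  assumes "abgroup X m v" "j \<in> Ar C" "Cod C j = X" "Dom C j = B"
  shows "coop X B j (m \<cdot> \<langle>pr1 X B, j \<cdot> pr2 X B\<rangle>)"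
proof -
  note A = abgroup_ar[OF assms(1)]
  have B: "B \<in> Ob C" using assms by auto
  have "m \<cdot> \<langle>zero B X, j\<rangle> = j" by (rule abgroup_laws(4)[OF assms(1)]) (use assms in simp_all)
  then show ?thesis unfolding coop_def using A assms(2-) B abgroup_in(1)[OF assms(1)] by simp
qed

text \<open>Both sides restrict to \<open>j\<close> on each axis of
  \<open>B \<times> B\<close>.\<close>

lemma coop_add:
  assumes co: "coop X B j \<rho>" and ab: "abgroup B m v"
    and x: "x \<in> Ar C" "y \<in> Ar C" "Dom C y = Dom C x" "Cod C x = B" "Cod C y = B"
  shows "\<rho> \<cdot> \<langle>j \<cdot> x, y\<rangle> = j \<cdot> (m \<cdot> \<langle>x, y\<rangle>)"
proof -
  note R = coop_ar[OF co] and A = abgroup_ar[OF ab] and I = abgroup_in[OF ab]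
  have 1: "\<rho> \<cdot> \<langle>j, zero B B\<rangle> = j" "\<rho> \<cdot> \<langle>zero B X, Idt C B\<rangle> = j"
    using coop_in[OF co, of j B] R by simp_all
  have "\<rho> \<cdot> \<langle>j \<cdot> pr1 B B, pr2 B B\<rangle> = j \<cdot> m"
    by (rule prd_epic[of _ B B]) (use R(1-6,9,10) A I 1 in simp_all)
  then have "(\<rho> \<cdot> \<langle>j \<cdot> pr1 B B, pr2 B B\<rangle>) \<cdot> \<langle>x, y\<rangle> = (j \<cdot> m) \<cdot> \<langle>x, y\<rangle>" by simp
  then show ?thesis using R(1-6,9,10) A x by simp
qed

text \<open>Tested on the axes of \<open>X \<times> (B \<times> B)\<close>: both sides are the
  identity on \<open>X\<close>, and on \<open>B \<times> B\<close> the equation is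
  \<open>coop_add\<close>.\<close>

lemma coop_assoc:
  assumes co: "coop X B j \<rho>" and ab: "abgroup B m v"
    and x: "x \<in> Ar C" "y \<in> Ar C" "z \<in> Ar C" "Dom C y = Dom C x" "Dom C z = Dom C x" "Cod C x = X" "Cod C y = B" "Cod C z = B"
  shows "\<rho> \<cdot> \<langle>\<rho> \<cdot> \<langle>x, y\<rangle>, z\<rangle> = \<rho> \<cdot> \<langle>x, m \<cdot> \<langle>y, z\<rangle>\<rangle>"
proof -
  note R = coop_ar[OF co] and A = abgroup_ar[OF ab]
  note ar = R(1-6,9,10) A
  let ?P = "prd B B"
  let ?x = "pr1 X ?P" and ?y = "pr1 B B \<cdot> pr2 X ?P" and ?z = "pr2 B B \<cdot> pr2 X ?P"
  have 1: "\<rho> \<cdot> \<langle>zero ?P X, pr1 B B\<rangle> = j \<cdot> pr1 B B" "\<rho> \<cdot> \<langle>zero ?P X, m\<rangle> = j \<cdot> m"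
    "\<rho> \<cdot> \<langle>j \<cdot> pr1 B B, pr2 B B\<rangle> = j \<cdot> m"
    using coop_in(2)[OF co, of "pr1 B B" ?P] coop_in(2)[OF co, of m ?P] coop_add[OF co ab, of "pr1 B B" "pr2 B B"] ar
    by simp_all
  have "\<rho> \<cdot> \<langle>\<rho> \<cdot> \<langle>?x, ?y\<rangle>, ?z\<rangle> = \<rho> \<cdot> \<langle>?x, m \<cdot> \<langle>?y, ?z\<rangle>\<rangle>"
    by (rule prd_epic[of _ X ?P]) (use ar 1 R(7) in simp_all)
  then have "(\<rho> \<cdot> \<langle>\<rho> \<cdot> \<langle>?x, ?y\<rangle>, ?z\<rangle>) \<cdot> \<langle>x, \<langle>y, z\<rangle>\<rangle> = (\<rho> \<cdot> \<langle>?x, m \<cdot> \<langle>?y, ?z\<rangle>\<rangle>) \<cdot> \<langle>x, \<langle>y, z\<rangle>\<rangle>" by simp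
  then show ?thesis using ar x by simp
qed

text \<open>Both sides restrict to \<open>u\<close> on each axis of \<open>B \<times> B\<close>, so
  arrows between abelian objects are automatically additive.\<close>

lemma abgroup_hom:
  assumes ab: "abgroup B m v" and ab': "abgroup B' m' v'" and u: "u \<in> Ar C" "Dom C u = B" "Cod C u = B'"
    and x: "x \<in> Ar C" "y \<in> Ar C" "Dom C y = Dom C x" "Cod C x = B" "Cod C y = B"
  shows "m' \<cdot> \<langle>u \<cdot> x, u \<cdot> y\<rangle> = u \<cdot> (m \<cdot> \<langle>x, y\<rangle>)"
proof -
  note A = abgroup_ar[OF ab] and A' = abgroup_ar[OF ab']
  have 1: "m' \<cdot> \<langle>u, zero B B'\<rangle> = u" "m' \<cdot> \<langle>zero B B', u\<rangle> = u"
    by (rule abgroup_laws(3,4)[OF ab']; use u in simp)+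
  have "m' \<cdot> \<langle>u \<cdot> pr1 B B, u \<cdot> pr2 B B\<rangle> = u \<cdot> m"
    by (rule prd_epic[of _ B B]) (use A A' u 1 abgroup_in[OF ab] in simp_all)
  then have "(m' \<cdot> \<langle>u \<cdot> pr1 B B, u \<cdot> pr2 B B\<rangle>) \<cdot> \<langle>x, y\<rangle> = (u \<cdot> m) \<cdot> \<langle>x, y\<rangle>" by simp
  then show ?thesis using A A' u x by simp
qed

text \<open>The kernel of the cooperator is equivariant, so the cooperator is equivariant for some action on
  its codomain; restricting to the first factor identifies that action.\<close>

lemma coop_equivariant:
  assumes co: "coop X B j \<rho>" and ab: "abgroup B m v" and x: "is_action C G X \<xi>" and b: "is_action C G B \<beta>"
    and j: "j \<cdot> \<beta> = \<xi> \<cdot> fl (Idt C G) j"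
  shows "\<rho> \<cdot> pact G X B \<xi> \<beta> = \<xi> \<cdot> fl (Idt C G) \<rho>"
proof -
  note R = coop_ar[OF co] and A = abgroup_ar[OF ab] and L = abgroup_laws[OF ab]
    and X = is_action_ar[OF x] and B = is_action_ar[OF b]
  note ar = R(1-6,9,10) A X(1-5) B(2-5)
  \<comment> \<open>The solutions of \<open>x + j b = 0\<close> are the pairs
    \<open>(j (-b), b)\<close>; equivariance of this kernel is where the equivariance of negation is
    used.\<close>
  let ?k = "\<langle>j \<cdot> v, Idt C B\<rangle>"
  have jv: "(j \<cdot> v) \<cdot> \<beta> = \<xi> \<cdot> fl (Idt C G) (j \<cdot> v)"
    using ar negation_equivariant[OF ab b] by (simp add: j[THEN rw])
  have k: "is_kernel C ?k \<rho>"
  proof (rule kernelI)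
    show "monic ?k" by (rule split_monic[of _ "pr2 X B"]) (use ar in simp_all)
    show "\<rho> \<cdot> ?k = zero (Dom C ?k) (Cod C \<rho>)"
      using coop_add[OF co ab, of v "Idt C B"] L(6)[of "Idt C B"] ar by simp
    fix h assume h: "h \<in> Ar C" "Cod C h = Dom C \<rho>" "\<rho> \<cdot> h = zero (Dom C h) (Cod C \<rho>)"
    let ?x = "pr1 X B \<cdot> h" and ?b = "pr2 X B \<cdot> h"
    have h2: "Cod C h = prd X B" using h ar by simp
    have xb: "?x \<in> Ar C" "?b \<in> Ar C" "v \<cdot> ?b \<in> Ar C" "Dom C ?x = Dom C h" "Dom C ?b = Dom C h" "Dom C (v \<cdot> ?b) = Dom C h"
      "Cod C ?x = X" "Cod C ?b = B" "Cod C (v \<cdot> ?b) = B" using h(1) h2 ar by simp_all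
    have 0: "\<rho> \<cdot> \<langle>?x, ?b\<rangle> = zero (Dom C h) X" using h(1,3) h2 ar by simp
    have "?x = \<rho> \<cdot> \<langle>?x, zero (Dom C h) B\<rangle>" by (rule coop_in(1)[OF co, symmetric]) (use xb in simp_all)
    also have "\<dots> = \<rho> \<cdot> \<langle>?x, m \<cdot> \<langle>?b, v \<cdot> ?b\<rangle>\<rangle>" using L(5)[of ?b] xb by simp
    also have "\<dots> = \<rho> \<cdot> \<langle>\<rho> \<cdot> \<langle>?x, ?b\<rangle>, v \<cdot> ?b\<rangle>" by (rule coop_assoc[OF co ab, symmetric]) (use xb in simp_all)
    also have "\<dots> = j \<cdot> (v \<cdot> ?b)" unfolding 0 by (rule coop_in(2)[OF co]) (use xb in simp_all)
    finally have xb': "?x = j \<cdot> (v \<cdot> ?b)" .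
    have "?k \<cdot> ?b = h" by (rule pair_eqI[of X B]) (use xb' h(1) h2 ar in simp_all)
    then show "\<exists>t. t \<in> Ar C \<and> Dom C t = Dom C h \<and> Cod C t = Dom C ?k \<and> ?k \<cdot> t = h"
      using xb ar by (intro exI[where x = ?b]) simp
  qed (use ar in simp_all)
  have re: "regular_epi C \<rho>" by (rule split_regular_epi[of _ "in1 X B"]) (use R(7) ar in simp_all)
  have kb: "?k \<cdot> \<beta> = pact G X B \<xi> \<beta> \<cdot> fl (Idt C G) ?k"
    using jv ar pact_pair[OF x b, of "Idt C G" "j \<cdot> v" "Idt C B"] by simp
  obtain \<omega> where \<omega>: "is_action C G (Cod C \<rho>) \<omega>" "\<rho> \<cdot> pact G X B \<xi> \<beta> = \<omega> \<cdot> fl (Idt C G) \<rho>"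
    by (rule quotient_action[OF b pact_action[OF x b] _ _ kb re k]) (use ar in simp_all)
  have \<omega>1: "is_action C G X \<omega>" using \<omega>(1) ar by simp
  note W = is_action_ar[OF \<omega>1]
  have e1: "\<rho> \<cdot> (pact G X B \<xi> \<beta> \<cdot> fl (Idt C G) (in1 X B)) = \<omega> \<cdot> fl (Idt C G) (\<rho> \<cdot> in1 X B)"
    using \<omega>(2)[THEN rw] ar W(1-5) x b by simp
  have e2: "pact G X B \<xi> \<beta> \<cdot> fl (Idt C G) (in1 X B) = in1 X B \<cdot> \<xi>"
    using ar by (simp add: pact_pair[OF x b])
  have "(\<rho> \<cdot> in1 X B) \<cdot> \<xi> = \<rho> \<cdot> (in1 X B \<cdot> \<xi>)" using ar by (simp del: pair_comp)
  then have "Idt C X \<cdot> \<xi> = \<omega> \<cdot> fl (Idt C G) (Idt C X)" using e1 unfolding e2 R(7) by simp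
  then have "\<omega> = \<xi>" using ar W(1-5) by simp
  then show ?thesis using \<omega>(2) by simp
qed

text \<open>By the Peiffer identity the conjugation action restricted to the kernel of a crossed module is
  trivial.\<close>

lemma crossed_module_kernel_coop:
  assumes cm: "crossed_module C d \<xi>" and k: "k \<in> Ar C" "Cod C k = Dom C d" "d \<cdot> k = zero (Dom C k) (Cod C d)"
  obtains \<rho> where "coop (Dom C d) (Dom C k) k \<rho>"
proof -
  have d: "d \<in> Ar C" and act: "is_action C (Cod C d) (Dom C d) \<xi>"
    and pf: "\<xi> \<cdot> fl d (Idt C (Dom C d)) = conjugation C (Dom C d)"
    using cm by (simp_all add: crossed_module_def)
  note A = is_action_ar[OF act]
  let ?X = "Dom C d" and ?K = "Dom C k"
  have ob: "?K \<in> Ob C" using k by simp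
  note ar = d A(1-5) k ob
  \<comment> \<open>The product is viewed as a semidirect product of \<open>K\<close> acting on
    \<open>X\<close> by \<open>\<tau>\<close>, the trivial action. The pair \<open>k\<close>,
    \<open>1\<close> descends to it once conjugation of \<open>X\<close> by \<open>K\<close> is
    trivial too, and \<open>d \<cdot> k = 0\<close> gives this through the Peiffer identity.\<close>
  obtain \<tau> where S: "semidirect (in2 ?K ?X) (pr1 ?K ?X) (in1 ?K ?X) \<tau>"
    by (rule split_ses_action[OF prd_split_ses[of ?K ?X]]) (use ar in simp_all)
  note T = semidirect_ar[OF S]
  have T': "\<tau> \<in> Ar C" "Dom C \<tau> = flat_ob C ?K ?X" "Cod C \<tau> = ?X" "in2 ?K ?X \<cdot> \<tau> = cop (in1 ?K ?X) (in2 ?K ?X) \<cdot> fk ?K ?X"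
    using T(11,13-15) ar by simp_all
  have "pr2 ?K ?X \<cdot> (in2 ?K ?X \<cdot> \<tau>) = pr2 ?K ?X \<cdot> (cop (in1 ?K ?X) (in2 ?K ?X) \<cdot> fk ?K ?X)" by (simp only: T'(4))
  then have t: "\<tau> = cop (zero ?K ?X) (Idt C ?X) \<cdot> fk ?K ?X" using T'(1-3) ar by simp
  have "cop k (Idt C ?X) \<cdot> fk ?K ?X = conjugation C ?X \<cdot> fl k (Idt C ?X)"
    using ar by (simp add: conjugation_def)
  also have "\<dots> = \<xi> \<cdot> fl (zero ?K (Cod C d)) (Idt C ?X)" using ar by (simp add: pf[symmetric])
  also have "\<dots> = \<tau>" unfolding t using action_zero_base[OF act ob, of "Idt C ?X"] ar by simp
  finally have e: "cop k (Idt C ?X) \<cdot> fk ?K ?X = \<tau>" .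
  obtain h where h: "h \<in> Ar C" "Dom C h = Dom C (pr1 ?K ?X)" "Cod C h = Cod C k" "h \<cdot> in1 ?K ?X = k" "h \<cdot> in2 ?K ?X = Idt C ?X"
    by (rule semidirect_desc[OF S, of k "Idt C ?X"]) (use ar e T' in simp_all)
  have h2: "Dom C h = prd ?K ?X" using h ar by simp
  \<comment> \<open>The factors are swapped, since \<open>coop\<close> takes \<open>X\<close> as the
    first one.\<close>
  have "coop ?X ?K k (h \<cdot> \<langle>pr2 ?X ?K, pr1 ?X ?K\<rangle>)"
    unfolding coop_def using h(1,3-5) h2 ar by simp
  then show ?thesis by (rule that)
qed

section \<open>Pushing forward\<close>

text \<open>\<open>1 \<flat> q\<close> is epic, so equivariance of \<open>w\<close> may be tested on
  the domain of \<open>q\<close>. The arrow \<open>g\<close> allows the acting object to change, as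
  happens for morphisms of extensions with \<open>n = 2\<close>.\<close>

lemma quotient_equivariant:
  assumes q: "regular_epi C q" and G: "G \<in> Ob C" and w: "w \<in> Ar C" "Dom C w = Cod C q"
    and \<upsilon>: "\<upsilon> \<in> Ar C" "Dom C \<upsilon> = flat_ob C G (Dom C q)" "Cod C \<upsilon> = Dom C q"
    and \<omega>: "\<omega> \<in> Ar C" "Dom C \<omega> = flat_ob C G (Cod C q)" "Cod C \<omega> = Cod C q"
    and g: "g \<in> Ar C" "Dom C g = G" and \<tau>: "\<tau> \<in> Ar C" "Dom C \<tau> = flat_ob C (Cod C g) (Cod C w)" "Cod C \<tau> = Cod C w"
    and qv: "q \<cdot> \<upsilon> = \<omega> \<cdot> fl (Idt C G) q" and wq: "(w \<cdot> q) \<cdot> \<upsilon> = \<tau> \<cdot> fl g (w \<cdot> q)"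
  shows "w \<cdot> \<omega> = \<tau> \<cdot> fl g w"
proof -
  note qa = regular_epi_ar[OF q]
  have "(w \<cdot> \<omega>) \<cdot> fl (Idt C G) q = w \<cdot> (q \<cdot> \<upsilon>)" using qa G w \<omega> by (simp add: qv)
  also have "\<dots> = (w \<cdot> q) \<cdot> \<upsilon>" using qa w \<upsilon> by simp
  also have "\<dots> = \<tau> \<cdot> fl g (w \<cdot> q)" by (rule wq)
  also have "\<dots> = (\<tau> \<cdot> fl g w) \<cdot> fl (Idt C G) q" using qa G w g \<tau> by simp
  finally show ?thesis
    by (rule epicD[OF regular_epi_epic[OF regular_epi_flat_right[OF q G]]]) (use qa G w \<omega> g \<tau> in simp_all)
qed

section \<open>The pushforward of a central equivariant monomorphism \<open>j\<close> along
  \<open>\<beta>\<close>\<close>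

context
  fixes G X B B' :: 'o and \<xi> b \<phi> j \<beta> \<rho> m v :: 'a
  assumes x: "is_action C G X \<xi>" and b: "is_action C G B b" and \<phi>: "is_action C G B' \<phi>"
    and ab: "abgroup B' m v" and jm: "monic j" and co: "coop X B j \<rho>"
    and jb: "j \<cdot> b = \<xi> \<cdot> fl (Idt C G) j"
    and \<beta>: "\<beta> \<in> Ar C" "Dom C \<beta> = B" "Cod C \<beta> = B'" "\<beta> \<cdot> b = \<phi> \<cdot> fl (Idt C G) \<beta>"
begin

text \<open>The last clause says that \<open>q\<close> identifies
  \<open>(x + j s, w - \<beta> s)\<close> with \<open>(x, w)\<close>. It is recorded because it
  moves elements explicitly between \<open>X\<close> and \<open>B'\<close>.\<close>

definition is_push :: "'a \<Rightarrow> 'a \<Rightarrow> bool" where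
  "is_push q \<omega> \<longleftrightarrow> regular_epi C q \<and> Dom C q = prd X B' \<and> is_kernel C \<langle>j, v \<cdot> \<beta>\<rangle> q \<and>
     is_action C G (Cod C q) \<omega> \<and> q \<cdot> pact G X B' \<xi> \<phi> = \<omega> \<cdot> fl (Idt C G) q \<and>
     (\<forall>x\<in>Ar C. \<forall>w\<in>Ar C. \<forall>s\<in>Ar C. Dom C w = Dom C x \<longrightarrow> Dom C s = Dom C x \<longrightarrow> Cod C x = X \<longrightarrow> Cod C w = B' \<longrightarrow>
        Cod C s = B \<longrightarrow> q \<cdot> \<langle>\<rho> \<cdot> \<langle>x, s\<rangle>, m \<cdot> \<langle>w, v \<cdot> (\<beta> \<cdot> s)\<rangle>\<rangle> = q \<cdot> \<langle>x, w\<rangle>)"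

lemmas push_ar = coop_ar(1-6,9,10)[OF co] abgroup_ar[OF ab] is_action_ar(1-5)[OF x] is_action_ar(2-5)[OF b]
  is_action_ar(2-5)[OF \<phi>] \<beta>(1-3)

lemma push_exists: obtains q \<omega> where "is_push q \<omega>"
proof -
  note ar = push_ar and L = abgroup_laws[OF ab] and R = coop_ar[OF co]
  let ?Y = "prd X B'" and ?k = "\<langle>j, v \<cdot> \<beta>\<rangle>"
  \<comment> \<open>The cooperator of \<open>(j, -\<beta>)\<close> with the identity of
    \<open>X \<times> B'\<close>, sending \<open>((x, w), s)\<close> to
    \<open>(x + j s, w - \<beta> s)\<close>.\<close>
  let ?r = "\<langle>\<rho> \<cdot> \<langle>pr1 X B' \<cdot> pr1 ?Y B, pr2 ?Y B\<rangle>, m \<cdot> \<langle>pr2 X B' \<cdot> pr1 ?Y B, v \<cdot> \<beta> \<cdot> pr2 ?Y B\<rangle>\<rangle>"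
  have km: "monic ?k" by (rule monic_cancel[of "pr1 X B'"]) (use jm ar in simp_all)
  have 1: "\<rho> \<cdot> \<langle>pr1 X B', zero ?Y B\<rangle> = pr1 X B'" by (rule coop_in(1)[OF co]) (use ar in simp_all)
  have 2: "m \<cdot> \<langle>pr2 X B', zero ?Y B'\<rangle> = pr2 X B'" by (rule L(3)) (use ar in simp_all)
  have 3: "m \<cdot> \<langle>zero B B', v \<cdot> \<beta>\<rangle> = v \<cdot> \<beta>" by (rule L(4)) (use ar in simp_all)
  obtain q where q: "regular_epi C q" "is_kernel C ?k q" "q \<cdot> pr1 ?Y B = q \<cdot> ?r"
    by (rule central_monic_normal[OF km, of B ?Y ?r]) (use ar R(8) 1 2 3 in simp_all)
  have Q: "q \<in> Ar C" "Dom C q = ?Y" using kernel_ar[OF q(2)] ar by simp_all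
  have vb: "(v \<cdot> \<beta>) \<cdot> b = \<phi> \<cdot> fl (Idt C G) (v \<cdot> \<beta>)"
    using ar by (simp add: \<beta>(4) negation_equivariant[OF ab \<phi>, THEN rw])
  have kb: "?k \<cdot> b = pact G X B' \<xi> \<phi> \<cdot> fl (Idt C G) ?k"
    using ar vb jb pact_pair[OF x \<phi>, of "Idt C G" j "v \<cdot> \<beta>"] by simp
  obtain \<omega> where \<omega>: "is_action C G (Cod C q) \<omega>" "q \<cdot> pact G X B' \<xi> \<phi> = \<omega> \<cdot> fl (Idt C G) q"
    by (rule quotient_action[OF b pact_action[OF x \<phi>] _ _ kb q(1,2)]) (use ar in simp_all)
  have "q \<cdot> \<langle>\<rho> \<cdot> \<langle>y, s\<rangle>, m \<cdot> \<langle>w, v \<cdot> (\<beta> \<cdot> s)\<rangle>\<rangle> = q \<cdot> \<langle>y, w\<rangle>"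
    if "y \<in> Ar C" "w \<in> Ar C" "s \<in> Ar C" "Dom C w = Dom C y" "Dom C s = Dom C y" "Cod C y = X" "Cod C w = B'" "Cod C s = B"
    for y w s
  proof -
    have "(q \<cdot> pr1 ?Y B) \<cdot> \<langle>\<langle>y, w\<rangle>, s\<rangle> = (q \<cdot> ?r) \<cdot> \<langle>\<langle>y, w\<rangle>, s\<rangle>" by (simp only: q(3))
    then show ?thesis using that ar Q by simp
  qed
  then have "is_push q \<omega>" unfolding is_push_def using q Q \<omega> by blast
  then show ?thesis by (rule that)
qed

context
  fixes q \<omega>
  assumes push: "is_push q \<omega>"
begin

lemma push_facts:
  "regular_epi C q" "Dom C q = prd X B'" "is_kernel C \<langle>j, v \<cdot> \<beta>\<rangle> q" "is_action C G (Cod C q) \<omega>"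
  "q \<cdot> pact G X B' \<xi> \<phi> = \<omega> \<cdot> fl (Idt C G) q" "q \<in> Ar C"
  "\<omega> \<in> Ar C" "Dom C \<omega> = flat_ob C G (Cod C q)" "Cod C \<omega> = Cod C q" "Cod C q \<in> Ob C"
  using push is_action_ar[of G "Cod C q" \<omega>] regular_epi_ar[of q] unfolding is_push_def by auto

lemma push_relation:
  assumes "y \<in> Ar C" "w \<in> Ar C" "s \<in> Ar C" "Dom C w = Dom C y" "Dom C s = Dom C y" "Cod C y = X" "Cod C w = B'"
    "Cod C s = B"
  shows "q \<cdot> \<langle>\<rho> \<cdot> \<langle>y, s\<rangle>, m \<cdot> \<langle>w, v \<cdot> (\<beta> \<cdot> s)\<rangle>\<rangle> = q \<cdot> \<langle>y, w\<rangle>"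
  using push assms unfolding is_push_def by blast

lemma push_square: "(q \<cdot> in1 X B') \<cdot> j = (q \<cdot> in2 X B') \<cdot> \<beta>"
proof -
  note ar = push_ar and L = abgroup_laws[OF ab] and R = coop_ar[OF co] and Q = push_facts
  \<comment> \<open>The relation at \<open>x = 0\<close>, \<open>w = \<beta>\<close> and
    \<open>s = 1\<close> compares \<open>(j, 0)\<close> with \<open>(0, \<beta>)\<close>.\<close>
  have "q \<cdot> \<langle>\<rho> \<cdot> \<langle>zero B X, Idt C B\<rangle>, m \<cdot> \<langle>\<beta>, v \<cdot> (\<beta> \<cdot> Idt C B)\<rangle>\<rangle> = q \<cdot> \<langle>zero B X, \<beta>\<rangle>"
    by (rule push_relation) (use ar in simp_all)
  then show ?thesis using ar Q(2,6) R(8) L(5)[of \<beta>] by simp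
qed

lemma push_desc:
  assumes "w0 \<in> Ar C" "Dom C w0 = prd X B'" "w0 \<cdot> \<langle>j, v \<cdot> \<beta>\<rangle> = zero B (Cod C w0)"
  obtains w where "w \<in> Ar C" "Dom C w = Cod C q" "Cod C w = Cod C w0" "w \<cdot> q = w0"
  by (rule regular_epi_cokernel[OF push_facts(1,3), of w0]) (use assms push_facts push_ar in simp_all)

text \<open>\<open>q\<close> is epic and the axes of \<open>X \<times> B'\<close> are jointly
  epic.\<close>

lemma push_epic:
  assumes "w \<in> Ar C" "w' \<in> Ar C" "Dom C w = Cod C q" "Dom C w' = Cod C q" "Cod C w = Cod C w'"
    "w \<cdot> (q \<cdot> in1 X B') = w' \<cdot> (q \<cdot> in1 X B')" "w \<cdot> (q \<cdot> in2 X B') = w' \<cdot> (q \<cdot> in2 X B')"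
  shows "w = w'"
proof -
  note ar = push_ar and Q = push_facts
  have "w \<cdot> q = w' \<cdot> q"
    by (rule prd_epic[of _ X B']) (use assms ar Q in simp_all)
  then show ?thesis by (rule epicD[OF regular_epi_epic[OF Q(1)]]) (use assms Q in simp_all)
qed

lemma push_equivariant:
  "(q \<cdot> in1 X B') \<cdot> \<xi> = \<omega> \<cdot> fl (Idt C G) (q \<cdot> in1 X B')"
  "(q \<cdot> in2 X B') \<cdot> \<phi> = \<omega> \<cdot> fl (Idt C G) (q \<cdot> in2 X B')"
proof -
  note ar = push_ar and Q = push_facts
  have 1: "pact G X B' \<xi> \<phi> \<cdot> fl (Idt C G) (in1 X B') = in1 X B' \<cdot> \<xi>"
    "pact G X B' \<xi> \<phi> \<cdot> fl (Idt C G) (in2 X B') = in2 X B' \<cdot> \<phi>"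
    using ar by (simp_all add: pact_pair[OF x \<phi>])
  have "q \<cdot> (pact G X B' \<xi> \<phi> \<cdot> fl (Idt C G) (in1 X B')) = \<omega> \<cdot> fl (Idt C G) (q \<cdot> in1 X B')"
    "q \<cdot> (pact G X B' \<xi> \<phi> \<cdot> fl (Idt C G) (in2 X B')) = \<omega> \<cdot> fl (Idt C G) (q \<cdot> in2 X B')"
    using Q(5)[THEN rw] ar Q(2,6-10) x \<phi> by simp_all
  then show "(q \<cdot> in1 X B') \<cdot> \<xi> = \<omega> \<cdot> fl (Idt C G) (q \<cdot> in1 X B')"
    "(q \<cdot> in2 X B') \<cdot> \<phi> = \<omega> \<cdot> fl (Idt C G) (q \<cdot> in2 X B')"
    unfolding 1 using ar Q(2,6) by (simp_all del: pair_comp)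
qed

text \<open>If \<open>d'\<close> kills the class of \<open>(x, w)\<close> then
  \<open>d x = 0\<close>, so \<open>x = j s\<close>, and the relation moves the pair to
  \<open>(0, w + \<beta> s)\<close>, which comes from \<open>B'\<close>. The new arrow is monic
  because a pair \<open>(0, y)\<close> killed by \<open>q\<close> is of the form
  \<open>(j t, -\<beta> t)\<close>, and \<open>j\<close> is monic.\<close>

lemma push_kernel:
  assumes d: "is_kernel C j d" and d': "d' \<in> Ar C" "Dom C d' = Cod C q" "Cod C d' = Cod C d" "d' \<cdot> q = d \<cdot> pr1 X B'"
  shows "is_kernel C (q \<cdot> in2 X B') d'"
proof -
  note ar = push_ar and L = abgroup_laws[OF ab] and Q = push_facts
  note D = kernel_ar[OF d]
  have D': "Dom C d = X" using D ar by simp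
  let ?j = "q \<cdot> in2 X B'"
  have jm': "monic ?j"
  proof (rule monic_if_trivial_kernel)
    fix y assume y: "y \<in> Ar C" "Cod C y = Dom C ?j" "?j \<cdot> y = zero (Dom C y) (Cod C ?j)"
    have y2: "Cod C y = B'" using y ar Q by simp
    have "q \<cdot> \<langle>zero (Dom C y) X, y\<rangle> = zero (Dom C y) (Cod C q)" using y(1,3) y2 ar Q(2,6) by simp
    then obtain t where t: "t \<in> Ar C" "Dom C t = Dom C \<langle>zero (Dom C y) X, y\<rangle>" "Cod C t = Dom C \<langle>j, v \<cdot> \<beta>\<rangle>"
      "\<langle>j, v \<cdot> \<beta>\<rangle> \<cdot> t = \<langle>zero (Dom C y) X, y\<rangle>"
      using y(1) y2 ar Q(2,6) by - (rule kernel_lift[OF Q(3), of "\<langle>zero (Dom C y) X, y\<rangle>"], simp_all)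
    have t2: "Dom C t = Dom C y" "Cod C t = B" using t(2,3) y(1) y2 ar by simp_all
    have "\<langle>j \<cdot> t, v \<cdot> \<beta> \<cdot> t\<rangle> = \<langle>zero (Dom C y) X, y\<rangle>" using t(1,4) t2 ar by simp
    note eq = pair_inject[OF this]
    have e: "j \<cdot> t = zero (Dom C y) X" "v \<cdot> \<beta> \<cdot> t = y"
      by (rule eq; use t(1) t2 y(1) y2 ar in simp)+
    have tz: "t = zero (Dom C y) B"
      by (rule monicD[OF jm]) (use e(1) t(1) t2 y(1) ar in simp_all)
    have "y = v \<cdot> \<beta> \<cdot> zero (Dom C y) B" by (rule e(2)[symmetric, unfolded tz])
    also have "\<dots> = zero (Dom C y) (Dom C ?j)" using y(1) ar Q(2,6) by simp
    finally show "y = zero (Dom C y) (Dom C ?j)" .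
  qed (use ar Q in simp_all)
  show ?thesis
  proof (rule kernelI[OF jm'])
    show "d' \<cdot> ?j = zero (Dom C ?j) (Cod C d')"
      using d'(1-3) ar Q(2,6) D D' by (simp add: d'(4)[THEN rw])
    fix h assume h: "h \<in> Ar C" "Cod C h = Dom C d'" "d' \<cdot> h = zero (Dom C h) (Cod C d')"
    obtain t y where t: "regular_epi C t" "t \<in> Ar C" "y \<in> Ar C" "Cod C t = Dom C h" "Dom C y = Dom C t"
      "Cod C y = Dom C q" "q \<cdot> y = h \<cdot> t"
      by (rule regular_epi_cover[OF Q(1), of h]) (use h d' in simp_all)
    have y2: "Cod C y = prd X B'" using t Q by simp
    have "d' \<cdot> (q \<cdot> y) = d' \<cdot> (h \<cdot> t)" by (simp only: t(7))
    then have dy: "d \<cdot> (pr1 X B' \<cdot> y) = zero (Dom C t) (Cod C d)"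
      using d'(1-3) h t(2-5) y2 ar Q(2,6) D(1,2) D' by (simp add: d'(4)[THEN rw] h(3)[THEN rw])
    obtain s where s: "s \<in> Ar C" "Dom C s = Dom C (pr1 X B' \<cdot> y)" "Cod C s = Dom C j" "j \<cdot> s = pr1 X B' \<cdot> y"
      by (rule kernel_lift[OF d, of "pr1 X B' \<cdot> y"]) (use dy t(2-5) y2 ar D' in simp_all)
    have s2: "Dom C s = Dom C t" "Cod C s = B" using s t(2-5) y2 ar by simp_all
    let ?u = "pr2 X B' \<cdot> y" and ?w = "m \<cdot> \<langle>pr2 X B' \<cdot> y, \<beta> \<cdot> s\<rangle>"
    have u: "?u \<in> Ar C" "Dom C ?u = Dom C t" "Cod C ?u = B'" "\<beta> \<cdot> s \<in> Ar C" "Dom C (\<beta> \<cdot> s) = Dom C t" "Cod C (\<beta> \<cdot> s) = B'"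
      "v \<cdot> (\<beta> \<cdot> s) \<in> Ar C" "Dom C (v \<cdot> (\<beta> \<cdot> s)) = Dom C t" "Cod C (v \<cdot> (\<beta> \<cdot> s)) = B'"
      using s(1) s2 t(2-5) y2 ar by simp_all
    have w: "?w \<in> Ar C" "Dom C ?w = Dom C t" "Cod C ?w = B'" using u ar by simp_all
    have "m \<cdot> \<langle>?w, v \<cdot> (\<beta> \<cdot> s)\<rangle> = m \<cdot> \<langle>?u, m \<cdot> \<langle>\<beta> \<cdot> s, v \<cdot> (\<beta> \<cdot> s)\<rangle>\<rangle>"
      by (rule L(1)) (use u in simp_all)
    also have "\<dots> = m \<cdot> \<langle>?u, zero (Dom C t) B'\<rangle>" using L(5)[of "\<beta> \<cdot> s"] u by simp
    also have "\<dots> = ?u" by (rule L(3)) (use u in simp_all)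
    finally have mw: "m \<cdot> \<langle>?w, v \<cdot> (\<beta> \<cdot> s)\<rangle> = ?u" .
    have rs: "\<rho> \<cdot> \<langle>zero (Dom C t) X, s\<rangle> = pr1 X B' \<cdot> y"
      using coop_in(2)[OF co s(1), of "Dom C t"] s s2 by simp
    have "q \<cdot> \<langle>\<rho> \<cdot> \<langle>zero (Dom C t) X, s\<rangle>, m \<cdot> \<langle>?w, v \<cdot> (\<beta> \<cdot> s)\<rangle>\<rangle> = q \<cdot> \<langle>zero (Dom C t) X, ?w\<rangle>"
      by (rule push_relation) (use w s(1) s2 t(2) ar in simp_all)
    then have "q \<cdot> y = q \<cdot> \<langle>zero (Dom C t) X, ?w\<rangle>" unfolding rs mw using t(3) y2 ar by simp
    then have jw: "?j \<cdot> ?w = h \<cdot> t" using w t(2,7) ar Q(2,6) by simp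
    \<comment> \<open>The preimage of \<open>h\<close> exists so far only over the cover
      \<open>t\<close>; monicity of the new arrow lets it descend.\<close>
    obtain e where "e \<in> Ar C" "Dom C e = Cod C t" "Cod C e = Dom C ?j" "e \<cdot> t = ?w" "?j \<cdot> e = h"
      by (rule regular_epi_orthogonal[OF t(1) jm' jw]) (use w t(2-4) h d' ar Q(2,6) in simp_all)
    then show "\<exists>t. t \<in> Ar C \<and> Dom C t = Dom C h \<and> Cod C t = Dom C ?j \<and> ?j \<cdot> t = h" using t(4) by auto
  qed (use d' ar Q in simp_all)
qed

text \<open>The arrow \<open>(x, w) |-> f x + j'' (u w)\<close> sends \<open>(j, -\<beta>)\<close>
  to \<open>j'' (u \<beta> - u \<beta>)\<close>, because \<open>u\<close> is additive, and so
  descends to the quotient. It is tested for equivariance on \<open>X \<times> B'\<close>.\<close>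

lemma push_universal:
  assumes x'': "is_action C G'' X'' \<xi>''" and b'': "is_action C G'' B'' b''" and ab'': "abgroup B'' m'' v''"
    and co'': "coop X'' B'' j'' \<rho>''" and jb'': "j'' \<cdot> b'' = \<xi>'' \<cdot> fl (Idt C G'') j''"
    and g: "g \<in> Ar C" "Dom C g = G" "Cod C g = G''" and f: "f \<in> Ar C" "Dom C f = X" "Cod C f = X''"
    and u: "u \<in> Ar C" "Dom C u = B'" "Cod C u = B''"
    and f\<xi>: "f \<cdot> \<xi> = \<xi>'' \<cdot> fl g f" and u\<phi>: "u \<cdot> \<phi> = b'' \<cdot> fl g u" and fj: "f \<cdot> j = j'' \<cdot> (u \<cdot> \<beta>)"
  obtains w where "w \<in> Ar C" "Dom C w = Cod C q" "Cod C w = X''" "w \<cdot> (q \<cdot> in1 X B') = f" "w \<cdot> (q \<cdot> in2 X B') = j'' \<cdot> u"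
    "w \<cdot> \<omega> = \<xi>'' \<cdot> fl g w"
proof -
  note ar = push_ar and L = abgroup_laws[OF ab] and Q = push_facts
  note A'' = is_action_ar[OF x''] is_action_ar[OF b'']
  note ar'' = coop_ar(1-6,9,10)[OF co''] abgroup_ar[OF ab''] A''(1-5) A''(8-12)
  let ?w = "\<rho>'' \<cdot> \<langle>f \<cdot> pr1 X B', u \<cdot> pr2 X B'\<rangle>"
  have "?w \<cdot> \<langle>j, v \<cdot> \<beta>\<rangle> = \<rho>'' \<cdot> \<langle>j'' \<cdot> (u \<cdot> \<beta>), u \<cdot> (v \<cdot> \<beta>)\<rangle>" using ar ar'' f u fj by simp
  also have "\<dots> = j'' \<cdot> (m'' \<cdot> \<langle>u \<cdot> \<beta>, u \<cdot> (v \<cdot> \<beta>)\<rangle>)"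
    by (rule coop_add[OF co'' ab'']) (use ar u in simp_all)
  also have "\<dots> = j'' \<cdot> (u \<cdot> (m \<cdot> \<langle>\<beta>, v \<cdot> \<beta>\<rangle>))"
    using abgroup_hom[OF ab ab'' u, of \<beta> "v \<cdot> \<beta>"] ar by simp
  also have "\<dots> = zero B X''" using L(5)[of \<beta>] ar ar'' u by simp
  finally have z: "?w \<cdot> \<langle>j, v \<cdot> \<beta>\<rangle> = zero B X''" .
  obtain w where w: "w \<in> Ar C" "Dom C w = Cod C q" "Cod C w = Cod C ?w" "w \<cdot> q = ?w"
    by (rule push_desc[of ?w]) (use z ar ar'' f u in simp_all)
  have w3: "Cod C w = X''" using w ar ar'' f u by simp
  have c: "\<rho>'' \<cdot> \<langle>f, zero X B''\<rangle> = f" "\<rho>'' \<cdot> \<langle>zero B' X'', u\<rangle> = j'' \<cdot> u"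
    using coop_in(1)[OF co'' f(1), of X] coop_in(2)[OF co'' u(1), of B'] f u by simp_all
  have "(w \<cdot> q) \<cdot> in1 X B' = f" "(w \<cdot> q) \<cdot> in2 X B' = j'' \<cdot> u"
    unfolding w(4) using c ar ar'' f u by simp_all
  then have 1: "w \<cdot> (q \<cdot> in1 X B') = f" "w \<cdot> (q \<cdot> in2 X B') = j'' \<cdot> u" using w(1-3) ar Q(2,6) by simp_all
  have "(w \<cdot> q) \<cdot> pact G X B' \<xi> \<phi> = \<rho>'' \<cdot> \<langle>(f \<cdot> \<xi>) \<cdot> fl (Idt C G) (pr1 X B'), (u \<cdot> \<phi>) \<cdot> fl (Idt C G) (pr2 X B')\<rangle>"
    unfolding w(4) using ar ar'' f u x \<phi> by (simp add: pr_pact[OF x \<phi>])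
  also have "\<dots> = \<rho>'' \<cdot> \<langle>\<xi>'' \<cdot> fl g (f \<cdot> pr1 X B'), b'' \<cdot> fl g (u \<cdot> pr2 X B')\<rangle>"
    unfolding f\<xi> u\<phi> using ar ar'' f u g by simp
  also have "\<dots> = \<rho>'' \<cdot> (pact G'' X'' B'' \<xi>'' b'' \<cdot> fl g \<langle>f \<cdot> pr1 X B', u \<cdot> pr2 X B'\<rangle>)"
    using ar ar'' f u g by (simp add: pact_pair[OF x'' b''])
  also have "\<dots> = \<xi>'' \<cdot> fl g (w \<cdot> q)"
    unfolding w(4) using ar ar'' f u g x'' b'' by (simp add: coop_equivariant[OF co'' ab'' x'' b'' jb'', THEN rw])
  finally have e: "(w \<cdot> q) \<cdot> pact G X B' \<xi> \<phi> = \<xi>'' \<cdot> fl g (w \<cdot> q)" .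
  have "w \<cdot> \<omega> = \<xi>'' \<cdot> fl g w"
    by (rule quotient_equivariant[OF Q(1) _ w(1,2) _ _ _ Q(7-9) g(1,2) _ _ _ Q(5) e])
      (use ar ar'' g w(1,2) w3 Q x \<phi> in simp_all)
  with w(1,2) w3 1 show ?thesis by (rule that)
qed

text \<open>For arrows that ignore the factor \<open>B'\<close>, such as the differential out of the
  new object: equivariance on \<open>X \<times> B'\<close> is that of \<open>f\<close> after the
  projection.\<close>

lemma push_desc_equivariant:
  assumes \<tau>: "is_action C G D \<tau>" and f: "f \<in> Ar C" "Dom C f = X" "Cod C f = D" "f \<cdot> \<xi> = \<tau> \<cdot> fl (Idt C G) f"
    and w: "w \<in> Ar C" "Dom C w = Cod C q" "Cod C w = D" "w \<cdot> q = f \<cdot> pr1 X B'"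
  shows "w \<cdot> \<omega> = \<tau> \<cdot> fl (Idt C G) w"
proof -
  note ar = push_ar and Q = push_facts and T = is_action_ar[OF \<tau>]
  have "(w \<cdot> q) \<cdot> pact G X B' \<xi> \<phi> = \<tau> \<cdot> fl (Idt C G) (w \<cdot> q)"
    unfolding w(4) using ar f(1-3) T x \<phi> by (simp add: pr_pact[OF x \<phi>] f(4)[THEN rw])
  then show ?thesis
    by - (rule quotient_equivariant[OF Q(1) _ w(1,2) _ _ _ Q(7-9) _ _ _ _ _ Q(5)],
      (use ar w T Q x \<phi> in simp_all))
qed

text \<open>On \<open>X \<times> B'\<close> the Peiffer identity is checked componentwise: both sides act trivially on \<open>B'\<close>.\<close>

lemma push_crossed_module:
  assumes cm: "crossed_module C d \<xi>" and d: "Dom C d = X" "Cod C d = G"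
    and p: "p \<in> Ar C" "Dom C p = G" "Cod C p = c" "p \<cdot> d = zero X c"
    and \<phi>': "is_action C c B' \<phi>'" "\<phi> = \<phi>' \<cdot> fl p (Idt C B')"
    and d': "d' \<in> Ar C" "Dom C d' = Cod C q" "Cod C d' = G" "d' \<cdot> q = d \<cdot> pr1 X B'"
  shows "crossed_module C d' \<omega>"
proof -
  note ar = push_ar and Q = push_facts and F' = is_action_ar[OF \<phi>'(1)]
  have da: "d \<in> Ar C" and d1: "d \<cdot> \<xi> = conjugation C G \<cdot> fl (Idt C G) d"
    and d2: "\<xi> \<cdot> fl d (Idt C X) = conjugation C X"
    using cm d by (simp_all add: crossed_module_def)
  let ?Y = "prd X B'" and ?t = "pact G X B' \<xi> \<phi>"
  have d'1: "d' \<cdot> \<omega> = conjugation C G \<cdot> fl (Idt C G) d'"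
  proof (rule quotient_equivariant[OF Q(1) _ d'(1,2) _ _ _ Q(7-9) _ _ _ _ _ Q(5)])
    have "(d' \<cdot> q) \<cdot> ?t = d \<cdot> (\<xi> \<cdot> fl (Idt C G) (pr1 X B'))"
      unfolding d'(4) using ar da d x \<phi> by (simp add: pr_pact[OF x \<phi>])
    also have "\<dots> = conjugation C G \<cdot> fl (Idt C G) (d' \<cdot> q)"
      unfolding d'(4) using ar da d by (simp add: d1[THEN rw])
    finally show "(d' \<cdot> q) \<cdot> ?t = conjugation C G \<cdot> fl (Idt C G) (d' \<cdot> q)" .
  qed (use ar d' Q x \<phi> in simp_all)
  have t: "?t \<cdot> fl (d \<cdot> pr1 X B') (Idt C ?Y) = conjugation C ?Y"
  proof (rule pair_eqI[of X B'])
    have "pr1 X B' \<cdot> (?t \<cdot> fl (d \<cdot> pr1 X B') (Idt C ?Y)) = \<xi> \<cdot> fl (d \<cdot> pr1 X B') (pr1 X B')"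
      using ar da d x \<phi> by (simp add: pr_pact[OF x \<phi>, THEN rw])
    also have "\<dots> = (\<xi> \<cdot> fl d (Idt C X)) \<cdot> fl (pr1 X B') (pr1 X B')" using ar da d by simp
    also have "\<dots> = pr1 X B' \<cdot> conjugation C ?Y"
      unfolding d2 using conjugation_natural[of "pr1 X B'"] ar by simp
    finally show "pr1 X B' \<cdot> (?t \<cdot> fl (d \<cdot> pr1 X B') (Idt C ?Y)) = pr1 X B' \<cdot> conjugation C ?Y" .
    \<comment> \<open>On \<open>B'\<close> the action is restricted along \<open>p\<close>, and
      \<open>p \<cdot> d = 0\<close>; conjugation is trivial there because \<open>B'\<close> is
      abelian.\<close>
    have "pr2 X B' \<cdot> (?t \<cdot> fl (d \<cdot> pr1 X B') (Idt C ?Y)) = \<phi> \<cdot> fl (d \<cdot> pr1 X B') (pr2 X B')"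
      using ar da d x \<phi> by (simp add: pr_pact[OF x \<phi>, THEN rw])
    also have "\<dots> = \<phi>' \<cdot> fl (zero ?Y c) (pr2 X B')"
      unfolding \<phi>'(2) using ar da d p(1-3) F' by (simp add: p(4)[THEN rw])
    also have "\<dots> = cop (zero ?Y B') (pr2 X B') \<cdot> fk ?Y ?Y"
      using action_zero_base[OF \<phi>'(1), of ?Y "pr2 X B'"] ar by simp
    also have "\<dots> = (cop (zero B' B') (Idt C B') \<cdot> fk B' B') \<cdot> fl (pr2 X B') (pr2 X B')"
      using ar by simp
    also have "\<dots> = pr2 X B' \<cdot> conjugation C ?Y"
      unfolding abgroup_conjugation[OF ab, symmetric] using conjugation_natural[of "pr2 X B'"] ar by simp
    finally show "pr2 X B' \<cdot> (?t \<cdot> fl (d \<cdot> pr1 X B') (Idt C ?Y)) = pr2 X B' \<cdot> conjugation C ?Y" .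
  qed (use ar da d x \<phi> in simp_all)
  let ?Q = "Cod C q"
  \<comment> \<open>Conjugation involves the object in both variables of \<open>\<flat>\<close>, so
    the Peiffer identity is tested after \<open>q \<flat> q\<close>.\<close>
  have "(\<omega> \<cdot> fl d' (Idt C ?Q)) \<cdot> fl q q = (\<omega> \<cdot> fl (Idt C G) q) \<cdot> fl (d' \<cdot> q) (Idt C ?Y)"
    using ar Q(2,6-10) d'(1-3) by simp
  also have "\<dots> = q \<cdot> (?t \<cdot> fl (d \<cdot> pr1 X B') (Idt C ?Y))"
    unfolding Q(5)[symmetric] d'(4) using ar Q(2,6-10) da d x \<phi> by simp
  also have "\<dots> = conjugation C ?Q \<cdot> fl q q"
    unfolding t using conjugation_natural[of q] Q(2,6) by simp
  finally have "\<omega> \<cdot> fl d' (Idt C ?Q) = conjugation C ?Q"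
    by (rule epicD[OF regular_epi_epic[OF regular_epi_flat[OF Q(1) Q(1)]]]) (use Q d' in simp_all)
  with d'1 show ?thesis unfolding crossed_module_def using d' Q by simp
qed

end

end

end

section \<open>Generalities on fibrations\<close>

lemma fcomp_functor:
  assumes "is_functor A B F" "is_functor B D G" shows "is_functor A D (fcomp G F)"
  using assms unfolding is_functor_def fcomp_def hom_def by simp

lemma fiber_category:
  assumes F: "is_functor X A F" shows "category (fiber X A F a)"
proof -
  have X: "category X" and A: "category A" using F by (simp_all add: is_functor_def)
  interpret X: categ X by unfold_locales (rule X)
  interpret A: categ A by unfold_locales (rule A)
  have obj: "omap F x \<in> Ob A" if "x \<in> Ob X" for x using F that by (simp add: is_functor_def)
  have comp: "amap F (Comp X g f) = Comp A (amap F g) (amap F f)"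
    if "f \<in> Ar X" "g \<in> Ar X" "Cod X f = Dom X g" for f g using F that by (simp add: is_functor_def)
  have Id: "amap F (Idt X x) = Idt A (omap F x)" if "x \<in> Ob X" for x using F that by (simp add: is_functor_def)
  have aI: "a \<in> Ob A" if "x \<in> Ob X" "omap F x = a" for x using obj that by auto
  show ?thesis
    unfolding category_def fiber_def hom_def
    using comp Id obj by (auto simp: aI) 
qed

lemma fiber_functor:
  assumes F: "is_functor X A F" and G: "is_functor M A G" and P: "is_functor X M P"
    and eq: "functor_eq X (fcomp G P) F"
  shows "is_functor (fiber X A F a) (fiber M A G a) P"
proof -
  have X: "category X" using F by (simp add: is_functor_def)
  interpret X: categ X by unfold_locales (rule X)
  have e: "omap G (omap P x) = omap F x" if "x \<in> Ob X" for x
    using eq that by (simp add: functor_eq_def fcomp_def)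
  have e': "amap G (amap P f) = amap F f" if "f \<in> Ar X" for f
    using eq that by (simp add: functor_eq_def fcomp_def)
  have P': "amap P f \<in> Ar M" "Dom M (amap P f) = omap P (Dom X f)" "Cod M (amap P f) = omap P (Cod X f)"
    if "f \<in> Ar X" for f using P that by (auto simp: is_functor_def hom_def)
  show ?thesis
    unfolding is_functor_def
  proof (intro conjI ballI impI)
    show "category (fiber X A F a)" by (rule fiber_category[OF F])
    show "category (fiber M A G a)" by (rule fiber_category[OF G])
  qed (use P P' e e' in \<open>auto simp: fiber_def hom_def is_functor_def\<close>)
qed

text \<open>Each lift factors through the other, and uniqueness makes the factorisations mutually
  inverse. This carries properties of the constructed lifts over to arbitrary cartesian
  arrows.\<close>

lemma cartesian_comparison:
  assumes F: "is_functor X A F" and f: "cartesian X A F f" and g: "cartesian X A F g"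
    and fg: "Cod X f = Cod X g" "omap F (Dom X f) = omap F (Dom X g)" "amap F f = amap F g"
  obtains w w' where "w \<in> Ar X" "Dom X w = Dom X f" "Cod X w = Dom X g" "w' \<in> Ar X" "Dom X w' = Dom X g"
    "Cod X w' = Dom X f" "Comp X g w = f" "Comp X w' w = Idt X (Dom X f)" "Comp X w w' = Idt X (Dom X g)"
proof -
  have X: "category X" and A: "category A" using F by (simp_all add: is_functor_def)
  interpret X: categ X by unfold_locales (rule X)
  interpret A: categ A by unfold_locales (rule A)
  have lift: "\<exists>!w. w \<in> hom X (Dom X h) (Dom X k) \<and> amap F w = Idt A (omap F (Dom X k)) \<and> Comp X k w = h"
    if k: "cartesian X A F k" and h: "h \<in> Ar X" "Cod X h = Cod X k" "omap F (Dom X h) = omap F (Dom X k)" "amap F h = amap F k"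
    for h k
  proof -
    have ka: "k \<in> Ar X" using k by (simp add: cartesian_def)
    have Fk: "amap F k \<in> Ar A" "Dom A (amap F k) = omap F (Dom X k)" "omap F (Dom X k) \<in> Ob A"
      using F ka by (auto simp: is_functor_def)
    have "Comp A (amap F k) (Idt A (omap F (Dom X k))) = amap F h" using Fk h by simp
    moreover have "Idt A (omap F (Dom X k)) \<in> hom A (omap F (Dom X h)) (omap F (Dom X k))" using Fk h by simp
    ultimately show ?thesis using k h unfolding cartesian_def by blast
  qed
  have ar: "f \<in> Ar X" "g \<in> Ar X" using f g by (simp_all add: cartesian_def)
  obtain w where w: "w \<in> Ar X" "Dom X w = Dom X f" "Cod X w = Dom X g" "amap F w = Idt A (omap F (Dom X g))" "Comp X g w = f"
    using lift[OF g ar(1)] fg by auto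
  obtain w' where w': "w' \<in> Ar X" "Dom X w' = Dom X g" "Cod X w' = Dom X f" "amap F w' = Idt A (omap F (Dom X f))" "Comp X f w' = g"
    using lift[OF f ar(2)] fg by auto
  have FF: "amap F (Comp X u v) = Comp A (amap F u) (amap F v)" if "v \<in> Ar X" "u \<in> Ar X" "Cod X v = Dom X u" for u v
    using F that by (simp add: is_functor_def)
  have FI: "amap F (Idt X x) = Idt A (omap F x)" "omap F x \<in> Ob A" if "x \<in> Ob X" for x
    using F that by (simp_all add: is_functor_def)
  have "Comp X w' w = Idt X (Dom X f)"
  proof -
    have "Comp X w' w \<in> hom X (Dom X f) (Dom X f) \<and> amap F (Comp X w' w) = Idt A (omap F (Dom X f)) \<and> Comp X f (Comp X w' w) = f"
      using w w' ar FF FI fg by (simp add: X.comp_assoc[symmetric] del: X.comp_assoc)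
    moreover have "Idt X (Dom X f) \<in> hom X (Dom X f) (Dom X f) \<and> amap F (Idt X (Dom X f)) = Idt A (omap F (Dom X f)) \<and>
        Comp X f (Idt X (Dom X f)) = f"
      using ar FI by simp
    ultimately show ?thesis using lift[OF f ar(1)] fg by blast
  qed
  moreover have "Comp X w w' = Idt X (Dom X g)"
  proof -
    have "Comp X w w' \<in> hom X (Dom X g) (Dom X g) \<and> amap F (Comp X w w') = Idt A (omap F (Dom X g)) \<and> Comp X g (Comp X w w') = g"
      using w w' ar FF FI fg by (simp add: X.comp_assoc[symmetric] del: X.comp_assoc)
    moreover have "Idt X (Dom X g) \<in> hom X (Dom X g) (Dom X g) \<and> amap F (Idt X (Dom X g)) = Idt A (omap F (Dom X g)) \<and>
        Comp X g (Idt X (Dom X g)) = g"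
      using ar FI by simp
    ultimately show ?thesis using lift[OF g ar(2)] fg by blast
  qed
  ultimately show ?thesis using that w w' by blast
qed

context ssa
begin

section \<open>The category of modules\<close>

lemma action_morphismD:
  assumes "action_morphism C \<xi> \<xi>' f h"
  shows "f \<in> Ar C" "h \<in> Ar C" "is_action C (Dom C f) (Dom C h) \<xi>" "is_action C (Cod C f) (Cod C h) \<xi>'"
    "h \<cdot> \<xi> = \<xi>' \<cdot> fl f h" "\<xi> \<in> Ar C" "Dom C \<xi> = flat_ob C (Dom C f) (Dom C h)" "Cod C \<xi> = Dom C h"
    "\<xi>' \<in> Ar C" "Dom C \<xi>' = flat_ob C (Cod C f) (Cod C h)" "Cod C \<xi>' = Cod C h"
  using assms by (auto simp: action_morphism_def is_action_def)

lemma action_morphism_Idt: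
  "is_action C B X \<xi> \<Longrightarrow> action_morphism C \<xi> \<xi> (Idt C B) (Idt C X)"
  using is_action_ar[of B X \<xi>] by (simp add: action_morphism_def)

lemma action_morphism_comp:
  assumes "action_morphism C \<xi> \<xi>' f h" "action_morphism C \<xi>' \<xi>'' f' h'" "Cod C f = Dom C f'" "Cod C h = Dom C h'"
  shows "action_morphism C \<xi> \<xi>'' (f' \<cdot> f) (h' \<cdot> h)"
proof -
  note A = action_morphismD[OF assms(1)] and A' = action_morphismD[OF assms(2)]
  have "(h' \<cdot> h) \<cdot> \<xi> = \<xi>'' \<cdot> fl (f' \<cdot> f) (h' \<cdot> h)"
    using A(1,2,6-11) A'(1,2,6-11) assms(3,4) by (simp add: A(5) A'(5)[THEN rw])
  then show ?thesis using A A' assms(3,4) by (simp add: action_morphism_def)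
qed

lemma action_morphism_base_change:
  assumes "action_morphism C \<zeta> \<zeta>' (Idt C c) h" "g \<in> Ar C" "Cod C g = c" "Dom C h = X" "Cod C h = Y"
  shows "action_morphism C (\<zeta> \<cdot> fl g (Idt C X)) (\<zeta>' \<cdot> fl g (Idt C Y)) (Idt C (Dom C g)) h"
proof -
  have c: "c \<in> Ob C" using assms by auto
  note A = action_morphismD[OF assms(1)]
  have B: "is_action C c X \<zeta>" "is_action C c Y \<zeta>'" using A(3,4) assms c by simp_all
  have "h \<cdot> (\<zeta> \<cdot> fl g (Idt C X)) = (\<zeta>' \<cdot> fl g (Idt C Y)) \<cdot> fl (Idt C (Dom C g)) h"
    using A(2,6-11) assms(2-5) c is_action_ar(2)[OF B(1)] is_action_ar(2)[OF B(2)] by (simp add: A(5)[THEN rw])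
  then show ?thesis
    using base_change_action[OF B(1) assms(2,3)] base_change_action[OF B(2) assms(2,3)] A(2) assms
    by (simp add: action_morphism_def)
qed

abbreviation Mod :: "(('o, 'a) cmodule, (('o, 'a) cmodule, 'a \<times> 'a) arrow) cat" where "Mod \<equiv> mod_cat C"

lemma mod_simps [simp]:
  "M \<in> Ob Mod \<longleftrightarrow> is_module C (mod_base M) (mod_ob M) (mod_act M)"
  "Dom Mod = src" "Cod Mod = tgt" "Idt Mod M = Arrow M (Idt C (mod_base M), Idt C (mod_ob M)) M"
  "Comp Mod g f = Arrow (src f) (fst (comps g) \<cdot> fst (comps f), snd (comps g) \<cdot> snd (comps f)) (tgt g)"
  "omap mod_proj M = mod_base M" "amap mod_proj f = fst (comps f)"
  by (simp_all add: mod_cat_def mod_proj_def)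

lemma mod_ar:
  "f \<in> Ar Mod \<longleftrightarrow> is_module C (mod_base (src f)) (mod_ob (src f)) (mod_act (src f)) \<and>
     is_module C (mod_base (tgt f)) (mod_ob (tgt f)) (mod_act (tgt f)) \<and>
     fst (comps f) \<in> hom C (mod_base (src f)) (mod_base (tgt f)) \<and>
     snd (comps f) \<in> hom C (mod_ob (src f)) (mod_ob (tgt f)) \<and>
     action_morphism C (mod_act (src f)) (mod_act (tgt f)) (fst (comps f)) (snd (comps f))"
  by (cases f; cases "comps f") (auto simp: mod_cat_def)

lemma is_module_ob: "is_module C G B \<phi> \<Longrightarrow> G \<in> Ob C" "is_module C G B \<phi> \<Longrightarrow> B \<in> Ob C"
  "is_module C G B \<phi> \<Longrightarrow> is_action C G B \<phi>"
  by (auto simp: is_module_def is_action_def)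

lemma mod_category: "category Mod"
  unfolding category_def
proof (intro conjI ballI impI)
  fix f g h assume a: "f \<in> Ar Mod" "g \<in> Ar Mod" "h \<in> Ar Mod"
    "Cod Mod f = Dom Mod g \<and> Cod Mod g = Dom Mod h"
  show "Comp Mod (Comp Mod h g) f = Comp Mod h (Comp Mod g f)"
    using a by (simp add: mod_ar)
next
  fix f g assume a: "f \<in> Ar Mod" "g \<in> Ar Mod" "Cod Mod f = Dom Mod g"
  show "Comp Mod g f \<in> hom Mod (Dom Mod f) (Cod Mod g)"
    using a by (auto simp: mod_ar hom_def intro!: action_morphism_comp)
next
  fix f assume a: "f \<in> Ar Mod"
  show "Dom Mod f \<in> Ob Mod" "Cod Mod f \<in> Ob Mod" using a by (simp_all add: mod_ar)
  show "Comp Mod f (Idt Mod (Dom Mod f)) = f" "Comp Mod (Idt Mod (Cod Mod f)) f = f"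
    using a by (simp_all add: mod_ar arrow.expand)
next
  fix M assume a: "M \<in> Ob Mod"
  show "Idt Mod M \<in> hom Mod M M"
    using a is_module_ob[of "mod_base M" "mod_ob M" "mod_act M"]
    by (auto simp: mod_ar hom_def intro!: action_morphism_Idt)
qed

lemma mod_proj_functor: "is_functor Mod C mod_proj"
  unfolding is_functor_def
proof (intro conjI ballI impI)
  show "category Mod" by (rule mod_category)
  show "category C" by (rule category)
qed (auto simp: mod_ar dest: is_module_ob)

text \<open>With \<open>\<beta>\<close> invertible, the module component of a factorisation can only
  be that of \<open>h\<close> followed by the inverse of \<open>\<beta>\<close>; its equivariance is
  tested after the monomorphism \<open>\<beta>\<close>.\<close>

lemma mod_cartesian:
  assumes f: "f \<in> Ar Mod" and iso: "is_iso C (snd (comps f))"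
  shows "cartesian Mod C mod_proj f"
  unfolding cartesian_def
proof (intro conjI ballI impI f)
  let ?\<beta> = "snd (comps f)" and ?\<gamma> = "fst (comps f)"
  fix h u assume h: "h \<in> Ar Mod" and u: "u \<in> hom C (omap mod_proj (Dom Mod h)) (omap mod_proj (Dom Mod f))"
    and hf: "Cod Mod h = Cod Mod f \<and> amap mod_proj f \<cdot> u = amap mod_proj h"
  obtain i where i: "?\<beta> \<in> Ar C" "i \<in> Ar C" "Dom C i = Cod C ?\<beta>" "Cod C i = Dom C ?\<beta>"
    "i \<cdot> ?\<beta> = Idt C (Dom C ?\<beta>)" "?\<beta> \<cdot> i = Idt C (Cod C ?\<beta>)" by (rule iso_inverse[OF iso])
  have f': "?\<gamma> \<in> Ar C" "Dom C ?\<gamma> = mod_base (src f)" "Cod C ?\<gamma> = mod_base (tgt f)"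
    "Dom C ?\<beta> = mod_ob (src f)" "Cod C ?\<beta> = mod_ob (tgt f)" using f by (simp_all add: mod_ar)
  have h': "fst (comps h) \<in> Ar C" "Dom C (fst (comps h)) = mod_base (src h)" "Cod C (fst (comps h)) = mod_base (tgt f)"
    "snd (comps h) \<in> Ar C" "Dom C (snd (comps h)) = mod_ob (src h)" "Cod C (snd (comps h)) = mod_ob (tgt f)" "tgt h = tgt f"
    using h hf by (simp_all add: mod_ar)
  have u': "u \<in> Ar C" "Dom C u = mod_base (src h)" "Cod C u = mod_base (src f)" "?\<gamma> \<cdot> u = fst (comps h)"
    using u hf by simp_all
  let ?b = "i \<cdot> snd (comps h)"
  have am: "action_morphism C (mod_act (src f)) (mod_act (tgt f)) ?\<gamma> ?\<beta>"
    "action_morphism C (mod_act (src h)) (mod_act (tgt f)) (fst (comps h)) (snd (comps h))"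
    using f h hf by (simp_all add: mod_ar)
  note A = action_morphismD[OF am(1)] and A' = action_morphismD[OF am(2)]
  have bb: "?\<beta> \<cdot> ?b = snd (comps h)" using i f' h' by (simp add: i(6)[THEN rw])
  have "?\<beta> \<cdot> (?b \<cdot> mod_act (src h)) = (?\<beta> \<cdot> ?b) \<cdot> mod_act (src h)"
    using i(1-4) f' h' A' by simp
  also have "\<dots> = mod_act (tgt f) \<cdot> fl (?\<gamma> \<cdot> u) (?\<beta> \<cdot> ?b)" unfolding bb u'(4) by (rule A'(5))
  also have "\<dots> = (mod_act (tgt f) \<cdot> fl ?\<gamma> ?\<beta>) \<cdot> fl u ?b"
    using i(1-4) f' h' u'(1-3) A(9-11) by simp
  also have "\<dots> = ?\<beta> \<cdot> (mod_act (src f) \<cdot> fl u ?b)"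
    unfolding A(5)[symmetric] using i(1-4) f' h' u'(1-3) A(6-8) by simp
  finally have "?b \<cdot> mod_act (src h) = mod_act (src f) \<cdot> fl u ?b"
    by (rule monicD[OF iso_monic[OF iso]]) (use i(1-4) f' h' u'(1-3) A(6-8) A'(6-8) in simp_all)
  then have am'': "action_morphism C (mod_act (src h)) (mod_act (src f)) u ?b"
    using A(3) A'(3) i(1-4) f' h' u'(1-3) by (simp add: action_morphism_def)
  show "\<exists>!w. w \<in> hom Mod (Dom Mod h) (Dom Mod f) \<and> amap mod_proj w = u \<and> Comp Mod f w = h"
  proof (rule ex1I[where a = "Arrow (src h) (u, ?b) (src f)"])
    show "Arrow (src h) (u, ?b) (src f) \<in> hom Mod (Dom Mod h) (Dom Mod f) \<and>
      amap mod_proj (Arrow (src h) (u, ?b) (src f)) = u \<and> Comp Mod f (Arrow (src h) (u, ?b) (src f)) = h"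
      using f h hf am'' i(1-4) f' h' u' bb by (simp add: hom_def mod_ar arrow.expand[of _ h] prod_eq_iff)
    fix w assume w: "w \<in> hom Mod (Dom Mod h) (Dom Mod f) \<and> amap mod_proj w = u \<and> Comp Mod f w = h"
    then have w': "snd (comps w) \<in> Ar C" "Dom C (snd (comps w)) = mod_ob (src h)" "Cod C (snd (comps w)) = mod_ob (src f)"
      "src w = src h" "tgt w = src f" "fst (comps w) = u" by (simp_all add: hom_def mod_ar)
    have "Comp Mod f w = h" using w by blast
    then have "snd (comps (Comp Mod f w)) = snd (comps h)" by (simp only:)
    then have "?\<beta> \<cdot> snd (comps w) = snd (comps h)" by simp
    then have "i \<cdot> (?\<beta> \<cdot> snd (comps w)) = ?b" by simp
    then have "snd (comps w) = ?b" using i(1-4) f' w'(1-3) by (simp add: i(5)[THEN rw])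
    then show "w = Arrow (src h) (u, ?b) (src f)" using w' by (simp add: arrow.expand prod_eq_iff)
  qed
qed

lemma mod_fibration: "fibration Mod C mod_proj"
  unfolding fibration_def
proof (intro conjI ballI impI mod_proj_functor)
  fix M \<gamma> assume M: "M \<in> Ob Mod" and \<gamma>: "\<gamma> \<in> Ar C" "Cod C \<gamma> = omap mod_proj M"
  have ac: "is_action C (mod_base M) (mod_ob M) (mod_act M)" "abelian_object C (mod_ob M)"
    using M by (simp_all add: is_module_def)
  note A = is_action_ar[OF ac(1)]
  let ?a = "mod_act M \<cdot> fl \<gamma> (Idt C (mod_ob M))"
  let ?N = "\<lparr>mod_base = Dom C \<gamma>, mod_ob = mod_ob M, mod_act = ?a\<rparr>"
  have b: "is_action C (Dom C \<gamma>) (mod_ob M) ?a" by (rule base_change_action[OF ac(1)]) (use \<gamma> in simp_all)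
  let ?g = "Arrow ?N (\<gamma>, Idt C (mod_ob M)) M"
  have "?g \<in> Ar Mod" using M \<gamma> b ac A by (simp add: mod_ar is_module_def action_morphism_def)
  then have "cartesian Mod C mod_proj ?g" by (rule mod_cartesian) (use A in simp)
  then show "\<exists>g. cartesian Mod C mod_proj g \<and> Cod Mod g = M \<and> amap mod_proj g = \<gamma>"
    by (intro exI[where x = ?g]) simp
qed

section \<open>Exactness\<close>

lemma exact_at_zero_comp:
  assumes "exact_at C f g" shows "g \<cdot> f = zero (Dom C f) (Cod C g)"
proof -
  obtain e m where em: "regular_epi C e" "is_kernel C m g" "Cod C e = Dom C m" "f = m \<cdot> e"
    using assms unfolding exact_at_def by blast
  note K = kernel_ar[OF em(2)] and E = regular_epi_ar[OF em(1)]
  show ?thesis unfolding em(4) using K(1-3) E em(3) by (simp add: K(4)[THEN rw])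
qed

lemma kernel_exact_at:
  assumes "is_kernel C f g" shows "exact_at C f g"
  unfolding exact_at_def
  using assms kernel_ar[OF assms] by (intro exI[where x = "Idt C (Dom C f)"] exI[where x = f]) (simp add: iso_regular_epi)

text \<open>The regular epimorphism onto the image is then monic as well, hence invertible.\<close>

lemma exact_at_monic_kernel:
  assumes "exact_at C f g" "monic f" shows "is_kernel C f g"
proof -
  obtain e m where em: "regular_epi C e" "is_kernel C m g" "Cod C e = Dom C m" "f = m \<cdot> e"
    using assms(1) unfolding exact_at_def by blast
  note K = kernel_ar[OF em(2)] and E = regular_epi_ar[OF em(1)]
  have "monic e" by (rule monic_cancel[of m]) (use assms(2) em K E in simp_all)
  then have "is_iso C e" by (rule regular_epi_monic_iso[OF em(1), where a = "Idt C (Dom C e)"]) (use E in simp_all)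
  then obtain i where i: "e \<in> Ar C" "i \<in> Ar C" "Dom C i = Cod C e" "Cod C i = Dom C e"
    "i \<cdot> e = Idt C (Dom C e)" "e \<cdot> i = Idt C (Cod C e)" by (rule iso_inverse)
  show ?thesis
  proof (rule kernelI[OF assms(2)])
    show "g \<cdot> f = zero (Dom C f) (Cod C g)" by (rule exact_at_zero_comp[OF assms(1)])
    show "Cod C f = Dom C g" unfolding em(4) using K E em(3) by simp
    fix h assume h: "h \<in> Ar C" "Cod C h = Dom C g" "g \<cdot> h = zero (Dom C h) (Cod C g)"
    obtain t where t: "t \<in> Ar C" "Dom C t = Dom C h" "Cod C t = Dom C m" "m \<cdot> t = h" by (rule kernel_lift[OF em(2) h])
    have "f \<cdot> (i \<cdot> t) = h" unfolding em(4) using t i(1-4) em(3) K by (simp add: i(6)[THEN rw])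
    moreover have "Dom C f = Dom C e" unfolding em(4) using K E em(3) by simp
    ultimately show "\<exists>t. t \<in> Ar C \<and> Dom C t = Dom C h \<and> Cod C t = Dom C f \<and> f \<cdot> t = h"
      using t(1-3) i(1-4) em(3) by (intro exI[where x = "i \<cdot> t"]) simp
  qed (rule K)
qed

text \<open>The image of an arrow out of zero is zero, and a trivial kernel characterises
  monomorphisms. With \<open>exact_at_to_Z\<close> this translates the two ends of an exact
  sequence.\<close>

lemma exact_at_from_Z:
  assumes "f \<in> Ar C" "A = Dom C f" shows "exact_at C (zero Z A) f \<longleftrightarrow> monic f"
proof
  assume "exact_at C (zero Z A) f"
  then obtain e m where em: "regular_epi C e" "is_kernel C m f" "Cod C e = Dom C m" "zero Z A = m \<cdot> e"
    unfolding exact_at_def by blast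
  note K = kernel_ar[OF em(2)] and E = regular_epi_ar[OF em(1)]
  have "Dom C (zero Z A) = Dom C (m \<cdot> e)" by (simp only: em(4))
  then have De: "Dom C e = Z" using assms K E em(3) by simp
  have "m = zero (Dom C m) A"
    by (rule epicD[OF regular_epi_epic[OF em(1)]]) (use em(4)[symmetric] K E De em(3) assms in simp_all)
  then show "monic f"
  proof (intro monic_if_trivial_kernel assms(1))
    fix x assume m: "m = zero (Dom C m) A" and x: "x \<in> Ar C" "Cod C x = Dom C f" "f \<cdot> x = zero (Dom C x) (Cod C f)"
    obtain t where t: "t \<in> Ar C" "Dom C t = Dom C x" "Cod C t = Dom C m" "m \<cdot> t = x" by (rule kernel_lift[OF em(2) x])
    have "x = zero (Dom C m) A \<cdot> t" using t(4) m by simp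
    then show "x = zero (Dom C x) (Dom C f)" using t(1-3) assms K by simp
  qed
next
  assume m: "monic f"
  have "is_kernel C (zero Z (Dom C f)) f"
  proof (rule trivial_kernel[OF assms(1)])
    fix x assume x: "x \<in> Ar C" "Cod C x = Dom C f" "f \<cdot> x = zero (Dom C x) (Cod C f)"
    show "x = zero (Dom C x) (Dom C f)" by (rule monicD[OF m]) (use x assms in simp_all)
  qed
  then show "exact_at C (zero Z A) f" unfolding assms(2) by (rule kernel_exact_at)
qed

lemma exact_at_to_Z:
  assumes "f \<in> Ar C" "A = Cod C f" shows "exact_at C f (zero A Z) \<longleftrightarrow> regular_epi C f"
proof
  assume "exact_at C f (zero A Z)"
  then obtain e m where em: "regular_epi C e" "is_kernel C m (zero A Z)" "Cod C e = Dom C m" "f = m \<cdot> e"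
    unfolding exact_at_def by blast
  note K = kernel_ar[OF em(2)] and E = regular_epi_ar[OF em(1)]
  have K': "Cod C m = A" using K assms by simp
  obtain t where "t \<in> Ar C" "Dom C t = Dom C (Idt C A)" "Cod C t = Dom C m" "m \<cdot> t = Idt C A"
    by (rule kernel_lift[OF em(2), of "Idt C A"]) (use assms in simp_all)
  then have "regular_epi C m" by - (rule split_regular_epi[of m t], (use K K' assms in simp_all))
  then show "regular_epi C f" unfolding em(4) by (rule regular_epi_comp[OF em(1) _ em(3)])
next
  assume r: "regular_epi C f"
  have "is_kernel C (Idt C A) (zero A Z)"
  proof (rule kernelI)
    show "monic (Idt C A)" by (rule iso_monic) (use assms in simp)
    show "\<exists>t. t \<in> Ar C \<and> Dom C t = Dom C h \<and> Cod C t = Dom C (Idt C A) \<and> Idt C A \<cdot> t = h"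
      if "h \<in> Ar C" "Cod C h = Dom C (zero A Z)" for h
      using that assms by (intro exI[where x = h]) simp
  qed (use assms in simp_all)
  then show "exact_at C f (zero A Z)" unfolding exact_at_def
    using r assms by (intro exI[where x = f] exI[where x = "Idt C A"]) simp
qed

text \<open>A kernel depends only on which generalised elements are annihilated. It is meant for
  \<open>\<partial>\<close> and its lift to a pullback of \<open>G\<^sub>1\<close>.\<close>

lemma kernel_cong:
  assumes k: "is_kernel C k f" and f': "f' \<in> Ar C" "Dom C f' = Dom C f"
    and iff: "\<And>x. x \<in> Ar C \<Longrightarrow> Cod C x = Dom C f \<Longrightarrow>
      f' \<cdot> x = zero (Dom C x) (Cod C f') \<longleftrightarrow> f \<cdot> x = zero (Dom C x) (Cod C f)"
  shows "is_kernel C k f'"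
proof (rule kernelI[OF kernel_monic[OF k] f'(1)])
  note K = kernel_ar[OF k]
  show "Cod C k = Dom C f'" using K f' by simp
  show "f' \<cdot> k = zero (Dom C k) (Cod C f')" using iff[of k] K by simp
  fix h assume h: "h \<in> Ar C" "Cod C h = Dom C f'" "f' \<cdot> h = zero (Dom C h) (Cod C f')"
  then have "f \<cdot> h = zero (Dom C h) (Cod C f)" using iff[of h] f' by simp
  then obtain t where "t \<in> Ar C" "Dom C t = Dom C h" "Cod C t = Dom C k" "k \<cdot> t = h"
    using h f' by - (rule kernel_lift[OF k, of h], simp_all)
  then show "\<exists>t. t \<in> Ar C \<and> Dom C t = Dom C h \<and> Cod C t = Dom C k \<and> k \<cdot> t = h" by blast
qed

end

section \<open>The category of crossed extensions\<close>

locale xe = ssa C for C :: "('o, 'a) cat" (structure) +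
  fixes n :: nat
  assumes n: "n \<ge> 2"
begin

abbreviation XE :: "('a xext, ('a xext, 'a list) arrow) cat" where "XE \<equiv> xext_cat C n"
abbreviation Pi :: "('a xext, ('a xext, 'a list) arrow, ('o, 'a) cmodule, (('o, 'a) cmodule, 'a \<times> 'a) arrow) fctr" where
  "Pi \<equiv> xext_Pi C n"
abbreviation Pi0 :: "('a xext, ('a xext, 'a list) arrow, 'o, 'a) fctr" where "Pi0 \<equiv> xext_Pi0 C n"
abbreviation ob :: "'a xext \<Rightarrow> nat \<Rightarrow> 'o" where "ob \<equiv> x_ob C"
abbreviation xext :: "'a xext \<Rightarrow> bool" where "xext \<equiv> crossed_extension C n"

definition xid :: "'a xext \<Rightarrow> 'a list" where
  "xid E = map (\<lambda>i. Idt C (ob E i)) [0..<n + 2]"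

definition xcomp :: "'a list \<Rightarrow> 'a list \<Rightarrow> 'a list" where
  "xcomp gs fs = map2 (Comp C) gs fs"

lemma xid [simp]: "length (xid E) = n + 2" "i < n + 2 \<Longrightarrow> xid E ! i = Idt C (ob E i)"
  by (simp_all add: xid_def del: upt_Suc add_2_eq_Suc')

lemma xcomp [simp]: "length fs = n + 2 \<Longrightarrow> length gs = n + 2 \<Longrightarrow> length (xcomp gs fs) = n + 2"
  "length fs = n + 2 \<Longrightarrow> length gs = n + 2 \<Longrightarrow> i < n + 2 \<Longrightarrow> xcomp gs fs ! i = gs ! i \<cdot> fs ! i"
  by (simp_all add: xcomp_def)

lemma xext_simps [simp]:
  "E \<in> Ob XE \<longleftrightarrow> xext E" "Dom XE = src" "Cod XE = tgt" "Idt XE E = Arrow E (xid E) E"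
  "Comp XE g f = Arrow (src f) (xcomp (comps g) (comps f)) (tgt g)"
  "omap Pi E = xext_module C n E"
  "amap Pi f = Arrow (xext_module C n (src f)) (comps f ! 0, comps f ! (n + 1)) (xext_module C n (tgt f))"
  "omap Pi0 E = ob E 0" "amap Pi0 f = comps f ! 0"
  by (simp_all add: xext_cat_def xid_def xcomp_def xext_Pi_def xext_Pi0_def fcomp_def mod_proj_def xext_module_def)

lemma xext_ar: "f \<in> Ar XE \<longleftrightarrow> xext (src f) \<and> xext (tgt f) \<and> xext_morphism C n (src f) (comps f) (tgt f)"
  by (cases f) (auto simp: xext_cat_def)

lemma xext_maps:
  assumes "xext E"
  shows "length (x_maps E) = n + 1"
    "i \<le> n \<Longrightarrow> x_maps E ! i \<in> Ar C" "i \<le> n \<Longrightarrow> Dom C (x_maps E ! i) = ob E (i + 1)" "i \<le> n \<Longrightarrow> Cod C (x_maps E ! i) = ob E i"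
    "i \<le> n + 1 \<Longrightarrow> ob E i \<in> Ob C"
proof -
  show l: "length (x_maps E) = n + 1" and
    1: "i \<le> n \<Longrightarrow> x_maps E ! i \<in> Ar C" "i \<le> n \<Longrightarrow> Dom C (x_maps E ! i) = ob E (i + 1)" "i \<le> n \<Longrightarrow> Cod C (x_maps E ! i) = ob E i"
    for i
    using assms unfolding crossed_extension_def exact_sequence_def by auto
  show "ob E i \<in> Ob C" if "i \<le> n + 1"
  proof (cases "i \<le> n")
    case True then show ?thesis using 1[of i] Cod_ob[of "x_maps E ! i"] by metis
  next
    case False then have "i = n + 1" using that by simp
    then show ?thesis using 1[of n] Dom_ob[of "x_maps E ! n"] by simp
  qed
qed

lemma xext_exact:
  assumes "xext E"
  shows "monic (x_maps E ! n)" "regular_epi C (x_maps E ! 0)"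
    "1 \<le> i \<Longrightarrow> i \<le> n \<Longrightarrow> exact_at C (x_maps E ! i) (x_maps E ! (i - 1))"
    "is_kernel C (x_maps E ! n) (x_maps E ! (n - 1))"
    "1 \<le> i \<Longrightarrow> i \<le> n \<Longrightarrow> x_maps E ! (i - 1) \<cdot> x_maps E ! i = zero (ob E (i + 1)) (ob E (i - 1))"
proof -
  note M = xext_maps[OF assms]
  have ex: "exact_at C (zero Z (ob E (n + 1))) (x_maps E ! n)" "\<forall>i\<in>{1..n}. exact_at C (x_maps E ! i) (x_maps E ! (i - 1))"
    "exact_at C (x_maps E ! 0) (zero (ob E 0) Z)"
    using assms unfolding crossed_extension_def exact_sequence_def by blast+
  show m: "monic (x_maps E ! n)" using ex(1) exact_at_from_Z[of "x_maps E ! n" "ob E (n + 1)"] M(2,3)[of n] by simp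
  show "regular_epi C (x_maps E ! 0)" using ex(3) exact_at_to_Z[of "x_maps E ! 0" "ob E 0"] M(2,4)[of 0] by simp
  show e: "exact_at C (x_maps E ! i) (x_maps E ! (i - 1))" if "1 \<le> i" "i \<le> n" for i using ex(2) that by simp
  show "is_kernel C (x_maps E ! n) (x_maps E ! (n - 1))" by (rule exact_at_monic_kernel[OF e m]) (use n in simp_all)
  show "x_maps E ! (i - 1) \<cdot> x_maps E ! i = zero (ob E (i + 1)) (ob E (i - 1))" if "1 \<le> i" "i \<le> n"
    using exact_at_zero_comp[OF e[OF that]] M(3)[of i] M(4)[of "i - 1"] that by simp
qed

lemma xext_actions:
  assumes "xext E"
  shows "crossed_module C (x_maps E ! 1) (x_xi E)" "is_action C (ob E 1) (ob E 2) (x_xi E)"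
    "3 \<le> i \<Longrightarrow> i \<le> n + 1 \<Longrightarrow> is_module C (ob E 0) (ob E i) (x_act E i)" "length (x_acts E) = n - 1"
    "3 \<le> i \<Longrightarrow> i \<le> n \<Longrightarrow> action_morphism C (x_act E (i + 1)) (x_act E i) (Idt C (ob E 0)) (x_maps E ! i)"
    "\<exists>k \<phi> e. induced_action C (x_maps E ! 0) (x_maps E ! 1) (x_xi E) k \<phi> \<and>
        e \<in> hom C (ob E 3) (Dom C k) \<and> x_maps E ! 2 = k \<cdot> e \<and> action_morphism C (x_act E 3) \<phi> (Idt C (ob E 0)) e"
proof -
  show "crossed_module C (x_maps E ! 1) (x_xi E)"
    "3 \<le> i \<Longrightarrow> i \<le> n + 1 \<Longrightarrow> is_module C (ob E 0) (ob E i) (x_act E i)" "length (x_acts E) = n - 1"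
    "3 \<le> i \<Longrightarrow> i \<le> n \<Longrightarrow> action_morphism C (x_act E (i + 1)) (x_act E i) (Idt C (ob E 0)) (x_maps E ! i)"
    "\<exists>k \<phi> e. induced_action C (x_maps E ! 0) (x_maps E ! 1) (x_xi E) k \<phi> \<and>
        e \<in> hom C (ob E 3) (Dom C k) \<and> x_maps E ! 2 = k \<cdot> e \<and> action_morphism C (x_act E 3) \<phi> (Idt C (ob E 0)) e"
    using assms unfolding crossed_extension_def equivariant_def by simp_all
  then show "is_action C (ob E 1) (ob E 2) (x_xi E)"
    using xext_maps(3,4)[OF assms, of 1] n unfolding crossed_module_def by (simp add: numeral_2_eq_2)
qed

lemma xext_morphismD:
  assumes "xext_morphism C n E fs E'"
  shows "length fs = n + 2" "i \<le> n + 1 \<Longrightarrow> fs ! i \<in> Ar C" "i \<le> n + 1 \<Longrightarrow> Dom C (fs ! i) = ob E i"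
    "i \<le> n + 1 \<Longrightarrow> Cod C (fs ! i) = ob E' i"
    "i \<le> n \<Longrightarrow> fs ! i \<cdot> x_maps E ! i = x_maps E' ! i \<cdot> fs ! (i + 1)"
    "action_morphism C (x_xi E) (x_xi E') (fs ! 1) (fs ! 2)"
    "3 \<le> i \<Longrightarrow> i \<le> n + 1 \<Longrightarrow> action_morphism C (x_act E i) (x_act E' i) (fs ! 0) (fs ! i)"
  using assms unfolding xext_morphism_def by auto

lemma xext_morphismI:
  assumes "length fs = n + 2"
    "\<And>i. i \<le> n + 1 \<Longrightarrow> fs ! i \<in> Ar C \<and> Dom C (fs ! i) = ob E i \<and> Cod C (fs ! i) = ob E' i"
    "\<And>i. i \<le> n \<Longrightarrow> fs ! i \<cdot> x_maps E ! i = x_maps E' ! i \<cdot> fs ! (i + 1)"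
    "action_morphism C (x_xi E) (x_xi E') (fs ! 1) (fs ! 2)"
    "\<And>i. 3 \<le> i \<Longrightarrow> i \<le> n + 1 \<Longrightarrow> action_morphism C (x_act E i) (x_act E' i) (fs ! 0) (fs ! i)"
  shows "xext_morphism C n E fs E'"
  using assms unfolding xext_morphism_def by simp

lemma xext_morphism_comp:
  assumes E: "xext E" "xext E'" "xext E''" and f: "xext_morphism C n E fs E'" and g: "xext_morphism C n E' gs E''"
  shows "xext_morphism C n E (xcomp gs fs) E''"
proof (rule xext_morphismI)
  note F = xext_morphismD[OF f] and G = xext_morphismD[OF g]
  show "length (xcomp gs fs) = n + 2" using F(1) G(1) by simp
  show "xcomp gs fs ! i \<in> Ar C \<and> Dom C (xcomp gs fs ! i) = ob E i \<and> Cod C (xcomp gs fs ! i) = ob E'' i" if "i \<le> n + 1" for i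
    using that F(1-4) G(1-4) by simp
  show "xcomp gs fs ! i \<cdot> x_maps E ! i = x_maps E'' ! i \<cdot> xcomp gs fs ! (i + 1)" if i: "i \<le> n" for i
  proof -
    note ar = F(2-4)[of i] F(2-4)[of "i + 1"] G(2-4)[of i] G(2-4)[of "i + 1"] xext_maps(2-4)[OF E(1), of i]
      xext_maps(2-4)[OF E(2), of i] xext_maps(2-4)[OF E(3), of i]
    have "(gs ! i \<cdot> fs ! i) \<cdot> x_maps E ! i = gs ! i \<cdot> (fs ! i \<cdot> x_maps E ! i)" using ar i by simp
    also have "\<dots> = (gs ! i \<cdot> x_maps E' ! i) \<cdot> fs ! (i + 1)" unfolding F(5)[OF i] using ar i by simp
    also have "\<dots> = x_maps E'' ! i \<cdot> (gs ! (i + 1) \<cdot> fs ! (i + 1))" unfolding G(5)[OF i] using ar i by simp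
    finally show ?thesis using F(1) G(1) i by simp
  qed
  show "action_morphism C (x_xi E) (x_xi E'') (xcomp gs fs ! 1) (xcomp gs fs ! 2)"
    using action_morphism_comp[OF F(6) G(6)] F(1,3,4) G(1,3,4) n by simp
  show "action_morphism C (x_act E i) (x_act E'' i) (xcomp gs fs ! 0) (xcomp gs fs ! i)" if "3 \<le> i" "i \<le> n + 1" for i
    using action_morphism_comp[OF F(7)[OF that] G(7)[OF that]] F(1,3,4) G(1,3,4) that by simp
qed

lemma xext_morphism_Idt:
  assumes "xext E" shows "xext_morphism C n E (xid E) E"
proof (rule xext_morphismI)
  note M = xext_maps[OF assms] and A = xext_actions[OF assms]
  show "xid E ! i \<in> Ar C \<and> Dom C (xid E ! i) = ob E i \<and> Cod C (xid E ! i) = ob E i" if "i \<le> n + 1" for i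
    using that M(5)[of i] by simp
  show "xid E ! i \<cdot> x_maps E ! i = x_maps E ! i \<cdot> xid E ! (i + 1)" if "i \<le> n" for i
    using that M(2-4)[of i] by simp
  show "action_morphism C (x_xi E) (x_xi E) (xid E ! 1) (xid E ! 2)"
    using action_morphism_Idt[OF A(2)] n by simp
  show "action_morphism C (x_act E i) (x_act E i) (xid E ! 0) (xid E ! i)" if "3 \<le> i" "i \<le> n + 1" for i
    using action_morphism_Idt[OF is_module_ob(3)[OF A(3)[OF that]]] that by simp
qed simp

lemma xext_category: "category XE"
  unfolding category_def
proof (intro conjI ballI impI)
  fix f g h assume a: "f \<in> Ar XE" "g \<in> Ar XE" "h \<in> Ar XE" "Cod XE f = Dom XE g \<and> Cod XE g = Dom XE h"
  then have m: "xext_morphism C n (src f) (comps f) (tgt f)" "xext_morphism C n (tgt f) (comps g) (tgt g)"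
    "xext_morphism C n (tgt g) (comps h) (tgt h)" by (simp_all add: xext_ar)
  note F = xext_morphismD[OF m(1)] and G = xext_morphismD[OF m(2)] and H = xext_morphismD[OF m(3)]
  have "xcomp (xcomp (comps h) (comps g)) (comps f) = xcomp (comps h) (xcomp (comps g) (comps f))"
    by (rule nth_equalityI) (use F(1-4) G(1-4) H(1-4) in simp_all)
  then show "Comp XE (Comp XE h g) f = Comp XE h (Comp XE g f)" by simp
next
  fix f g assume a: "f \<in> Ar XE" "g \<in> Ar XE" "Cod XE f = Dom XE g"
  then show "Comp XE g f \<in> hom XE (Dom XE f) (Cod XE g)"
    using xext_morphism_comp[of "src f" "tgt f" "tgt g" "comps f" "comps g"] by (simp add: xext_ar hom_def)
next
  fix f assume a: "f \<in> Ar XE"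
  then show "Dom XE f \<in> Ob XE" "Cod XE f \<in> Ob XE" by (simp_all add: xext_ar)
  note F = xext_morphismD[of "src f" "comps f" "tgt f"]
  have "xcomp (comps f) (xid (src f)) = comps f" "xcomp (xid (tgt f)) (comps f) = comps f"
    by (rule nth_equalityI; use F(1-4) a in \<open>simp add: xext_ar\<close>)+
  then show "Comp XE f (Idt XE (Dom XE f)) = f" "Comp XE (Idt XE (Cod XE f)) f = f" by simp_all
next
  fix E assume "E \<in> Ob XE"
  then show "Idt XE E \<in> hom XE E E" using xext_morphism_Idt by (simp add: hom_def xext_ar)
qed

lemma Pi_functor: "is_functor XE Mod Pi"
  unfolding is_functor_def
proof (intro conjI ballI impI xext_category mod_category)
  have M: "is_module C (ob E 0) (ob E (n + 1)) (x_act E (n + 1))" if "xext E" for E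
    using xext_actions(3)[OF that, of "n + 1"] n by simp
  fix E assume "E \<in> Ob XE"
  then show "omap Pi E \<in> Ob Mod" using M by (simp add: xext_module_def)
  show "amap Pi (Idt XE E) = Idt Mod (omap Pi E)" by (simp add: xext_module_def)
next
  have M: "is_module C (ob E 0) (ob E (n + 1)) (x_act E (n + 1))" if "xext E" for E
    using xext_actions(3)[OF that, of "n + 1"] n by simp
  fix f assume "f \<in> Ar XE"
  then have f: "xext (src f)" "xext (tgt f)" "xext_morphism C n (src f) (comps f) (tgt f)" by (simp_all add: xext_ar)
  note F = xext_morphismD[OF f(3)]
  show "amap Pi f \<in> hom Mod (omap Pi (Dom XE f)) (omap Pi (Cod XE f))"
    using M[OF f(1)] M[OF f(2)] F(2-4)[of 0] F(2-4)[of "n + 1"] F(7)[of "n + 1"] n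
    by (simp add: hom_def mod_ar xext_module_def)
next
  fix f g assume "f \<in> Ar XE" "g \<in> Ar XE" "Cod XE f = Dom XE g"
  then show "amap Pi (Comp XE g f) = Comp Mod (amap Pi g) (amap Pi f)"
    by (simp add: xext_ar xext_morphism_def)
qed

lemma Pi0_functor: "is_functor XE C Pi0"
  unfolding xext_Pi0_def by (rule fcomp_functor[OF Pi_functor mod_proj_functor])

section \<open>Cartesian lifts of crossed extensions\<close>

lemma base_change_module:
  assumes "is_module C c B \<phi>" "\<gamma> \<in> Ar C" "Cod C \<gamma> = c"
  shows "is_module C (Dom C \<gamma>) B (\<phi> \<cdot> fl \<gamma> (Idt C B))"
  using assms base_change_action[of c B \<phi> \<gamma>] by (simp add: is_module_def)

text \<open>Pulling \<open>p\<close> back does not change its kernel, so all objects from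
  \<open>G\<^sub>2\<close> on can be kept. The conclusion records that the lift is the identity on
  \<open>B\<close>, which is what makes \<open>Pi\<close> preserve cartesian arrows.\<close>

lemma xext_cartesian_lift:
  assumes E: "xext E" and \<gamma>: "\<gamma> \<in> Ar C" "Cod C \<gamma> = ob E 0"
  obtains g where "cartesian XE C Pi0 g" "tgt g = E" "comps g ! 0 = \<gamma>" "comps g ! (n + 1) = Idt C (ob E (n + 1))"
    "ob (src g) 0 = Dom C \<gamma>"
proof -
  note M = xext_maps[OF E] and X = xext_exact[OF E] and A = xext_actions[OF E]
  define p where "p = x_maps E ! 0"
  define d where "d = x_maps E ! 1"
  have M0: "p \<in> Ar C" "Dom C p = ob E 1" "Cod C p = ob E 0" "d \<in> Ar C" "Dom C d = ob E 2" "Cod C d = ob E 1"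
    "ob E 2 \<in> Ob C" "ob E 1 \<in> Ob C" "ob E 0 \<in> Ob C"
    using M(2-4)[of 0] M(2-4)[of 1] M(5)[of 0] M(5)[of 1] M(5)[of 2] n by (simp_all add: p_def d_def numeral_2_eq_2)
  have pd: "p \<cdot> d = zero (ob E 2) (ob E 0)" using X(5)[of 1] n by (simp add: p_def d_def numeral_2_eq_2)
  obtain r p' where pb: "is_pullback C p \<gamma> r p'"
    by (rule pullback_exists[of p \<gamma>]) (use M0 \<gamma> in simp_all)
  note P = pullback_ar[OF pb]
  have p're: "regular_epi C p'" by (rule regular_epi_pullback[OF pb X(2)[folded p_def]])
  \<comment> \<open>The new crossed module is the arrow \<open>(d, 0)\<close> into the
    pullback.\<close>
  obtain d' where d': "d' \<in> Ar C" "Dom C d' = Dom C d" "Cod C d' = Dom C r" "r \<cdot> d' = d"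
    "p' \<cdot> d' = zero (ob E 2) (Dom C \<gamma>)"
    by (rule pullback_lift[OF pb, of d "zero (ob E 2) (Dom C \<gamma>)"]) (use M0 \<gamma> pd in simp_all)
  have d'2: "Dom C d' = ob E 2" using d' M0 by simp
  \<comment> \<open>\<open>x_xi\<close> is restricted along \<open>r\<close>, the
    \<open>C\<close>-actions along \<open>\<gamma>\<close>. The list of actions begins with the one
    on \<open>A\<^sub>3\<close>, whence the range of indices.\<close>
  define E' where "E' = \<lparr>x_maps = (x_maps E)[0 := p', 1 := d'], x_xi = x_xi E \<cdot> fl r (Idt C (ob E 2)),
    x_acts = map (\<lambda>i. x_act E i \<cdot> fl \<gamma> (Idt C (ob E i))) [3..<n + 2]\<rparr>"
  have maps': "x_maps E' ! 0 = p'" "x_maps E' ! 1 = d'" "x_maps E' ! Suc 0 = d'" "length (x_maps E') = n + 1"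
    "2 \<le> i \<Longrightarrow> x_maps E' ! i = x_maps E ! i" for i
    using M(1) n by (simp_all add: E'_def)
  have xi': "x_xi E' = x_xi E \<cdot> fl r (Idt C (ob E 2))" by (simp add: E'_def)
  have act': "x_act E' i = x_act E i \<cdot> fl \<gamma> (Idt C (ob E i))" if "3 \<le> i" "i \<le> n + 1" for i
  proof -
    have "[3..<n + 2] ! (i - 3) = i" using nth_upt[of 3 "i - 3" "n + 2"] that by simp
    then show ?thesis using that by (simp add: E'_def x_act_def del: upt_Suc add_2_eq_Suc')
  qed
  have len': "length (x_acts E') = n - 1" by (simp add: E'_def del: upt_Suc)
  have ob': "ob E' 0 = Dom C \<gamma>" "ob E' 1 = Dom C r" "ob E' (Suc 0) = Dom C r" using P maps' by (simp_all add: x_ob_def)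
  have ob2: "ob E' i = ob E i" if "2 \<le> i" "i \<le> n + 1" for i
  proof (cases "i = 2")
    case True then show ?thesis using maps' d'2 by (simp add: x_ob_def)
  next
    case False
    then have "2 \<le> i - 1" using that by simp
    then show ?thesis using maps'(5)[of "i - 1"] that by (simp add: x_ob_def)
  qed
  note ar = P(1-8) M0 \<gamma> d'(1,3) d'2
  have rr: "r \<in> Ar C" "Cod C r = ob E 1" "Dom C r \<in> Ob C" using P M0 by simp_all
  \<comment> \<open>The second component of \<open>d'\<close> is zero, so \<open>d'\<close> kills
    the same elements as \<open>d\<close>. Exactness at \<open>G\<^sub>2\<close> and the
    factorisation through the kernel are inherited.\<close>
  have kc: "is_kernel C k d'" if k: "is_kernel C k d" for k
  proof (rule kernel_cong[OF k d'(1,2)])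
    fix x assume x: "x \<in> Ar C" "Cod C x = Dom C d"
    show "d' \<cdot> x = zero (Dom C x) (Cod C d') \<longleftrightarrow> d \<cdot> x = zero (Dom C x) (Cod C d)"
    proof
      assume "d' \<cdot> x = zero (Dom C x) (Cod C d')"
      then have "r \<cdot> (d' \<cdot> x) = zero (Dom C x) (Cod C d)" using x(1) ar by simp
      then show "d \<cdot> x = zero (Dom C x) (Cod C d)" using x ar by (simp add: d'(4)[THEN rw])
    next
      assume "d \<cdot> x = zero (Dom C x) (Cod C d)"
      then show "d' \<cdot> x = zero (Dom C x) (Cod C d')"
        by - (rule pullback_eq[OF pb], (use x ar in \<open>simp_all add: d'(4,5)[THEN rw]\<close>))
    qed
  qed
  have xiA: "is_action C (Dom C r) (ob E 2) (x_xi E')" unfolding xi'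
    by (rule base_change_action[OF A(2) rr(1,2)])
  have dr: "d \<cdot> x_xi E = conjugation C (ob E 1) \<cdot> fl (Idt C (ob E 1)) d"
    "x_xi E \<cdot> fl d (Idt C (ob E 2)) = conjugation C (ob E 2)"
    using A(1) M0 unfolding crossed_module_def d_def by simp_all
  note xa = is_action_ar(3-5)[OF A(2)]
  have cm: "crossed_module C d' (x_xi E')"
  proof -
    \<comment> \<open>Tested on the two projections: after \<open>r\<close> it is the identity known
      for \<open>d\<close>, after \<open>p'\<close> both sides vanish.\<close>
    have "d' \<cdot> x_xi E' = conjugation C (Dom C r) \<cdot> fl (Idt C (Dom C r)) d'"
    proof (rule pullback_eq[OF pb])
      have "r \<cdot> (d' \<cdot> x_xi E') = d \<cdot> x_xi E \<cdot> fl r (Idt C (ob E 2))"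
        unfolding xi' using ar xa rr by (simp add: d'(4)[THEN rw])
      also have "\<dots> = conjugation C (ob E 1) \<cdot> fl r d"
        using ar xa rr by (simp add: dr(1)[THEN rw])
      also have "\<dots> = (conjugation C (ob E 1) \<cdot> fl r r) \<cdot> fl (Idt C (Dom C r)) d'"
        using ar rr by (simp add: d'(4))
      also have "\<dots> = r \<cdot> (conjugation C (Dom C r) \<cdot> fl (Idt C (Dom C r)) d')"
        using conjugation_natural[of r] ar rr by simp
      finally show "r \<cdot> (d' \<cdot> x_xi E') = r \<cdot> (conjugation C (Dom C r) \<cdot> fl (Idt C (Dom C r)) d')" .
      have "p' \<cdot> (conjugation C (Dom C r) \<cdot> fl (Idt C (Dom C r)) d') =
          (conjugation C (Dom C \<gamma>) \<cdot> fl p' p') \<cdot> fl (Idt C (Dom C r)) d'"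
        using conjugation_natural[of p'] ar rr by simp
      also have "\<dots> = zero (flat_ob C (Dom C r) (ob E 2)) (Dom C \<gamma>)"
        using ar rr by (simp add: d'(5))
      also have "\<dots> = p' \<cdot> (d' \<cdot> x_xi E')"
        unfolding xi' using ar xa rr by (simp add: d'(5)[THEN rw])
      finally show "p' \<cdot> (d' \<cdot> x_xi E') = p' \<cdot> (conjugation C (Dom C r) \<cdot> fl (Idt C (Dom C r)) d')" by simp
    qed (use ar rr xiA is_action_ar[OF xiA] in simp_all)
    moreover have "x_xi E' \<cdot> fl d' (Idt C (ob E 2)) = conjugation C (ob E 2)"
      unfolding xi' using ar xa rr dr(2) by (simp add: d'(4))
    ultimately show ?thesis unfolding crossed_module_def using ar rr xiA by simp
  qed
  have ex1: "exact_at C d' p'"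
  proof -
    \<comment> \<open>The image of \<open>d\<close> is the kernel of \<open>p\<close>, which is also
      the kernel of \<open>p'\<close>; the same \<open>e\<close> serves as the regular part of
      \<open>d'\<close>.\<close>
    obtain e m where em: "regular_epi C e" "is_kernel C m p" "Cod C e = Dom C m" "d = m \<cdot> e"
      using X(3)[of 1] n unfolding exact_at_def p_def d_def by auto
    note K = kernel_ar[OF em(2)] and Ee = regular_epi_ar[OF em(1)]
    have De: "Dom C e = ob E 2" using M0(5) unfolding em(4) using K Ee em(3) by simp
    obtain m' where "m' \<in> Ar C" "Dom C m' = Dom C m" "Cod C m' = Dom C p'" "p' \<cdot> m' = zero (Dom C m) (Dom C \<gamma>)"
      "r \<cdot> m' = m" and mk: "is_kernel C m' p'"
      by (rule pullback_kernel[OF pullback_sym[OF pb] em(2)])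
    then have m': "m' \<in> Ar C" "Dom C m' = Dom C m" "Cod C m' = Dom C r" "r \<cdot> m' = m" "p' \<cdot> m' = zero (Dom C m) (Dom C \<gamma>)"
      using P by simp_all
    have "d' = m' \<cdot> e"
      by (rule pullback_eq[OF pb])
        (use d'(4,5) m'(1-3) ar K(1) Ee em(3) De in \<open>simp_all add: m'(4,5)[THEN rw] em(4)[symmetric]\<close>)
    then show ?thesis unfolding exact_at_def using em(1,3) m'(2) mk
      by (intro exI[where x = e] exI[where x = m']) simp
  qed
  have ex: "exact_sequence C n E'"
    unfolding exact_sequence_def
  proof (intro conjI allI impI ballI)
    show "x_maps E' ! i \<in> hom C (ob E' (i + 1)) (ob E' i)" if i: "i \<le> n" for i
    proof -
      consider "i = 0" | "i = 1" | "2 \<le> i" by linarith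
      then show ?thesis
      proof cases
        case 1 then show ?thesis using maps' ob' ar by simp
      next
        case 2 then show ?thesis using maps' ob' ob2[of 2] ar n by (simp add: numeral_2_eq_2)
      next
        case 3 then show ?thesis using maps'(5)[of i] ob2[of i] ob2[of "i + 1"] M(2-4)[of i] i by simp
      qed
    qed
    show "exact_at C (zero Z (ob E' (n + 1))) (x_maps E' ! n)"
      using exact_at_from_Z[of "x_maps E ! n" "ob E (n + 1)"] X(1) M(2,3)[of n] maps'(5)[of n] ob2[of "n + 1"] n by simp
    show "exact_at C (x_maps E' ! i) (x_maps E' ! (i - 1))" if i: "i \<in> {1..n}" for i
    proof -
      consider "i = 1" | "i = 2" | "3 \<le> i" using i by force
      then show ?thesis
      proof cases
        case 1 then show ?thesis using maps' ex1 by simp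
      next
        case 2
        obtain e m where em: "regular_epi C e" "is_kernel C m d" "Cod C e = Dom C m" "x_maps E ! 2 = m \<cdot> e"
          using X(3)[of 2] n unfolding exact_at_def d_def by auto
        then have "exact_at C (x_maps E ! 2) d'" unfolding exact_at_def using kc by blast
        then show ?thesis using 2 maps' by simp
      next
        case 3
        then show ?thesis using X(3)[of i] i maps'(5)[of i] maps'(5)[of "i - 1"] by simp
      qed
    qed
    show "exact_at C (x_maps E' ! 0) (zero (ob E' 0) Z)"
      using exact_at_to_Z[of p' "Dom C \<gamma>"] p're maps' ob' ar by simp
  qed (use maps' in simp)
  have E': "xext E'" unfolding crossed_extension_def
  proof (intro conjI ballI ex len')
    show "crossed_module C (x_maps E' ! 1) (x_xi E')" using cm maps' by simp
    show "is_module C (ob E' 0) (ob E' i) (x_act E' i)" if "i \<in> {3..n + 1}" for i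
      using base_change_module[OF A(3)[of i] \<gamma>] that ob' ob2[of i] act'[of i] by simp
    show "equivariant C (ob E' 0) (x_act E' (i + 1)) (x_act E' i) (x_maps E' ! i)" if i: "i \<in> {3..n}" for i
      using action_morphism_base_change[OF A(5)[of i] \<gamma> M(3,4)[of i]] i ob' act'[of i] act'[of "i + 1"] maps'(5)[of i]
      by (simp add: equivariant_def)
    obtain k \<phi> e where k: "induced_action C p d (x_xi E) k \<phi>" "e \<in> hom C (ob E 3) (Dom C k)" "x_maps E ! 2 = k \<cdot> e"
      "action_morphism C (x_act E 3) \<phi> (Idt C (ob E 0)) e" using A(6) unfolding p_def d_def by blast
    have k': "is_kernel C k d" "is_action C (ob E 0) (Dom C k) \<phi>"
      "k \<cdot> \<phi> \<cdot> fl p (Idt C (Dom C k)) = x_xi E \<cdot> fl (Idt C (ob E 1)) k"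
      using k(1) M0 by (simp_all add: induced_action_def)
    note K = kernel_ar[OF k'(1)] and F = is_action_ar[OF k'(2)]
    let ?\<phi> = "\<phi> \<cdot> fl \<gamma> (Idt C (Dom C k))"
    have "k \<cdot> (?\<phi> \<cdot> fl p' (Idt C (Dom C k))) = (k \<cdot> \<phi> \<cdot> fl p (Idt C (Dom C k))) \<cdot> fl r (Idt C (Dom C k))"
      using ar K F rr by (simp add: P(9))
    also have "\<dots> = x_xi E' \<cdot> fl (Idt C (Dom C r)) k"
      unfolding k'(3) xi' using ar K xa rr by simp
    finally have "induced_action C p' d' (x_xi E') k ?\<phi>"
      unfolding induced_action_def using kc[OF k'(1)] base_change_action[OF k'(2) \<gamma>] ar by simp
    moreover have "action_morphism C (x_act E' 3) ?\<phi> (Idt C (Dom C \<gamma>)) e"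
      using action_morphism_base_change[OF k(4) \<gamma>, of "ob E 3" "Dom C k"] k(2) act'[of 3] n by simp
    ultimately show "\<exists>k \<phi> e. induced_action C (x_maps E' ! 0) (x_maps E' ! 1) (x_xi E') k \<phi> \<and>
        e \<in> hom C (ob E' 3) (Dom C k) \<and> x_maps E' ! 2 = k \<cdot> e \<and> equivariant C (ob E' 0) (x_act E' 3) \<phi> e"
      using k(2,3) maps' ob' ob2[of 3] n unfolding equivariant_def by auto
  qed
  define gs where "gs = (xid E)[0 := \<gamma>, 1 := r]"
  have gs: "length gs = n + 2" "gs ! 0 = \<gamma>" "gs ! 1 = r" "gs ! Suc 0 = r"
    "2 \<le> i \<Longrightarrow> i \<le> n + 1 \<Longrightarrow> gs ! i = Idt C (ob E i)" for i
    by (simp_all add: gs_def)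
  have gm: "xext_morphism C n E' gs E"
  proof (rule xext_morphismI)
    show "gs ! i \<in> Ar C \<and> Dom C (gs ! i) = ob E' i \<and> Cod C (gs ! i) = ob E i" if i: "i \<le> n + 1" for i
    proof -
      consider "i = 0" | "i = 1" | "2 \<le> i" by linarith
      then show ?thesis
        by cases (use gs ob' ar ob2[of i] M(5)[of i] i in simp_all)
    qed
    show "gs ! i \<cdot> x_maps E' ! i = x_maps E ! i \<cdot> gs ! (i + 1)" if i: "i \<le> n" for i
    proof -
      consider "i = 0" | "i = 1" | "2 \<le> i" by linarith
      then show ?thesis
      proof cases
        case 1 then show ?thesis using gs maps' P(9) by (simp add: p_def)
      next
        case 2 then show ?thesis using gs(3,4) gs(5)[of 2] maps' d'(4) M0 n by (simp add: d_def numeral_2_eq_2)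
      next
        case 3 then show ?thesis using gs(5)[of i] gs(5)[of "i + 1"] maps'(5)[of i] M(2-4)[of i] i by simp
      qed
    qed
    show "action_morphism C (x_xi E') (x_xi E) (gs ! 1) (gs ! 2)"
      using gs(3,4) gs(5)[of 2] xiA A(2) xi' xa ar rr n by (simp add: action_morphism_def)
    show "action_morphism C (x_act E' i) (x_act E i) (gs ! 0) (gs ! i)" if i: "3 \<le> i" "i \<le> n + 1" for i
    proof -
      have a: "is_action C (ob E 0) (ob E i) (x_act E i)" using A(3)[OF i] by (rule is_module_ob)
      show ?thesis
        using gs(2) gs(5)[of i] act'[OF i] a base_change_action[OF a \<gamma>] is_action_ar(3-5)[OF a] M(5)[of i] \<gamma> i by (simp add: action_morphism_def)
    qed
  qed (rule gs)
  let ?g = "Arrow E' gs E"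
  have gA: "?g \<in> Ar XE" using E E' gm by (simp add: xext_ar)
  have "cartesian XE C Pi0 ?g"
    unfolding cartesian_def
  proof (intro conjI ballI impI gA)
    fix h u assume h: "h \<in> Ar XE" and u: "u \<in> hom C (omap Pi0 (Dom XE h)) (omap Pi0 (Dom XE ?g))"
      and hg: "Cod XE h = Cod XE ?g \<and> amap Pi0 ?g \<cdot> u = amap Pi0 h"
    let ?E = "src h" and ?hs = "comps h"
    have h': "xext ?E" "xext_morphism C n ?E ?hs E" "tgt h = E" using h hg by (auto simp: xext_ar)
    note H = xext_morphismD[OF h'(2)] and M'' = xext_maps[OF h'(1)] and A'' = xext_actions[OF h'(1)]
    have u': "u \<in> Ar C" "Dom C u = ob ?E 0" "Cod C u = Dom C \<gamma>" "\<gamma> \<cdot> u = ?hs ! 0"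
      using u hg ob' gs by simp_all
    define pp where "pp = x_maps ?E ! 0"
    define dd where "dd = x_maps ?E ! 1"
    define h1 where "h1 = ?hs ! 1"
    define h2 where "h2 = ?hs ! 2"
    have M0'': "pp \<in> Ar C" "Dom C pp = ob ?E 1" "Cod C pp = ob ?E 0" "dd \<in> Ar C" "Dom C dd = ob ?E 2" "Cod C dd = ob ?E 1"
      "ob ?E 2 \<in> Ob C" "ob ?E 1 \<in> Ob C" "ob ?E 0 \<in> Ob C" "pp \<cdot> dd = zero (ob ?E 2) (ob ?E 0)"
      using M''(2-4)[of 0] M''(2-4)[of 1] M''(5)[of 0] M''(5)[of 1] M''(5)[of 2] xext_exact(5)[OF h'(1), of 1] n
      by (simp_all add: pp_def dd_def numeral_2_eq_2)
    have H0: "h1 \<in> Ar C" "Dom C (h1) = ob ?E 1" "Cod C (h1) = ob E 1"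
      "h2 \<in> Ar C" "Dom C (h2) = ob ?E 2" "Cod C (h2) = ob E 2"
      "?hs ! 0 \<cdot> pp = p \<cdot> h1" "h1 \<cdot> dd = d \<cdot> h2"
      using H(2-4)[of 1] H(2-4)[of 2] H(5)[of 0] H(5)[of 1] n
      by (simp_all add: h1_def h2_def p_def d_def pp_def dd_def numeral_2_eq_2)
    have "p \<cdot> h1 = \<gamma> \<cdot> (u \<cdot> pp)"
      using u' \<gamma> M0'' by (simp add: H0(7)[symmetric] u'(4)[THEN rw])
    \<comment> \<open>Only the component at \<open>G\<^sub>1\<close> needs a construction; from
      \<open>G\<^sub>2\<close> on the lift consists of identities, so the components are those of
      \<open>h\<close>.\<close>
    then obtain l where l: "l \<in> Ar C" "Dom C l = Dom C (h1)" "Cod C l = Dom C r" "r \<cdot> l = h1" "p' \<cdot> l = u \<cdot> pp"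
      using u' M0'' H0(1-6) ar by - (rule pullback_lift[OF pb, of "h1" "u \<cdot> pp"], simp_all)
    have l2: "Dom C l = ob ?E 1" using l H0 by simp
    define ws where "ws = ?hs[0 := u, 1 := l]"
    have ws: "length ws = n + 2" "ws ! 0 = u" "ws ! 1 = l" "ws ! Suc 0 = l" "2 \<le> i \<Longrightarrow> ws ! i = ?hs ! i" for i
      using H(1) by (simp_all add: ws_def)
    have wm: "xext_morphism C n ?E ws E'"
    proof (rule xext_morphismI)
      show "ws ! i \<in> Ar C \<and> Dom C (ws ! i) = ob ?E i \<and> Cod C (ws ! i) = ob E' i" if i: "i \<le> n + 1" for i
      proof -
        consider "i = 0" | "i = 1" | "2 \<le> i" by linarith
        then show ?thesis
          by cases (use ws ob' u' l l2 ob2[of i] H(2-4)[of i] i in simp_all)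
      qed
      show "ws ! i \<cdot> x_maps ?E ! i = x_maps E' ! i \<cdot> ws ! (i + 1)" if i: "i \<le> n" for i
      proof -
        consider "i = 0" | "i = 1" | "2 \<le> i" by linarith
        then show ?thesis
        proof cases
          case 1 then show ?thesis using ws maps' l(5) by (simp add: pp_def)
        next
          case 2
          have "l \<cdot> dd = d' \<cdot> h2"
            by (rule pullback_eq[OF pb])
              (use u' l(1,3) l2 M0'' H0(1-6) ar in \<open>simp_all add: l(4,5)[THEN rw] d'(4,5)[THEN rw] H0(8)\<close>)
          then show ?thesis using 2 ws(3,4) ws(5)[of 2] maps' by (simp add: dd_def h2_def numeral_2_eq_2)
        next
          case 3 then show ?thesis using ws(5)[of i] ws(5)[of "i + 1"] maps'(5)[of i] H(5)[OF i] by simp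
        qed
      qed
      note Hx = action_morphismD[OF H(6), folded h1_def h2_def]
      have "h2 \<cdot> x_xi ?E = x_xi E' \<cdot> fl l (h2)"
        unfolding xi' using Hx(5) l(1,3,4) l2 H0(1-6) xa rr ar by simp
      then show "action_morphism C (x_xi ?E) (x_xi E') (ws ! 1) (ws ! 2)"
        using ws(3,4) ws(5)[of 2] xiA A''(2) l(1,3) l2 H0(1-6) by (simp add: action_morphism_def h2_def)
      show "action_morphism C (x_act ?E i) (x_act E' i) (ws ! 0) (ws ! i)" if i: "3 \<le> i" "i \<le> n + 1" for i
      proof -
        note Hi = action_morphismD[OF H(7)[OF i]]
        have a: "is_action C (ob E 0) (ob E i) (x_act E i)" using A(3)[OF i] by (rule is_module_ob)
        note aa = is_action_ar(3-5)[OF a]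
        have hi: "?hs ! i \<in> Ar C" "Dom C (?hs ! i) = ob ?E i" "Cod C (?hs ! i) = ob E i" "ob E i \<in> Ob C"
          using H(2-4)[of i] M(5)[of i] i by simp_all
        have "?hs ! i \<cdot> x_act ?E i = x_act E' i \<cdot> fl u (?hs ! i)"
          unfolding act'[OF i] using Hi(5) u' hi aa \<gamma> by simp
        then show ?thesis
          using ws(2) ws(5)[of i] base_change_action[OF a \<gamma>] act'[OF i] is_module_ob(3)[OF A''(3)[OF i]] u' hi i
          by (simp add: action_morphism_def)
      qed
    qed (rule ws)
    have gw: "xcomp gs ws = ?hs"
    proof (rule nth_equalityI)
      show "length (xcomp gs ws) = length ?hs" using gs(1) ws(1) H(1) by simp
      fix i assume "i < length (xcomp gs ws)"
      then have i: "i < n + 2" using gs(1) ws(1) by simp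
      consider "i = 0" | "i = 1" | "2 \<le> i" by linarith
      then show "xcomp gs ws ! i = ?hs ! i"
        by cases (use gs ws u' l H(2-4)[of i] i h1_def in simp_all)
    qed
    show "\<exists>!w. w \<in> hom XE (Dom XE h) (Dom XE ?g) \<and> amap Pi0 w = u \<and> Comp XE ?g w = h"
    proof (rule ex1I[where a = "Arrow ?E ws E'"])
      show "Arrow ?E ws E' \<in> hom XE (Dom XE h) (Dom XE ?g) \<and> amap Pi0 (Arrow ?E ws E') = u \<and> Comp XE ?g (Arrow ?E ws E') = h"
        using h' E' wm ws(2) gw by (simp add: hom_def xext_ar arrow.expand[of _ h])
      fix w assume w: "w \<in> hom XE (Dom XE h) (Dom XE ?g) \<and> amap Pi0 w = u \<and> Comp XE ?g w = h"
      then have w': "src w = ?E" "tgt w = E'" "xext_morphism C n ?E (comps w) E'" "comps w ! 0 = u"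
        by (auto simp: hom_def xext_ar)
      note W = xext_morphismD[OF w'(3)]
      have "comps (Comp XE ?g w) = ?hs" using w by simp
      then have gw': "xcomp gs (comps w) = ?hs" by simp
      have "comps w = ws"
      proof (rule nth_equalityI)
        show "length (comps w) = length ws" using W(1) ws(1) by simp
        fix i assume "i < length (comps w)"
        then have i: "i < n + 2" using W(1) by simp
        have gi: "gs ! i \<cdot> comps w ! i = ?hs ! i" using i gs(1) W(1) xcomp(2)[of "comps w" gs i] gw' by simp
        consider "i = 0" | "i = 1" | "2 \<le> i" by linarith
        then show "comps w ! i = ws ! i"
        proof cases
          case 1 then show ?thesis using w' ws by simp
        next
          case 2
          have "comps w ! 1 = l"
          proof (rule pullback_eq[OF pb])
            show "r \<cdot> comps w ! 1 = r \<cdot> l" using gi 2 gs l by (simp add: h1_def)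
            show "p' \<cdot> comps w ! 1 = p' \<cdot> l" using W(5)[of 0] maps' w' l by (simp add: pp_def)
          qed (use W(2-4)[of 1] l l2 ob' in simp_all)
          then show ?thesis using 2 ws by simp
        next
          case 3 then show ?thesis using gi gs(5)[of i] ws(5)[of i] W(2,4)[of i] ob2[of i] i by simp
        qed
      qed
      then show "w = Arrow ?E ws E'" using w' by (simp add: arrow.expand)
    qed
  qed
  then show ?thesis by (rule that) (use gs gs(5)[of "n + 1"] ob' n in simp_all)
qed

lemma xext_fibration: "fibration XE C Pi0"
  unfolding fibration_def
proof (intro conjI ballI impI Pi0_functor)
  fix E \<gamma> assume a: "E \<in> Ob XE" "\<gamma> \<in> Ar C" "Cod C \<gamma> = omap Pi0 E"
  obtain g where "cartesian XE C Pi0 g" "tgt g = E" "comps g ! 0 = \<gamma>"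
    by (rule xext_cartesian_lift[of E \<gamma>]) (use a in simp_all)
  then show "\<exists>g. cartesian XE C Pi0 g \<and> Cod XE g = E \<and> amap Pi0 g = \<gamma>" by auto
qed

text \<open>An arbitrary cartesian arrow differs by an isomorphism from the constructed lift, whose
  module component is an identity. Hence its own module component is invertible.\<close>

lemma Pi_preserves_cartesian:
  assumes f: "cartesian XE C Pi0 f" shows "cartesian Mod C mod_proj (amap Pi f)"
proof (rule mod_cartesian)
  have fa: "f \<in> Ar XE" using f by (simp add: cartesian_def)
  then show "amap Pi f \<in> Ar Mod" using Pi_functor unfolding is_functor_def hom_def by blast
  have f': "xext (src f)" "xext (tgt f)" "xext_morphism C n (src f) (comps f) (tgt f)" using fa by (simp_all add: xext_ar)
  note F = xext_morphismD[OF f'(3)]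
  obtain g where g: "cartesian XE C Pi0 g" "tgt g = tgt f" "comps g ! 0 = comps f ! 0"
    "comps g ! (n + 1) = Idt C (ob (tgt f) (n + 1))" "ob (src g) 0 = Dom C (comps f ! 0)"
    by (rule xext_cartesian_lift[OF f'(2), of "comps f ! 0"]) (use F(2,4)[of 0] in simp_all)
  obtain w w' where w: "w \<in> Ar XE" "Dom XE w = Dom XE f" "Cod XE w = Dom XE g" "w' \<in> Ar XE" "Dom XE w' = Dom XE g"
    "Cod XE w' = Dom XE f" "Comp XE g w = f" "Comp XE w' w = Idt XE (Dom XE f)" "Comp XE w w' = Idt XE (Dom XE g)"
    by (rule cartesian_comparison[OF Pi0_functor f g(1)]) (use g F(3)[of 0] in simp_all)
  have wm: "xext_morphism C n (src f) (comps w) (src g)" "xext_morphism C n (src g) (comps w') (src f)"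
    using w(1-6) by (simp_all add: xext_ar)
  have ga: "xext_morphism C n (src g) (comps g) (tgt f)" using g(1,2) by (simp add: cartesian_def xext_ar)
  note W = xext_morphismD[OF wm(1)] and W' = xext_morphismD[OF wm(2)] and G = xext_morphismD[OF ga]
  have c: "xcomp (comps g) (comps w) = comps f" "xcomp (comps w') (comps w) = xid (src f)" "xcomp (comps w) (comps w') = xid (src g)"
    using arg_cong[OF w(7), of comps] arg_cong[OF w(8), of comps] arg_cong[OF w(9), of comps] by simp_all
  have e: "comps g ! (n + 1) \<cdot> comps w ! (n + 1) = comps f ! (n + 1)"
    "comps w' ! (n + 1) \<cdot> comps w ! (n + 1) = Idt C (ob (src f) (n + 1))"
    "comps w ! (n + 1) \<cdot> comps w' ! (n + 1) = Idt C (ob (src g) (n + 1))"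
    using xcomp(2)[OF W(1) G(1), of "n + 1"] xcomp(2)[OF W(1) W'(1), of "n + 1"] xcomp(2)[OF W'(1) W(1), of "n + 1"]
    by (simp_all add: c)
  have "Dom C (comps g ! (n + 1)) = ob (src g) (n + 1)" using G(3)[of "n + 1"] by simp
  then have og: "ob (src g) (n + 1) = ob (tgt f) (n + 1)" using g(4) xext_maps(5)[OF f'(2), of "n + 1"] by simp
  have "comps w ! (n + 1) = comps f ! (n + 1)" using e(1) g(4) W(2,4)[of "n + 1"] og by simp
  moreover have "is_iso C (comps w ! (n + 1))"
    by (rule isoI[where g = "comps w' ! (n + 1)"]) (use e W(2-4)[of "n + 1"] W'(2-4)[of "n + 1"] in simp_all)
  ultimately show "is_iso C (snd (comps (amap Pi f)))" by simp
qed

lemma Pi_fib_morphism: "fib_morphism C XE Pi0 Mod mod_proj Pi"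
  unfolding fib_morphism_def
  using xext_fibration mod_fibration Pi_functor Pi_preserves_cartesian
  by (simp add: functor_eq_def xext_Pi0_def)


section \<open>Opcartesian lifts\<close>

text \<open>The object \<open>A\<^sub>n\<close> carries an action of \<open>G\<^sub>1\<close> if \<open>n = 2\<close> and of \<open>C\<close> otherwise.\<close>

definition topbase :: "'a xext \<Rightarrow> 'o" where "topbase E = (if n = 2 then ob E 1 else ob E 0)"
text \<open>Restriction along this arrow gives \<open>C\<close>-modules an action of
  \<open>topbase E\<close>, so that the pushforward treats \<open>n = 2\<close> and
  \<open>n > 2\<close> alike.\<close>

definition topmap :: "'a xext \<Rightarrow> 'a" where "topmap E = (if n = 2 then x_maps E ! 0 else Idt C (ob E 0))"
definition topact :: "'a xext \<Rightarrow> 'a" where "topact E = (if n = 2 then x_xi E else x_act E n)"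

lemma top_cases:
  "n = 2 \<Longrightarrow> topbase E = ob E 1" "n = 2 \<Longrightarrow> topmap E = x_maps E ! 0" "n = 2 \<Longrightarrow> topact E = x_xi E"
  "n \<noteq> 2 \<Longrightarrow> topbase E = ob E 0" "n \<noteq> 2 \<Longrightarrow> topmap E = Idt C (ob E 0)" "n \<noteq> 2 \<Longrightarrow> topact E = x_act E n"
  unfolding topbase_def topmap_def topact_def by simp_all

lemma topmap:
  assumes "xext E"
  shows "topmap E \<in> Ar C" "Dom C (topmap E) = topbase E" "Cod C (topmap E) = ob E 0" "topbase E \<in> Ob C"
  using xext_maps(2-4)[OF assms, of 0] xext_maps(5)[OF assms, of 0] xext_maps(5)[OF assms, of 1]
  by (simp_all add: topmap_def topbase_def)

lemma topact: "xext E \<Longrightarrow> is_action C (topbase E) (ob E n) (topact E)"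
  using xext_actions(2)[of E] xext_actions(3)[of E n] n by (auto simp: topbase_def topact_def is_module_def)

text \<open>For \<open>n = 2\<close> the arrow factors through the kernel of
  \<open>\<partial>\<close>, where the induced action restricted along \<open>p\<close> is that of
  \<open>x_xi\<close>. For \<open>n > 2\<close> it is the equivariance of \<open>j\<close> as a map
  of modules.\<close>

lemma top_equivariant:
  assumes "xext E"
  shows "x_maps E ! n \<cdot> (x_act E (n + 1) \<cdot> fl (topmap E) (Idt C (ob E (n + 1)))) =
    topact E \<cdot> fl (Idt C (topbase E)) (x_maps E ! n)"
proof -
  note M = xext_maps[OF assms] and A = xext_actions[OF assms] and T = topmap[OF assms]
  let ?j = "x_maps E ! n" and ?b = "x_act E (n + 1)"
  have j: "?j \<in> Ar C" "Dom C ?j = ob E (n + 1)" "Cod C ?j = ob E n" using M(2-4)[of n] by simp_all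
  have b: "?b \<in> Ar C" "Dom C ?b = flat_ob C (ob E 0) (ob E (n + 1))" "Cod C ?b = ob E (n + 1)" "ob E (n + 1) \<in> Ob C" "ob E 0 \<in> Ob C"
    using is_action_ar[OF is_module_ob(3)[OF A(3)[of "n + 1"]]] n by simp_all
  show ?thesis
  proof (cases "n = 2")
    case True
    obtain k \<phi> e where k: "induced_action C (x_maps E ! 0) (x_maps E ! 1) (x_xi E) k \<phi>" "e \<in> hom C (ob E 3) (Dom C k)"
      "x_maps E ! 2 = k \<cdot> e" "action_morphism C (x_act E 3) \<phi> (Idt C (ob E 0)) e" using A(6) by blast
    have k': "is_kernel C k (x_maps E ! 1)" "k \<cdot> \<phi> \<cdot> fl (x_maps E ! 0) (Idt C (Dom C k)) = x_xi E \<cdot> fl (Idt C (ob E 1)) k"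
      using k(1) M(4)[of 1] n by (simp_all add: induced_action_def)
    note K = kernel_ar[OF k'(1)] and Am = action_morphismD[OF k(4)]
    define p where "p = x_maps E ! 0"
    define G where "G = ob E 1"
    define K' where "K' = Dom C k"
    have p: "p \<in> Ar C" "Dom C p = G" "Cod C p = ob E 0" "G \<in> Ob C" using M(2-4)[of 0] M(5)[of 1] by (simp_all add: p_def G_def)
    have e: "e \<in> Ar C" "Dom C e = ob E 3" "Cod C e = K'" using k(2) by (simp_all add: K'_def)
    have b3: "x_act E 3 \<in> Ar C" "Dom C (x_act E 3) = flat_ob C (ob E 0) (ob E 3)" "Cod C (x_act E 3) = ob E 3" "ob E 3 \<in> Ob C"
      using b True by simp_all
    have ke: "k \<in> Ar C" "Dom C k = K'" "Cod C k = ob E 2" "K' \<in> Ob C"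
      using K M(3)[of 1] n by (simp_all add: K'_def numeral_2_eq_2)
    have F: "\<phi> \<in> Ar C" "Dom C \<phi> = flat_ob C (ob E 0) K'" "Cod C \<phi> = K'" using Am(9-11) e(3) b(5) by simp_all
    have xi: "x_xi E \<in> Ar C" "Dom C (x_xi E) = flat_ob C G (ob E 2)" "Cod C (x_xi E) = ob E 2"
      using is_action_ar[OF A(2)] by (simp_all add: G_def)
    have "(k \<cdot> e) \<cdot> (x_act E 3 \<cdot> fl p (Idt C (ob E 3))) = k \<cdot> ((e \<cdot> x_act E 3) \<cdot> fl p (Idt C (ob E 3)))"
      using ke e b3 p b(5) by simp
    also have "\<dots> = (k \<cdot> \<phi> \<cdot> fl p (Idt C K')) \<cdot> fl (Idt C G) e"
      unfolding Am(5) using ke e b3 p b(5) F by simp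
    also have "\<dots> = x_xi E \<cdot> fl (Idt C G) (k \<cdot> e)"
      unfolding k'(2)[folded p_def G_def K'_def] using ke e p b(5) xi by simp
    finally show ?thesis
      using top_cases(1-3)[OF True, of E] True k(3) by (simp add: p_def G_def)
  next
    case False
    then have "3 \<le> n" using n by simp
    from action_morphismD(5)[OF A(5)[OF this order.refl]] show ?thesis
      using False j b by (simp add: topmap_def topact_def topbase_def)
  qed
qed

text \<open>Centrality has two sources: the Peiffer identity for \<open>n = 2\<close>, addition in
  the abelian object \<open>G\<^sub>n\<close> otherwise.\<close>

lemma top_coop:
  assumes "xext E"
  obtains \<rho> where "coop (ob E n) (ob E (n + 1)) (x_maps E ! n) \<rho>"
proof (cases "n = 2")
  case True
  note M = xext_maps[OF assms]
  have "Dom C (x_maps E ! 1) = ob E 2" "Dom C (x_maps E ! 2) = ob E 3" "x_maps E ! 2 \<in> Ar C" "Cod C (x_maps E ! 2) = ob E 2"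
    "x_maps E ! 1 \<cdot> x_maps E ! 2 = zero (ob E 3) (ob E 1)" "Cod C (x_maps E ! 1) = ob E 1"
    using M(3,4)[of 1] M(2-4)[of 2] xext_exact(5)[OF assms, of 2] n by (simp_all add: numeral_2_eq_2 numeral_3_eq_3)
  note facts = this
  obtain \<rho> where "coop (Dom C (x_maps E ! 1)) (Dom C (x_maps E ! 2)) (x_maps E ! 2) \<rho>"
    by (rule crossed_module_kernel_coop[OF xext_actions(1)[OF assms], of "x_maps E ! 2"]) (use facts in simp_all)
  then have "coop (ob E 2) (ob E 3) (x_maps E ! 2) \<rho>" by (simp only: facts)
  then show ?thesis by - (rule that[of \<rho>], (use True in simp))
next
  case False
  then have "abelian_object C (ob E n)" using xext_actions(3)[OF assms, of n] n by (simp add: is_module_def)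
  then obtain m v where "abgroup (ob E n) m v" by (rule abelian_objectE)
  from abgroup_coop[OF this xext_maps(2,4,3)[OF assms]] show ?thesis by (intro that) simp_all
qed

text \<open>The component at \<open>G\<^sub>n\<close> is equivariant along the component at
  \<open>G\<^sub>1\<close> or at \<open>C\<close>. The equation for \<open>topmap\<close> expresses
  that the morphism lies over the identity of \<open>C\<close>.\<close>

lemma top_morphism:
  assumes E: "xext E" and E': "xext E'" and f: "xext_morphism C n E fs E'" and 0: "fs ! 0 = Idt C (ob E 0)"
  obtains g where "g \<in> Ar C" "Dom C g = topbase E" "Cod C g = topbase E'" "fs ! n \<cdot> topact E = topact E' \<cdot> fl g (fs ! n)"
    "topmap E' \<cdot> g = topmap E" "n = 2 \<longrightarrow> g = fs ! 1" "n \<noteq> 2 \<longrightarrow> g = fs ! 0"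
proof (cases "n = 2")
  case True
  note F = xext_morphismD[OF f]
  have "x_maps E' ! 0 \<cdot> fs ! 1 = x_maps E ! 0" using F(5)[of 0] 0 xext_maps(2,4)[OF E, of 0] by simp
  then show ?thesis
    by (intro that[of "fs ! 1"])
      (use F(2-4)[of 1] action_morphismD(5)[OF F(6)] True top_cases(1-3)[OF True, of E] top_cases(1-3)[OF True, of E']
       in simp_all)
next
  case False
  note F = xext_morphismD[OF f]
  have o: "ob E' 0 = ob E 0" using F(4)[of 0] 0 xext_maps(5)[OF E, of 0] by simp
  show ?thesis
    by (rule that[of "fs ! 0"])
      (use F(2-4)[of 0] action_morphismD(5)[OF F(7)[of n]] False n 0 o xext_maps(5)[OF E, of 0]
       in \<open>simp_all add: topbase_def topact_def topmap_def\<close>)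
qed

text \<open>The universal property is tested only against morphisms over the identity of
  \<open>C\<close>, as opcartesianness inside a fiber requires. It is phrased with component lists,
  to be packaged as arrows afterwards.\<close>

lemma xext_opcartesian_lift:
  assumes E: "xext E" and N: "is_module C (ob E 0) B' \<phi>'"
    and \<beta>: "\<beta> \<in> Ar C" "Dom C \<beta> = ob E (n + 1)" "Cod C \<beta> = B'"
    and am: "action_morphism C (x_act E (n + 1)) \<phi>' (Idt C (ob E 0)) \<beta>"
  obtains E' fs where "xext E'" "xext_morphism C n E fs E'" "ob E' 0 = ob E 0" "ob E' (n + 1) = B'" "x_act E' (n + 1) = \<phi>'"
    "fs ! 0 = Idt C (ob E 0)" "fs ! (n + 1) = \<beta>"
    "\<And>E'' hs u. xext E'' \<Longrightarrow> xext_morphism C n E hs E'' \<Longrightarrow> hs ! 0 = Idt C (ob E 0) \<Longrightarrow>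
       u \<in> Ar C \<Longrightarrow> Dom C u = B' \<Longrightarrow> Cod C u = ob E'' (n + 1) \<Longrightarrow>
       action_morphism C \<phi>' (x_act E'' (n + 1)) (Idt C (ob E 0)) u \<Longrightarrow> u \<cdot> \<beta> = hs ! (n + 1) \<Longrightarrow>
       \<exists>!ws. xext_morphism C n E' ws E'' \<and> ws ! 0 = Idt C (ob E 0) \<and> ws ! (n + 1) = u \<and> xcomp ws fs = hs"
proof -
  note M = xext_maps[OF E] and Ex = xext_exact[OF E] and A = xext_actions[OF E] and T = topmap[OF E]
  define c where "c = ob E 0"
  define G where "G = topbase E"
  define X where "X = ob E n"
  define B where "B = ob E (n + 1)"
  define j where "j = x_maps E ! n"
  define d where "d = x_maps E ! (n - 1)"
  define p where "p = topmap E"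
  define \<xi> where "\<xi> = topact E"
  define b where "b = x_act E (n + 1) \<cdot> fl p (Idt C B)"
  define \<phi> where "\<phi> = \<phi>' \<cdot> fl p (Idt C B')"
  have n1: "n - 1 + 1 = n" "Suc (n - 1) = n" "n - 1 \<le> n" "n - 1 \<noteq> n" "1 \<le> n - 1" "n - 1 < n + 1" using n by simp_all
  have pG: "p \<in> Ar C" "Dom C p = G" "Cod C p = c" "G \<in> Ob C" "c \<in> Ob C" using T M(5)[of 0] by (simp_all add: p_def G_def c_def)
  have x: "is_action C G X \<xi>" using topact[OF E] by (simp add: G_def X_def \<xi>_def)
  have b0: "is_action C c B (x_act E (n + 1))" using A(3)[of "n + 1"] n by (simp add: is_module_def c_def B_def)
  have f0: "is_action C c B' \<phi>'" and abB: "abelian_object C B'" using N by (simp_all add: is_module_def c_def)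
  note X0 = is_action_ar[OF x] and B0 = is_action_ar[OF b0] and F0 = is_action_ar[OF f0]
  have bb: "is_action C G B b" using base_change_action[OF b0 pG(1,3)] by (simp add: b_def pG)
  have \<phi>: "is_action C G B' \<phi>" using base_change_action[OF f0 pG(1,3)] by (simp add: \<phi>_def pG)
  obtain m v where ab: "abgroup B' m v" by (rule abelian_objectE[OF abB])
  have jm: "monic j" using Ex(1) by (simp add: j_def)
  obtain \<rho> where co: "coop X B j \<rho>" using top_coop[OF E] unfolding X_def B_def j_def .
  have jb: "j \<cdot> b = \<xi> \<cdot> fl (Idt C G) j"
    using top_equivariant[OF E] by (simp add: j_def b_def p_def B_def \<xi>_def G_def)
  have \<beta>': "Dom C \<beta> = B" using \<beta> by (simp add: B_def)
  have ame: "\<beta> \<cdot> x_act E (Suc n) = \<phi>' \<cdot> fl (Idt C c) \<beta>" using action_morphismD(5)[OF am] by (simp add: c_def)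
  have \<beta>b: "\<beta> \<cdot> b = \<phi> \<cdot> fl (Idt C G) \<beta>"
    unfolding b_def \<phi>_def using \<beta>(1,3) \<beta>' B0 F0 pG by (simp add: ame[THEN rw])
  note ctx = x bb \<phi> ab jm co jb \<beta>(1) \<beta>' \<beta>(3) \<beta>b
  obtain q \<omega> where push: "is_push G X B B' \<xi> \<phi> j \<beta> \<rho> m v q \<omega>" by (rule push_exists[OF ctx])
  note Q = push_facts[OF ctx push] and J = coop_ar[OF co]
  define Q' where "Q' = Cod C q"
  define f where "f = q \<cdot> in1 X B'"
  define j' where "j' = q \<cdot> in2 X B'"
  have Qo: "Q' \<in> Ob C" using Q by (simp add: Q'_def)
  have fa: "f \<in> Ar C" "Dom C f = X" "Cod C f = Q'" "j' \<in> Ar C" "Dom C j' = B'" "Cod C j' = Q'"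
    using Q J X0 F0 by (simp_all add: f_def j'_def Q'_def)
  have da: "d \<in> Ar C" "Dom C d = X" "Cod C d = ob E (n - 1)" "ob E (n - 1) \<in> Ob C"
    using M(2-4)[of "n - 1"] M(5)[of "n - 1"] n1 by (simp_all add: d_def X_def)
  have kd: "is_kernel C j d" using Ex(4) by (simp add: j_def d_def)
  have dj: "d \<cdot> j = zero B (ob E (n - 1))" using kernel_ar(4)[OF kd] J da by simp
  \<comment> \<open>An arrow out of \<open>X\<close> that kills \<open>j\<close> passes to the
    quotient by ignoring \<open>B'\<close>.\<close>
  have desc: "\<exists>w. w \<in> Ar C \<and> Dom C w = Q' \<and> Cod C w = Cod C g \<and> w \<cdot> q = g \<cdot> pr1 X B'"
    if g: "g \<in> Ar C" "Dom C g = X" "g \<cdot> j = zero B (Cod C g)" for g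
  proof -
    have "(g \<cdot> pr1 X B') \<cdot> \<langle>j, v \<cdot> \<beta>\<rangle> = zero B (Cod C (g \<cdot> pr1 X B'))"
      using g X0 F0 J abgroup_ar[OF ab] \<beta>(1,3) \<beta>' by simp
    then obtain w where "w \<in> Ar C" "Dom C w = Cod C q" "Cod C w = Cod C (g \<cdot> pr1 X B')" "w \<cdot> q = g \<cdot> pr1 X B'"
      using g X0 F0 by - (rule push_desc[OF ctx push, of "g \<cdot> pr1 X B'"], simp_all)
    then show ?thesis using g X0 F0 by (auto simp: Q'_def)
  qed
  obtain d' where d': "d' \<in> Ar C" "Dom C d' = Q'" "Cod C d' = ob E (n - 1)" "d' \<cdot> q = d \<cdot> pr1 X B'"
    using desc[OF da(1,2)] dj da by auto
  have qa: "q \<in> Ar C" "Dom C q = prd X B'" "Cod C q = Q'" using Q by (simp_all add: Q'_def)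
  have d'f: "d' \<cdot> f = d" "d' \<cdot> j' = zero B' (ob E (n - 1))"
    unfolding f_def j'_def using d'(1-3) qa da X0 F0 by (simp_all add: d'(4)[THEN rw])
  have kj: "is_kernel C j' d'"
    unfolding j'_def by (rule push_kernel[OF ctx push kd]) (use d' da in \<open>simp_all add: Q'_def\<close>)
  note eqv = push_equivariant[OF ctx push, folded f_def j'_def]
  have sq: "f \<cdot> j = j' \<cdot> \<beta>" using push_square[OF ctx push] by (simp only: f_def j'_def)
  have w\<omega>: "is_action C G Q' \<omega>" using Q(4) by (simp add: Q'_def)
  note W0 = is_action_ar[OF w\<omega>]
  \<comment> \<open>Only the last two maps change. The action on \<open>A\<^sub>i\<close> has list
    position \<open>i - 3\<close>, so those on the new \<open>G\<^sub>n\<close> and on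
    \<open>B'\<close> are at \<open>n - 3\<close> and \<open>n - 2\<close>. For \<open>n = 2\<close>
    the list has one entry and \<open>\<omega>\<close> belongs to the crossed module.\<close>
  define E' where "E' = \<lparr>x_maps = (x_maps E)[n - 1 := d', n := j'], x_xi = (if n = 2 then \<omega> else x_xi E),
    x_acts = (if n = 2 then [\<phi>'] else (x_acts E)[n - 3 := \<omega>, n - 2 := \<phi>'])\<rparr>"
  have maps': "x_maps E' ! n = j'" "x_maps E' ! (n - 1) = d'" "length (x_maps E') = n + 1"
    "i < n - 1 \<Longrightarrow> x_maps E' ! i = x_maps E ! i" for i
    using M(1) n by (simp_all add: E'_def)
  have ob': "ob E' n = Q'" "ob E' (n + 1) = B'" "i < n \<Longrightarrow> ob E' i = ob E i" for i
  proof -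
    show "ob E' n = Q'" using maps'(2) d' n by (simp add: x_ob_def)
    show "ob E' (n + 1) = B'" using maps'(1) fa by (simp add: x_ob_def)
    show "ob E' i = ob E i" if "i < n"
      using maps'(4)[of "i - 1"] maps'(4)[of 0] that n by (simp add: x_ob_def)
  qed
  have act': "x_act E' (n + 1) = \<phi>'" "n \<noteq> 2 \<Longrightarrow> x_act E' n = \<omega>" "3 \<le> i \<Longrightarrow> i < n \<Longrightarrow> x_act E' i = x_act E i" for i
  proof -
    have l: "length (x_acts E) = n - 1" by (rule A(4))
    show "x_act E' (n + 1) = \<phi>'" using l n by (cases "n = 2") (simp_all add: E'_def x_act_def)
    show "x_act E' n = \<omega>" if "n \<noteq> 2" using l n that by (simp add: E'_def x_act_def)
    show "x_act E' i = x_act E i" if "3 \<le> i" "i < n"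
    proof -
      have "i - 3 \<noteq> n - 3" "i - 3 \<noteq> n - 2" using that by simp_all
      then show ?thesis using that by (simp add: E'_def x_act_def)
    qed
  qed
  have xi': "n = 2 \<Longrightarrow> x_xi E' = \<omega>" "n \<noteq> 2 \<Longrightarrow> x_xi E' = x_xi E" by (simp_all add: E'_def)
  have top2: "G = ob E 1" "p = x_maps E ! 0" "\<xi> = x_xi E" if "n = 2"
    using top_cases(1-3)[OF that, of E] by (simp_all add: G_def p_def \<xi>_def)
  have top3: "G = c" "p = Idt C c" "\<xi> = x_act E n" if "n \<noteq> 2"
    using top_cases(4-6)[OF that, of E] by (simp_all add: G_def p_def \<xi>_def c_def)
  have \<phi>3: "\<phi> = \<phi>'" if "n \<noteq> 2" unfolding \<phi>_def top3(2)[OF that] using F0 by simp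
  have split: "i < n - 1 \<or> i = n - 1 \<or> i = n \<or> i = n + 1" if "i \<le> n + 1" for i using that by linarith
  \<comment> \<open>\<open>d'\<close> has the same image as \<open>d\<close>, because
    \<open>d' \<cdot> q = d \<cdot> pr1 X B'\<close> and both \<open>q\<close> and the projection
    are regular epimorphisms.\<close>
  have exd: "exact_at C d' (x_maps E ! (n - 2))"
  proof -
    have n2: "n - 1 - 1 = n - 2" by simp
    have "exact_at C d (x_maps E ! (n - 2))" using Ex(3)[of "n - 1"] n1 by (simp only: n2 d_def)
    then obtain e k where e: "regular_epi C e" "is_kernel C k (x_maps E ! (n - 2))" "Cod C e = Dom C k" "d = k \<cdot> e"
      unfolding exact_at_def by blast
    note K = kernel_ar[OF e(2)] and Ee = regular_epi_ar[OF e(1)]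
    define a where "a = x_maps E ! (n - 2)"
    have a: "a \<in> Ar C" "Dom C a = ob E (n - 1)" "Cod C a = ob E (n - 2)"
      using M(2-4)[of "n - 2"] n by (simp_all add: a_def Suc_diff_Suc numeral_2_eq_2)
    have ao: "ob E (n - 2) \<in> Ob C" "Dom C k \<in> Ob C" using M(5)[of "n - 2"] K by simp_all
    have ka: "k \<in> Ar C" "Cod C k = ob E (n - 1)" "a \<cdot> k = zero (Dom C k) (ob E (n - 2))" "is_kernel C k a"
      using K a e(2) by (simp_all add: a_def)
    have De: "Dom C e = X" using da(2) unfolding e(4) using ka Ee e(3) by simp
    have "a \<cdot> d' = zero Q' (ob E (n - 2))"
      by (rule epicD[OF regular_epi_epic[OF Q(1)]])
        (use a ao d' qa ka(1,2) Ee e(3) De X0 F0 Qo in \<open>simp_all add: e(4) ka(3)[THEN rw]\<close>)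
    then obtain t where t: "t \<in> Ar C" "Dom C t = Dom C d'" "Cod C t = Dom C k" "k \<cdot> t = d'"
      using a d' by - (rule kernel_lift[OF ka(4), of d'], simp_all)
    have "t \<cdot> q = e \<cdot> pr1 X B'"
      by (rule monicD[OF kernel_monic[OF ka(4)]])
        (use t(1-3) d' qa ka(1,2) Ee e(3) De X0 F0 in \<open>simp_all add: t(4)[THEN rw] e(4)\<close>)
    moreover have "regular_epi C (e \<cdot> pr1 X B')"
      by (rule regular_epi_comp[OF split_regular_epi_prd(1) e(1)]) (use De X0 F0 in simp_all)
    ultimately have "regular_epi C t" by - (rule regular_epi_cancel[of t q], (use t(1,2) d' qa in simp_all))
    then show ?thesis unfolding exact_at_def using ka(4) t(3,4)
      by (intro exI[where x = t] exI[where x = k]) (simp add: a_def)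
  qed
  have ex: "exact_sequence C n E'"
    unfolding exact_sequence_def
  proof (intro conjI allI impI ballI)
    show "x_maps E' ! i \<in> hom C (ob E' (i + 1)) (ob E' i)" if i: "i \<le> n" for i
    proof -
      consider "i < n - 1" | "i = n - 1" | "i = n" using i by linarith
      then show ?thesis
      proof cases
        case 1 then show ?thesis using maps'(4)[of i] ob'(3)[of i] ob'(3)[of "i + 1"] M(2-4)[of i] by simp
      next
        case 2 then show ?thesis using maps' ob' d' n1 by simp
      next
        case 3 then show ?thesis using maps' ob' fa by simp
      qed
    qed
    show "exact_at C (zero Z (ob E' (n + 1))) (x_maps E' ! n)"
      using exact_at_from_Z[of j' B'] kernel_monic[OF kj] fa maps' ob' by simp
    show "exact_at C (x_maps E' ! i) (x_maps E' ! (i - 1))" if i: "i \<in> {1..n}" for i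
    proof -
      consider "i < n - 1" | "i = n - 1" | "i = n" using i by force
      then show ?thesis
      proof cases
        case 1 then show ?thesis using maps'(4)[of i] maps'(4)[of "i - 1"] Ex(3)[of i] i by simp
      next
        case 2
        have "n - 1 - 1 < n - 1" using n by simp
        then show ?thesis using 2 maps'(2) maps'(4)[of "n - 1 - 1"] exd by (simp add: numeral_2_eq_2)
      next
        case 3 then show ?thesis using kernel_exact_at[OF kj] maps' by simp
      qed
    qed
    show "exact_at C (x_maps E' ! 0) (zero (ob E' 0) Z)"
      using exact_at_to_Z[of "x_maps E ! 0" "ob E 0"] Ex(2) M(2,4)[of 0] maps'(4)[of 0] ob'(3)[of 0] n by simp
  qed (rule maps')
  have d'\<omega>: "w \<cdot> \<omega> = \<tau> \<cdot> fl (Idt C G) w"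
    if "is_action C G D \<tau>" "g \<in> Ar C" "Dom C g = X" "Cod C g = D" "g \<cdot> \<xi> = \<tau> \<cdot> fl (Idt C G) g"
      "w \<in> Ar C" "Dom C w = Q'" "Cod C w = D" "w \<cdot> q = g \<cdot> pr1 X B'" for D \<tau> g w
    by (rule push_desc_equivariant[OF ctx push that(1-5)]) (use that in \<open>simp_all add: Q'_def\<close>)
  have E': "xext E'" unfolding crossed_extension_def
  proof (intro conjI ballI ex)
    show "crossed_module C (x_maps E' ! 1) (x_xi E')"
    proof (cases "n = 2")
      case True
      have cm: "crossed_module C d \<xi>" using A(1) True top2(3)[OF True] by (simp add: d_def)
      have pd: "p \<cdot> d = zero X c"
        using Ex(5)[of 1] True top2(2)[OF True] by (simp add: d_def X_def c_def numeral_2_eq_2)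
      have "crossed_module C d' \<omega>"
        by (rule push_crossed_module[OF ctx push cm da(2) _ pG(1-3) pd f0 \<phi>_def])
          (use d' da True top2(1)[OF True] in \<open>simp_all add: Q'_def\<close>)
      then show ?thesis using maps'(2) xi'(1) True by simp
    next
      case False then show ?thesis using maps'(4)[of 1] xi'(2) A(1) n by simp
    qed
    show "length (x_acts E') = n - 1" using A(4) n by (simp add: E'_def)
    show "is_module C (ob E' 0) (ob E' i) (x_act E' i)" if i: "i \<in> {3..n + 1}" for i
    proof -
      have o: "ob E' 0 = c" using ob'(3)[of 0] n by (simp add: c_def)
      consider "i < n" | "i = n" | "i = n + 1" using i by force
      then show ?thesis
      proof cases
        case 1 then show ?thesis using A(3)[of i] i ob'(3)[of i] act'(3)[of i] o by (simp add: c_def)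
      next
        case 2
        then have n3: "n \<noteq> 2" using i by simp
        \<comment> \<open>The new \<open>G\<^sub>n\<close> is abelian as a quotient of the product
          of two abelian objects.\<close>
        have "abelian_object C X" using A(3)[of n] 2 i by (simp add: is_module_def X_def)
        then obtain mX vX where abX: "abgroup X mX vX" by (rule abelian_objectE)
        obtain mP vP where abP: "abgroup (prd X B') mP vP" using abgroup_prd[OF abX ab] by blast
        obtain mQ vQ where "abgroup Q' mQ vQ" using abgroup_quotient[OF abP Q(1) qa(2,3)] by blast
        then show ?thesis
          using 2 ob' act'(2)[OF n3] w\<omega> top3(1)[OF n3] o abgroup_abelian_object by (simp add: is_module_def)
      next
        case 3 then show ?thesis using N ob' act' o by (simp add: c_def)
      qed
    qed
    show "equivariant C (ob E' 0) (x_act E' (i + 1)) (x_act E' i) (x_maps E' ! i)" if i: "i \<in> {3..n}" for i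
    proof -
      have n3: "n \<noteq> 2" using i by auto
      have o: "ob E' 0 = c" using ob'(3)[of 0] n by (simp add: c_def)
      have G: "G = c" by (rule top3(1)[OF n3])
      consider "i < n - 1" | "i = n - 1" | "i = n" using i by force
      then show ?thesis
      proof cases
        case 1 then show ?thesis
          using A(5)[of i] i act'(3)[of i] act'(3)[of "i + 1"] maps'(4)[of i] o by (simp add: equivariant_def c_def)
      next
        case 2
        have a: "is_action C c (ob E (n - 1)) (x_act E (n - 1))"
          using is_module_ob(3)[OF A(3)[of "n - 1"]] 2 i by (simp add: c_def)
        have e: "d \<cdot> \<xi> = x_act E (n - 1) \<cdot> fl (Idt C G) d"
          using action_morphismD(5)[OF A(5)[of "n - 1"]] 2 i top3[OF n3] n1 by (simp add: d_def c_def)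
        have "d' \<cdot> \<omega> = x_act E (n - 1) \<cdot> fl (Idt C G) d'"
          by (rule d'\<omega>[OF a[folded G] da(1-3) e d'])
        then have "action_morphism C \<omega> (x_act E (n - 1)) (Idt C c) d'"
          using a w\<omega> d' pG by (simp add: action_morphism_def G)
        then show ?thesis using 2 i act'(2)[OF n3] act'(3)[of "n - 1"] maps' o n1 by (simp add: equivariant_def)
      next
        case 3
        have "action_morphism C \<phi>' \<omega> (Idt C c) j'"
          using eqv(2) w\<omega> f0 fa pG \<phi>3[OF n3] by (simp add: action_morphism_def G)
        then show ?thesis using 3 act'(1) act'(2)[OF n3] maps' o by (simp add: equivariant_def)
      qed
    qed
    have o: "ob E' 0 = c" using ob'(3)[of 0] n by (simp add: c_def)
    \<comment> \<open>For \<open>n = 2\<close> the kernel of \<open>d'\<close> is \<open>j'\<close>,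
      with induced action \<open>\<phi>'\<close>. For \<open>n = 3\<close> the factorisation of
      \<open>d\<close> through the kernel of \<open>\<partial>\<close> descends to
      \<open>d'\<close>. For larger \<open>n\<close> this part of the sequence is unchanged.\<close>
    show "\<exists>k \<phi> e. induced_action C (x_maps E' ! 0) (x_maps E' ! 1) (x_xi E') k \<phi> \<and>
        e \<in> hom C (ob E' 3) (Dom C k) \<and> x_maps E' ! 2 = k \<cdot> e \<and> equivariant C (ob E' 0) (x_act E' 3) \<phi> e"
    proof (cases "n = 2")
      case True
      note t = top2[OF True]
      have m0: "x_maps E' ! 0 = p" "x_maps E' ! 1 = d'" "x_maps E' ! 2 = j'" "ob E' 3 = B'" "x_act E' 3 = \<phi>'" "x_xi E' = \<omega>"
        using maps'(1,2) maps'(4)[of 0] ob'(2) act'(1) xi'(1) True t by simp_all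
      have "Cod C d' = G" using d' t True by simp
      then have "induced_action C p d' \<omega> j' \<phi>'"
        unfolding induced_action_def using kj f0 fa pG eqv(2) F0 by (simp add: \<phi>_def)
      moreover have "equivariant C c \<phi>' \<phi>' (Idt C B')" unfolding equivariant_def by (rule action_morphism_Idt[OF f0])
      ultimately show ?thesis unfolding m0 o using fa F0
        by (intro exI[where x = j'] exI[where x = \<phi>'] exI[where x = "Idt C B'"]) simp
    next
      case False
      note t = top3[OF False]
      obtain k \<kappa> e where k: "induced_action C (x_maps E ! 0) (x_maps E ! 1) (x_xi E) k \<kappa>" "e \<in> hom C (ob E 3) (Dom C k)"
        "x_maps E ! 2 = k \<cdot> e" "action_morphism C (x_act E 3) \<kappa> (Idt C (ob E 0)) e" using A(6) by blast
      have m0: "x_maps E' ! 0 = x_maps E ! 0" "x_maps E' ! 1 = x_maps E ! 1" "x_xi E' = x_xi E"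
        using maps'(4)[of 0] maps'(4)[of 1] xi'(2) False n by simp_all
      show ?thesis
      proof (cases "n = 3")
        case True
        have k1: "is_kernel C k (x_maps E ! 1)" "is_action C c (Dom C k) \<kappa>" using k(1) M(4)[of 0] by (simp_all add: induced_action_def c_def)
        note K = kernel_ar[OF k1(1)]
        have dk: "d = k \<cdot> e" using k(3) True by (simp add: d_def)
        have ea: "e \<in> Ar C" "Dom C e = X" "Cod C e = Dom C k" using k(2) True by (simp_all add: X_def)
        have Dk: "Cod C k = ob E (n - 1)" using da(3) unfolding dk using K(1) ea by simp
        have "e \<cdot> j = zero B (Cod C e)"
          by (rule monicD[OF kernel_monic[OF k1(1)]]) (use dj K(1) ea J Dk in \<open>simp_all add: dk\<close>)
        then obtain w where w: "w \<in> Ar C" "Dom C w = Q'" "Cod C w = Cod C e" "w \<cdot> q = e \<cdot> pr1 X B'"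
          using desc[OF ea(1,2)] by blast
        have d'k: "d' = k \<cdot> w"
          by (rule epicD[OF regular_epi_epic[OF Q(1)]])
            (use d' w qa K(1) ea Dk X0 F0 in \<open>simp_all add: dk\<close>)
        have e\<xi>: "e \<cdot> \<xi> = \<kappa> \<cdot> fl (Idt C G) e"
          using action_morphismD(5)[OF k(4)] t True by (simp add: c_def)
        have "w \<cdot> \<omega> = \<kappa> \<cdot> fl (Idt C G) w"
          by (rule d'\<omega>[OF k1(2)[folded t(1)] ea e\<xi> w(1,2) _ w(4)]) (use w ea in simp)
        then have "equivariant C c \<omega> \<kappa> w"
          using w\<omega> k1(2) w ea pG t by (simp add: equivariant_def action_morphism_def)
        moreover have "x_act E' 3 = \<omega>" "ob E' 3 = Q'" "x_maps E' ! 2 = d'"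
          using act'(2)[OF False] ob'(1) maps'(2) True by simp_all
        ultimately show ?thesis unfolding m0 o using k(1) w ea d'k
          by (intro exI[where x = k] exI[where x = \<kappa>] exI[where x = w]) simp
      next
        case n4: False
        have "x_act E' 3 = x_act E 3" "ob E' 3 = ob E 3" "x_maps E' ! 2 = x_maps E ! 2"
          using act'(3)[of 3] ob'(3)[of 3] maps'(4)[of 2] False n4 n by simp_all
        then show ?thesis unfolding m0 o using k
          by (intro exI[where x = k] exI[where x = \<kappa>] exI[where x = e]) (simp add: equivariant_def c_def)
      qed
    qed
  qed
  define fs where "fs = (xid E)[n := f, n + 1 := \<beta>]"
  have fs: "length fs = n + 2" "fs ! n = f" "fs ! (n + 1) = \<beta>" "fs ! Suc n = \<beta>" "i < n \<Longrightarrow> fs ! i = Idt C (ob E i)" for i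
    by (simp_all add: fs_def)
  have fm: "xext_morphism C n E fs E'"
  proof (rule xext_morphismI)
    show "fs ! i \<in> Ar C \<and> Dom C (fs ! i) = ob E i \<and> Cod C (fs ! i) = ob E' i" if i: "i \<le> n + 1" for i
    proof -
      consider "i < n" | "i = n" | "i = n + 1" using i by linarith
      then show ?thesis
        by cases (use fs fs(5)[of i] ob' ob'(3)[of i] M(5)[of i] fa \<beta> in \<open>simp_all add: X_def\<close>)
    qed
    show "fs ! i \<cdot> x_maps E ! i = x_maps E' ! i \<cdot> fs ! (i + 1)" if i: "i \<le> n" for i
    proof -
      consider "i < n - 1" | "i = n - 1" | "i = n" using i by linarith
      then show ?thesis
      proof cases
        case 1 then show ?thesis using fs(5)[of i] fs(5)[of "i + 1"] maps'(4)[of i] M(2-4)[of i] by simp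
      next
        case 2
        have "fs ! (n - 1) \<cdot> d = d' \<cdot> fs ! n" using fs(2) fs(5)[of "n - 1"] n1 d'f da by simp
        then show ?thesis using 2 maps'(2) n1 by (simp add: d_def)
      next
        case 3 then show ?thesis using fs maps' sq by (simp add: j_def)
      qed
    qed
    show "action_morphism C (x_xi E) (x_xi E') (fs ! 1) (fs ! 2)"
    proof (cases "n = 2")
      case True
      have "action_morphism C \<xi> \<omega> (Idt C G) f" using x w\<omega> eqv(1) fa pG by (simp add: action_morphism_def)
      then show ?thesis using True fs(2) fs(5)[of 1] xi'(1) top2[OF True] by simp
    next
      case False then show ?thesis using action_morphism_Idt[OF A(2)] fs(5)[of 1] fs(5)[of 2] xi'(2) n by simp
    qed
    show "action_morphism C (x_act E i) (x_act E' i) (fs ! 0) (fs ! i)" if i: "3 \<le> i" "i \<le> n + 1" for i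
    proof -
      consider "i < n" | "i = n" | "i = n + 1" using i by linarith
      then show ?thesis
      proof cases
        case 1 then show ?thesis
          using action_morphism_Idt[OF is_module_ob(3)[OF A(3)[OF i]]] fs(5)[of 0] fs(5)[of i] act'(3)[of i] i by simp
      next
        case 2
        then have n3: "n \<noteq> 2" using i by simp
        have "action_morphism C \<xi> \<omega> (Idt C G) f" using x w\<omega> eqv(1) fa pG by (simp add: action_morphism_def)
        then show ?thesis using 2 fs(2) fs(5)[of 0] act'(2)[OF n3] top3[OF n3] n by (simp add: c_def)
      next
        case 3 then show ?thesis using am fs(4) fs(5)[of 0] act'(1) n by simp
      qed
    qed
  qed (rule fs)
  have univ: "\<exists>!ws. xext_morphism C n E' ws E'' \<and> ws ! 0 = Idt C (ob E 0) \<and> ws ! (n + 1) = u \<and> xcomp ws fs = hs"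
    if E'': "xext E''" and hm: "xext_morphism C n E hs E''" and h0: "hs ! 0 = Idt C (ob E 0)"
      and u: "u \<in> Ar C" "Dom C u = B'" "Cod C u = ob E'' (n + 1)"
      and um: "action_morphism C \<phi>' (x_act E'' (n + 1)) (Idt C (ob E 0)) u" and ub: "u \<cdot> \<beta> = hs ! (n + 1)" for E'' hs u
  proof -
    note H = xext_morphismD[OF hm] and M'' = xext_maps[OF E''] and A'' = xext_actions[OF E''] and T'' = topmap[OF E'']
    obtain g where g: "g \<in> Ar C" "Dom C g = topbase E" "Cod C g = topbase E''" "hs ! n \<cdot> topact E = topact E'' \<cdot> fl g (hs ! n)"
      "topmap E'' \<cdot> g = topmap E" "n = 2 \<longrightarrow> g = hs ! 1" "n \<noteq> 2 \<longrightarrow> g = hs ! 0" by (rule top_morphism[OF E E'' hm h0])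
    have o'': "ob E'' 0 = c" using H(4)[of 0] h0 pG by (simp add: c_def)
    let ?act = "x_act E'' (n + 1)" and ?B = "ob E'' (n + 1)" and ?X = "ob E'' n" and ?j = "x_maps E'' ! n"
    have md: "is_module C c ?B ?act" using A''(3)[of "n + 1"] n o'' by simp
    have b0'': "is_action C c ?B ?act" "abelian_object C ?B" using md by (simp_all add: is_module_def)
    note B'' = is_action_ar[OF b0''(1)]
    let ?b = "?act \<cdot> fl (topmap E'') (Idt C ?B)"
    have b'': "is_action C (topbase E'') ?B ?b" using base_change_action[OF b0''(1) T''(1)] T'' o'' by simp
    obtain m'' v'' where ab'': "abgroup ?B m'' v''" by (rule abelian_objectE[OF b0''(2)])
    obtain \<rho>'' where co'': "coop ?X ?B ?j \<rho>''" by (rule top_coop[OF E''])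
    have u\<phi>: "u \<cdot> \<phi> = ?b \<cdot> fl g u"
    proof -
      have uf: "u \<cdot> \<phi>' = ?act \<cdot> fl (Idt C c) u" using action_morphismD(5)[OF um] by (simp add: c_def)
      have "u \<cdot> \<phi> = ?act \<cdot> fl p u" unfolding \<phi>_def using u F0 pG B'' by (simp add: uf[THEN rw])
      also have "\<dots> = ?b \<cdot> fl g u"
        unfolding p_def g(5)[symmetric] using g(1-3) T'' o'' u B'' by simp
      finally show ?thesis .
    qed
    have hn: "hs ! n \<in> Ar C" "Dom C (hs ! n) = X" "Cod C (hs ! n) = ?X" using H(2-4)[of n] by (simp_all add: X_def)
    have h\<xi>: "hs ! n \<cdot> \<xi> = topact E'' \<cdot> fl g (hs ! n)" using g(4) by (simp add: \<xi>_def)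
    have hj: "hs ! n \<cdot> j = ?j \<cdot> (u \<cdot> \<beta>)" using H(5)[of n] by (simp add: j_def ub)
    obtain w where w: "w \<in> Ar C" "Dom C w = Cod C q" "Cod C w = ?X" "w \<cdot> (q \<cdot> in1 X B') = hs ! n" "w \<cdot> (q \<cdot> in2 X B') = ?j \<cdot> u"
      "w \<cdot> \<omega> = topact E'' \<cdot> fl g w"
      by (rule push_universal[OF ctx push topact[OF E''] b'' ab'' co'' top_equivariant[OF E''] g(1) _ g(3) hn u h\<xi> u\<phi> hj])
        (use g(2) in \<open>simp add: G_def\<close>)
    have w': "Dom C w = Q'" "w \<cdot> f = hs ! n" "w \<cdot> j' = ?j \<cdot> u" using w by (simp_all add: Q'_def f_def j'_def)
    let ?d = "x_maps E'' ! (n - 1)"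
    have d'': "?d \<in> Ar C" "Dom C ?d = ?X" "Cod C ?d = ob E'' (n - 1)" "?d \<cdot> ?j = zero ?B (ob E'' (n - 1))"
      using M''(2-4)[of "n - 1"] n1 xext_exact(5)[OF E'', of n] by simp_all
    have hn1: "hs ! (n - 1) \<in> Ar C" "Dom C (hs ! (n - 1)) = ob E (n - 1)" "Cod C (hs ! (n - 1)) = ob E'' (n - 1)"
      "hs ! (n - 1) \<cdot> d = ?d \<cdot> hs ! n"
      using H(2-5)[of "n - 1"] n1 by (simp_all add: d_def)
    have j'': "?j \<in> Ar C" "Dom C ?j = ?B" "Cod C ?j = ?X" using M''(2-4)[of n] by simp_all
    have dju: "?d \<cdot> (?j \<cdot> u) = zero B' (ob E'' (n - 1))"
    proof -
      have "?d \<cdot> (?j \<cdot> u) = (?d \<cdot> ?j) \<cdot> u" using d''(1-3) j'' u by simp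
      also have "\<dots> = zero B' (ob E'' (n - 1))"
        unfolding d''(4) using M''(5)[of "n - 1"] u by simp
      finally show ?thesis .
    qed
    \<comment> \<open>Tested on the two legs: on the old \<open>G\<^sub>n\<close> it is the
      commuting square of \<open>hs\<close>, on \<open>B'\<close> both sides vanish.\<close>
    have wd: "hs ! (n - 1) \<cdot> d' = ?d \<cdot> w"
    proof (rule push_epic[OF ctx push], unfold f_def[symmetric] j'_def[symmetric])
      show "(hs ! (n - 1) \<cdot> d') \<cdot> f = (?d \<cdot> w) \<cdot> f"
        using hn1 d' d'f fa d'' w(1,3) w' by simp
      show "(hs ! (n - 1) \<cdot> d') \<cdot> j' = (?d \<cdot> w) \<cdot> j'"
        using hn1(1-3) d' d'f fa d''(1-3) w(1,3) w' j'' u F0 dju by simp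
    qed (use hn1 d' d'' w in \<open>simp_all add: Q'_def\<close>)
    define ws where "ws = hs[n := w, n + 1 := u]"
    have ws: "length ws = n + 2" "ws ! n = w" "ws ! (n + 1) = u" "ws ! Suc n = u" "i < n \<Longrightarrow> ws ! i = hs ! i" for i
      using H(1) by (simp_all add: ws_def)
    have wm: "xext_morphism C n E' ws E''"
    proof (rule xext_morphismI)
      show "ws ! i \<in> Ar C \<and> Dom C (ws ! i) = ob E' i \<and> Cod C (ws ! i) = ob E'' i" if i: "i \<le> n + 1" for i
      proof -
        consider "i < n" | "i = n" | "i = n + 1" using i by linarith
        then show ?thesis
          by cases (use ws ws(5)[of i] ob' ob'(3)[of i] H(2-4)[of i] w(1,3) w' u in simp_all)
      qed
      show "ws ! i \<cdot> x_maps E' ! i = x_maps E'' ! i \<cdot> ws ! (i + 1)" if i: "i \<le> n" for i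
      proof -
        consider "i < n - 1" | "i = n - 1" | "i = n" using i by linarith
        then show ?thesis
        proof cases
          case 1 then show ?thesis using ws(5)[of i] ws(5)[of "i + 1"] maps'(4)[of i] H(5)[OF i] by simp
        next
          case 2
          have "ws ! (n - 1) \<cdot> d' = ?d \<cdot> ws ! n" using ws(2) ws(5)[of "n - 1"] n1 wd by simp
          then show ?thesis using 2 maps'(2) n1 by simp
        next
          case 3 then show ?thesis using ws maps' w' by simp
        qed
      qed
      show "action_morphism C (x_xi E') (x_xi E'') (ws ! 1) (ws ! 2)"
      proof (cases "n = 2")
        case True
        have "action_morphism C \<omega> (topact E'') g w"
          using w\<omega> topact[OF E''] w(1,3,6) w' g(1-3) by (simp add: action_morphism_def G_def)
        then show ?thesis using True ws(2) ws(5)[of 1] xi'(1) g(6) top_cases(3)[OF True, of E''] by simp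
      next
        case False then show ?thesis using H(6) ws(5)[of 1] ws(5)[of 2] xi'(2) n by simp
      qed
      show "action_morphism C (x_act E' i) (x_act E'' i) (ws ! 0) (ws ! i)" if i: "3 \<le> i" "i \<le> n + 1" for i
      proof -
        have ws0: "ws ! 0 = hs ! 0" using ws(5)[of 0] n by simp
        consider "i < n" | "i = n" | "i = n + 1" using i by linarith
        then show ?thesis
        proof cases
          case 1 then show ?thesis using H(7)[OF i] ws(5)[of i] ws0 act'(3)[of i] i by simp
        next
          case 2
          then have n3: "n \<noteq> 2" using i by simp
          have "action_morphism C \<omega> (topact E'') g w"
            using w\<omega> topact[OF E''] w(1,3,6) w' g(1-3) by (simp add: action_morphism_def G_def)
          then show ?thesis using 2 n3 ws(2) ws0 act'(2)[OF n3] mp[OF g(7) n3] by (simp add: topact_def)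
        next
          case 3 then show ?thesis using um ws(4) ws0 h0 act'(1) by simp
        qed
      qed
    qed (rule ws)
    show ?thesis
    proof (rule ex1I[where a = ws])
      have "xcomp ws fs = hs"
      proof (rule nth_equalityI)
        show "length (xcomp ws fs) = length hs" using ws(1) fs(1) H(1) by simp
        fix i assume "i < length (xcomp ws fs)"
        then have i: "i < n + 2" using ws(1) fs(1) by simp
        have e: "xcomp ws fs ! i = ws ! i \<cdot> fs ! i" using i ws(1) fs(1) by simp
        consider "i < n" | "i = n" | "i = n + 1" using i by linarith
        then show "xcomp ws fs ! i = hs ! i" unfolding e
          by cases (use ws ws(5)[of i] fs fs(5)[of i] H(2-4)[of i] i w' ub in simp_all)
      qed
      then show "xext_morphism C n E' ws E'' \<and> ws ! 0 = Idt C (ob E 0) \<and> ws ! (n + 1) = u \<and> xcomp ws fs = hs"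
        using wm ws ws(5)[of 0] h0 n by simp
      fix zs assume zs: "xext_morphism C n E' zs E'' \<and> zs ! 0 = Idt C (ob E 0) \<and> zs ! (n + 1) = u \<and> xcomp zs fs = hs"
      then have z: "xext_morphism C n E' zs E''" "zs ! (n + 1) = u" "xcomp zs fs = hs" by simp_all
      note Zm = xext_morphismD[OF z(1)]
      have e: "zs ! i \<cdot> fs ! i = hs ! i" if "i < n + 2" for i
        using xcomp(2)[OF fs(1) Zm(1) that] z(3) by simp
      show "zs = ws"
      proof (rule nth_equalityI)
        show "length zs = length ws" using Zm(1) ws(1) by simp
        fix i assume "i < length zs"
        then have i: "i < n + 2" using Zm(1) by simp
        consider "i < n" | "i = n" | "i = n + 1" using i by linarith
        then show "zs ! i = ws ! i"
        proof cases
          case 1 then show ?thesis using e[OF i] fs(5)[of i] ws(5)[of i] Zm(2,3)[of i] ob'(3)[of i] by simp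
        next
          case 2
          have zn: "zs ! n \<in> Ar C" "Dom C (zs ! n) = Q'" "Cod C (zs ! n) = ?X" using Zm(2-4)[of n] ob' by simp_all
          \<comment> \<open>The two legs are jointly epic and both composites are prescribed: by
            \<open>hs\<close> on the old \<open>G\<^sub>n\<close>, and by the square with
            \<open>u\<close> on \<open>B'\<close>.\<close>
          have "zs ! n = w"
          proof (rule push_epic[OF ctx push], unfold f_def[symmetric] j'_def[symmetric])
            show "zs ! n \<cdot> f = w \<cdot> f" using e[of n] fs(2) w' by simp
            show "zs ! n \<cdot> j' = w \<cdot> j'" using Zm(5)[of n] maps'(1) z(2) w' by simp
          qed (use zn w in \<open>simp_all add: Q'_def\<close>)
          then show ?thesis using 2 ws by simp
        next
          case 3 then show ?thesis using z(2) ws by simp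
        qed
      qed
    qed
  qed
  show ?thesis
    by (rule that[OF E' fm _ _ act'(1) _ fs(3) univ]) (use ob' ob'(3)[of 0] fs(5)[of 0] n in simp_all)
qed

text \<open>Arrows of the fibers have \<open>Idt C c\<close> as component at \<open>C\<close>; for
  these the list form of the universal property is opcartesianness.\<close>

lemma Pi_fiber_opfibration:
  assumes c: "c \<in> Ob C"
  shows "opfibration (fiber XE C Pi0 c) (fiber Mod C mod_proj c) Pi"
  unfolding opfibration_def
proof (intro conjI ballI impI)
  show "is_functor (fiber XE C Pi0 c) (fiber Mod C mod_proj c) Pi"
    by (rule fiber_functor[OF Pi0_functor mod_proj_functor Pi_functor])
      (simp add: functor_eq_def xext_Pi0_def)
  let ?X = "fiber XE C Pi0 c" and ?M = "fiber Mod C mod_proj c"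
  have XA: "k \<in> Ar ?X \<longleftrightarrow> xext (src k) \<and> xext (tgt k) \<and> xext_morphism C n (src k) (comps k) (tgt k) \<and>
      ob (src k) 0 = c \<and> ob (tgt k) 0 = c \<and> comps k ! 0 = Idt C c" for k
    by (auto simp: fiber_def xext_ar)
  have XD: "Dom ?X = src" "Cod ?X = tgt" "Comp ?X = Comp XE" "Dom ?M = src" "Cod ?M = tgt" "Comp ?M = Comp Mod"
    by (simp_all add: fiber_def)
  have MA: "k \<in> Ar ?M \<longleftrightarrow> k \<in> Ar Mod \<and> mod_base (src k) = c \<and> mod_base (tgt k) = c \<and> fst (comps k) = Idt C c" for k
    by (auto simp: fiber_def)
  fix E k assume E: "E \<in> Ob ?X" and k: "k \<in> Ar ?M" "Dom ?M k = omap Pi E"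
  have E': "xext E" "ob E 0 = c" using E by (simp_all add: fiber_def)
  let ?N = "tgt k" and ?\<beta> = "snd (comps k)"
  have k': "k \<in> Ar Mod" "src k = xext_module C n E" "mod_base ?N = c" "fst (comps k) = Idt C c"
    using k by (simp_all add: MA XD)
  have N: "is_module C (ob E 0) (mod_ob ?N) (mod_act ?N)" and \<beta>: "?\<beta> \<in> Ar C" "Dom C ?\<beta> = ob E (n + 1)" "Cod C ?\<beta> = mod_ob ?N"
    and am: "action_morphism C (x_act E (n + 1)) (mod_act ?N) (Idt C (ob E 0)) ?\<beta>"
    using k'(1) unfolding mod_ar k'(2-4) E'(2) by (simp_all add: xext_module_def)
  obtain F fs where F: "xext F" "xext_morphism C n E fs F" "ob F 0 = ob E 0" "ob F (n + 1) = mod_ob ?N" "x_act F (n + 1) = mod_act ?N"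
    "fs ! 0 = Idt C (ob E 0)" "fs ! (n + 1) = ?\<beta>"
    and univ: "\<And>E'' hs u. xext E'' \<Longrightarrow> xext_morphism C n E hs E'' \<Longrightarrow> hs ! 0 = Idt C (ob E 0) \<Longrightarrow>
       u \<in> Ar C \<Longrightarrow> Dom C u = mod_ob ?N \<Longrightarrow> Cod C u = ob E'' (n + 1) \<Longrightarrow>
       action_morphism C (mod_act ?N) (x_act E'' (n + 1)) (Idt C (ob E 0)) u \<Longrightarrow> u \<cdot> ?\<beta> = hs ! (n + 1) \<Longrightarrow>
       \<exists>!ws. xext_morphism C n F ws E'' \<and> ws ! 0 = Idt C (ob E 0) \<and> ws ! (n + 1) = u \<and> xcomp ws fs = hs"
    by (rule xext_opcartesian_lift[OF E'(1) N \<beta> am]) blast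
  let ?g = "Arrow E fs F"
  \<comment> \<open>Objects of \<open>Mod\<close> are records, and base, object and action of the
    lift were all prescribed; so \<open>Pi\<close> sends the lift to the given arrow on the
    nose.\<close>
  have FN: "xext_module C n F = ?N" using F k'(3) E'(2) by (simp add: xext_module_def)
  have "amap Pi ?g = k" using FN k'(2,4) F(6,7) E'(2) by (simp add: arrow.expand prod_eq_iff)
  moreover have "opcartesian ?X ?M Pi ?g"
    unfolding opcartesian_def
  proof (intro conjI ballI impI)
    show "?g \<in> Ar ?X" using E' F by (simp add: XA)
    fix h u assume h: "h \<in> Ar ?X" and u: "u \<in> hom ?M (omap Pi (Cod ?X ?g)) (omap Pi (Cod ?X h))"
      and hu: "Dom ?X h = Dom ?X ?g \<and> Comp ?M u (amap Pi ?g) = amap Pi h"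
    let ?T = "tgt h"
    have h': "xext ?T" "xext_morphism C n E (comps h) ?T" "comps h ! 0 = Idt C (ob E 0)" "src h = E" "ob ?T 0 = c"
      using h hu E' by (auto simp: XA XD)
    have u': "u \<in> Ar Mod" "src u = ?N" "tgt u = xext_module C n ?T" "fst (comps u) = Idt C c"
      using u FN by (simp_all add: hom_def MA XD)
    have us: "snd (comps u) \<in> Ar C" "Dom C (snd (comps u)) = mod_ob ?N" "Cod C (snd (comps u)) = ob ?T (n + 1)"
      "action_morphism C (mod_act ?N) (x_act ?T (n + 1)) (Idt C (ob E 0)) (snd (comps u))"
      using u'(1) unfolding mod_ar u'(2-4) E'(2) by (simp_all add: xext_module_def)
    have "comps (Comp Mod u (amap Pi ?g)) = comps (amap Pi h)" using hu by (simp only: XD)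
    then have ub: "snd (comps u) \<cdot> ?\<beta> = comps h ! (n + 1)" using F(7) by simp
    have ex: "\<exists>!ws. xext_morphism C n F ws ?T \<and> ws ! 0 = Idt C (ob E 0) \<and> ws ! (n + 1) = snd (comps u) \<and> xcomp ws fs = comps h"
      by (rule univ[OF h'(1-3) us ub])
    then obtain ws where ws: "xext_morphism C n F ws ?T" "ws ! 0 = Idt C (ob E 0)" "ws ! (n + 1) = snd (comps u)" "xcomp ws fs = comps h"
      by blast
    show "\<exists>!w. w \<in> hom ?X (Cod ?X ?g) (Cod ?X h) \<and> amap Pi w = u \<and> Comp ?X w ?g = h"
    proof (rule ex1I[where a = "Arrow F ws ?T"])
      have "Arrow F ws ?T \<in> hom ?X (Cod ?X ?g) (Cod ?X h)"
        using ws F h' E' by (simp add: hom_def XA XD)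
      moreover have "amap Pi (Arrow F ws ?T) = u"
        using ws(2,3) u' FN E'(2) by (simp add: arrow.expand prod_eq_iff)
      moreover have "Comp ?X (Arrow F ws ?T) ?g = h"
        using ws(4) h'(4) by (simp add: XD arrow.expand)
      ultimately show "Arrow F ws ?T \<in> hom ?X (Cod ?X ?g) (Cod ?X h) \<and> amap Pi (Arrow F ws ?T) = u \<and>
        Comp ?X (Arrow F ws ?T) ?g = h" by blast
      fix w assume w: "w \<in> hom ?X (Cod ?X ?g) (Cod ?X h) \<and> amap Pi w = u \<and> Comp ?X w ?g = h"
      then have w1: "src w = F" "tgt w = ?T" "xext_morphism C n F (comps w) ?T" "comps w ! 0 = Idt C (ob E 0)"
        using E' by (auto simp: hom_def XA XD)
      have "comps (amap Pi w) = comps u" "comps (Comp XE w ?g) = comps h" using w by (simp_all only: XD)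
      then have "comps w ! (n + 1) = snd (comps u)" "xcomp (comps w) fs = comps h" by (simp_all add: prod_eq_iff)
      then have "comps w = ws" using ex ws w1 by blast
      then show "w = Arrow F ws ?T" using w1 by (simp add: arrow.expand)
    qed
  qed
  ultimately show "\<exists>g. opcartesian ?X ?M Pi g \<and> Dom ?X g = E \<and> amap Pi g = k"
    by (intro exI[where x = ?g]) (simp add: XD)
qed

end

theorem theorem4p9:
  fixes C :: "('o, 'a) cat" and n :: nat
  assumes "strongly_semi_abelian C" and "n \<ge> 2"
  shows "fiberwise_opfibration C (xext_cat C n) (xext_Pi0 C n) (mod_cat C) mod_proj (xext_Pi C n)"
proof -
  interpret xe C n
    by unfold_locales (use assms in \<open>simp_all add: strongly_semi_abelian_def\<close>)
  show ?thesis
    unfolding fiberwise_opfibration_def using Pi_fib_morphism Pi_fiber_opfibration by blast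
qed

end
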